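(* Let $(R,\mathfrak m)$ be a one-dimensional Noetherian Cohen-Macaulay local ring possessing a canonical module $\omega_R$, with total ring of fractions $Q(R)$ and integral closure $\overline R$ of $R$ in $Q(R)$. Suppose that: (a) there is an $R$-submodule $C$ of $Q(R)$ with $R\subseteq C\subseteq\overline R$ and $C\cong\omega_R$; (b) $\overline R$ is finitely generated as an $R$-module; (c) $\overline R$ is a local ring; (d) there is a non-zerodivisor $a\in\mathfrak m$ such that $(a)$ is a reduction of $\mathfrak m$. If $R$ is a far-flung Gorenstein ring, then the ring $B=\mathfrak m:\mathfrak m\cong\mathrm{Hom}_R(\mathfrak m,\mathfrak m)$ is also a far-flung Gorenstein ring.
   Context: For a Noetherian ring $A$ and a finitely generated $A$-module $M$, the trace ideal is $\mathrm{tr}_A(M)=\sum_{f\in\mathrm{Hom}_A(M,A)}\mathrm{Im}\,f\subseteq A$. For fractional ideals $I,J$ (finitely generated $R$-submodules of $Q(R)$ containing a non-zerodivisor of $R$), $I:J=\{\alpha\in Q(R): \alpha J\subseteq I\}$; thus $\mathfrak m:\mathfrak m=\{\alpha\in Q(R):\alpha\mathfrak m\subseteq\mathfrak m\}$, a subring of $Q(R)$ containing $R$. A one-dimensional Cohen-Macaulay local ring $A$ with canonical module $\omega_A$ is called far-flung Gorenstein if it satisfies the analogues of (a) and (b) (there is an $A$-submodule of $Q(A)$ between $A$ and $\overline A$ isomorphic to $\omega_A$, and $\overline A$ is a finitely generated $A$-module) and $\mathrm{tr}_A(\omega_A)=A:\overline A$. *)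

theory Defs
  imports "HOL-Algebra.Algebra" "HOL-Library.Extended_Nat"
begin

text \<open>
  A subring \<open>A\<close> of a ring \<open>Q\<close> is the ring \<open>Q\<lparr>carrier := A\<rparr>\<close>. In module records only the fields
  \<open>carrier\<close>, \<open>zero\<close>, \<open>add\<close> and \<open>smult\<close> matter, so \<open>mult\<close> and \<open>one\<close> are left \<open>undefined\<close>
  where no multiplication is at hand.
\<close>


section \<open>Modules\<close>

text \<open>Homomorphisms are extensional, so that equality of homomorphisms is equality of functions.\<close>

definition module_hom ::
  "('a, 'r) ring_scheme \<Rightarrow> ('a, 'b, 's) module_scheme \<Rightarrow> ('a, 'c, 't) module_scheme \<Rightarrow> ('b \<Rightarrow> 'c) set"
  where "module_hom R M N =
    {f \<in> carrier M \<rightarrow>\<^sub>E carrier N.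
       (\<forall>x\<in>carrier M. \<forall>y\<in>carrier M. f (x \<oplus>\<^bsub>M\<^esub> y) = f x \<oplus>\<^bsub>N\<^esub> f y) \<and>
       (\<forall>a\<in>carrier R. \<forall>x\<in>carrier M. f (a \<odot>\<^bsub>M\<^esub> x) = a \<odot>\<^bsub>N\<^esub> f x)}"

definition module_isomorphic ::
  "('a, 'r) ring_scheme \<Rightarrow> ('a, 'b, 's) module_scheme \<Rightarrow> ('a, 'c, 't) module_scheme \<Rightarrow> bool"
  where "module_isomorphic R M N \<longleftrightarrow>
    (\<exists>f\<in>module_hom R M N. bij_betw f (carrier M) (carrier N))"

definition hom_module ::
  "('a, 'r) ring_scheme \<Rightarrow> ('a, 'b, 's) module_scheme \<Rightarrow> ('a, 'c, 't) module_scheme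
     \<Rightarrow> ('a, 'b \<Rightarrow> 'c) module"
  where "hom_module R M N =
    \<lparr>carrier = module_hom R M N, monoid.mult = undefined, one = undefined,
     ring.zero = (\<lambda>x\<in>carrier M. \<zero>\<^bsub>N\<^esub>),
     ring.add = (\<lambda>f g. \<lambda>x\<in>carrier M. f x \<oplus>\<^bsub>N\<^esub> g x),
     smult = (\<lambda>a f. \<lambda>x\<in>carrier M. a \<odot>\<^bsub>N\<^esub> f x)\<rparr>"

definition endomorphism_ring ::
  "('a, 'r) ring_scheme \<Rightarrow> ('a, 'b, 's) module_scheme \<Rightarrow> ('b \<Rightarrow> 'b) ring"
  where "endomorphism_ring R M =
    \<lparr>carrier = module_hom R M M,
     monoid.mult = compose (carrier M), one = (\<lambda>x\<in>carrier M. x),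
     ring.zero = (\<lambda>x\<in>carrier M. \<zero>\<^bsub>M\<^esub>),
     ring.add = (\<lambda>f g. \<lambda>x\<in>carrier M. f x \<oplus>\<^bsub>M\<^esub> g x)\<rparr>"

text \<open>
  The module \<open>Q\<close> over itself, hence also over each of its subrings; a submodule carried by
  \<open>C \<subseteq> Q\<close> is \<open>(regular_module Q)\<lparr>carrier := C\<rparr>\<close>.
\<close>

definition regular_module :: "('a, 'r) ring_scheme \<Rightarrow> ('a, 'a) module"
  where "regular_module Q =
    \<lparr>carrier = carrier Q, monoid.mult = monoid.mult Q, one = one Q, ring.zero = ring.zero Q, ring.add = ring.add Q,
     smult = monoid.mult Q\<rparr>"

definition quotient_module :: "('a, 'b, 's) module_scheme \<Rightarrow> 'b set \<Rightarrow> ('a, 'b set) module"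
  where "quotient_module M N =
    \<lparr>carrier = a_rcosets\<^bsub>M\<^esub> N, monoid.mult = undefined, one = undefined,
     ring.zero = N, ring.add = set_add M,
     smult = (\<lambda>a U. N <+>\<^bsub>M\<^esub> ((\<lambda>x. a \<odot>\<^bsub>M\<^esub> x) ` U))\<rparr>"

definition free_module :: "('a, 'r) ring_scheme \<Rightarrow> nat \<Rightarrow> ('a, nat \<Rightarrow> 'a) module"
  where "free_module R n =
    \<lparr>carrier = {..<n} \<rightarrow>\<^sub>E carrier R, monoid.mult = undefined, one = undefined,
     ring.zero = (\<lambda>i\<in>{..<n}. \<zero>\<^bsub>R\<^esub>),
     ring.add = (\<lambda>v w. \<lambda>i\<in>{..<n}. v i \<oplus>\<^bsub>R\<^esub> w i),
     smult = (\<lambda>a v. \<lambda>i\<in>{..<n}. a \<otimes>\<^bsub>R\<^esub> v i)\<rparr>"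

definition finitely_generated_module ::
  "('a, 'r) ring_scheme \<Rightarrow> ('a, 'b) module \<Rightarrow> bool"
  where "finitely_generated_module R M \<longleftrightarrow>
    module R M \<and>
    (\<exists>S. finite S \<and> S \<subseteq> carrier M \<and> (\<forall>N. submodule N R M \<and> S \<subseteq> N \<longrightarrow> N = carrier M))"

definition trace_ideal :: "('a, 'r) ring_scheme \<Rightarrow> ('a, 'b) module \<Rightarrow> 'a set"
  where "trace_ideal R M =
    Idl\<^bsub>R\<^esub> (\<Union>f\<in>module_hom R M (regular_module R). f ` carrier M)"


section \<open>Ext\<close>

text \<open>
  \<open>free_resolution R M r d e\<close>: the sequence
  \<open>\<dots> \<rightarrow> R\<^bsup>r 2\<^esup> \<rightarrow> R\<^bsup>r 1\<^esup> \<rightarrow> R\<^bsup>r 0\<^esup> \<rightarrow> M \<rightarrow> 0\<close> with maps \<open>\<dots>, d 1, d 0, e\<close> is exact.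
\<close>

definition free_resolution ::
  "('a, 'r) ring_scheme \<Rightarrow> ('a, 'b) module \<Rightarrow> (nat \<Rightarrow> nat) \<Rightarrow> (nat \<Rightarrow> (nat \<Rightarrow> 'a) \<Rightarrow> (nat \<Rightarrow> 'a))
     \<Rightarrow> ((nat \<Rightarrow> 'a) \<Rightarrow> 'b) \<Rightarrow> bool"
  where "free_resolution R M r d e \<longleftrightarrow>
    e \<in> module_hom R (free_module R (r 0)) M \<and>
    (\<forall>i. d i \<in> module_hom R (free_module R (r (Suc i))) (free_module R (r i))) \<and>
    e ` carrier (free_module R (r 0)) = carrier M \<and>
    d 0 ` carrier (free_module R (r 1)) =
      {v \<in> carrier (free_module R (r 0)). e v = \<zero>\<^bsub>M\<^esub>} \<and>
    (\<forall>i. d (Suc i) ` carrier (free_module R (r (Suc (Suc i)))) =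
      {v \<in> carrier (free_module R (r (Suc i))). d i v = \<zero>\<^bsub>free_module R (r i)\<^esub>})"

definition dual_differential ::
  "('a, 'r) ring_scheme \<Rightarrow> (nat \<Rightarrow> nat) \<Rightarrow> (nat \<Rightarrow> (nat \<Rightarrow> 'a) \<Rightarrow> (nat \<Rightarrow> 'a)) \<Rightarrow> nat
     \<Rightarrow> ((nat \<Rightarrow> 'a) \<Rightarrow> 'c) \<Rightarrow> ((nat \<Rightarrow> 'a) \<Rightarrow> 'c)"
  where "dual_differential R r d i f = compose (carrier (free_module R (r (Suc i)))) f (d i)"

definition cocycles ::
  "('a, 'r) ring_scheme \<Rightarrow> (nat \<Rightarrow> nat) \<Rightarrow> (nat \<Rightarrow> (nat \<Rightarrow> 'a) \<Rightarrow> (nat \<Rightarrow> 'a)) \<Rightarrow> ('a, 'c) module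
     \<Rightarrow> nat \<Rightarrow> ((nat \<Rightarrow> 'a) \<Rightarrow> 'c) set"
  where "cocycles R r d N i =
    {f \<in> module_hom R (free_module R (r i)) N.
       dual_differential R r d i f = \<zero>\<^bsub>hom_module R (free_module R (r (Suc i))) N\<^esub>}"

definition coboundaries ::
  "('a, 'r) ring_scheme \<Rightarrow> (nat \<Rightarrow> nat) \<Rightarrow> (nat \<Rightarrow> (nat \<Rightarrow> 'a) \<Rightarrow> (nat \<Rightarrow> 'a)) \<Rightarrow> ('a, 'c) module
     \<Rightarrow> nat \<Rightarrow> ((nat \<Rightarrow> 'a) \<Rightarrow> 'c) set"
  where "coboundaries R r d N i =
    (case i of
       0 \<Rightarrow> {\<zero>\<^bsub>hom_module R (free_module R (r 0)) N\<^esub>}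
     | Suc j \<Rightarrow> dual_differential R r d j ` module_hom R (free_module R (r j)) N)"

text \<open>
  \<open>Ext_module R i M N\<close> is meaningful when \<open>R\<close> is Noetherian and \<open>M\<close> is finitely generated: then
  a resolution of \<open>M\<close> by free modules of finite rank exists, and up to isomorphism the result
  does not depend on which one is chosen.
\<close>

definition Ext_module ::
  "('a, 'r) ring_scheme \<Rightarrow> nat \<Rightarrow> ('a, 'b) module \<Rightarrow> ('a, 'c) module
     \<Rightarrow> ('a, ((nat \<Rightarrow> 'a) \<Rightarrow> 'c) set) module"
  where "Ext_module R i M N =
    (let (r, d) = (SOME (r, d). \<exists>e. free_resolution R M r d e)
     in quotient_module
          ((hom_module R (free_module R (r i)) N)\<lparr>carrier := cocycles R r d N i\<rparr>)
          (coboundaries R r d N i))"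


section \<open>Cohen-Macaulay local rings and canonical modules\<close>

definition nonzerodivisors :: "('a, 'r) ring_scheme \<Rightarrow> 'a set"
  where "nonzerodivisors R =
    {s \<in> carrier R. \<forall>x\<in>carrier R. s \<otimes>\<^bsub>R\<^esub> x = \<zero>\<^bsub>R\<^esub> \<longrightarrow> x = \<zero>\<^bsub>R\<^esub>}"

definition local_ring :: "('a, 'r) ring_scheme \<Rightarrow> bool"
  where "local_ring R \<longleftrightarrow> cring R \<and> (\<exists>!m. maximalideal m R)"

definition max_ideal :: "('a, 'r) ring_scheme \<Rightarrow> 'a set"
  where "max_ideal R = (THE m. maximalideal m R)"

definition residue_module :: "('a, 'r) ring_scheme \<Rightarrow> ('a, 'a set) module"
  where "residue_module R = quotient_module (regular_module R) (max_ideal R)"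

definition krull_dim :: "('a, 'r) ring_scheme \<Rightarrow> enat"
  where "krull_dim R =
    Sup {enat n | n. \<exists>P :: nat \<Rightarrow> 'a set.
           (\<forall>i\<le>n. primeideal (P i) R) \<and> (\<forall>i<n. P i \<subset> P (Suc i))}"

definition regular_sequence :: "('a, 'r) ring_scheme \<Rightarrow> 'a list \<Rightarrow> bool"
  where "regular_sequence R xs \<longleftrightarrow>
    set xs \<subseteq> carrier R \<and> Idl\<^bsub>R\<^esub> (set xs) \<noteq> carrier R \<and>
    (\<forall>i<length xs. \<forall>a\<in>carrier R.
       xs ! i \<otimes>\<^bsub>R\<^esub> a \<in> Idl\<^bsub>R\<^esub> (set (take i xs)) \<longrightarrow> a \<in> Idl\<^bsub>R\<^esub> (set (take i xs)))"

definition depth :: "('a, 'r) ring_scheme \<Rightarrow> enat"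
  where "depth R =
    Sup {enat (length xs) | xs. regular_sequence R xs \<and> set xs \<subseteq> max_ideal R}"

definition CM_local_ring :: "('a, 'r) ring_scheme \<Rightarrow> bool"
  where "CM_local_ring R \<longleftrightarrow> local_ring R \<and> noetherian_ring R \<and> depth R = krull_dim R"

text \<open>
  For a Cohen-Macaulay local ring \<open>(R, \<mm>, k)\<close> of dimension \<open>d\<close>, a canonical module is a finitely
  generated module \<open>W\<close> with \<open>dim\<^sub>k Ext\<^sup>i\<^sub>R(k, W) = \<delta>\<^sub>i\<^sub>d\<close> for all \<open>i\<close> (Bruns and Herzog,
  Definition 3.3.1). As \<open>Ext\<^sup>i\<^sub>R(k, W)\<close> is killed by \<open>\<mm>\<close>, dimension \<open>1\<close> over \<open>k\<close> means being
  isomorphic to \<open>k\<close> over \<open>R\<close>.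
\<close>

definition canonical_module :: "('a, 'r) ring_scheme \<Rightarrow> ('a, 'b) module \<Rightarrow> bool"
  where "canonical_module R W \<longleftrightarrow>
    CM_local_ring R \<and> finitely_generated_module R W \<and>
    (\<forall>i. if enat i = krull_dim R
         then module_isomorphic R (Ext_module R i (residue_module R) W) (residue_module R)
         else carrier (Ext_module R i (residue_module R) W)
                = {\<zero>\<^bsub>Ext_module R i (residue_module R) W\<^esub>})"


section \<open>Subrings of the total ring of fractions\<close>

definition total_ring_of_fractions :: "('a, 'r) ring_scheme \<Rightarrow> 'a set \<Rightarrow> bool"
  where "total_ring_of_fractions Q A \<longleftrightarrow>
    cring Q \<and> subcring A Q \<and>
    nonzerodivisors (Q\<lparr>carrier := A\<rparr>) \<subseteq> Units Q \<and>
    (\<forall>q\<in>carrier Q. \<exists>a\<in>A. \<exists>s\<in>nonzerodivisors (Q\<lparr>carrier := A\<rparr>). q = a \<otimes>\<^bsub>Q\<^esub> inv\<^bsub>Q\<^esub> s)"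

definition integral_closure :: "('a, 'r) ring_scheme \<Rightarrow> 'a set \<Rightarrow> 'a set"
  where "integral_closure Q A =
    {x \<in> carrier Q. \<exists>p\<in>carrier (A[X]\<^bsub>Q\<^esub>).
       p \<noteq> [] \<and> lead_coeff p = \<one>\<^bsub>Q\<^esub> \<and> ring.eval Q p x = \<zero>\<^bsub>Q\<^esub>}"

definition colon :: "('a, 'r) ring_scheme \<Rightarrow> 'a set \<Rightarrow> 'a set \<Rightarrow> 'a set"
  where "colon Q I J = {\<alpha> \<in> carrier Q. \<forall>x\<in>J. \<alpha> \<otimes>\<^bsub>Q\<^esub> x \<in> I}"

definition is_reduction :: "('a, 'r) ring_scheme \<Rightarrow> 'a set \<Rightarrow> 'a set \<Rightarrow> bool"
  where "is_reduction R J I \<longleftrightarrow>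
    ideal J R \<and> ideal I R \<and> J \<subseteq> I \<and>
    (\<exists>n::nat. J \<cdot>\<^bsub>R\<^esub> (I [^]\<^bsub>ideals_set R\<^esub> n) = I [^]\<^bsub>ideals_set R\<^esub> Suc n)"

definition canonical_between :: "('a, 'r) ring_scheme \<Rightarrow> 'a set \<Rightarrow> ('a, 'b) module \<Rightarrow> bool"
  where "canonical_between Q A W \<longleftrightarrow>
    (\<exists>C. A \<subseteq> C \<and> C \<subseteq> integral_closure Q A \<and>
         submodule C (Q\<lparr>carrier := A\<rparr>) (regular_module Q) \<and>
         module_isomorphic (Q\<lparr>carrier := A\<rparr>) ((regular_module Q)\<lparr>carrier := C\<rparr>) W)"

definition finite_integral_closure :: "('a, 'r) ring_scheme \<Rightarrow> 'a set \<Rightarrow> bool"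
  where "finite_integral_closure Q A \<longleftrightarrow>
    finitely_generated_module (Q\<lparr>carrier := A\<rparr>)
      ((regular_module Q)\<lparr>carrier := integral_closure Q A\<rparr>)"

text \<open>The ring \<open>A\<close>, with total ring of fractions \<open>Q\<close> and canonical module \<open>W\<close>, is far-flung Gorenstein.\<close>

definition far_flung_Gorenstein :: "('a, 'r) ring_scheme \<Rightarrow> 'a set \<Rightarrow> ('a, 'b) module \<Rightarrow> bool"
  where "far_flung_Gorenstein Q A W \<longleftrightarrow>
    total_ring_of_fractions Q A \<and>
    CM_local_ring (Q\<lparr>carrier := A\<rparr>) \<and> krull_dim (Q\<lparr>carrier := A\<rparr>) = 1 \<and>
    canonical_module (Q\<lparr>carrier := A\<rparr>) W \<and>
    canonical_between Q A W \<and>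
    finite_integral_closure Q A \<and>
    trace_ideal (Q\<lparr>carrier := A\<rparr>) W = colon Q A (integral_closure Q A)"

end

theory Submission
  imports Defs
begin

text \<open>
  Since the integral closure \<open>R'\<close> of \<open>R\<close> in \<open>Q\<close> is local and finite over \<open>R\<close>, \<open>Q\<close> is a field. A fractional ideal
  \<open>C\<close> is then a canonical module exactly when \<open>Q / C\<close> is injective and \<open>(C : m) / C\<close> is one-dimensional;
  Baer's criterion gives the duality \<open>C : (C : I) = I\<close> for fractional ideals \<open>I\<close>. With \<open>R \<subseteq> C \<subseteq> R'\<close>, being
  far-flung Gorenstein amounts to \<open>R : C = R : R'\<close>.

  If \<open>R : m \<noteq> m : m\<close>, then \<open>m\<close> is principal and \<open>B = R\<close>. Otherwise \<open>B = R : m\<close>, and \<open>K = a\<inverse> (C : B)\<close> is a canonical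
  ideal of \<open>B\<close>, where \<open>(a)\<close> is the given reduction of \<open>m\<close>. The reduction yields \<open>m R' = a R'\<close>; dualising,
  \<open>K \<subseteq> R'\<close>, and \<open>B, C \<subseteq> K\<close>. If \<open>\<alpha> K \<subseteq> B\<close>, then \<open>a \<alpha> C C \<subseteq> a K = C : B \<subseteq> C\<close>, so
  \<open>a \<alpha> \<in> R : C = R : R'\<close>, whence \<open>\<alpha> R' m = \<alpha> a R' \<subseteq> R\<close> and \<open>\<alpha> R' \<subseteq> B\<close>.
\<close>

section \<open>Ideals\<close>

text \<open>The weight of the proof lies in turning the Ext definition of a canonical module into
  statements about submodules of Q. Q is injective over R, so Ext^2(k, C) = Ext^1(k, Q / C) tests
  whether every map m -> Q / C is a multiplication, and Ext^1(k, C) is (C : m) / C.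
  \<open>Ext_module\<close> works with an unspecified resolution, whose rank in degree 0 need not be
  1, so only exactness may be used. Quotients Q / C are never formed: maps into them are handled
  through representatives.

  Q is a field because idempotents and nilpotents of Q are integral over R. A local R' has only
  trivial idempotents. For a nilpotent x all the a^(-j) x lie in R', which a finite R' permits only
  for x = 0.

  C : B is Hom(B, C) realised inside Q, the standard way to carry a canonical module along the
  finite extension R \<subseteq> B. Every nonzero multiple of it is equally canonical; the multiple
  by a^(-1) is the one lying between B and R'.\<close>

lemma (in cring) exists_ideal_maximal_disjoint:
  assumes "ideal J R" and "J \<inter> S = {}"
  obtains P where "ideal P R" "J \<subseteq> P" "P \<inter> S = {}"
    "\<And>I. ideal I R \<Longrightarrow> P \<subseteq> I \<Longrightarrow> I \<inter> S = {} \<Longrightarrow> I = P"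
proof -
  define \<F> where "\<F> = {I. ideal I R \<and> J \<subseteq> I \<and> I \<inter> S = {}}"
  have "\<exists>P\<in>\<F>. \<forall>I\<in>\<F>. P \<subseteq> I \<longrightarrow> I = P"
  proof (rule subset_Zorn)
    fix C assume C: "subset.chain \<F> C"
    show "\<exists>U\<in>\<F>. \<forall>I\<in>C. I \<subseteq> U"
    proof (cases "C = {}")
      case True then show ?thesis using assms by (auto simp: \<F>_def)
    next
      case False
      have "subset.chain {I. ideal I R} C"
        using C by (auto simp: \<F>_def pred_on.chain_def)
      from chain_Union_is_ideal[OF this] have "ideal (\<Union>C) R" using False by simp
      then have "\<Union>C \<in> \<F>" using C False by (auto simp: \<F>_def pred_on.chain_def)
      then show ?thesis by blast
    qed
  qed
  then obtain P where "P \<in> \<F>" "\<forall>I\<in>\<F>. P \<subseteq> I \<longrightarrow> I = P" by blast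
  then show thesis by (intro that[of P]) (auto simp: \<F>_def)
qed

lemma (in cring) exists_maximalideal:
  assumes "ideal J R" and "\<one> \<notin> J"
  obtains M where "maximalideal M R" "J \<subseteq> M"
proof -
  obtain P where P: "ideal P R" "J \<subseteq> P" "P \<inter> {\<one>} = {}"
    "\<And>I. ideal I R \<Longrightarrow> P \<subseteq> I \<Longrightarrow> I \<inter> {\<one>} = {} \<Longrightarrow> I = P"
    \<comment> \<open>Proper ideals are the ideals that miss \<open>{\<one>}\<close>.\<close>
    using exists_ideal_maximal_disjoint[of J "{\<one>}"] assms by blast
  have "maximalideal P R"
  proof (rule maximalidealI)
    fix I assume "ideal I R" "P \<subseteq> I" "I \<subseteq> carrier R"
    then show "I = P \<or> I = carrier R"
      using P(4)[of I] ideal.one_imp_carrier by blast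
  qed (use P in auto)
  then show thesis using P(2) that by blast
qed

text \<open>An ideal P maximal among those missing a multiplicative set is prime. If a and b lie
  outside P, then P + (a) and P + (b) both meet S; in the product of two such elements every term
  has a factor in P or the factor a b, so a b \<in> P would put an element of S into P.\<close>

lemma (in cring) exists_primeideal_disjoint:
  assumes J: "ideal J R" and disj: "J \<inter> S = {}" and S: "S \<subseteq> carrier R" "\<one> \<in> S"
    "\<And>x y. x \<in> S \<Longrightarrow> y \<in> S \<Longrightarrow> x \<otimes> y \<in> S"
  obtains P where "primeideal P R" "J \<subseteq> P" "P \<inter> S = {}"
proof -
  obtain P where P: "ideal P R" "J \<subseteq> P" "P \<inter> S = {}"
    and max: "\<And>I. ideal I R \<Longrightarrow> P \<subseteq> I \<Longrightarrow> I \<inter> S = {} \<Longrightarrow> I = P"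
    using exists_ideal_maximal_disjoint[OF J disj] by blast
  interpret P: ideal P R by fact
  have meets: "\<exists>p\<in>P. \<exists>r\<in>carrier R. p \<oplus> r \<otimes> a \<in> S" if a: "a \<in> carrier R" "a \<notin> P" for a
  proof -
    have I: "ideal (P <+> PIdl a) R"
      using add_ideals[OF P(1) cgenideal_ideal[OF a(1)]] .
    have "P \<subseteq> P <+> PIdl a"
    proof
      fix p assume p: "p \<in> P"
      then have "p = p \<oplus> \<zero> \<otimes> a" using a by simp
      then show "p \<in> P <+> PIdl a"
        using p unfolding set_add_def' cgenideal_def by blast
    qed
    moreover have "a \<in> P <+> PIdl a"
    proof -
      have "a = \<zero> \<oplus> \<one> \<otimes> a" using a by simp
      then show ?thesis unfolding set_add_def' cgenideal_def using P.zero_closed by blast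
    qed
    ultimately have "(P <+> PIdl a) \<inter> S \<noteq> {}" using max[OF I] a(2) by blast
    then show ?thesis unfolding set_add_def' cgenideal_def by blast
  qed
  have "primeideal P R"
  proof (rule primeidealI[OF P(1) cring_axioms])
    show "carrier R \<noteq> P" using P(3) S by auto
    fix a b assume a: "a \<in> carrier R" and b: "b \<in> carrier R" and ab: "a \<otimes> b \<in> P"
    show "a \<in> P \<or> b \<in> P"
    proof (rule ccontr)
      assume "\<not> (a \<in> P \<or> b \<in> P)"
      then obtain p r q s where pr: "p \<in> P" "r \<in> carrier R" "p \<oplus> r \<otimes> a \<in> S"
        and qs: "q \<in> P" "s \<in> carrier R" "q \<oplus> s \<otimes> b \<in> S"
        using meets a b by metis
      have c: "p \<in> carrier R" "q \<in> carrier R" using P.Icarr[OF pr(1)] P.Icarr[OF qs(1)] .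
      have "(p \<oplus> r \<otimes> a) \<otimes> (q \<oplus> s \<otimes> b) = (q \<oplus> s \<otimes> b) \<otimes> p \<oplus> ((r \<otimes> a) \<otimes> q \<oplus> (r \<otimes> s) \<otimes> (a \<otimes> b))"
        using a b pr(2) qs(2) c by algebra
      also have "\<dots> \<in> P"
        by (intro P.a_closed P.I_l_closed[OF pr(1)] P.I_l_closed[OF qs(1)] P.I_l_closed[OF ab])
          (simp_all add: a b c pr(2) qs(2))
      finally show False using S(3)[OF pr(3) qs(3)] P(3) by blast
    qed
  qed
  then show thesis using P that by blast
qed

text \<open>In a Noetherian ring a nonempty chain of ideals contains its own union, so Zorn's lemma
  applies to an arbitrary family of ideals.\<close>

lemma (in noetherian_ring) exists_maximal_ideal_in_family:
  assumes "\<F> \<noteq> {}" and "\<And>I. I \<in> \<F> \<Longrightarrow> ideal I R"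
  obtains I where "I \<in> \<F>" "\<And>J. J \<in> \<F> \<Longrightarrow> I \<subseteq> J \<Longrightarrow> J = I"
proof -
  have "\<exists>I\<in>\<F>. \<forall>J\<in>\<F>. I \<subseteq> J \<longrightarrow> J = I"
  proof (rule subset_Zorn)
    fix C assume C: "subset.chain \<F> C"
    show "\<exists>U\<in>\<F>. \<forall>I\<in>C. I \<subseteq> U"
    proof (cases "C = {}")
      case True then show ?thesis using assms by auto
    next
      case False
      have "subset.chain {I. ideal I R} C"
        using C assms(2) by (auto simp: pred_on.chain_def)
      from ideal_chain_is_trivial[OF False this] have "\<Union>C \<in> C" .
      then show ?thesis using C by (auto simp: pred_on.chain_def)
    qed
  qed
  then show thesis using that by blast
qed

section \<open>Local rings and their units\<close>

lemma local_ring_max_ideal: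
  assumes "local_ring R" and "maximalideal m R"
  shows "max_ideal R = m"
  using assms unfolding local_ring_def max_ideal_def by (auto intro!: the1_equality)

lemma local_ring_maximalideal: "local_ring R \<Longrightarrow> maximalideal (max_ideal R) R"
  unfolding local_ring_def max_ideal_def using theI'[of "\<lambda>m. maximalideal m R"] by simp

lemma local_ring_unit:
  assumes "local_ring R" and m: "maximalideal m R" and x: "x \<in> carrier R" "x \<notin> m"
  shows "x \<in> Units R"
proof (rule ccontr)
  interpret cring R using assms(1) by (simp add: local_ring_def)
  assume "x \<notin> Units R"
  have "\<one>\<^bsub>R\<^esub> \<notin> PIdl\<^bsub>R\<^esub> x"
  proof
    assume "\<one>\<^bsub>R\<^esub> \<in> PIdl\<^bsub>R\<^esub> x"
    then obtain y where y: "y \<in> carrier R" "\<one>\<^bsub>R\<^esub> = y \<otimes>\<^bsub>R\<^esub> x" by (auto simp: cgenideal_def)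
    then have "x \<in> Units R" using x m_comm[of x y] by (auto simp: Units_def)
    with \<open>x \<notin> Units R\<close> show False by blast
  qed
  then obtain M where "maximalideal M R" "PIdl\<^bsub>R\<^esub> x \<subseteq> M"
    using exists_maximalideal[OF cgenideal_ideal[OF x(1)]] by blast
  moreover have "M = m"
    using assms(1,2) \<open>maximalideal M R\<close> unfolding local_ring_def by blast
  ultimately show False using cgenideal_self[OF x(1)] x(2) by blast
qed

lemma local_ringI:
  assumes "cring R" and "ideal m R" and "\<one>\<^bsub>R\<^esub> \<notin> m"
    and units: "\<And>x. x \<in> carrier R \<Longrightarrow> x \<notin> m \<Longrightarrow> x \<in> Units R"
  shows "local_ring R" and "maximalideal m R"
proof -
  interpret cring R by fact
  interpret m: ideal m R by fact
  have sub: "I = carrier R" if I: "ideal I R" "\<not> I \<subseteq> m" for I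
  proof -
    interpret I: ideal I R by fact
    obtain x where x: "x \<in> I" "x \<notin> m" using I by blast
    then have "x \<in> Units R" using units I.Icarr by blast
    then have "inv\<^bsub>R\<^esub> x \<otimes>\<^bsub>R\<^esub> x = \<one>\<^bsub>R\<^esub>" "inv\<^bsub>R\<^esub> x \<in> carrier R" by auto
    then have "\<one>\<^bsub>R\<^esub> \<in> I" using I.I_l_closed[OF x(1)] by metis
    then show ?thesis by (rule I.one_imp_carrier)
  qed
  show max: "maximalideal m R"
    using assms sub by (intro maximalidealI) auto
  have "M = m" if M: "maximalideal M R" for M
  proof -
    interpret M: maximalideal M R by fact
    have "M \<subseteq> m" using sub[OF M.is_ideal] M.I_notcarr by auto
    then show ?thesis
      using M.I_maximal[OF assms(2)] m.a_subset assms(3) by auto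
  qed
  then show "local_ring R" unfolding local_ring_def using max \<open>cring R\<close> by blast
qed

section \<open>Submodules of a commutative ring over a subring\<close>

text \<open>A single predicate on subsets of Q serves for ideals, fractional ideals and overrings,
  and lets the coefficient ring vary while the records stay fixed. Closure under negation follows
  once -1 lies in A.\<close>

definition submod :: "('a, 'r) ring_scheme \<Rightarrow> 'a set \<Rightarrow> 'a set \<Rightarrow> bool"
  where "submod Q A U \<longleftrightarrow> U \<subseteq> carrier Q \<and> \<zero>\<^bsub>Q\<^esub> \<in> U \<and>
    (\<forall>x\<in>U. \<forall>y\<in>U. x \<oplus>\<^bsub>Q\<^esub> y \<in> U) \<and> (\<forall>a\<in>A. \<forall>x\<in>U. a \<otimes>\<^bsub>Q\<^esub> x \<in> U)"

lemma submodI: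
  assumes "U \<subseteq> carrier Q" "\<zero>\<^bsub>Q\<^esub> \<in> U"
    "\<And>x y. x \<in> U \<Longrightarrow> y \<in> U \<Longrightarrow> x \<oplus>\<^bsub>Q\<^esub> y \<in> U" "\<And>a x. a \<in> A \<Longrightarrow> x \<in> U \<Longrightarrow> a \<otimes>\<^bsub>Q\<^esub> x \<in> U"
  shows "submod Q A U"
  using assms by (simp add: submod_def)

lemma submodD:
  assumes "submod Q A U"
  shows "x \<in> U \<Longrightarrow> x \<in> carrier Q" "\<zero>\<^bsub>Q\<^esub> \<in> U"
    "x \<in> U \<Longrightarrow> y \<in> U \<Longrightarrow> x \<oplus>\<^bsub>Q\<^esub> y \<in> U" "a \<in> A \<Longrightarrow> x \<in> U \<Longrightarrow> a \<otimes>\<^bsub>Q\<^esub> x \<in> U"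
  using assms by (auto simp: submod_def)

lemma submod_mono: "submod Q B U \<Longrightarrow> A \<subseteq> B \<Longrightarrow> submod Q A U"
  by (auto simp: submod_def)

lemma regular_module_sel [simp]:
  "carrier (regular_module Q) = carrier Q" "ring.zero (regular_module Q) = \<zero>\<^bsub>Q\<^esub>"
  "ring.add (regular_module Q) = ring.add Q" "module.smult (regular_module Q) = monoid.mult Q"
  by (simp_all add: regular_module_def)

locale cring_with_subring = cring Q for Q (structure) +
  fixes A
  assumes subA: "subcring A Q"
begin

abbreviation S where "S \<equiv> Q\<lparr>carrier := A\<rparr>"

lemma A_sub [simp]: "x \<in> A \<Longrightarrow> x \<in> carrier Q" using subcringE(1)[OF subA] by blast
lemma A_zero [simp]: "\<zero> \<in> A" using subcringE(2)[OF subA] .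
lemma A_one [simp]: "\<one> \<in> A" using subcringE(3)[OF subA] .
lemma A_neg: "x \<in> A \<Longrightarrow> \<ominus> x \<in> A" using subcringE(5)[OF subA] .
lemma A_mult: "x \<in> A \<Longrightarrow> y \<in> A \<Longrightarrow> x \<otimes> y \<in> A" using subcringE(6)[OF subA] .
lemma A_add: "x \<in> A \<Longrightarrow> y \<in> A \<Longrightarrow> x \<oplus> y \<in> A" using subcringE(7)[OF subA] .
lemma A_diff: "x \<in> A \<Longrightarrow> y \<in> A \<Longrightarrow> x \<ominus> y \<in> A" by (simp add: a_minus_def A_add A_neg)
lemma A_pow: "x \<in> A \<Longrightarrow> x [^] (n::nat) \<in> A" by (induct n) (auto intro: A_mult)

lemma S_cring: "cring S"
  using subcring_iff[OF subcringE(1)[OF subA]] subA by blast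

lemma S_minus: assumes "x \<in> A" shows "\<ominus>\<^bsub>S\<^esub> x = \<ominus> x"
proof -
  interpret S: cring S by (rule S_cring)
  have "\<ominus> x \<oplus>\<^bsub>S\<^esub> x = \<zero>\<^bsub>S\<^esub>" using assms A_sub by (simp add: l_neg)
  then show ?thesis using S.minus_equality[of "\<ominus> x" x] assms A_neg by simp
qed

lemma submod_neg:
  assumes U: "submod Q A U" and x: "x \<in> U" shows "\<ominus> x \<in> U"
proof -
  have "\<ominus> x = \<ominus> \<one> \<otimes> x" using submodD(1)[OF U x] by (simp add: l_minus)
  then show ?thesis using submodD(4)[OF U A_neg[OF A_one] x] by simp
qed

lemma submod_diff:
  assumes U: "submod Q A U" and "x \<in> U" "y \<in> U" shows "x \<ominus> y \<in> U"
  unfolding a_minus_def using submod_neg[OF U assms(3)] submodD(3)[OF U assms(2)] by blast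

lemma submod_A: "submod Q A A"
  by (rule submodI) (auto intro: A_sub A_add A_mult)

lemma submod_zero: "submod Q A {\<zero>}"
  by (rule submodI) (auto intro: A_sub)

lemma submod_carrier: "submod Q A (carrier Q)"
  by (rule submodI) (auto intro: A_sub)

lemma submod_Int: "submod Q A U \<Longrightarrow> submod Q A Y \<Longrightarrow> submod Q A (U \<inter> Y)"
  by (auto simp: submod_def)

lemma regular_module_module: "module S (regular_module Q)"
proof (rule moduleI)
  show "abelian_group (regular_module Q)"
  proof (rule abelian_groupI)
    fix x assume "x \<in> carrier (regular_module Q)"
    then show "\<exists>y\<in>carrier (regular_module Q). y \<oplus>\<^bsub>regular_module Q\<^esub> x = \<zero>\<^bsub>regular_module Q\<^esub>"
      by (auto intro!: bexI[of _ "\<ominus> x"] simp: l_neg)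
  qed (auto simp: a_ac)
qed (auto simp: S_cring A_sub l_distr r_distr m_assoc)

lemma submodule_iff: "submodule U S (regular_module Q) \<longleftrightarrow> submod Q A U"
proof
  assume U: "submodule U S (regular_module Q)"
  interpret U: submodule U S "regular_module Q" by fact
  show "submod Q A U"
    using U.subset U.one_closed U.m_closed U.smult_closed by (intro submodI) auto
next
  assume U: "submod Q A U"
  interpret V: module S "regular_module Q" by (rule regular_module_module)
  have neg: "\<ominus>\<^bsub>regular_module Q\<^esub> a = \<ominus> a" if "a \<in> U" for a
  proof -
    have a: "a \<in> carrier Q" using submodD(1)[OF U that] .
    have "\<ominus> a \<oplus>\<^bsub>regular_module Q\<^esub> a = \<zero>\<^bsub>regular_module Q\<^esub>" using a by (simp add: l_neg)
    then show ?thesis using V.minus_equality[of "\<ominus> a" a] a by simp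
  qed
  show "submodule U S (regular_module Q)"
    using neg submod_neg[OF U] submodD[OF U] by (intro V.submoduleI) auto
qed

lemma ideal_iff: "ideal U S \<longleftrightarrow> submod Q A U \<and> U \<subseteq> A"
proof
  assume U: "ideal U S"
  interpret U: ideal U S by fact
  have "U \<subseteq> A" using U.a_subset by simp
  have 1: "x \<oplus> y \<in> U" if "x \<in> U" "y \<in> U" for x y
    using additive_subgroup.a_closed[OF U.additive_subgroup_axioms that] by simp
  have 2: "a \<otimes> x \<in> U" if "a \<in> A" "x \<in> U" for a x
    using U.I_l_closed[of x a] that by simp
  have 3: "\<zero> \<in> U" using additive_subgroup.zero_closed[OF U.additive_subgroup_axioms] by simp
  have "submod Q A U"
    by (rule submodI[OF _ 3 1 2]) (use \<open>U \<subseteq> A\<close> A_sub in blast)+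
  then show "submod Q A U \<and> U \<subseteq> A" using \<open>U \<subseteq> A\<close> by simp
next
  assume U: "submod Q A U \<and> U \<subseteq> A"
  interpret S: cring S by (rule S_cring)
  show "ideal U S"
  proof (rule idealI[OF S.ring_axioms])
    have neg: "\<ominus>\<^bsub>S\<^esub> a \<in> U" if "a \<in> U" for a
    proof -
      have "a \<in> A" using U that by blast
      show ?thesis unfolding S_minus[OF \<open>a \<in> A\<close>] using U that submod_neg by simp
    qed
    show "subgroup U (add_monoid S)"
    proof (rule S.add.subgroupI)
      show "\<ominus>\<^bsub>S\<^esub> a \<in> U" if "a \<in> U" for a using neg[OF that] .
    qed (use U in \<open>auto simp: submod_def\<close>)
    fix a x assume "a \<in> U" "x \<in> carrier S"
    then have "x \<in> A" "a \<in> carrier Q" using U submodD(1)[of Q A U a] by auto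
    moreover have "x \<otimes> a \<in> U" using U submodD(4)[of Q A U x a] \<open>x \<in> A\<close> \<open>a \<in> U\<close> by blast
    ultimately have "x \<otimes> a \<in> U" "a \<otimes> x \<in> U" using m_comm[of a x] by simp_all
    then show "x \<otimes>\<^bsub>S\<^esub> a \<in> U" "a \<otimes>\<^bsub>S\<^esub> x \<in> U" by simp_all
  qed
qed

lemma submod_image:
  assumes U: "submod Q A U" and c: "c \<in> carrier Q"
  shows "submod Q A ((\<lambda>x. c \<otimes> x) ` U)"
proof (rule submodI)
  note [simp] = submodD(1)[OF U]
  show "(\<lambda>x. c \<otimes> x) ` U \<subseteq> carrier Q" using c by auto
  show "\<zero> \<in> (\<lambda>x. c \<otimes> x) ` U" using c submodD(2)[OF U] by (auto intro!: image_eqI[of _ _ \<zero>])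
  fix x y assume "x \<in> (\<lambda>x. c \<otimes> x) ` U" "y \<in> (\<lambda>x. c \<otimes> x) ` U"
  then show "x \<oplus> y \<in> (\<lambda>x. c \<otimes> x) ` U" using c submodD(3)[OF U]
    by (auto simp: r_distr[symmetric])
next
  note [simp] = submodD(1)[OF U]
  fix a x assume a: "a \<in> A" and "x \<in> (\<lambda>x. c \<otimes> x) ` U"
  then obtain y where y: "y \<in> U" "x = c \<otimes> y" by blast
  have "a \<otimes> x = c \<otimes> (a \<otimes> y)" using a y c A_sub by (simp add: m_lcomm)
  then show "a \<otimes> x \<in> (\<lambda>x. c \<otimes> x) ` U" using submodD(4)[OF U a y(1)] by blast
qed

text \<open>With \<open>Y = A\<close> this is the ideal (U : c) of A; with
  \<open>Y = carrier Q\<close> it turns a denominator condition into a submodule, to which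
  minimality of generators can be applied.\<close>

lemma submod_preimage:
  assumes U: "submod Q A U" and Y: "submod Q A Y" and c: "c \<in> carrier Q"
  shows "submod Q A {x \<in> Y. x \<otimes> c \<in> U}"
proof (rule submodI)
  fix a x assume "a \<in> A" and x: "x \<in> {x \<in> Y. x \<otimes> c \<in> U}"
  then have "a \<otimes> x \<otimes> c = a \<otimes> (x \<otimes> c)" using c A_sub submodD(1)[OF Y] m_assoc by auto
  then show "a \<otimes> x \<in> {x \<in> Y. x \<otimes> c \<in> U}"
    using x \<open>a \<in> A\<close> submodD(4)[OF U] submodD(4)[OF Y] by auto
qed (use U Y c in \<open>auto simp: submod_def l_distr subset_eq\<close>)

lemma submod_sum:
  assumes U: "submod Q A U" and c: "c \<in> carrier Q"
  shows "submod Q A {x \<oplus> a \<otimes> c | x a. x \<in> U \<and> a \<in> A}" (is "submod Q A ?Y")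
    and "U \<subseteq> {x \<oplus> a \<otimes> c | x a. x \<in> U \<and> a \<in> A}"
    and "c \<in> {x \<oplus> a \<otimes> c | x a. x \<in> U \<and> a \<in> A}"
proof -
  note U1 = submodD(1)[OF U]
  show sub: "U \<subseteq> ?Y"
  proof
    fix x assume "x \<in> U"
    moreover from this have "x = x \<oplus> \<zero> \<otimes> c" using c U1 by simp
    ultimately show "x \<in> ?Y" using A_zero by blast
  qed
  have "c = \<zero> \<oplus> \<one> \<otimes> c" using c by simp
  then show "c \<in> ?Y" using submodD(2)[OF U] A_one by blast
  show "submod Q A ?Y"
  proof (rule submodI)
    show "?Y \<subseteq> carrier Q" using U1 c A_sub by auto
    show "\<zero> \<in> ?Y" using sub submodD(2)[OF U] by blast
    fix u v assume "u \<in> ?Y" "v \<in> ?Y"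
    then obtain x a y b where h: "x \<in> U" "a \<in> A" "u = x \<oplus> a \<otimes> c" "y \<in> U" "b \<in> A" "v = y \<oplus> b \<otimes> c" by blast
    then have "x \<in> carrier Q" "y \<in> carrier Q" "a \<in> carrier Q" "b \<in> carrier Q" using U1 A_sub by auto
    then have "u \<oplus> v = (x \<oplus> y) \<oplus> (a \<oplus> b) \<otimes> c" using h c by algebra
    then show "u \<oplus> v \<in> ?Y" using submodD(3)[OF U h(1,4)] A_add[OF h(2,5)] by blast
  next
    fix b u assume b: "b \<in> A" and "u \<in> ?Y"
    then obtain x a where h: "x \<in> U" "a \<in> A" "u = x \<oplus> a \<otimes> c" by blast
    then have "x \<in> carrier Q" "b \<in> carrier Q" "a \<in> carrier Q" using U1 A_sub b by auto
    then have "b \<otimes> u = (b \<otimes> x) \<oplus> (b \<otimes> a) \<otimes> c" using h c by algebra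
    then show "b \<otimes> u \<in> ?Y" using submodD(4)[OF U b h(1)] A_mult[OF b h(2)] by blast
  qed
qed

lemma colon_submod:
  assumes U: "submod Q A U" and Y: "Y \<subseteq> carrier Q"
  shows "submod Q A (colon Q U Y)"
proof (rule submodI)
  fix a x assume a: "a \<in> A" and x: "x \<in> colon Q U Y"
  have "a \<otimes> x \<otimes> y \<in> U" if "y \<in> Y" for y
  proof -
    have "a \<otimes> x \<otimes> y = a \<otimes> (x \<otimes> y)" using a x that Y A_sub m_assoc by (auto simp: colon_def)
    then show ?thesis using x submodD(4)[OF U a] that by (auto simp: colon_def)
  qed
  then show "a \<otimes> x \<in> colon Q U Y" using a A_sub x by (auto simp: colon_def)
next
  fix x y assume x: "x \<in> colon Q U Y" "y \<in> colon Q U Y"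
  have "(x \<oplus> y) \<otimes> z \<in> U" if "z \<in> Y" for z
  proof -
    have "(x \<oplus> y) \<otimes> z = x \<otimes> z \<oplus> y \<otimes> z" using x that Y by (intro l_distr) (auto simp: colon_def)
    then show ?thesis using x submodD(3)[OF U] that by (auto simp: colon_def)
  qed
  then show "x \<oplus> y \<in> colon Q U Y" using x by (auto simp: colon_def)
qed (use Y submodD(2)[OF U] in \<open>auto simp: colon_def subset_eq\<close>)

end

section \<open>Finite generation over a Noetherian subring\<close>

locale noetherian_subring = cring_with_subring +
  assumes noeth: "noetherian_ring (Q\<lparr>carrier := A\<rparr>)"
begin

lemma submod_max:
  assumes "\<F> \<noteq> {}" and "\<And>I. I \<in> \<F> \<Longrightarrow> submod Q A I \<and> I \<subseteq> A"
  obtains I where "I \<in> \<F>" "\<And>J. J \<in> \<F> \<Longrightarrow> I \<subseteq> J \<Longrightarrow> J = I"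
proof (rule noetherian_ring.exists_maximal_ideal_in_family[OF noeth assms(1)])
  show "ideal I S" if "I \<in> \<F>" for I using assms(2)[OF that] ideal_iff by simp
qed (rule that)

lemma submod_fg:
  assumes U: "submod Q A U" "U \<subseteq> A"
  obtains G where "finite G" "G \<subseteq> U" "\<And>Y. submod Q A Y \<Longrightarrow> G \<subseteq> Y \<Longrightarrow> U \<subseteq> Y"
proof -
  interpret S: noetherian_ring S by (rule noeth)
  obtain G where G: "G \<subseteq> A" "finite G" "U = Idl\<^bsub>S\<^esub> G"
    using S.finetely_gen[of U] U ideal_iff by auto
  show thesis
  proof (rule that[OF G(2)])
    show "G \<subseteq> U" using S.genideal_self[of G] G by simp
    fix Y assume Y: "submod Q A Y" "G \<subseteq> Y"
    have "ideal (Y \<inter> A) S" using submod_Int[OF Y(1) submod_A] ideal_iff by simp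
    then have "Idl\<^bsub>S\<^esub> G \<subseteq> Y \<inter> A" using G Y by (intro S.genideal_minimal) auto
    then show "U \<subseteq> Y" using G(3) by blast
  qed
qed

text \<open>Multiplication by the unit d embeds U into A, where the Noetherian property gives
  generators; they are pulled back along the injective multiplication.\<close>

lemma fractional_fg:
  assumes U: "submod Q A U" and d: "d \<in> Units Q" "\<And>x. x \<in> U \<Longrightarrow> d \<otimes> x \<in> A"
  obtains G where "finite G" "G \<subseteq> U" "\<And>Y. submod Q A Y \<Longrightarrow> G \<subseteq> Y \<Longrightarrow> U \<subseteq> Y"
proof -
  have dc: "d \<in> carrier Q" "inv d \<in> carrier Q" using d by auto
  obtain G where G: "finite G" "G \<subseteq> (\<lambda>x. d \<otimes> x) ` U"
    "\<And>Y. submod Q A Y \<Longrightarrow> G \<subseteq> Y \<Longrightarrow> (\<lambda>x. d \<otimes> x) ` U \<subseteq> Y"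
    using submod_fg[OF submod_image[OF U dc(1)]] d(2) by blast
  obtain H where H: "finite H" "H \<subseteq> U" "G = (\<lambda>x. d \<otimes> x) ` H"
    using finite_subset_image[OF G(1,2)] by blast
  show thesis
  proof (rule that[OF H(1,2)])
    fix Y assume Y: "submod Q A Y" "H \<subseteq> Y"
    have "(\<lambda>x. d \<otimes> x) ` U \<subseteq> (\<lambda>x. d \<otimes> x) ` Y"
      using Y H(3) by (intro G(3) submod_image dc) auto
    show "U \<subseteq> Y"
    proof
      fix x assume x: "x \<in> U"
      then obtain y where y: "y \<in> Y" "d \<otimes> x = d \<otimes> y"
        using \<open>(\<lambda>x. d \<otimes> x) ` U \<subseteq> (\<lambda>x. d \<otimes> x) ` Y\<close> by blast
      then have "x = y" using Units_l_cancel[OF d(1)] submodD(1)[OF U x] submodD(1)[OF Y(1) y(1)] by blast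
      then show "x \<in> Y" using y by simp
    qed
  qed
qed

text \<open>One coincidence of neighbours is enough for the integrality and Nakayama arguments that
  follow.\<close>

lemma submod_chain_stabilizes:
  assumes U: "\<And>n::nat. submod Q A (U n)" "\<And>n. U n \<subseteq> A" "\<And>n. U n \<subseteq> U (Suc n)"
  obtains n where "U (Suc n) = U n"
proof -
  obtain I where I: "I \<in> range U" "\<And>J. J \<in> range U \<Longrightarrow> I \<subseteq> J \<Longrightarrow> J = I"
  proof (rule submod_max[of "range U"])
    show "submod Q A I \<and> I \<subseteq> A" if "I \<in> range U" for I using U(1,2) that by auto
  qed auto
  then obtain n where "I = U n" by auto
  then have "U (Suc n) = U n" using I(2)[of "U (Suc n)"] U(3)[of n] by simp
  then show thesis by (rule that)
qed

end

section \<open>Homomorphisms and quotients of modules\<close>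

lemma module_homI:
  assumes "\<And>x. x \<in> carrier M \<Longrightarrow> f x \<in> carrier N" "f \<in> extensional (carrier M)"
    "\<And>x y. x \<in> carrier M \<Longrightarrow> y \<in> carrier M \<Longrightarrow> f (x \<oplus>\<^bsub>M\<^esub> y) = f x \<oplus>\<^bsub>N\<^esub> f y"
    "\<And>a x. a \<in> carrier R \<Longrightarrow> x \<in> carrier M \<Longrightarrow> f (a \<odot>\<^bsub>M\<^esub> x) = a \<odot>\<^bsub>N\<^esub> f x"
  shows "f \<in> module_hom R M N"
  using assms by (auto simp: module_hom_def PiE_def)

lemma module_homD:
  assumes "f \<in> module_hom R M N"
  shows "x \<in> carrier M \<Longrightarrow> f x \<in> carrier N" "f \<in> extensional (carrier M)"
    "x \<in> carrier M \<Longrightarrow> y \<in> carrier M \<Longrightarrow> f (x \<oplus>\<^bsub>M\<^esub> y) = f x \<oplus>\<^bsub>N\<^esub> f y"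
    "a \<in> carrier R \<Longrightarrow> x \<in> carrier M \<Longrightarrow> f (a \<odot>\<^bsub>M\<^esub> x) = a \<odot>\<^bsub>N\<^esub> f x"
  using assms by (auto simp: module_hom_def PiE_def)

lemma module_hom_compose:
  assumes f: "f \<in> module_hom R M N" and g: "g \<in> module_hom R N P"
    and "module R M"
  shows "compose (carrier M) g f \<in> module_hom R M P"
proof -
  interpret M: module R M by fact
  show ?thesis
    using module_homD[OF f] module_homD[OF g]
    by (intro module_homI) (simp_all add: compose_def)
qed

lemma module_hom_zero:
  assumes "module R M" "module R N" and f: "f \<in> module_hom R M N"
  shows "f \<zero>\<^bsub>M\<^esub> = \<zero>\<^bsub>N\<^esub>"
proof -
  interpret M: module R M by fact
  interpret N: module R N by fact
  have "f (\<zero>\<^bsub>R\<^esub> \<odot>\<^bsub>M\<^esub> \<zero>\<^bsub>M\<^esub>) = \<zero>\<^bsub>R\<^esub> \<odot>\<^bsub>N\<^esub> f \<zero>\<^bsub>M\<^esub>"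
    using module_homD(4)[OF f] by blast
  then show ?thesis using module_homD(1)[OF f M.zero_closed] by simp
qed

lemma module_hom_neg:
  assumes "module R M" "module R N" and f: "f \<in> module_hom R M N" and x: "x \<in> carrier M"
  shows "f (\<ominus>\<^bsub>M\<^esub> x) = \<ominus>\<^bsub>N\<^esub> f x"
proof -
  interpret M: module R M by fact
  interpret N: module R N by fact
  have "f (\<ominus>\<^bsub>M\<^esub> x) \<oplus>\<^bsub>N\<^esub> f x = \<zero>\<^bsub>N\<^esub>"
    using module_homD(3)[OF f M.a_inv_closed[OF x] x] module_hom_zero[OF assms(1-3)] x
    by (simp add: M.l_neg)
  then show ?thesis using N.minus_equality module_homD(1)[OF f] x by simp
qed

lemma module_hom_diff:
  assumes "module R M" "module R N" and f: "f \<in> module_hom R M N" and x: "x \<in> carrier M" "y \<in> carrier M"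
  shows "f (x \<ominus>\<^bsub>M\<^esub> y) = f x \<ominus>\<^bsub>N\<^esub> f y"
proof -
  interpret M: module R M by fact
  show ?thesis unfolding a_minus_def
    using module_homD(3)[OF f x(1) M.a_inv_closed[OF x(2)]] module_hom_neg[OF assms(1-3) x(2)] by simp
qed

lemma module_hom_add:
  assumes "module R M" "module R N" and f: "f \<in> module_hom R M N" and g: "g \<in> module_hom R M N"
  shows "(\<lambda>x\<in>carrier M. f x \<oplus>\<^bsub>N\<^esub> g x) \<in> module_hom R M N"
proof -
  interpret M: module R M by fact
  interpret N: module R N by fact
  note * = module_homD[OF f] module_homD[OF g]
  show ?thesis
    by (rule module_homI) (simp_all add: * N.a_ac N.smult_r_distr)
qed

lemma module_hom_smult:
  assumes "module R M" "module R N" and f: "f \<in> module_hom R M N" and a: "a \<in> carrier R"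
  shows "(\<lambda>x\<in>carrier M. a \<odot>\<^bsub>N\<^esub> f x) \<in> module_hom R M N"
proof -
  interpret M: module R M by fact
  interpret N: module R N by fact
  note * = module_homD[OF f]
  show ?thesis
    by (rule module_homI)
      (simp_all add: * a N.smult_r_distr N.smult_assoc1[symmetric] M.R.m_comm)
qed

lemma module_hom_const_zero:
  assumes "module R M" "module R N"
  shows "(\<lambda>x\<in>carrier M. \<zero>\<^bsub>N\<^esub>) \<in> module_hom R M N"
proof -
  interpret M: module R M by fact
  interpret N: module R N by fact
  show ?thesis by (rule module_homI) simp_all
qed

lemma module_hom_image:
  assumes "module R M" "module R N" and f: "f \<in> module_hom R M N"
  shows "submodule (f ` carrier M) R N"
proof -
  interpret M: module R M by fact
  interpret N: module R N by fact
  show ?thesis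
  proof (rule N.submoduleI)
    show "\<zero>\<^bsub>N\<^esub> \<in> f ` carrier M"
      using module_hom_zero[OF assms] M.zero_closed by (metis imageI)
    fix y assume "y \<in> f ` carrier M"
    then obtain x where x: "x \<in> carrier M" "y = f x" by blast
    show "\<ominus>\<^bsub>N\<^esub> y \<in> f ` carrier M"
      using module_hom_neg[OF assms x(1)] x by (metis imageI M.a_inv_closed)
    fix z assume "z \<in> f ` carrier M"
    then obtain w where w: "w \<in> carrier M" "z = f w" by blast
    show "y \<oplus>\<^bsub>N\<^esub> z \<in> f ` carrier M"
      using module_homD(3)[OF f x(1) w(1)] x w by (metis imageI M.a_closed)
  next
    fix a y assume a: "a \<in> carrier R" and "y \<in> f ` carrier M"
    then obtain x where x: "x \<in> carrier M" "y = f x" by blast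
    show "a \<odot>\<^bsub>N\<^esub> y \<in> f ` carrier M"
      using module_homD(4)[OF f a x(1)] x a by (metis imageI M.smult_closed)
  qed (use module_homD(1)[OF f] in blast)
qed

lemma module_hom_kernel:
  assumes "module R M" "module R N" and f: "f \<in> module_hom R M N"
  shows "submodule {x \<in> carrier M. f x = \<zero>\<^bsub>N\<^esub>} R M"
proof -
  interpret M: module R M by fact
  interpret N: module R N by fact
  show ?thesis
    by (rule M.submoduleI)
      (auto simp: module_hom_zero[OF assms] module_hom_neg[OF assms] module_homD[OF f])
qed

lemma hom_module_sel [simp]:
  "carrier (hom_module R M N) = module_hom R M N"
  "ring.zero (hom_module R M N) = (\<lambda>x\<in>carrier M. \<zero>\<^bsub>N\<^esub>)"
  "ring.add (hom_module R M N) = (\<lambda>f g. \<lambda>x\<in>carrier M. f x \<oplus>\<^bsub>N\<^esub> g x)"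
  "module.smult (hom_module R M N) = (\<lambda>a f. \<lambda>x\<in>carrier M. a \<odot>\<^bsub>N\<^esub> f x)"
  by (simp_all add: hom_module_def)

lemma hom_module_module:
  assumes "module R M" "module R N"
  shows "module R (hom_module R M N)"
proof -
  interpret M: module R M by fact
  interpret N: module R N by fact
  note c = module_homD(1)
  note ext = extensionalityI[where A = "carrier M"]
  show ?thesis
  proof (rule moduleI)
    show "cring R" by (rule M.R.cring_axioms)
    show "abelian_group (hom_module R M N)"
    proof (rule abelian_groupI, goal_cases)
      case (1 f g) then show ?case using module_hom_add[OF assms] by simp
    next
      case 2 show ?case using module_hom_const_zero[OF assms] by simp
    next
      case (3 f g h) then show ?case
        by (auto intro!: ext simp: N.a_assoc c)
    next
      case (4 f g) then show ?case
        by (auto intro!: ext simp: N.a_comm c)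
    next
      case (5 f) then show ?case
        by (auto intro!: ext simp: c module_homD(2))
    next
      case (6 f)
      then have f: "f \<in> module_hom R M N" by simp
      have "(\<lambda>x\<in>carrier M. \<ominus>\<^bsub>R\<^esub> \<one>\<^bsub>R\<^esub> \<odot>\<^bsub>N\<^esub> f x) \<in> module_hom R M N"
        by (intro module_hom_smult[OF assms f] M.R.a_inv_closed M.R.one_closed)
      moreover have "(\<lambda>x\<in>carrier M. (\<lambda>x\<in>carrier M. \<ominus>\<^bsub>R\<^esub> \<one>\<^bsub>R\<^esub> \<odot>\<^bsub>N\<^esub> f x) x \<oplus>\<^bsub>N\<^esub> f x)
          = (\<lambda>x\<in>carrier M. \<zero>\<^bsub>N\<^esub>)"
        by (rule restrict_ext) (simp add: c[OF f] N.smult_l_minus N.l_neg)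
      ultimately show ?case unfolding hom_module_sel
        by (intro bexI[of _ "\<lambda>x\<in>carrier M. \<ominus>\<^bsub>R\<^esub> \<one>\<^bsub>R\<^esub> \<odot>\<^bsub>N\<^esub> f x"])
    qed
  next
    fix a x assume "a \<in> carrier R" "x \<in> carrier (hom_module R M N)"
    then show "a \<odot>\<^bsub>hom_module R M N\<^esub> x \<in> carrier (hom_module R M N)"
      using module_hom_smult[OF assms] by simp
  qed (auto intro!: ext simp: N.smult_l_distr N.smult_r_distr N.smult_assoc1 c module_homD(2))
qed

section \<open>Cosets and quotient modules\<close>

lemma quotient_module_sel [simp]:
  "carrier (quotient_module M N) = a_rcosets\<^bsub>M\<^esub> N" "ring.zero (quotient_module M N) = N"
  "ring.add (quotient_module M N) = set_add M"
  "module.smult (quotient_module M N) = (\<lambda>a U. N <+>\<^bsub>M\<^esub> ((\<lambda>x. a \<odot>\<^bsub>M\<^esub> x) ` U))"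
  by (simp_all add: quotient_module_def)

locale module_with_submodule = module R M for R (structure) and M (structure) +
  fixes N
  assumes sub: "submodule N R M"
begin

lemma abelian_subgroup: "abelian_subgroup N M"
  using sub by (intro abelian_subgroupI3 M.abelian_group_axioms additive_subgroup.intro)
    (simp add: submodule_def)

lemma N_closed: "x \<in> N \<Longrightarrow> x \<in> carrier M" "\<zero>\<^bsub>M\<^esub> \<in> N" "x \<in> N \<Longrightarrow> y \<in> N \<Longrightarrow> x \<oplus>\<^bsub>M\<^esub> y \<in> N"
  "x \<in> N \<Longrightarrow> y \<in> N \<Longrightarrow> x \<ominus>\<^bsub>M\<^esub> y \<in> N" "a \<in> carrier R \<Longrightarrow> x \<in> N \<Longrightarrow> a \<odot>\<^bsub>M\<^esub> x \<in> N"
proof -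
  interpret N: abelian_subgroup N M by (rule abelian_subgroup)
  show "x \<in> N \<Longrightarrow> x \<in> carrier M" using N.a_subset by blast
  show "\<zero>\<^bsub>M\<^esub> \<in> N" by (rule N.zero_closed)
  show "x \<in> N \<Longrightarrow> y \<in> N \<Longrightarrow> x \<oplus>\<^bsub>M\<^esub> y \<in> N" by (rule N.a_closed)
  show "x \<in> N \<Longrightarrow> y \<in> N \<Longrightarrow> x \<ominus>\<^bsub>M\<^esub> y \<in> N"
    unfolding a_minus_def using N.a_closed N.a_inv_closed by blast
  show "a \<in> carrier R \<Longrightarrow> x \<in> N \<Longrightarrow> a \<odot>\<^bsub>M\<^esub> x \<in> N" using submoduleE(4)[OF sub] .
qed

lemma coset_eq: "N +>\<^bsub>M\<^esub> x = {h \<oplus>\<^bsub>M\<^esub> x | h. h \<in> N}"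
  by (auto simp: a_r_coset_def')

lemma mem_coset:
  assumes "x \<in> carrier M" "y \<in> carrier M"
  shows "y \<in> N +>\<^bsub>M\<^esub> x \<longleftrightarrow> y \<ominus>\<^bsub>M\<^esub> x \<in> N"
proof
  assume "y \<in> N +>\<^bsub>M\<^esub> x"
  then obtain h where h: "h \<in> N" "y = h \<oplus>\<^bsub>M\<^esub> x" by (auto simp: coset_eq)
  then have "y \<ominus>\<^bsub>M\<^esub> x = h" using assms N_closed(1)[OF h(1)]
    by (simp add: a_minus_def M.a_assoc M.r_neg)
  then show "y \<ominus>\<^bsub>M\<^esub> x \<in> N" using h by simp
next
  assume "y \<ominus>\<^bsub>M\<^esub> x \<in> N"
  moreover have "y = (y \<ominus>\<^bsub>M\<^esub> x) \<oplus>\<^bsub>M\<^esub> x" using assms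
    by (simp add: a_minus_def M.a_assoc M.l_neg)
  ultimately show "y \<in> N +>\<^bsub>M\<^esub> x" unfolding coset_eq by blast
qed

lemma coset_self: "x \<in> carrier M \<Longrightarrow> x \<in> N +>\<^bsub>M\<^esub> x"
  using mem_coset[of x x] N_closed(2) by (simp add: a_minus_def M.r_neg)

lemma coset_eq_iff:
  assumes "x \<in> carrier M" "y \<in> carrier M"
  shows "N +>\<^bsub>M\<^esub> x = N +>\<^bsub>M\<^esub> y \<longleftrightarrow> x \<ominus>\<^bsub>M\<^esub> y \<in> N"
proof -
  interpret N: abelian_subgroup N M by (rule abelian_subgroup)
  show ?thesis
    using mem_coset[OF assms(2,1)] coset_self[OF assms(1)] N.a_repr_independence'[OF _ assms(2), of x]
    by auto
qed

lemma coset_eq_N_iff: "x \<in> carrier M \<Longrightarrow> N +>\<^bsub>M\<^esub> x = N \<longleftrightarrow> x \<in> N"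
  using coset_eq_iff[of x "\<zero>\<^bsub>M\<^esub>"] abelian_subgroup.a_rcos_const[OF abelian_subgroup N_closed(2)]
    M.minus_equality[of "\<zero>\<^bsub>M\<^esub>" "\<zero>\<^bsub>M\<^esub>"]
  by (simp add: a_minus_def)

lemma cosets: "a_rcosets\<^bsub>M\<^esub> N = (\<lambda>x. N +>\<^bsub>M\<^esub> x) ` carrier M"
  by (auto simp: A_RCOSETS_def')

lemma coset_add:
  "x \<in> carrier M \<Longrightarrow> y \<in> carrier M \<Longrightarrow> (N +>\<^bsub>M\<^esub> x) <+>\<^bsub>M\<^esub> (N +>\<^bsub>M\<^esub> y) = N +>\<^bsub>M\<^esub> (x \<oplus>\<^bsub>M\<^esub> y)"
  using abelian_subgroup.a_rcos_sum[OF abelian_subgroup] by blast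

lemma coset_smult:
  assumes a: "a \<in> carrier R" and x: "x \<in> carrier M"
  shows "N <+>\<^bsub>M\<^esub> ((\<lambda>x. a \<odot>\<^bsub>M\<^esub> x) ` (N +>\<^bsub>M\<^esub> x)) = N +>\<^bsub>M\<^esub> (a \<odot>\<^bsub>M\<^esub> x)"
proof -
  have "h \<oplus>\<^bsub>M\<^esub> a \<odot>\<^bsub>M\<^esub> (k \<oplus>\<^bsub>M\<^esub> x) = (h \<oplus>\<^bsub>M\<^esub> a \<odot>\<^bsub>M\<^esub> k) \<oplus>\<^bsub>M\<^esub> a \<odot>\<^bsub>M\<^esub> x" if "h \<in> N" "k \<in> N" for h k
    using N_closed(1)[OF that(1)] N_closed(1)[OF that(2)] a x by (simp add: smult_r_distr M.a_assoc)
  moreover have "h \<oplus>\<^bsub>M\<^esub> a \<odot>\<^bsub>M\<^esub> k \<in> N" if "h \<in> N" "k \<in> N" for h k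
    using that N_closed(3,5) a by blast
  ultimately have "h \<oplus>\<^bsub>M\<^esub> a \<odot>\<^bsub>M\<^esub> (k \<oplus>\<^bsub>M\<^esub> x) \<in> N +>\<^bsub>M\<^esub> (a \<odot>\<^bsub>M\<^esub> x)" if "h \<in> N" "k \<in> N" for h k
    unfolding coset_eq using that by blast
  moreover have "h \<oplus>\<^bsub>M\<^esub> a \<odot>\<^bsub>M\<^esub> x \<in> N <+>\<^bsub>M\<^esub> ((\<lambda>x. a \<odot>\<^bsub>M\<^esub> x) ` (N +>\<^bsub>M\<^esub> x))" if "h \<in> N" for h
    unfolding set_add_def' using that coset_self[OF x] by blast
  ultimately show ?thesis
    by (auto simp: coset_eq[of x] coset_eq[of "a \<odot>\<^bsub>M\<^esub> x"] set_add_def')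
qed

lemma projection_hom:
  "(\<lambda>x\<in>carrier M. N +>\<^bsub>M\<^esub> x) \<in> module_hom R M (quotient_module M N)"
  by (rule module_homI) (auto simp: cosets coset_add coset_smult)

lemma quotient_trivial_iff: "carrier (quotient_module M N) = {\<zero>\<^bsub>quotient_module M N\<^esub>} \<longleftrightarrow> carrier M \<subseteq> N"
proof -
  have "carrier (quotient_module M N) = {\<zero>\<^bsub>quotient_module M N\<^esub>} \<longleftrightarrow> (\<forall>x\<in>carrier M. N +>\<^bsub>M\<^esub> x = N)"
    using M.zero_closed by (auto simp: cosets)
  also have "\<dots> \<longleftrightarrow> carrier M \<subseteq> N" using coset_eq_N_iff by blast
  finally show ?thesis .
qed

end

text \<open>The isomorphism theorem for L -> M / N, which is onto with kernel I. The map is built in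
  the direction M / N -> L / I, sending a coset to its preimage under b; this involves no choice of
  representatives.\<close>

lemma quotient_module_isomorphic:
  assumes H: "module_with_submodule R M N" and L: "module_with_submodule R L I"
    and b: "b \<in> module_hom R L M"
    and surj: "\<And>f. f \<in> carrier M \<Longrightarrow> \<exists>l\<in>carrier L. f \<ominus>\<^bsub>M\<^esub> b l \<in> N"
    and ker: "\<And>l. l \<in> carrier L \<Longrightarrow> b l \<in> N \<longleftrightarrow> l \<in> I"
  shows "module_isomorphic R (quotient_module M N) (quotient_module L I)"
proof -
  interpret M: module_with_submodule R M N by fact
  interpret L: module_with_submodule R L I by fact
  define \<Phi> where "\<Phi> = (\<lambda>U\<in>carrier (quotient_module M N). {l \<in> carrier L. b l \<in> U})"
  have eq: "\<Phi> (N +>\<^bsub>M\<^esub> b l) = I +>\<^bsub>L\<^esub> l" if l: "l \<in> carrier L" for l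
  proof -
    have "b k \<in> N +>\<^bsub>M\<^esub> b l \<longleftrightarrow> k \<in> I +>\<^bsub>L\<^esub> l" if k: "k \<in> carrier L" for k
      using M.mem_coset[OF module_homD(1)[OF b l] module_homD(1)[OF b k]] L.mem_coset[OF l k]
        module_hom_diff[OF L.module_axioms M.module_axioms b k l] ker[of "k \<ominus>\<^bsub>L\<^esub> l"] k l by simp
    moreover have "I +>\<^bsub>L\<^esub> l \<subseteq> carrier L" using l L.N_closed(1) by (auto simp: L.coset_eq)
    ultimately show ?thesis
      unfolding \<Phi>_def using module_homD(1)[OF b l] by (auto simp: M.cosets)
  qed
  have rep: "\<exists>l\<in>carrier L. U = N +>\<^bsub>M\<^esub> b l" if U: "U \<in> carrier (quotient_module M N)" for U
  proof -
    obtain f where f: "f \<in> carrier M" "U = N +>\<^bsub>M\<^esub> f" using U by (auto simp: M.cosets)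
    obtain l where l: "l \<in> carrier L" "f \<ominus>\<^bsub>M\<^esub> b l \<in> N" using surj[OF f(1)] by blast
    then show ?thesis using M.coset_eq_iff[OF f(1) module_homD(1)[OF b l(1)]] f by blast
  qed
  have "\<Phi> \<in> module_hom R (quotient_module M N) (quotient_module L I)"
  proof (rule module_homI)
    fix U assume "U \<in> carrier (quotient_module M N)"
    then obtain l where l: "l \<in> carrier L" "U = N +>\<^bsub>M\<^esub> b l" using rep by blast
    then show "\<Phi> U \<in> carrier (quotient_module L I)" using eq by (auto simp: L.cosets)
    note bl = module_homD(1)[OF b l(1)]
    {
      fix V assume "V \<in> carrier (quotient_module M N)"
      then obtain k where k: "k \<in> carrier L" "V = N +>\<^bsub>M\<^esub> b k" using rep by blast
      have "U \<oplus>\<^bsub>quotient_module M N\<^esub> V = N +>\<^bsub>M\<^esub> b (l \<oplus>\<^bsub>L\<^esub> k)"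
        using l k bl module_homD(1)[OF b k(1)] by (simp add: M.coset_add module_homD(3)[OF b])
      then show "\<Phi> (U \<oplus>\<^bsub>quotient_module M N\<^esub> V) = \<Phi> U \<oplus>\<^bsub>quotient_module L I\<^esub> \<Phi> V"
        using l k by (simp add: eq L.coset_add)
    }
    fix a assume a: "a \<in> carrier R"
    have "a \<odot>\<^bsub>quotient_module M N\<^esub> U = N +>\<^bsub>M\<^esub> b (a \<odot>\<^bsub>L\<^esub> l)"
      using a l bl by (simp add: M.coset_smult module_homD(4)[OF b])
    then show "\<Phi> (a \<odot>\<^bsub>quotient_module M N\<^esub> U) = a \<odot>\<^bsub>quotient_module L I\<^esub> \<Phi> U"
      using a l by (simp add: eq L.coset_smult)
  qed (simp add: \<Phi>_def)
  moreover have "bij_betw \<Phi> (carrier (quotient_module M N)) (carrier (quotient_module L I))"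
  proof (rule bij_betwI')
    fix U V assume "U \<in> carrier (quotient_module M N)" "V \<in> carrier (quotient_module M N)"
    then obtain l k where l: "l \<in> carrier L" "U = N +>\<^bsub>M\<^esub> b l" and k: "k \<in> carrier L" "V = N +>\<^bsub>M\<^esub> b k"
      using rep by meson
    note bl = module_homD(1)[OF b l(1)] module_homD(1)[OF b k(1)]
    show "\<Phi> U = \<Phi> V \<longleftrightarrow> U = V"
      using l k bl eq[OF l(1)] eq[OF k(1)] M.coset_eq_iff[OF bl] L.coset_eq_iff[OF l(1) k(1)]
        module_hom_diff[OF L.module_axioms M.module_axioms b l(1) k(1)] ker[of "l \<ominus>\<^bsub>L\<^esub> k"] by simp
  next
    fix U assume "U \<in> carrier (quotient_module M N)"
    then obtain l where l: "l \<in> carrier L" "U = N +>\<^bsub>M\<^esub> b l" using rep by blast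
    then show "\<Phi> U \<in> carrier (quotient_module L I)" using eq by (auto simp: L.cosets)
  next
    fix V assume "V \<in> carrier (quotient_module L I)"
    then obtain l where l: "l \<in> carrier L" "V = I +>\<^bsub>L\<^esub> l" by (auto simp: L.cosets)
    then have "V = \<Phi> (N +>\<^bsub>M\<^esub> b l)" "N +>\<^bsub>M\<^esub> b l \<in> carrier (quotient_module M N)"
      using eq module_homD(1)[OF b l(1)] by (auto simp: M.cosets)
    then show "\<exists>U\<in>carrier (quotient_module M N). V = \<Phi> U" by blast
  qed
  ultimately show ?thesis unfolding module_isomorphic_def by blast
qed

section \<open>Free modules and free resolutions\<close>

lemma free_module_sel [simp]:
  "carrier (free_module R n) = {..<n} \<rightarrow>\<^sub>E carrier R"
  "ring.zero (free_module R n) = (\<lambda>i\<in>{..<n}. \<zero>\<^bsub>R\<^esub>)"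
  "ring.add (free_module R n) = (\<lambda>v w. \<lambda>i\<in>{..<n}. v i \<oplus>\<^bsub>R\<^esub> w i)"
  "module.smult (free_module R n) = (\<lambda>a v. \<lambda>i\<in>{..<n}. a \<otimes>\<^bsub>R\<^esub> v i)"
  by (simp_all add: free_module_def)

definition unit_vector :: "('a, 'r) ring_scheme \<Rightarrow> nat \<Rightarrow> nat \<Rightarrow> (nat \<Rightarrow> 'a)"
  where "unit_vector R n j = (\<lambda>i\<in>{..<n}. if i = j then \<one>\<^bsub>R\<^esub> else \<zero>\<^bsub>R\<^esub>)"

lemma submodule_zero: "submodule N R M \<Longrightarrow> \<zero>\<^bsub>M\<^esub> \<in> N"
  using subgroup.one_closed[of N "add_monoid M"] by (simp add: submodule_def)

context cring
begin

abbreviation F where "F \<equiv> free_module R"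

lemma free_module_closed: "v \<in> carrier (F n) \<Longrightarrow> i < n \<Longrightarrow> v i \<in> carrier R"
  by auto

lemma free_module_eqI:
  assumes "v \<in> carrier (F n)" "w \<in> carrier (F n)" "\<And>i. i < n \<Longrightarrow> v i = w i"
  shows "v = w"
  using assms by (intro PiE_ext[of v "{..<n}" _ w]) auto

lemma free_module_module: "module R (F n)"
proof -
  note c = free_module_closed
  have restr: "(\<lambda>i\<in>{..<n}. f i) \<in> carrier (F n)" if "\<And>i. i < n \<Longrightarrow> f i \<in> carrier R" for f
    using that by auto
  have eqI: "(\<lambda>i\<in>{..<n}. f i) = (\<lambda>i\<in>{..<n}. g i)" if "\<And>i. i < n \<Longrightarrow> f i = g i" for f g :: "nat \<Rightarrow> 'a"
    using that by (intro restrict_ext) simp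
  have eqI': "(\<lambda>i\<in>{..<n}. f i) = v" if "v \<in> carrier (F n)" "\<And>i. i < n \<Longrightarrow> f i = v i" for f v
    by (rule free_module_eqI[OF _ that(1)]) (use that c[OF that(1)] in \<open>auto simp del: free_module_sel intro!: restr\<close>)
  note ops = free_module_sel(2-4)
  have "abelian_group (F n)"
  proof (rule abelian_groupI, goal_cases)
    case (1 v w) then show ?case unfolding ops by (intro restr a_closed c)
  next
    case 2 show ?case unfolding ops by (intro restr zero_closed)
  next
    case (3 u v w) then show ?case unfolding ops by (intro eqI) (simp add: a_assoc c del: free_module_sel)
  next
    case (4 v w) then show ?case unfolding ops by (intro eqI a_comm c)
  next
    case (5 v) then show ?case unfolding ops by (intro eqI') (simp_all add: c del: free_module_sel)
  next
    case (6 v)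
    let ?w = "\<lambda>i\<in>{..<n}. \<ominus> v i"
    have "?w \<in> carrier (F n)" by (intro restr a_inv_closed c[OF 6])
    moreover have "?w \<oplus>\<^bsub>F n\<^esub> v = \<zero>\<^bsub>F n\<^esub>"
      unfolding ops by (intro eqI) (simp add: l_neg c[OF 6])
    ultimately show ?case by (intro bexI[of _ ?w])
  qed
  then show ?thesis
  proof (rule moduleI[OF cring_axioms], goal_cases)
    case (1 a v) then show ?case unfolding ops by (intro restr m_closed) (simp_all add: c del: free_module_sel)
  next
    case (2 a b v) then show ?case unfolding ops by (intro eqI) (simp add: l_distr c del: free_module_sel)
  next
    case (3 a v w) then show ?case unfolding ops by (intro eqI) (simp add: r_distr c del: free_module_sel)
  next
    case (4 a b v) then show ?case unfolding ops by (intro eqI) (simp add: m_assoc c del: free_module_sel)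
  next
    case (5 v) then show ?case unfolding ops by (intro eqI') (simp_all add: c del: free_module_sel)
  qed
qed

lemma unit_vector_closed [simp]: "unit_vector R n j \<in> carrier (F n)"
  by (auto simp: unit_vector_def)

text \<open>The set N is given only by closure properties, so that the lemma serves as an induction
  rule: N is usually the set of vectors with some property.\<close>

lemma free_module_span:
  assumes N: "\<zero>\<^bsub>F n\<^esub> \<in> N" "\<And>v w. v \<in> N \<Longrightarrow> w \<in> N \<Longrightarrow> v \<oplus>\<^bsub>F n\<^esub> w \<in> N"
    "\<And>a v. a \<in> carrier R \<Longrightarrow> v \<in> N \<Longrightarrow> a \<odot>\<^bsub>F n\<^esub> v \<in> N" "\<And>j. j < n \<Longrightarrow> unit_vector R n j \<in> N"
  shows "carrier (F n) \<subseteq> N"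
proof -
  \<comment> \<open>Induction on the number k of leading coordinates that may be nonzero.\<close>
  have "v \<in> N" if "v \<in> carrier (F n)" "\<And>i. k \<le> i \<Longrightarrow> i < n \<Longrightarrow> v i = \<zero>" "k \<le> n" for k v
    using that
  proof (induct k arbitrary: v)
    case 0
    then have "v = \<zero>\<^bsub>F n\<^esub>" by (intro free_module_eqI[of v n]) auto
    then show ?case using N(1) by (simp only:)
  next
    case (Suc k)
    have v: "v i \<in> carrier R" if "i < n" for i using Suc(2) that by auto
    define w where "w = (\<lambda>i\<in>{..<n}. if i = k then \<zero> else v i)"
    have w: "w \<in> carrier (F n)" using v by (auto simp: w_def)
    have "w \<in> N"
    proof (rule Suc(1)[OF w])
      show "w i = \<zero>" if "k \<le> i" "i < n" for i
        using that Suc(3)[of i] by (auto simp: w_def)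
    qed (use Suc(4) in simp)
    moreover have "v = w \<oplus>\<^bsub>F n\<^esub> v k \<odot>\<^bsub>F n\<^esub> unit_vector R n k"
      using Suc(2,4) w v by (intro free_module_eqI[of v n]) (auto simp: w_def unit_vector_def)
    moreover have "v k \<odot>\<^bsub>F n\<^esub> unit_vector R n k \<in> N"
      using Suc(4) by (intro N(3,4) v) auto
    ultimately show ?case using N(2) by metis
  qed
  from this[of _ n] show ?thesis by auto
qed

lemma free_module_hom_eqI:
  assumes "module R M" and f: "f \<in> module_hom R (F n) M" and g: "g \<in> module_hom R (F n) M"
    and eq: "\<And>j. j < n \<Longrightarrow> f (unit_vector R n j) = g (unit_vector R n j)" and v: "v \<in> carrier (F n)"
  shows "f v = g v"
proof -
  interpret F: module R "F n" by (rule free_module_module)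
  have "carrier (F n) \<subseteq> {v \<in> carrier (F n). f v = g v}"
  proof (rule free_module_span)
    show "\<zero>\<^bsub>F n\<^esub> \<in> {v \<in> carrier (F n). f v = g v}"
      using module_hom_zero[OF free_module_module assms(1) f] module_hom_zero[OF free_module_module assms(1) g]
        F.zero_closed by simp
    fix v w assume "v \<in> {v \<in> carrier (F n). f v = g v}" "w \<in> {v \<in> carrier (F n). f v = g v}"
    then show "v \<oplus>\<^bsub>F n\<^esub> w \<in> {v \<in> carrier (F n). f v = g v}"
      using module_homD(3)[OF f, of v w] module_homD(3)[OF g, of v w] F.a_closed[of v w] by (simp del: free_module_sel)
  next
    fix a v assume "a \<in> carrier R" "v \<in> {v \<in> carrier (F n). f v = g v}"
    then show "a \<odot>\<^bsub>F n\<^esub> v \<in> {v \<in> carrier (F n). f v = g v}"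
      using module_homD(4)[OF f, of a v] module_homD(4)[OF g, of a v] F.smult_closed[of a v] by (simp del: free_module_sel)
  qed (use eq unit_vector_closed in blast)
  then show ?thesis using v by blast
qed

lemma coordinate_hom:
  assumes "module R M" and k: "k < n" and m: "m \<in> carrier M"
  shows "(\<lambda>v\<in>carrier (F n). v k \<odot>\<^bsub>M\<^esub> m) \<in> module_hom R (F n) M"
proof -
  interpret M: module R M by fact
  interpret F: module R "F n" by (rule free_module_module)
  show ?thesis
  proof (rule module_homI)
    fix v w assume "v \<in> carrier (F n)" "w \<in> carrier (F n)"
    moreover from this have "v \<oplus>\<^bsub>F n\<^esub> w \<in> carrier (F n)" by (rule F.a_closed)
    moreover have "v k \<in> carrier R" "w k \<in> carrier R" using calculation(1,2) k by auto
    ultimately show "(\<lambda>v\<in>carrier (F n). v k \<odot>\<^bsub>M\<^esub> m) (v \<oplus>\<^bsub>F n\<^esub> w)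
        = (\<lambda>v\<in>carrier (F n). v k \<odot>\<^bsub>M\<^esub> m) v \<oplus>\<^bsub>M\<^esub> (\<lambda>v\<in>carrier (F n). v k \<odot>\<^bsub>M\<^esub> m) w"
      using k m by (simp add: M.smult_l_distr)
  next
    fix a v assume "a \<in> carrier R" "v \<in> carrier (F n)"
    moreover from this have "a \<odot>\<^bsub>F n\<^esub> v \<in> carrier (F n)" by (rule F.smult_closed)
    moreover have "v k \<in> carrier R" using calculation(2) k by auto
    ultimately show "(\<lambda>v\<in>carrier (F n). v k \<odot>\<^bsub>M\<^esub> m) (a \<odot>\<^bsub>F n\<^esub> v) = a \<odot>\<^bsub>M\<^esub> (\<lambda>v\<in>carrier (F n). v k \<odot>\<^bsub>M\<^esub> m) v"
      using k m by (simp add: M.smult_assoc1)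
  next
    fix v assume "v \<in> carrier (F n)"
    then have "v k \<in> carrier R" using k by auto
    then show "(\<lambda>v\<in>carrier (F n). v k \<odot>\<^bsub>M\<^esub> m) v \<in> carrier M" using \<open>v \<in> carrier (F n)\<close> m by simp
  qed simp
qed

lemma free_module_hom_exists:
  assumes M: "module R M" and g: "\<And>j. j < n \<Longrightarrow> g j \<in> carrier M"
  obtains h where "h \<in> module_hom R (F n) M" "\<And>j. j < n \<Longrightarrow> h (unit_vector R n j) = g j"
proof -
  interpret M: module R M by fact
  \<comment> \<open>The homomorphism is a sum of coordinate maps, added one at a time; unit vectors
    not yet treated go to zero.\<close>
  have "\<exists>h\<in>module_hom R (F n) M. \<forall>j<n. h (unit_vector R n j) = (if j < k then g j else \<zero>\<^bsub>M\<^esub>)" if "k \<le> n" for k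
    using that
  proof (induct k)
    case 0
    show ?case
      by (rule bexI[OF _ module_hom_const_zero[OF free_module_module M]]) (simp del: free_module_sel)
  next
    case (Suc k)
    then obtain h where h: "h \<in> module_hom R (F n) M"
      "\<And>j. j < n \<Longrightarrow> h (unit_vector R n j) = (if j < k then g j else \<zero>\<^bsub>M\<^esub>)" by auto
    let ?c = "\<lambda>v\<in>carrier (F n). v k \<odot>\<^bsub>M\<^esub> g k"
    have c: "?c \<in> module_hom R (F n) M" using Suc(2) g by (intro coordinate_hom M) auto
    let ?h = "\<lambda>v\<in>carrier (F n). h v \<oplus>\<^bsub>M\<^esub> ?c v"
    have "?h (unit_vector R n j) = (if j < Suc k then g j else \<zero>\<^bsub>M\<^esub>)" if j: "j < n" for j
    proof -
      have "?h (unit_vector R n j) = (if j < k then g j else \<zero>\<^bsub>M\<^esub>) \<oplus>\<^bsub>M\<^esub> unit_vector R n j k \<odot>\<^bsub>M\<^esub> g k"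
        using h(2)[OF j] by (simp del: free_module_sel)
      also have "\<dots> = (if j < Suc k then g j else \<zero>\<^bsub>M\<^esub>)"
        using Suc(2) j g[of k] g[of j] by (auto simp: unit_vector_def less_Suc_eq)
      finally show ?thesis .
    qed
    then show ?case using module_hom_add[OF free_module_module M h(1) c] by blast
  qed
  from this[of n] show thesis using that by auto
qed

end

section \<open>Finite free resolutions over a Noetherian ring\<close>

context noetherian_ring
begin

text \<open>Induction on coordinates. The invariant for k is a finite G \<subseteq> N such that
  every submodule between G and N agrees with N in the first k coordinates. To pass to k + 1, lift
  generators of the ideal formed by the coordinates at position k of those vectors of N whose
  earlier coordinates vanish.\<close>

lemma free_submodule_fg:
  assumes cring: "cring R" and N: "submodule N R (free_module R n)"
  shows "\<exists>G. finite G \<and> G \<subseteq> N \<and> (\<forall>N'. submodule N' R (free_module R n) \<and> G \<subseteq> N' \<longrightarrow> N \<subseteq> N')"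
proof -
  interpret cring R by fact
  interpret F: module R "F n" by (rule free_module_module)
  note NE = F.submoduleE[OF N]
  note Nzero = submodule_zero[OF N]
  have Nc: "v i \<in> carrier R" if "v \<in> N" "i < n" for v i
    using free_module_closed[OF subsetD[OF NE(1) that(1)] that(2)] .
  have "\<exists>G. finite G \<and> G \<subseteq> N \<and> (\<forall>N'. submodule N' R (F n) \<and> N' \<subseteq> N \<and> G \<subseteq> N' \<longrightarrow>
      (\<forall>v\<in>N. \<exists>w\<in>N'. \<forall>i<k. v i = w i))" if "k \<le> n" for k
    using that
  proof (induct k)
    case 0
    show ?case by (rule exI[of _ "{\<zero>\<^bsub>F n\<^esub>}"]) (use Nzero in \<open>auto simp del: free_module_sel\<close>)
  next
    case (Suc k)
    then obtain G where G: "finite G" "G \<subseteq> N" and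
      GN: "\<And>N' v. submodule N' R (F n) \<Longrightarrow> N' \<subseteq> N \<Longrightarrow> G \<subseteq> N' \<Longrightarrow> v \<in> N \<Longrightarrow> \<exists>w\<in>N'. \<forall>i<k. v i = w i"
      by auto
    have k: "k < n" using Suc(2) by simp
    define T where "T N' = {v \<in> N'. \<forall>i<k. v i = \<zero>}" for N'
    have I: "ideal ((\<lambda>v. v k) ` T N') R" if N': "submodule N' R (F n)" "N' \<subseteq> N" for N'
    proof -
      note NE' = F.submoduleE[OF N'(1)]
      note z = submodule_zero[OF N'(1)]
      have c: "v i \<in> carrier R" if "v \<in> T N'" "i < n" for v i
        using Nc[of v i] that N' by (auto simp: T_def)
      show ?thesis
      proof (rule idealI[OF ring_axioms])
        have smul: "a \<otimes> x \<in> (\<lambda>v. v k) ` T N'" if a: "a \<in> carrier R" and x: "x \<in> (\<lambda>v. v k) ` T N'" for a x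
        proof -
          obtain v where v: "v \<in> T N'" "x = v k" using x by blast
          then have "a \<odot>\<^bsub>F n\<^esub> v \<in> T N'" using NE'(4)[of a v] a k by (auto simp: T_def)
          moreover have "(a \<odot>\<^bsub>F n\<^esub> v) k = a \<otimes> x" using v k by simp
          ultimately show ?thesis by (metis imageI)
        qed
        show "subgroup ((\<lambda>v. v k) ` T N') (add_monoid R)"
        proof (rule add.subgroupI)
          show "(\<lambda>v. v k) ` T N' \<subseteq> carrier R" using c k by auto
          have "\<zero>\<^bsub>F n\<^esub> \<in> T N'" using z k by (auto simp: T_def)
          then show "(\<lambda>v. v k) ` T N' \<noteq> {}" by blast
          show "\<ominus> x \<in> (\<lambda>v. v k) ` T N'" if "x \<in> (\<lambda>v. v k) ` T N'" for x
          proof -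
            have "x \<in> carrier R" using that c[OF _ k] by blast
            then have "\<ominus> x = \<ominus> \<one> \<otimes> x" by (simp add: l_minus)
            then show ?thesis using smul[of "\<ominus> \<one>" x] that by simp
          qed
          fix x y assume "x \<in> (\<lambda>v. v k) ` T N'" "y \<in> (\<lambda>v. v k) ` T N'"
          then obtain v w where v: "v \<in> T N'" "x = v k" and w: "w \<in> T N'" "y = w k" by blast
          then have "v \<oplus>\<^bsub>F n\<^esub> w \<in> T N'" using NE'(5)[of v w] k by (auto simp: T_def)
          moreover have "(v \<oplus>\<^bsub>F n\<^esub> w) k = x \<oplus> y" using v w k by simp
          ultimately show "x \<oplus> y \<in> (\<lambda>v. v k) ` T N'" by (metis imageI)
        qed
        fix a x assume a: "x \<in> (\<lambda>v. v k) ` T N'" "a \<in> carrier R"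
        then show "a \<otimes> x \<in> (\<lambda>v. v k) ` T N'" using smul by blast
        moreover have "x \<in> carrier R" using a c k by auto
        ultimately show "x \<otimes> a \<in> (\<lambda>v. v k) ` T N'" using m_comm[of x a] a by simp
      qed
    qed
    obtain Y where Y: "Y \<subseteq> carrier R" "finite Y" "(\<lambda>v. v k) ` T N = Idl Y"
      using finetely_gen[OF I[OF N]] by auto
    have YT: "Y \<subseteq> (\<lambda>v. v k) ` T N" using Y(3) genideal_self[OF Y(1)] by simp
    then obtain H where H: "finite H" "H \<subseteq> T N" "Y = (\<lambda>v. v k) ` H"
      using finite_subset_image[OF Y(2) YT] by blast
    show ?case
    proof (intro exI conjI allI impI ballI)
      show "finite (G \<union> H)" "G \<union> H \<subseteq> N" using G H by (auto simp: T_def)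
      fix N' v assume N': "submodule N' R (F n) \<and> N' \<subseteq> N \<and> G \<union> H \<subseteq> N'" and v: "v \<in> N"
      note NE' = F.submoduleE[OF conjunct1[OF N']]
      obtain w where w: "w \<in> N'" "\<forall>i<k. v i = w i" using GN[of N' v] N' v by auto
      have wN: "w \<in> N" using w N' by blast
      \<comment> \<open>The error u = v - w vanishes in the first k coordinates, so its coordinate
        at k lies in the ideal and is matched by some t in \<open>T N'\<close>; then w + t agrees
        with v one place further.\<close>
      define u where "u = v \<oplus>\<^bsub>F n\<^esub> (\<ominus> \<one> \<odot>\<^bsub>F n\<^esub> w)"
      have u: "u i = v i \<oplus> \<ominus> w i" if "i < n" for i
        using that Nc[OF v that] Nc[OF wN that] by (simp add: u_def l_minus)
      have "u \<in> N" unfolding u_def using NE(5)[OF v NE(4)[OF _ wN]] by blast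
      then have "u \<in> T N" unfolding T_def using u w(2) k Nc[OF wN] by (auto simp: r_neg)
      have "Idl Y \<subseteq> (\<lambda>v. v k) ` T N'"
      proof (rule genideal_minimal[OF I])
        have "H \<subseteq> T N'" using N' H(2) unfolding T_def by blast
        then show "Y \<subseteq> (\<lambda>v. v k) ` T N'" unfolding H(3) by (rule image_mono)
      qed (use N' in auto)
      moreover have "u k \<in> Idl Y" unfolding Y(3)[symmetric] using \<open>u \<in> T N\<close> by (rule imageI)
      ultimately have "u k \<in> (\<lambda>v. v k) ` T N'" by (rule subsetD)
      then obtain t where t: "t \<in> T N'" "u k = t k" by auto
      have tN: "t \<in> N'" "t \<in> N" using t N' by (auto simp: T_def)
      have "w \<oplus>\<^bsub>F n\<^esub> t \<in> N'" using NE'(5) w(1) tN(1) by blast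
      moreover have "v i = (w \<oplus>\<^bsub>F n\<^esub> t) i" if i: "i < Suc k" for i
      proof -
        have "i < n" using i k by simp
        note c = Nc[OF v this] Nc[OF wN this] Nc[OF tN(2) this]
        have "v i = w i \<oplus> t i"
        proof (cases "i = k")
          case True
          then have "t i = v i \<oplus> \<ominus> w i" using t(2) u[of k] k by simp
          then show ?thesis using c by (simp add: a_lcomm r_neg)
        next
          case False
          then have "i < k" using i by simp
          then show ?thesis using t(1) w(2) c by (simp add: T_def)
        qed
        then show ?thesis using \<open>i < n\<close> by simp
      qed
      ultimately show "\<exists>w\<in>N'. \<forall>i<Suc k. v i = w i" by blast
    qed
  qed
  from this[of n] obtain G where G: "finite G" "G \<subseteq> N" and
    GN: "\<And>N' v. submodule N' R (F n) \<Longrightarrow> N' \<subseteq> N \<Longrightarrow> G \<subseteq> N' \<Longrightarrow> v \<in> N \<Longrightarrow> \<exists>w\<in>N'. \<forall>i<n. v i = w i"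
    by auto
  show ?thesis
  proof (intro exI[of _ G] conjI allI impI G)
    fix N' assume "submodule N' R (F n) \<and> G \<subseteq> N'"
    then have N': "submodule N' R (F n)" "G \<subseteq> N'" by simp_all
    note NE' = F.submoduleE[OF N'(1)]
    \<comment> \<open>The invariant speaks of submodules inside N, so N' is first cut down to
      N.\<close>
    have int: "submodule (N' \<inter> N) R (F n)"
    proof (rule F.submoduleI)
      show "\<zero>\<^bsub>F n\<^esub> \<in> N' \<inter> N" using Nzero submodule_zero[OF N'(1)] by blast
    qed (use NE(1) in blast, use NE(3) NE'(3) in blast, use NE(5) NE'(5) in blast, use NE(4) NE'(4) in blast)
    show "N \<subseteq> N'"
    proof
      fix v assume v: "v \<in> N"
      have "\<exists>w\<in>N' \<inter> N. \<forall>i<n. v i = w i"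
        by (rule GN[OF int _ _ v]) (use G N' in blast)+
      then obtain w where w: "w \<in> N' \<inter> N" "\<forall>i<n. v i = w i" by blast
      have "v = w"
        by (rule free_module_eqI[of v n]) (use NE(1) v w in \<open>auto simp del: free_module_sel\<close>)
      then show "v \<in> N'" using w by blast
    qed
  qed
qed

lemma free_submodule_image:
  assumes cring: "cring R" and N: "submodule N R (free_module R n)"
  obtains m d where "d \<in> module_hom R (free_module R m) (free_module R n)" "d ` carrier (free_module R m) = N"
proof -
  interpret cring R by fact
  interpret F: module R "F n" by (rule free_module_module)
  obtain G where G: "finite G" "G \<subseteq> N" and GN: "\<And>N'. submodule N' R (F n) \<Longrightarrow> G \<subseteq> N' \<Longrightarrow> N \<subseteq> N'"
    using free_submodule_fg[OF cring N] by (elim exE conjE) simp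
  obtain m and g :: "nat \<Rightarrow> _" where g: "G = g ` {i. i < m}" using finite_imp_nat_seg_image_inj_on[OF G(1)] by blast
  have gN: "g j \<in> N" if "j < m" for j using g G(2) that by blast
  obtain d where d: "d \<in> module_hom R (F m) (F n)" "\<And>j. j < m \<Longrightarrow> d (unit_vector R m j) = g j"
  proof (rule free_module_hom_exists[OF free_module_module[of n], of m g])
    show "g j \<in> carrier (F n)" if "j < m" for j using gN[OF that] F.submoduleE(1)[OF N] by (rule subsetD[rotated])
  qed blast
  interpret Fm: module R "F m" by (rule free_module_module)
  note NE = F.submoduleE[OF N]
  have "carrier (F m) \<subseteq> {v \<in> carrier (F m). d v \<in> N}"
  proof (rule free_module_span)
    show "\<zero>\<^bsub>F m\<^esub> \<in> {v \<in> carrier (F m). d v \<in> N}"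
      using module_hom_zero[OF free_module_module free_module_module d(1)] Fm.zero_closed
        submodule_zero[OF N] by (simp del: free_module_sel)
    fix v w assume "v \<in> {v \<in> carrier (F m). d v \<in> N}" "w \<in> {v \<in> carrier (F m). d v \<in> N}"
    then show "v \<oplus>\<^bsub>F m\<^esub> w \<in> {v \<in> carrier (F m). d v \<in> N}"
      using module_homD(3)[OF d(1), of v w] Fm.a_closed[of v w] NE(5) by (simp del: free_module_sel)
  next
    fix a v assume "a \<in> carrier R" "v \<in> {v \<in> carrier (F m). d v \<in> N}"
    then show "a \<odot>\<^bsub>F m\<^esub> v \<in> {v \<in> carrier (F m). d v \<in> N}"
      using module_homD(4)[OF d(1), of a v] Fm.smult_closed[of a v] NE(4) by (simp del: free_module_sel)
  qed (use d(2) gN unit_vector_closed in \<open>simp del: free_module_sel\<close>)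
  moreover have "N \<subseteq> d ` carrier (F m)"
  proof (rule GN[OF module_hom_image[OF free_module_module free_module_module d(1)]])
    show "G \<subseteq> d ` carrier (F m)"
    proof
      fix x assume "x \<in> G"
      then obtain j where "j < m" "x = g j" using g by blast
      then show "x \<in> d ` carrier (F m)" using d(2)[of j] unit_vector_closed by (metis imageI)
    qed
  qed
  ultimately show thesis using that[OF d(1)] by blast
qed

lemma free_resolution_exists:
  assumes cring: "cring R" and M: "module R M"
    and e: "e \<in> module_hom R (free_module R n) M" "e ` carrier (free_module R n) = carrier M"
  obtains r d where "free_resolution R M r d e" "r 0 = n"
proof -
  interpret cring R by fact
  note mods = free_module_module
  \<comment> \<open>A state (m, n', d) stands for a map d : R^m -> R^n'. Keeping both ranks lets
    \<open>T\<close> demand that the next differential ends where this one starts and that its image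
    is the kernel; \<open>P 0\<close> ties the first differential to the kernel of e.\<close>
  define P where "P i = (\<lambda>(m, n', d). d \<in> module_hom R (F m) (F n') \<and>
    (i = (0::nat) \<longrightarrow> n' = n \<and> d ` carrier (F m) = {v \<in> carrier (F n). e v = \<zero>\<^bsub>M\<^esub>}))" for i
  define T where "T = (\<lambda>(m, n', d). \<lambda>(m', n'', d'). n'' = m \<and>
    d' ` carrier (F m') = {v \<in> carrier (F m). d v = \<zero>\<^bsub>F n'\<^esub>})"
  have "\<exists>f. \<forall>i. P i (f i) \<and> T (f i) (f (Suc i))"
  proof (rule dependent_nat_choice)
    obtain m d where "d \<in> module_hom R (F m) (F n)" "d ` carrier (F m) = {v \<in> carrier (F n). e v = \<zero>\<^bsub>M\<^esub>}"
      by (rule free_submodule_image[OF cring module_hom_kernel[OF mods M e(1)]])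
    then have "P 0 (m, n, d)" unfolding P_def by simp
    then show "\<exists>x. P 0 x" by blast
    fix x i assume x: "P i x"
    obtain m n' d where xx: "x = (m, n', d)" by (cases x)
    then have d: "d \<in> module_hom R (F m) (F n')" using x by (simp add: P_def)
    obtain m' d' where "d' \<in> module_hom R (F m') (F m)"
      "d' ` carrier (F m') = {v \<in> carrier (F m). d v = \<zero>\<^bsub>F n'\<^esub>}"
      by (rule free_submodule_image[OF cring module_hom_kernel[OF mods mods d]])
    then have "P (Suc i) (m', m, d') \<and> T x (m', m, d')"
      unfolding xx P_def T_def by simp
    then show "\<exists>y. P (Suc i) y \<and> T x y" by blast
  qed
  then obtain f where f: "\<And>i. P i (f i)" "\<And>i. T (f i) (f (Suc i))" by blast
  define r where "r i = fst (snd (f i))" for i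
  define d where "d i = snd (snd (f i))" for i
  have ft: "f i = (r (Suc i), r i, d i)" for i
    using f(2)[of i] unfolding T_def r_def d_def by (auto split: prod.splits)
  have d: "d i \<in> module_hom R (F (r (Suc i))) (F (r i))" for i
    using f(1)[of i] ft[of i] by (simp add: P_def del: free_module_sel)
  have 0: "r 0 = n" "d 0 ` carrier (F (r 1)) = {v \<in> carrier (F n). e v = \<zero>\<^bsub>M\<^esub>}"
    using f(1)[of 0] ft[of 0] by (simp_all add: P_def del: free_module_sel)
  have ex: "d (Suc i) ` carrier (F (r (Suc (Suc i)))) = {v \<in> carrier (F (r (Suc i))). d i v = \<zero>\<^bsub>F (r i)\<^esub>}" for i
    using f(2)[of i] ft[of i] ft[of "Suc i"] by (simp add: T_def del: free_module_sel)
  have "free_resolution R M r d e"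
    unfolding free_resolution_def using d 0 ex e by (simp del: free_module_sel)
  then show thesis using that 0 by blast
qed

end

section \<open>Maps into \<open>Q\<close> that are linear modulo a submodule\<close>

context cring_with_subring
begin

abbreviation V where "V \<equiv> regular_module Q"
abbreviation FS where "FS \<equiv> free_module S"

text \<open>Congruence stands for equality in Q / K. For \<open>K = {\<zero>}\<close> it is equality
  in Q, so statements about Q / K cover Q itself.\<close>

definition eqmod :: "'a set \<Rightarrow> 'a \<Rightarrow> 'a \<Rightarrow> bool"
  where "eqmod K x y \<longleftrightarrow> x \<in> carrier Q \<and> y \<in> carrier Q \<and> x \<ominus> y \<in> K"

lemma eqmodD: "eqmod K x y \<Longrightarrow> x \<in> carrier Q" "eqmod K x y \<Longrightarrow> y \<in> carrier Q"
  by (simp_all add: eqmod_def)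

lemma eqmod_refl: "submod Q A K \<Longrightarrow> x \<in> carrier Q \<Longrightarrow> eqmod K x x"
  by (simp add: eqmod_def submodD(2) a_minus_def r_neg)

lemma eqmod_sym: assumes K: "submod Q A K" and xy: "eqmod K x y" shows "eqmod K y x"
proof -
  have "y \<ominus> x = \<ominus> (x \<ominus> y)" using eqmodD[OF xy] by algebra
  then show ?thesis using submod_neg[OF K] xy by (simp add: eqmod_def)
qed

lemma eqmod_trans [trans]:
  assumes K: "submod Q A K" and xy: "eqmod K x y" "eqmod K y z" shows "eqmod K x z"
proof -
  have "x \<ominus> z = (x \<ominus> y) \<oplus> (y \<ominus> z)" using eqmodD[OF xy(1)] eqmodD[OF xy(2)] by algebra
  then show ?thesis using submodD(3)[OF K] xy by (simp add: eqmod_def)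
qed

lemma eqmod_add:
  assumes K: "submod Q A K" and "eqmod K x y" "eqmod K z w" shows "eqmod K (x \<oplus> z) (y \<oplus> w)"
proof -
  have "(x \<oplus> z) \<ominus> (y \<oplus> w) = (x \<ominus> y) \<oplus> (z \<ominus> w)"
    using eqmodD[OF assms(2)] eqmodD[OF assms(3)] by algebra
  then show ?thesis using submodD(3)[OF K] assms by (simp add: eqmod_def)
qed

lemma eqmod_diff:
  assumes K: "submod Q A K" and "eqmod K x y" "eqmod K z w" shows "eqmod K (x \<ominus> z) (y \<ominus> w)"
proof -
  have "(x \<ominus> z) \<ominus> (y \<ominus> w) = (x \<ominus> y) \<ominus> (z \<ominus> w)"
    using eqmodD[OF assms(2)] eqmodD[OF assms(3)] by algebra
  then show ?thesis using submod_diff[OF K] assms by (simp add: eqmod_def)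
qed

lemma eqmod_smult:
  assumes K: "submod Q A K" and xy: "eqmod K x y" and a: "a \<in> A" shows "eqmod K (a \<otimes> x) (a \<otimes> y)"
proof -
  have "(a \<otimes> x) \<ominus> (a \<otimes> y) = a \<otimes> (x \<ominus> y)"
    using eqmodD[OF xy] A_sub[OF a] by algebra
  then show ?thesis using submodD(4)[OF K a] xy A_sub[OF a] by (simp add: eqmod_def)
qed

lemma eqmod_zero: "submod Q A K \<Longrightarrow> eqmod K x \<zero> \<longleftrightarrow> x \<in> K"
  using submodD(1)[of Q A K x] minus_equality[of \<zero> \<zero>] by (auto simp: eqmod_def a_minus_def)

lemma eqmod_mem:
  assumes K: "submod Q A K" and xy: "eqmod K x y" shows "x \<in> K \<longleftrightarrow> y \<in> K"
  using eqmod_trans[OF K xy, of \<zero>] eqmod_trans[OF K eqmod_sym[OF K xy], of \<zero>] eqmod_zero[OF K] by blast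

lemma eqmod_zero_eq: "eqmod {\<zero>} x y \<longleftrightarrow> x = y \<and> x \<in> carrier Q"
  by (auto simp: eqmod_def a_minus_def r_neg dest: minus_equality)

text \<open>A homomorphism T -> Q / K, given by an arbitrary choice of representatives of its
  values; \<phi> itself need not be additive.\<close>

definition linear_mod :: "'a set \<Rightarrow> ('a, 'c) module \<Rightarrow> 'c set \<Rightarrow> ('c \<Rightarrow> 'a) \<Rightarrow> bool"
  where "linear_mod K M T \<phi> \<longleftrightarrow> (\<forall>x\<in>T. \<phi> x \<in> carrier Q) \<and>
    (\<forall>x\<in>T. \<forall>y\<in>T. eqmod K (\<phi> (x \<oplus>\<^bsub>M\<^esub> y)) (\<phi> x \<oplus> \<phi> y)) \<and>
    (\<forall>a\<in>A. \<forall>x\<in>T. eqmod K (\<phi> (a \<odot>\<^bsub>M\<^esub> x)) (a \<otimes> \<phi> x))"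

text \<open>Injectivity of \<open>Q / K\<close>, phrased with representatives in place of cosets.\<close>

definition baer_on :: "'a set \<Rightarrow> 'a set \<Rightarrow> bool"
  where "baer_on K I \<longleftrightarrow> (\<forall>\<phi>. linear_mod K V I \<phi> \<longrightarrow> (\<exists>q\<in>carrier Q. \<forall>x\<in>I. eqmod K (\<phi> x) (q \<otimes> x)))"

definition baer :: "'a set \<Rightarrow> bool"
  where "baer K \<longleftrightarrow> (\<forall>I. submod Q A I \<and> I \<subseteq> A \<longrightarrow> baer_on K I)"

lemma linear_modD:
  assumes "linear_mod K M T \<phi>"
  shows "x \<in> T \<Longrightarrow> \<phi> x \<in> carrier Q"
    "x \<in> T \<Longrightarrow> y \<in> T \<Longrightarrow> eqmod K (\<phi> (x \<oplus>\<^bsub>M\<^esub> y)) (\<phi> x \<oplus> \<phi> y)"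
    "a \<in> A \<Longrightarrow> x \<in> T \<Longrightarrow> eqmod K (\<phi> (a \<odot>\<^bsub>M\<^esub> x)) (a \<otimes> \<phi> x)"
  using assms by (simp_all add: linear_mod_def)

lemma V_hom_linear_mod:
  assumes "h \<in> module_hom S M V" "submod Q A K" "module S M"
  shows "linear_mod K M (carrier M) h"
  unfolding linear_mod_def
  using module_homD[OF assms(1)] by (auto intro!: eqmod_refl[OF assms(2)])

lemma linear_mod_diff:
  assumes K: "submod Q A K" and \<phi>: "linear_mod K M T \<phi>" and \<psi>: "linear_mod K M T \<psi>"
  shows "linear_mod K M T (\<lambda>x. \<phi> x \<ominus> \<psi> x)"
  unfolding linear_mod_def
proof (intro conjI ballI)
  note D = linear_modD[OF \<phi>] and E = linear_modD[OF \<psi>]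
  fix x assume x: "x \<in> T"
  {
    fix y assume y: "y \<in> T"
    have "(\<phi> x \<oplus> \<phi> y) \<ominus> (\<psi> x \<oplus> \<psi> y) = (\<phi> x \<ominus> \<psi> x) \<oplus> (\<phi> y \<ominus> \<psi> y)"
      using D(1)[OF x] D(1)[OF y] E(1)[OF x] E(1)[OF y] by algebra
    then show "eqmod K (\<phi> (x \<oplus>\<^bsub>M\<^esub> y) \<ominus> \<psi> (x \<oplus>\<^bsub>M\<^esub> y)) ((\<phi> x \<ominus> \<psi> x) \<oplus> (\<phi> y \<ominus> \<psi> y))"
      using eqmod_diff[OF K D(2)[OF x y] E(2)[OF x y]] by simp
  }
  fix a assume a: "a \<in> A"
  have "(a \<otimes> \<phi> x) \<ominus> (a \<otimes> \<psi> x) = a \<otimes> (\<phi> x \<ominus> \<psi> x)"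
    using D(1)[OF x] E(1)[OF x] A_sub[OF a] by algebra
  then show "eqmod K (\<phi> (a \<odot>\<^bsub>M\<^esub> x) \<ominus> \<psi> (a \<odot>\<^bsub>M\<^esub> x)) (a \<otimes> (\<phi> x \<ominus> \<psi> x))"
    using eqmod_diff[OF K D(3)[OF a x] E(3)[OF a x]] by simp
qed (use linear_modD(1)[OF \<phi>] linear_modD(1)[OF \<psi>] in blast)

lemma linear_mod_zero:
  assumes K: "submod Q A K" and M: "module S M" and \<phi>: "linear_mod K M T \<phi>"
    and T: "\<zero>\<^bsub>M\<^esub> \<in> T"
  shows "\<phi> \<zero>\<^bsub>M\<^esub> \<in> K"
proof -
  interpret M: module S M by fact
  have "eqmod K (\<phi> (\<zero> \<odot>\<^bsub>M\<^esub> \<zero>\<^bsub>M\<^esub>)) (\<zero> \<otimes> \<phi> \<zero>\<^bsub>M\<^esub>)"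
    using linear_modD(3)[OF \<phi> A_zero T] .
  then have "eqmod K (\<phi> \<zero>\<^bsub>M\<^esub>) \<zero>"
    using M.smult_l_null[of "\<zero>\<^bsub>M\<^esub>"] M.zero_closed linear_modD(1)[OF \<phi> T] by simp
  then show ?thesis using eqmod_zero[OF K] by simp
qed

lemma FS_module: "module S (FS n)"
  using cring.free_module_module[OF S_cring] .

lemma module_hom_restrict_iff:
  "f \<in> module_hom S M (V\<lparr>carrier := K\<rparr>) \<longleftrightarrow> f \<in> module_hom S M V \<and> (\<forall>x\<in>carrier M. f x \<in> K)"
  if "K \<subseteq> carrier Q"
  using that by (auto simp: module_hom_def PiE_def)

text \<open>The map is extended coordinate by coordinate.\<close>

lemma linear_mod_extends:
  assumes K: "submod Q A K" and baer: "baer K" and T: "submodule T S (FS n)"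
    and \<phi>: "linear_mod K (FS n) T \<phi>"
  obtains h where "h \<in> module_hom S (FS n) V" "\<And>v. v \<in> T \<Longrightarrow> eqmod K (\<phi> v) (h v)"
proof -
  interpret F: module S "FS n" by (rule FS_module)
  note TE = F.submoduleE[OF T]
  note Tz = submodule_zero[OF T]
  have Tc: "v i \<in> A" if "v \<in> T" "i < n" for v i
    using cring.free_module_closed[OF S_cring subsetD[OF TE(1) that(1)] that(2)] by simp
  have Tadd: "(v \<oplus>\<^bsub>FS n\<^esub> w) i = v i \<oplus> w i" and Tsm: "(a \<odot>\<^bsub>FS n\<^esub> v) i = a \<otimes> v i" if "i < n" for v w i a
    using that by simp_all
  \<comment> \<open>The third hypothesis measures progress. For k = n it concerns the zero vector
    alone, and for k = 0 it says that \<phi> vanishes modulo K. Passing from k + 1 to k subtracts a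
    multiple of the coordinate at position k.\<close>
  have main: "\<exists>h\<in>module_hom S (FS n) V. \<forall>v\<in>T. eqmod K (\<phi> v) (h v)"
    if "k \<le> n" "linear_mod K (FS n) T \<phi>" "\<And>v. v \<in> T \<Longrightarrow> (\<And>j. j < k \<Longrightarrow> v j = \<zero>) \<Longrightarrow> \<phi> v \<in> K" for k \<phi>
    using that
  proof (induct k arbitrary: \<phi>)
    case 0
    have "\<forall>v\<in>T. eqmod K (\<phi> v) ((\<lambda>x\<in>carrier (FS n). \<zero>\<^bsub>V\<^esub>) v)"
      using 0 TE(1) eqmod_zero[OF K] by (auto simp del: free_module_sel)
    then show ?case using module_hom_const_zero[OF FS_module regular_module_module] by blast
  next
    case (Suc k)
    note D = linear_modD[OF Suc(3)]
    have k: "k < n" using Suc(2) by simp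
    define T0 where "T0 = {v \<in> T. \<forall>j<k. v j = \<zero>}"
    have T0T: "v \<in> T" if "v \<in> T0" for v using that by (simp add: T0_def)
    have T0add: "v \<oplus>\<^bsub>FS n\<^esub> w \<in> T0" if "v \<in> T0" "w \<in> T0" for v w
      using that TE(5)[of v w] k Tadd by (auto simp: T0_def simp del: free_module_sel)
    have T0sm: "a \<odot>\<^bsub>FS n\<^esub> v \<in> T0" if "a \<in> A" "v \<in> T0" for a v
      using that TE(4)[of a v] k Tsm by (auto simp: T0_def simp del: free_module_sel)
    define I where "I = (\<lambda>v. v k) ` T0"
    have Isub: "submod Q A I"
    proof (rule submodI)
      show "I \<subseteq> carrier Q" using Tc[OF T0T k] A_sub by (auto simp: I_def)
      have "\<zero>\<^bsub>FS n\<^esub> \<in> T0" using Tz k by (auto simp: T0_def)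
      then have "\<zero>\<^bsub>FS n\<^esub> k \<in> I" unfolding I_def by (rule imageI)
      then show "\<zero> \<in> I" using k by simp
      show "x \<oplus> y \<in> I" if xy: "x \<in> I" "y \<in> I" for x y
      proof -
        obtain v w where v: "v \<in> T0" "x = v k" and w: "w \<in> T0" "y = w k" using xy unfolding I_def by blast
        have "(v \<oplus>\<^bsub>FS n\<^esub> w) k \<in> I" unfolding I_def by (rule imageI[OF T0add[OF v(1) w(1)]])
        then show ?thesis unfolding Tadd[OF k] v w .
      qed
      show "a \<otimes> x \<in> I" if ax: "a \<in> A" "x \<in> I" for a x
      proof -
        obtain v where v: "v \<in> T0" "x = v k" using ax unfolding I_def by blast
        have "(a \<odot>\<^bsub>FS n\<^esub> v) k \<in> I" unfolding I_def by (rule imageI[OF T0sm[OF ax(1) v(1)]])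
        then show ?thesis unfolding Tsm[OF k] v .
      qed
    qed
    have IA: "I \<subseteq> A" using Tc[OF T0T k] by (auto simp: I_def)
    \<comment> \<open>Modulo K the value depends on x alone: two vectors of \<open>T0\<close> with
      the same coordinate at k differ by one whose first k + 1 coordinates vanish, and there \<phi>
      lies in K.\<close>
    define \<psi> where "\<psi> x = \<phi> (SOME v. v \<in> T0 \<and> v k = x)" for x
    have \<psi>: "eqmod K (\<psi> (v k)) (\<phi> v)" if v: "v \<in> T0" for v
    proof -
      define w where "w = (SOME w. w \<in> T0 \<and> w k = v k)"
      have w: "w \<in> T0" "w k = v k" unfolding w_def using someI[of "\<lambda>w. w \<in> T0 \<and> w k = v k" v] v by auto
      have m: "\<ominus> \<one> \<in> A" by (simp add: A_neg)
      define u where "u = w \<oplus>\<^bsub>FS n\<^esub> (\<ominus> \<one> \<odot>\<^bsub>FS n\<^esub> v)"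
      have mv: "\<ominus> \<one> \<odot>\<^bsub>FS n\<^esub> v \<in> T0" using T0sm[OF m v] .
      have u: "u \<in> T0" unfolding u_def by (rule T0add[OF w(1) mv])
      have "u j = \<zero>" if "j < Suc k" for j
      proof (cases "j = k")
        case True
        have "v k \<in> carrier Q" using Tc[OF T0T[OF v] k] by simp
        then have "v k \<oplus> \<ominus> \<one> \<otimes> v k = \<zero>" by (simp add: l_minus r_neg)
        then show ?thesis unfolding True u_def by (simp only: Tadd[OF k] Tsm[OF k] w(2))
      qed (use u that in \<open>simp add: T0_def less_Suc_eq\<close>)
      then have "\<phi> u \<in> K" using Suc(4)[OF T0T[OF u]] by blast
      moreover have "eqmod K (\<phi> u) (\<phi> w \<ominus> \<phi> v)"
      proof -
        have c: "\<phi> w \<in> carrier Q" "\<phi> v \<in> carrier Q" using D(1)[OF T0T[OF w(1)]] D(1)[OF T0T[OF v]] by blast+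
        have "\<phi> w \<oplus> \<ominus> \<one> \<otimes> \<phi> v = \<phi> w \<ominus> \<phi> v" using c by algebra
        then show ?thesis
          using eqmod_trans[OF K D(2)[OF T0T[OF w(1)] T0T[OF mv]] eqmod_add[OF K eqmod_refl[OF K c(1)] D(3)[OF m T0T[OF v]]]]
          unfolding u_def by (simp del: free_module_sel)
      qed
      ultimately have "\<phi> w \<ominus> \<phi> v \<in> K" using eqmod_mem[OF K] by blast
      then show ?thesis unfolding \<psi>_def w_def[symmetric]
        using D(1) T0T w(1) v by (simp add: eqmod_def)
    qed
    have "linear_mod K V I \<psi>"
      unfolding linear_mod_def
    proof (intro conjI ballI)
      fix x assume "x \<in> I" then obtain v where v: "v \<in> T0" "x = v k" by (auto simp: I_def)
      show "\<psi> x \<in> carrier Q" unfolding v(2) by (rule eqmodD(1)[OF \<psi>[OF v(1)]])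
      {
        fix y assume "y \<in> I" then obtain w where w: "w \<in> T0" "y = w k" by (auto simp: I_def)
        have "eqmod K (\<psi> ((v \<oplus>\<^bsub>FS n\<^esub> w) k)) (\<phi> v \<oplus> \<phi> w)"
          by (rule eqmod_trans[OF K \<psi>[OF T0add[OF v(1) w(1)]] D(2)[OF T0T[OF v(1)] T0T[OF w(1)]]])
        then have "eqmod K (\<psi> ((v \<oplus>\<^bsub>FS n\<^esub> w) k)) (\<psi> x \<oplus> \<psi> y)" unfolding v w
          by (rule eqmod_trans[OF K _ eqmod_sym[OF K eqmod_add[OF K \<psi>[OF v(1)] \<psi>[OF w(1)]]]])
        then show "eqmod K (\<psi> (x \<oplus>\<^bsub>V\<^esub> y)) (\<psi> x \<oplus> \<psi> y)" using Tadd[OF k, of v w] v w by simp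
      }
      fix a assume a: "a \<in> A"
      have "eqmod K (\<psi> ((a \<odot>\<^bsub>FS n\<^esub> v) k)) (a \<otimes> \<phi> v)"
        by (rule eqmod_trans[OF K \<psi>[OF T0sm[OF a v(1)]] D(3)[OF a T0T[OF v(1)]]])
      then have "eqmod K (\<psi> ((a \<odot>\<^bsub>FS n\<^esub> v) k)) (a \<otimes> \<psi> x)" unfolding v
        by (rule eqmod_trans[OF K _ eqmod_sym[OF K eqmod_smult[OF K \<psi>[OF v(1)] a]]])
      then show "eqmod K (\<psi> (a \<odot>\<^bsub>V\<^esub> x)) (a \<otimes> \<psi> x)" using Tsm[OF k, of a v] v by simp
    qed
    then obtain q where q: "q \<in> carrier Q" "\<And>x. x \<in> I \<Longrightarrow> eqmod K (\<psi> x) (q \<otimes> x)"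
      using baer Isub IA unfolding baer_def baer_on_def by blast
    \<comment> \<open>Baer's condition makes \<psi> multiplication by q, so subtracting the
      coordinate at k times q kills \<phi> on \<open>T0\<close> modulo K.\<close>
    define c where "c = (\<lambda>v\<in>carrier (FS n). v k \<odot>\<^bsub>V\<^esub> q)"
    have c: "c \<in> module_hom S (FS n) V" unfolding c_def
      using q(1) by (intro cring.coordinate_hom[OF S_cring regular_module_module k]) simp
    have cv: "c v = v k \<otimes> q" if "v \<in> T" for v
      using subsetD[OF TE(1) that] by (simp add: c_def del: free_module_sel)
    have clin: "linear_mod K (FS n) T c"
      using V_hom_linear_mod[OF c K FS_module] TE(1) unfolding linear_mod_def by blast
    define \<phi>1 where "\<phi>1 v = \<phi> v \<ominus> c v" for v
    have "linear_mod K (FS n) T \<phi>1"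
      unfolding \<phi>1_def by (rule linear_mod_diff[OF K Suc(3) clin])
    moreover have "\<phi>1 v \<in> K" if v: "v \<in> T" "\<And>j. j < k \<Longrightarrow> v j = \<zero>" for v
    proof -
      have v0: "v \<in> T0" using v by (simp add: T0_def)
      have "v k \<in> I" using v0 by (auto simp: I_def)
      have "q \<otimes> v k = c v" using cv[OF v(1)] q(1) Tc[OF v(1) k] A_sub m_comm by simp
      then have "eqmod K (\<phi> v) (c v)"
        using eqmod_trans[OF K eqmod_sym[OF K \<psi>[OF v0]] q(2)[OF \<open>v k \<in> I\<close>]] by simp
      then show ?thesis unfolding \<phi>1_def eqmod_def by simp
    qed
    ultimately obtain h where h: "h \<in> module_hom S (FS n) V" "\<And>v. v \<in> T \<Longrightarrow> eqmod K (\<phi>1 v) (h v)"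
      using Suc(1)[of \<phi>1] Suc(2) by auto
    define g where "g = (\<lambda>v\<in>carrier (FS n). h v \<oplus>\<^bsub>V\<^esub> c v)"
    have "g \<in> module_hom S (FS n) V" unfolding g_def
      by (rule module_hom_add[OF FS_module regular_module_module h(1) c])
    moreover have "eqmod K (\<phi> v) (g v)" if v: "v \<in> T" for v
    proof -
      have vF: "v \<in> carrier (FS n)" using TE(1) v by blast
      have cc: "c v \<in> carrier Q" "\<phi> v \<in> carrier Q" using module_homD(1)[OF c vF] D(1)[OF v] by simp_all
      have "eqmod K (\<phi>1 v \<oplus> c v) (h v \<oplus> c v)"
        by (rule eqmod_add[OF K h(2)[OF v] eqmod_refl[OF K cc(1)]])
      moreover have "\<phi>1 v \<oplus> c v = \<phi> v" unfolding \<phi>1_def using cc by algebra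
      moreover have "g v = h v \<oplus> c v" using vF by (simp add: g_def del: free_module_sel)
      ultimately show ?thesis by simp
    qed
    ultimately show ?case by blast
  qed
  have "\<phi> v \<in> K" if "v \<in> T" "\<And>j. j < n \<Longrightarrow> v j = \<zero>" for v
  proof -
    have "v = \<zero>\<^bsub>FS n\<^esub>"
      by (rule cring.free_module_eqI[OF S_cring subsetD[OF TE(1) that(1)] F.zero_closed]) (simp add: that(2))
    then show ?thesis using linear_mod_zero[OF K FS_module \<phi> Tz] by (simp only:)
  qed
  then show thesis using main[of n \<phi>] \<phi> that by blast
qed

text \<open>Injectivity of Q / K in the form used for complexes: g induces a map on the image of d,
  since it is trivial modulo K on the kernel, and this map extends to the whole free module. With
  \<open>K = {\<zero>}\<close> maps into Q factor exactly.\<close>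

lemma factor_through:
  assumes K: "submod Q A K" and baer: "baer K"
    and d: "d \<in> module_hom S (FS m) (FS n)" and g: "g \<in> module_hom S (FS m) V"
    and ker: "\<And>v. v \<in> carrier (FS m) \<Longrightarrow> d v = \<zero>\<^bsub>FS n\<^esub> \<Longrightarrow> g v \<in> K"
  obtains h where "h \<in> module_hom S (FS n) V" "\<And>v. v \<in> carrier (FS m) \<Longrightarrow> eqmod K (g v) (h (d v))"
proof -
  interpret Fm: module S "FS m" by (rule FS_module)
  interpret Fn: module S "FS n" by (rule FS_module)
  define T where "T = d ` carrier (FS m)"
  have T: "submodule T S (FS n)" unfolding T_def by (rule module_hom_image[OF FS_module FS_module d])
  \<comment> \<open>The induced map on the image of d; the choice of a preimage affects the value
    only by an element of K.\<close>
  define \<phi> where "\<phi> t = g (SOME v. v \<in> carrier (FS m) \<and> d v = t)" for t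
  have \<phi>: "eqmod K (\<phi> (d v)) (g v)" if v: "v \<in> carrier (FS m)" for v
  proof -
    define w where "w = (SOME w. w \<in> carrier (FS m) \<and> d w = d v)"
    have w: "w \<in> carrier (FS m)" "d w = d v"
      unfolding w_def using someI[of "\<lambda>w. w \<in> carrier (FS m) \<and> d w = d v" v] v by (auto simp del: free_module_sel)
    have "d (w \<ominus>\<^bsub>FS m\<^esub> v) = \<zero>\<^bsub>FS n\<^esub>"
      using module_hom_diff[OF FS_module FS_module d w(1) v] w(2) module_homD(1)[OF d v]
      unfolding a_minus_def by (simp only: Fn.r_neg)
    then have "g (w \<ominus>\<^bsub>FS m\<^esub> v) \<in> K" using ker[OF Fm.minus_closed[OF w(1) v]] by blast
    moreover have "g (w \<ominus>\<^bsub>FS m\<^esub> v) = g w \<ominus> g v"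
    proof -
      interpret VV: module S V by (rule regular_module_module)
      have "g w \<ominus>\<^bsub>V\<^esub> g v = g w \<ominus> g v"
        using VV.minus_equality[of "\<ominus> g v" "g v"] module_homD(1)[OF g v] by (simp add: a_minus_def l_neg)
      then show ?thesis using module_hom_diff[OF FS_module regular_module_module g w(1) v] by simp
    qed
    ultimately show ?thesis unfolding \<phi>_def w_def[symmetric] eqmod_def
      using module_homD(1)[OF g w(1)] module_homD(1)[OF g v] by simp
  qed
  have "linear_mod K (FS n) T \<phi>"
    unfolding linear_mod_def
  proof (intro conjI ballI)
    fix x assume "x \<in> T" then obtain v where v: "v \<in> carrier (FS m)" "x = d v" by (auto simp: T_def simp del: free_module_sel)
    show "\<phi> x \<in> carrier Q" unfolding v(2) by (rule eqmodD(1)[OF \<phi>[OF v(1)]])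
    {
      fix y assume "y \<in> T" then obtain w where w: "w \<in> carrier (FS m)" "y = d w" by (auto simp: T_def simp del: free_module_sel)
      have "eqmod K (\<phi> (d (v \<oplus>\<^bsub>FS m\<^esub> w))) (g v \<oplus> g w)"
        using \<phi>[OF Fm.a_closed[OF v(1) w(1)]] module_homD(3)[OF g v(1) w(1)] by simp
      then have "eqmod K (\<phi> (d (v \<oplus>\<^bsub>FS m\<^esub> w))) (\<phi> x \<oplus> \<phi> y)" unfolding v w
        by (rule eqmod_trans[OF K _ eqmod_sym[OF K eqmod_add[OF K \<phi>[OF v(1)] \<phi>[OF w(1)]]]])
      then show "eqmod K (\<phi> (x \<oplus>\<^bsub>FS n\<^esub> y)) (\<phi> x \<oplus> \<phi> y)"
        using module_homD(3)[OF d v(1) w(1)] v w by (simp del: free_module_sel)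
    }
    fix a assume a: "a \<in> A"
    then have aS: "a \<in> carrier S" by simp
    have "eqmod K (\<phi> (d (a \<odot>\<^bsub>FS m\<^esub> v))) (a \<otimes> g v)"
      using \<phi>[OF Fm.smult_closed[OF aS v(1)]] module_homD(4)[OF g aS v(1)] by simp
    then have "eqmod K (\<phi> (d (a \<odot>\<^bsub>FS m\<^esub> v))) (a \<otimes> \<phi> x)" unfolding v
      by (rule eqmod_trans[OF K _ eqmod_sym[OF K eqmod_smult[OF K \<phi>[OF v(1)] a]]])
    then show "eqmod K (\<phi> (a \<odot>\<^bsub>FS n\<^esub> x)) (a \<otimes> \<phi> x)"
      using module_homD(4)[OF d aS v(1)] v by (simp del: free_module_sel)
  qed
  then obtain h where h: "h \<in> module_hom S (FS n) V" "\<And>v. v \<in> T \<Longrightarrow> eqmod K (\<phi> v) (h v)"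
    by (rule linear_mod_extends[OF K baer T]) blast
  show thesis
  proof (rule that[OF h(1)])
    fix v assume v: "v \<in> carrier (FS m)"
    show "eqmod K (g v) (h (d v))"
      by (rule eqmod_trans[OF K eqmod_sym[OF K \<phi>[OF v]] h(2)]) (use v in \<open>auto simp: T_def simp del: free_module_sel\<close>)
  qed
qed

end

declare free_module_sel [simp del]

section \<open>Duality over one-dimensional local domains\<close>

text \<open>A one-dimensional Noetherian local domain, described inside its fraction field. In this
  form the axioms are shown to pass to the rings between A and its integral closure, so that every
  result below is available for them too.\<close>

locale one_dim_domain = field Q + noetherian_subring Q A for Q (structure) and A +
  fixes M
  assumes fraction: "q \<in> carrier Q \<Longrightarrow> \<exists>a\<in>A. \<exists>s\<in>A. s \<noteq> \<zero> \<and> q = a \<otimes> inv s"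
    and M_submod: "submod Q A M" and M_A: "M \<subseteq> A" and one_notin_M: "\<one> \<notin> M" and M_nonzero: "M \<noteq> {\<zero>}"
    and unit_A: "x \<in> A \<Longrightarrow> x \<notin> M \<Longrightarrow> inv x \<in> A"
    and prime_eq_M: "primeideal P (Q\<lparr>carrier := A\<rparr>) \<Longrightarrow> P \<noteq> {\<zero>} \<Longrightarrow> P = M"

context field
begin

lemma inv_nonzero:
  assumes "x \<in> carrier R" "x \<noteq> \<zero>"
  shows "inv x \<in> carrier R" "x \<otimes> inv x = \<one>" "inv x \<otimes> x = \<one>" "inv x \<noteq> \<zero>"
proof -
  have u: "x \<in> Units R" using assms field_Units by blast
  show "inv x \<in> carrier R" "x \<otimes> inv x = \<one>" "inv x \<otimes> x = \<one>" using u by auto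
  then show "inv x \<noteq> \<zero>" using assms(1) by (metis r_null one_not_zero)
qed

end

text \<open>The common denominator may be any nonzero element of Q, and the zero submodule is
  included; duality statements exclude it explicitly.\<close>

definition (in cring_with_subring) fractional :: "'a set \<Rightarrow> bool"
  where "fractional X' \<longleftrightarrow> submod Q A X' \<and> (\<exists>t\<in>carrier Q. t \<noteq> \<zero> \<and> (\<forall>x\<in>X'. t \<otimes> x \<in> A))"

lemma (in cring_with_subring) baer_onD:
  assumes "baer_on K I" and "linear_mod K V I \<phi>"
  obtains q where "q \<in> carrier Q" "\<And>x. x \<in> I \<Longrightarrow> eqmod K (\<phi> x) (q \<otimes> x)"
  using assms unfolding baer_on_def by blast

lemma (in cring_with_subring) baerD: "baer K \<Longrightarrow> submod Q A I \<Longrightarrow> I \<subseteq> A \<Longrightarrow> baer_on K I"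
  unfolding baer_def by blast

lemma (in cring_with_subring) fractional_submod: "fractional Y \<Longrightarrow> submod Q A Y"
  by (simp add: fractional_def)

lemma (in cring_with_subring) fractional_subset:
  "fractional Y \<Longrightarrow> submod Q A Z \<Longrightarrow> Z \<subseteq> Y \<Longrightarrow> fractional Z"
  unfolding fractional_def by blast

section \<open>Socle elements and Baer's criterion\<close>

context one_dim_domain
begin

lemma M_zero: "\<zero> \<in> M" using submodD(2)[OF M_submod] .

lemma M_sub: "x \<in> M \<Longrightarrow> x \<in> carrier Q" using M_A A_sub by blast

lemma zero_or_fractional: "submod Q A I \<Longrightarrow> I \<subseteq> A \<Longrightarrow> fractional I"
  unfolding fractional_def using A_sub by (intro conjI bexI[of _ \<one>]) auto

text \<open>Among the ideals (I : x) with x in A outside I choose a maximal one. The usual argument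
  for associated primes shows it to be prime, and it contains I \<noteq> 0, so it is M.\<close>

lemma socle_element:
  assumes I: "submod Q A I" "I \<subseteq> A" "I \<noteq> {\<zero>}" "\<one> \<notin> I"
  obtains x where "x \<in> A" "x \<notin> I" "\<And>m. m \<in> M \<Longrightarrow> m \<otimes> x \<in> I"
proof -
  define P where "P x = {a \<in> A. a \<otimes> x \<in> I}" for x
  have Psub: "submod Q A (P x)" if "x \<in> A" for x
    unfolding P_def by (rule submod_preimage[OF I(1) submod_A A_sub[OF that]])
  have PA: "P x \<subseteq> A" for x by (auto simp: P_def)
  have "P ` (A - I) \<noteq> {}" using I(4) A_one by blast
  then obtain J where J: "J \<in> P ` (A - I)" "\<And>J'. J' \<in> P ` (A - I) \<Longrightarrow> J \<subseteq> J' \<Longrightarrow> J' = J"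
    by (rule submod_max[of "P ` (A - I)"]) (use Psub PA in blast)+
  then obtain x where x: "x \<in> A" "x \<notin> I" "J = P x" by auto
  have xc: "x \<in> carrier Q" using x A_sub by blast
  have "primeideal (P x) S"
  proof (rule primeidealI[OF _ S_cring])
    show "ideal (P x) S" using ideal_iff Psub[OF x(1)] PA by blast
    have "\<one> \<notin> P x" using x xc by (simp add: P_def)
    then show "carrier S \<noteq> P x" by auto
    fix a b assume ab: "a \<in> carrier S" "b \<in> carrier S" "a \<otimes>\<^bsub>S\<^esub> b \<in> P x"
    then have a: "a \<in> A" and b: "b \<in> A" and abx: "a \<otimes> b \<otimes> x \<in> I" by (auto simp: P_def)
    show "a \<in> P x \<or> b \<in> P x"
    proof (rule disjCI)
      assume "b \<notin> P x"
      then have bx: "b \<otimes> x \<in> A - I" using b x by (auto simp: P_def A_mult)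
      have "P x \<subseteq> P (b \<otimes> x)"
      proof
        fix c assume c: "c \<in> P x"
        then have "c \<otimes> (b \<otimes> x) = b \<otimes> (c \<otimes> x)" using A_sub[OF b] A_sub xc by (auto simp: P_def intro: m_lcomm)
        then show "c \<in> P (b \<otimes> x)" using c submodD(4)[OF I(1) b] by (simp add: P_def)
      qed
      then have "P (b \<otimes> x) = P x" using J(2)[of "P (b \<otimes> x)"] bx x(3) by blast
      moreover have "a \<in> P (b \<otimes> x)" using a abx m_assoc[OF A_sub[OF a] A_sub[OF b] xc] by (simp add: P_def)
      ultimately show "a \<in> P x" by simp
    qed
  qed
  moreover have "P x \<noteq> {\<zero>}"
  proof -
    obtain i where i: "i \<in> I" "i \<noteq> \<zero>" using I(3) submodD(2)[OF I(1)] by blast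
    have "i \<otimes> x = x \<otimes> i" using xc I(2) i A_sub by (intro m_comm) auto
    then have "i \<in> P x" using submodD(4)[OF I(1) x(1) i(1)] I(2) i(1) by (auto simp: P_def)
    then show ?thesis using i by blast
  qed
  ultimately have "P x = M" by (rule prime_eq_M)
  then show thesis using that[OF x(1,2)] by (auto simp: P_def)
qed

text \<open>An element of A outside M is a unit of A and would carry x back into J.\<close>

lemma multiplier_in_M:
  assumes J: "submod Q A J" and x: "x \<in> carrier Q" "x \<notin> J" and b: "b \<in> A" "b \<otimes> x \<in> J"
  shows "b \<in> M"
proof (rule ccontr)
  assume bM: "b \<notin> M"
  then have "inv b \<in> A" "b \<noteq> \<zero>" using unit_A[OF b(1)] M_zero by auto
  then have "inv b \<otimes> (b \<otimes> x) \<in> J" using submodD(4)[OF J] b by blast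
  moreover have "inv b \<otimes> (b \<otimes> x) = x"
    using inv_nonzero[OF A_sub[OF b(1)] \<open>b \<noteq> \<zero>\<close>] A_sub[OF b(1)] x(1) by (simp add: m_assoc[symmetric])
  ultimately show False using x by simp
qed

text \<open>The relation a x \<in> J forces a \<in> M, so q is an admissible value at x as soon as
  it is compatible with \<phi> on M x.\<close>

lemma extend_by_element:
  assumes K: "submod Q A K" and J: "submod Q A J" and x: "x \<in> carrier Q" "x \<notin> J"
    and Mx: "\<And>m. m \<in> M \<Longrightarrow> m \<otimes> x \<in> J" and \<phi>: "linear_mod K V J \<phi>"
    and q: "q \<in> carrier Q" "\<And>m. m \<in> M \<Longrightarrow> eqmod K (\<phi> (m \<otimes> x)) (q \<otimes> m)"
  obtains \<phi>' where "linear_mod K V {j \<oplus> a \<otimes> x | j a. j \<in> J \<and> a \<in> A} \<phi>'"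
    "\<And>j. j \<in> J \<Longrightarrow> eqmod K (\<phi>' j) (\<phi> j)" "eqmod K (\<phi>' x) q"
proof -
  let ?J = "{j \<oplus> a \<otimes> x | j a. j \<in> J \<and> a \<in> A}"
  note D = linear_modD[OF \<phi>, unfolded regular_module_sel]
  note Jc = submodD(1)[OF J]
  \<comment> \<open>Two representations of one element differ by a - b with (a - b) x \<in> J, hence
    a - b \<in> M, where q is known to represent \<phi>.\<close>
  have wd: "eqmod K (\<phi> j \<oplus> a \<otimes> q) (\<phi> k \<oplus> b \<otimes> q)"
    if j: "j \<in> J" "a \<in> A" and k: "k \<in> J" "b \<in> A" and eq: "j \<oplus> a \<otimes> x = k \<oplus> b \<otimes> x" for j a k b
  proof -
    note c = Jc[OF j(1)] A_sub[OF j(2)] Jc[OF k(1)] A_sub[OF k(2)]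
    let ?d = "a \<ominus> b"
    have d: "?d \<in> A" by (rule A_diff[OF j(2) k(2)])
    have "?d \<otimes> x = (j \<oplus> a \<otimes> x) \<ominus> j \<ominus> b \<otimes> x" using c x(1) by algebra
    also have "\<dots> = k \<ominus> j" unfolding eq using c x(1) by algebra
    finally have dx: "?d \<otimes> x = k \<ominus> j" .
    then have dJ: "?d \<otimes> x \<in> J" using submod_diff[OF J k(1) j(1)] by simp
    then have dM: "?d \<in> M" by (rule multiplier_in_M[OF J x d])
    have kk: "k = j \<oplus> ?d \<otimes> x" unfolding dx using c by algebra
    have qd: "q \<otimes> ?d \<in> carrier Q" using q(1) A_sub[OF d] by simp
    have "eqmod K (\<phi> k) (\<phi> j \<oplus> q \<otimes> ?d)"
      unfolding kk by (rule eqmod_trans[OF K D(2)[OF j(1) dJ] eqmod_add[OF K eqmod_refl[OF K D(1)[OF j(1)]] q(2)[OF dM]]])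
    then have "eqmod K (\<phi> k \<oplus> b \<otimes> q) (\<phi> j \<oplus> q \<otimes> ?d \<oplus> b \<otimes> q)"
      using c q(1) by (intro eqmod_add[OF K _ eqmod_refl[OF K]]) auto
    moreover have "\<phi> j \<oplus> q \<otimes> ?d \<oplus> b \<otimes> q = \<phi> j \<oplus> a \<otimes> q"
      using c q(1) D(1)[OF j(1)] by algebra
    ultimately show ?thesis using eqmod_sym[OF K] by simp
  qed
  define \<phi>' where "\<phi>' w = (let (j, a) = (SOME (j, a). j \<in> J \<and> a \<in> A \<and> w = j \<oplus> a \<otimes> x) in \<phi> j \<oplus> a \<otimes> q)" for w
  have \<phi>': "eqmod K (\<phi>' (j \<oplus> a \<otimes> x)) (\<phi> j \<oplus> a \<otimes> q)" if j: "j \<in> J" "a \<in> A" for j a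
  proof -
    define p where "p = (SOME (k, b). k \<in> J \<and> b \<in> A \<and> j \<oplus> a \<otimes> x = k \<oplus> b \<otimes> x)"
    have "(\<lambda>(k, b). k \<in> J \<and> b \<in> A \<and> j \<oplus> a \<otimes> x = k \<oplus> b \<otimes> x) p"
      unfolding p_def by (rule someI[of _ "(j, a)"]) (use j in simp)
    then obtain k b where p: "p = (k, b)" "k \<in> J" "b \<in> A" "j \<oplus> a \<otimes> x = k \<oplus> b \<otimes> x" by (cases p) auto
    have "\<phi>' (j \<oplus> a \<otimes> x) = \<phi> k \<oplus> b \<otimes> q" unfolding \<phi>'_def p_def[symmetric] p(1) by simp
    then show ?thesis using wd[OF p(2,3) j p(4)[symmetric]] by simp
  qed
  have "linear_mod K V ?J \<phi>'"
    unfolding linear_mod_def regular_module_sel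
  proof (intro conjI ballI)
    fix u assume "u \<in> ?J" then obtain j a where u: "j \<in> J" "a \<in> A" "u = j \<oplus> a \<otimes> x" by blast
    note c = Jc[OF u(1)] A_sub[OF u(2)] D(1)[OF u(1)]
    show "\<phi>' u \<in> carrier Q" unfolding u(3) by (rule eqmodD(1)[OF \<phi>'[OF u(1,2)]])
    {
      fix v assume "v \<in> ?J" then obtain k b where v: "k \<in> J" "b \<in> A" "v = k \<oplus> b \<otimes> x" by blast
      note c = c Jc[OF v(1)] A_sub[OF v(2)] D(1)[OF v(1)]
      have 1: "u \<oplus> v = (j \<oplus> k) \<oplus> (a \<oplus> b) \<otimes> x" unfolding u v using c x by algebra
      have 2: "eqmod K (\<phi>' (u \<oplus> v)) (\<phi> (j \<oplus> k) \<oplus> (a \<oplus> b) \<otimes> q)"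
        unfolding 1 by (rule \<phi>'[OF submodD(3)[OF J u(1) v(1)] A_add[OF u(2) v(2)]])
      have 3: "eqmod K (\<phi> (j \<oplus> k) \<oplus> (a \<oplus> b) \<otimes> q) (\<phi> j \<oplus> \<phi> k \<oplus> (a \<oplus> b) \<otimes> q)"
        using c q(1) by (intro eqmod_add[OF K D(2)[OF u(1) v(1)] eqmod_refl[OF K]]) auto
      have 4: "\<phi> j \<oplus> \<phi> k \<oplus> (a \<oplus> b) \<otimes> q = (\<phi> j \<oplus> a \<otimes> q) \<oplus> (\<phi> k \<oplus> b \<otimes> q)" using c q(1) by algebra
      have 5: "eqmod K (\<phi>' u \<oplus> \<phi>' v) ((\<phi> j \<oplus> a \<otimes> q) \<oplus> (\<phi> k \<oplus> b \<otimes> q))"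
        unfolding u v by (rule eqmod_add[OF K \<phi>'[OF u(1,2)] \<phi>'[OF v(1,2)]])
      show "eqmod K (\<phi>' (u \<oplus> v)) (\<phi>' u \<oplus> \<phi>' v)"
        using eqmod_trans[OF K eqmod_trans[OF K 2 3[unfolded 4]] eqmod_sym[OF K 5]] .
    }
    fix b assume b: "b \<in> A"
    note c = c A_sub[OF b]
    have 1: "b \<otimes> u = b \<otimes> j \<oplus> (b \<otimes> a) \<otimes> x" unfolding u using c x by algebra
    have 2: "eqmod K (\<phi>' (b \<otimes> u)) (\<phi> (b \<otimes> j) \<oplus> (b \<otimes> a) \<otimes> q)"
      unfolding 1 by (rule \<phi>'[OF submodD(4)[OF J b u(1)] A_mult[OF b u(2)]])
    have 3: "eqmod K (\<phi> (b \<otimes> j) \<oplus> (b \<otimes> a) \<otimes> q) (b \<otimes> \<phi> j \<oplus> (b \<otimes> a) \<otimes> q)"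
      using c q(1) by (intro eqmod_add[OF K D(3)[OF b u(1)] eqmod_refl[OF K]]) auto
    have 4: "b \<otimes> \<phi> j \<oplus> (b \<otimes> a) \<otimes> q = b \<otimes> (\<phi> j \<oplus> a \<otimes> q)" using c q(1) by algebra
    have 5: "eqmod K (b \<otimes> \<phi>' u) (b \<otimes> (\<phi> j \<oplus> a \<otimes> q))"
      unfolding u by (rule eqmod_smult[OF K \<phi>'[OF u(1,2)] b])
    show "eqmod K (\<phi>' (b \<otimes> u)) (b \<otimes> \<phi>' u)"
      using eqmod_trans[OF K eqmod_trans[OF K 2 3[unfolded 4]] eqmod_sym[OF K 5]] .
  qed
  moreover have "eqmod K (\<phi>' j) (\<phi> j)" if "j \<in> J" for j
    using \<phi>'[OF that A_zero] x(1) q(1) Jc[OF that] D(1)[OF that] by simp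
  moreover have "eqmod K (\<phi>' x) q"
  proof -
    have z: "\<zero> \<in> J" by (rule submodD(2)[OF J])
    have "eqmod K (\<phi> \<zero>) \<zero>"
      using linear_mod_zero[OF K regular_module_module \<phi>] z eqmod_zero[OF K] by simp
    then have "eqmod K (\<phi> \<zero> \<oplus> q) (\<zero> \<oplus> q)" by (rule eqmod_add[OF K _ eqmod_refl[OF K q(1)]])
    then show ?thesis using eqmod_trans[OF K \<phi>'[OF z A_one]] x(1) q(1) D(1)[OF z] by simp
  qed
  ultimately show thesis by (rule that)
qed

text \<open>Q is injective over A: x \<phi>(y) = y \<phi>(x) shows that \<phi> is multiplication by
  \<phi>(x) / x for any nonzero x in I.\<close>

lemma baer_zero: "baer {\<zero>}"
  unfolding baer_def baer_on_def
proof (intro allI impI, elim conjE)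
  fix I \<phi> assume I: "submod Q A I" "I \<subseteq> A" and \<phi>: "linear_mod {\<zero>} V I \<phi>"
  note D = linear_modD[OF \<phi>, unfolded regular_module_sel]
  show "\<exists>q\<in>carrier Q. \<forall>x\<in>I. eqmod {\<zero>} (\<phi> x) (q \<otimes> x)"
  proof (cases "I = {\<zero>}")
    case True
    then have "\<phi> \<zero> = \<zero>" using linear_mod_zero[OF submod_zero regular_module_module \<phi>] by simp
    then show ?thesis using True by (intro bexI[of _ \<zero>]) (auto simp: eqmod_zero_eq)
  next
    case False
    then obtain x0 where x0: "x0 \<in> I" "x0 \<noteq> \<zero>" using submodD(2)[OF I(1)] by blast
    have x0c: "x0 \<in> carrier Q" "x0 \<in> A" using x0 I A_sub by auto
    note inv = inv_nonzero[OF x0c(1) x0(2)]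
    show ?thesis
    proof (intro bexI ballI)
      show "\<phi> x0 \<otimes> inv x0 \<in> carrier Q" using D(1)[OF x0(1)] inv by simp
      fix x assume x: "x \<in> I"
      then have xc: "x \<in> carrier Q" "x \<in> A" using I A_sub by auto
      have "x \<otimes> \<phi> x0 = \<phi> (x \<otimes> x0)" using D(3)[OF xc(2) x0(1)] by (simp add: eqmod_zero_eq)
      also have "\<dots> = x0 \<otimes> \<phi> x" using D(3)[OF x0c(2) x] m_comm[OF xc(1) x0c(1)] by (simp add: eqmod_zero_eq)
      finally have e: "x \<otimes> \<phi> x0 = x0 \<otimes> \<phi> x" .
      have "\<phi> x0 \<otimes> inv x0 \<otimes> x = inv x0 \<otimes> (x \<otimes> \<phi> x0)"
        using D(1)[OF x0(1)] inv(1) xc(1) by (simp add: m_ac)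
      also have "\<dots> = (inv x0 \<otimes> x0) \<otimes> \<phi> x" unfolding e using D(1)[OF x] inv(1) x0c(1) by (simp add: m_assoc)
      also have "\<dots> = \<phi> x" using inv(3) D(1)[OF x] by simp
      finally show "eqmod {\<zero>} (\<phi> x) (\<phi> x0 \<otimes> inv x0 \<otimes> x)" using D(1)[OF x] by (simp add: eqmod_zero_eq)
    qed
  qed
qed

text \<open>Multiplication by a common denominator t identifies Y with an ideal of A.\<close>

lemma baer_fractional:
  assumes K: "submod Q A K" and baer: "baer K" and Y: "fractional Y"
  shows "baer_on K Y"
  unfolding baer_on_def
proof (intro allI impI)
  fix \<phi> assume \<phi>: "linear_mod K V Y \<phi>"
  note D = linear_modD[OF \<phi>, unfolded regular_module_sel]
  obtain t where t: "t \<in> carrier Q" "t \<noteq> \<zero>" "\<And>x. x \<in> Y \<Longrightarrow> t \<otimes> x \<in> A" and Ys: "submod Q A Y"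
    using Y by (auto simp: fractional_def)
  note Yc = submodD(1)[OF Ys]
  note inv = inv_nonzero[OF t(1,2)]
  have it: "inv t \<otimes> (t \<otimes> x) = x" if "x \<in> Y" for x
    using inv t(1) Yc[OF that] by (simp add: m_assoc[symmetric])
  let ?I = "(\<lambda>x. t \<otimes> x) ` Y"
  have "linear_mod K V ?I (\<lambda>y. \<phi> (inv t \<otimes> y))"
    unfolding linear_mod_def regular_module_sel
  proof (intro conjI ballI)
    fix u assume "u \<in> ?I" then obtain x where x: "x \<in> Y" "u = t \<otimes> x" by blast
    show "\<phi> (inv t \<otimes> u) \<in> carrier Q" using D(1)[OF x(1)] x it by simp
    {
      fix v assume "v \<in> ?I" then obtain y where y: "y \<in> Y" "v = t \<otimes> y" by blast
      have "inv t \<otimes> (u \<oplus> v) = x \<oplus> y"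
        using it[OF x(1)] it[OF y(1)] x y t inv Yc by (simp add: r_distr)
      then show "eqmod K (\<phi> (inv t \<otimes> (u \<oplus> v))) (\<phi> (inv t \<otimes> u) \<oplus> \<phi> (inv t \<otimes> v))"
        using D(2)[OF x(1) y(1)] it x y by simp
    }
    fix a assume a: "a \<in> A"
    have "inv t \<otimes> (a \<otimes> u) = a \<otimes> (inv t \<otimes> u)"
      using inv(1) A_sub[OF a] x t(1) Yc by (simp add: m_lcomm)
    then show "eqmod K (\<phi> (inv t \<otimes> (a \<otimes> u))) (a \<otimes> \<phi> (inv t \<otimes> u))"
      using D(3)[OF a x(1)] it x by simp
  qed
  moreover have "baer_on K ?I"
    by (rule baerD[OF baer submod_image[OF Ys t(1)]]) (use t(3) in blast)
  ultimately obtain q where q: "q \<in> carrier Q" "\<And>y. y \<in> ?I \<Longrightarrow> eqmod K (\<phi> (inv t \<otimes> y)) (q \<otimes> y)"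
    using baer_onD by blast
  show "\<exists>q\<in>carrier Q. \<forall>x\<in>Y. eqmod K (\<phi> x) (q \<otimes> x)"
  proof (intro bexI ballI)
    show "q \<otimes> t \<in> carrier Q" using q t by simp
    fix x assume x: "x \<in> Y"
    then have "t \<otimes> x \<in> ?I" by blast
    from q(2)[OF this] show "eqmod K (\<phi> x) (q \<otimes> t \<otimes> x)"
      using it[OF x] q(1) t(1) Yc[OF x] by (simp add: m_assoc)
  qed
qed

text \<open>An ideal to which a map can be extended maximally is \<open>A\<close>: otherwise a socle element of the
  quotient gives a map on \<open>M\<close>, and hence a further extension.\<close>

lemma baer_if_baer_on_M:
  assumes K: "submod Q A K" and baer: "baer_on K M"
  shows "baer K"
  unfolding baer_def
proof (intro allI impI, elim conjE)
  fix I assume I: "submod Q A I" "I \<subseteq> A"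
  show "baer_on K I"
    unfolding baer_on_def
  proof (intro allI impI)
    fix \<phi> assume \<phi>: "linear_mod K V I \<phi>"
    show "\<exists>q\<in>carrier Q. \<forall>x\<in>I. eqmod K (\<phi> x) (q \<otimes> x)"
    proof (cases "I = {\<zero>}")
      case True
      have "\<phi> \<zero> \<in> K" using linear_mod_zero[OF K regular_module_module \<phi>] submodD(2)[OF I(1)] by simp
      then show ?thesis using True eqmod_zero[OF K] by (intro bexI[of _ \<zero>]) auto
    next
      case False
      \<comment> \<open>Only the domains of extensions are collected. The Noetherian property yields
        a maximal one directly, and an extension of \<phi> to it is picked afterwards.\<close>
      define \<F> where "\<F> = {J. submod Q A J \<and> I \<subseteq> J \<and> J \<subseteq> A \<and>
        (\<exists>\<phi>'. linear_mod K V J \<phi>' \<and> (\<forall>x\<in>I. eqmod K (\<phi>' x) (\<phi> x)))}"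
      have "I \<in> \<F>" unfolding \<F>_def using I \<phi> eqmod_refl[OF K linear_modD(1)[OF \<phi>]] by blast
      then have "\<F> \<noteq> {}" by blast
      then obtain J where J: "J \<in> \<F>" "\<And>J'. J' \<in> \<F> \<Longrightarrow> J \<subseteq> J' \<Longrightarrow> J' = J"
        by (rule submod_max[of \<F>]) (auto simp: \<F>_def)
      obtain \<phi>' where Js: "submod Q A J" "I \<subseteq> J" "J \<subseteq> A" and \<phi>': "linear_mod K V J \<phi>'"
        "\<And>x. x \<in> I \<Longrightarrow> eqmod K (\<phi>' x) (\<phi> x)" using J(1) by (auto simp: \<F>_def)
      note D = linear_modD[OF \<phi>'(1), unfolded regular_module_sel]
      have "\<one> \<in> J"
      proof (rule ccontr)
        assume "\<one> \<notin> J"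
        moreover have "J \<noteq> {\<zero>}" using False Js(2) submodD(2)[OF I(1)] by blast
        ultimately obtain x where x: "x \<in> A" "x \<notin> J" "\<And>m. m \<in> M \<Longrightarrow> m \<otimes> x \<in> J"
          using socle_element[OF Js(1,3)] by blast
        have xc: "x \<in> carrier Q" by (rule A_sub[OF x(1)])
        have "linear_mod K V M (\<lambda>m. \<phi>' (m \<otimes> x))"
          unfolding linear_mod_def regular_module_sel
        proof (intro conjI ballI)
          fix m assume m: "m \<in> M"
          show "\<phi>' (m \<otimes> x) \<in> carrier Q" using D(1) x(3)[OF m] by blast
          show "eqmod K (\<phi>' ((m \<oplus> n) \<otimes> x)) (\<phi>' (m \<otimes> x) \<oplus> \<phi>' (n \<otimes> x))" if n: "n \<in> M" for n
            using D(2)[OF x(3)[OF m] x(3)[OF n]] l_distr[OF M_sub[OF m] M_sub[OF n] xc] by simp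
          show "eqmod K (\<phi>' (a \<otimes> m \<otimes> x)) (a \<otimes> \<phi>' (m \<otimes> x))" if a: "a \<in> A" for a
            using D(3)[OF a x(3)[OF m]] m_assoc[OF A_sub[OF a] M_sub[OF m] xc] by simp
        qed
        then obtain q where q: "q \<in> carrier Q" "\<And>m. m \<in> M \<Longrightarrow> eqmod K (\<phi>' (m \<otimes> x)) (q \<otimes> m)"
          using baer_onD[OF baer] by blast
        let ?J = "{j \<oplus> a \<otimes> x | j a. j \<in> J \<and> a \<in> A}"
        obtain \<psi> where \<psi>: "linear_mod K V ?J \<psi>" "\<And>j. j \<in> J \<Longrightarrow> eqmod K (\<psi> j) (\<phi>' j)"
          using extend_by_element[OF K Js(1) xc x(2,3) \<phi>'(1) q] by blast
        note JJ = submod_sum[OF Js(1) xc]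
        have "?J \<subseteq> A" using Js(3) x(1) by (auto intro!: A_add A_mult)
        moreover have "eqmod K (\<psi> y) (\<phi> y)" if "y \<in> I" for y
          by (rule eqmod_trans[OF K \<psi>(2)[OF subsetD[OF Js(2) that]] \<phi>'(2)[OF that]])
        ultimately have "?J \<in> \<F>" unfolding \<F>_def using JJ(1,2) Js(2) \<psi>(1) by blast
        then have "?J = J" using J(2)[OF _ JJ(2)] by blast
        then show False using JJ(3) x(2) by simp
      qed
      \<comment> \<open>With \<one> in the domain, the extended map is multiplication by its value
        at \<one>.\<close>
      show ?thesis
      proof (intro bexI ballI)
        show "\<phi>' \<one> \<in> carrier Q" by (rule D(1)[OF \<open>\<one> \<in> J\<close>])
        fix x assume x: "x \<in> I"
        have "eqmod K (\<phi>' (x \<otimes> \<one>)) (x \<otimes> \<phi>' \<one>)" using x I(2) by (intro D(3)[OF _ \<open>\<one> \<in> J\<close>]) auto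
        moreover have "x \<otimes> \<phi>' \<one> = \<phi>' \<one> \<otimes> x" using x submodD(1)[OF I(1)] D(1)[OF \<open>\<one> \<in> J\<close>] by (intro m_comm) auto
        ultimately have "eqmod K (\<phi>' x) (\<phi>' \<one> \<otimes> x)" using x submodD(1)[OF I(1)] by simp
        then show "eqmod K (\<phi> x) (\<phi>' \<one> \<otimes> x)" by (rule eqmod_trans[OF K eqmod_sym[OF K \<phi>'(2)[OF x]]])
      qed
    qed
  qed
qed

end

text \<open>\<open>C\<close> is a canonical ideal: \<open>Q / C\<close> is injective and has a nonzero socle.\<close>

locale canonical_ideal = one_dim_domain +
  fixes C
  assumes C_frac: "fractional C" and baer_C: "baer C" and socle_C: "\<not> colon Q C M \<subseteq> C"
begin

section \<open>Duality with respect to a canonical ideal\<close>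

lemma C_submod: "submod Q A C" using fractional_submod[OF C_frac] .

lemma C_sub: "x \<in> C \<Longrightarrow> x \<in> carrier Q" using submodD(1)[OF C_submod] .

lemma dual_submod: "submod Q A I \<Longrightarrow> submod Q A (colon Q C I)"
  by (rule colon_submod[OF C_submod]) (auto dest: submodD(1))

lemma dual_antimono: "I \<subseteq> J \<Longrightarrow> colon Q C J \<subseteq> colon Q C I"
  by (auto simp: colon_def)

text \<open>If J is smaller than I, then I / J contains a socle element z. Send J to 0 and z to a
  socle element s of Q / C; this is a map on J + A z, hence multiplication by some q. Then q J
  \<subseteq> C while q z is congruent to s, which lies outside C, so q lies in C : J but not in C :
  I.\<close>

lemma dual_reflects:
  assumes I: "fractional I" and J: "submod Q A J" "J \<subseteq> I" "J \<noteq> {\<zero>}" and dual: "colon Q C J \<subseteq> colon Q C I"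
  shows "I = J"
proof (rule ccontr)
  assume "I \<noteq> J"
  then obtain y where y: "y \<in> I" "y \<notin> J" using J(2) by blast
  note Is = fractional_submod[OF I]
  have yc: "y \<in> carrier Q" using submodD(1)[OF Is y(1)] .
  have y0: "y \<noteq> \<zero>" using y(2) submodD(2)[OF J(1)] by blast
  let ?P = "{r \<in> A. r \<otimes> y \<in> J}"
  have P: "submod Q A ?P" by (rule submod_preimage[OF J(1) submod_A yc])
  \<comment> \<open>Writing j / y as a fraction a / b, for a nonzero j in J, gives a y = b j \<in>
    J.\<close>
  have "?P \<noteq> {\<zero>}"
  proof -
    obtain j where j: "j \<in> J" "j \<noteq> \<zero>" using J submodD(2)[OF J(1)] by blast
    have jc: "j \<in> carrier Q" by (rule submodD(1)[OF J(1) j(1)])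
    note iy = inv_nonzero[OF yc y0] and ij = inv_nonzero[OF jc j(2)]
    obtain a b where ab: "a \<in> A" "b \<in> A" "b \<noteq> \<zero>" "j \<otimes> inv y = a \<otimes> inv b"
      using fraction[of "j \<otimes> inv y"] jc iy by auto
    note ib = inv_nonzero[OF A_sub[OF ab(2)] ab(3)]
    have c: "a \<in> carrier Q" "b \<in> carrier Q" using ab A_sub by auto
    have "j = (j \<otimes> inv y) \<otimes> y" using jc yc iy by (simp add: m_assoc)
    then have 1: "b \<otimes> j = a \<otimes> y" unfolding ab(4) using c yc ib by (metis m_assoc m_closed m_comm r_one)
    have "a \<otimes> y \<in> J" using submodD(4)[OF J(1) ab(2) j(1)] 1 by simp
    moreover have "a \<noteq> \<zero>"
    proof
      assume "a = \<zero>"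
      then have "b \<otimes> j = \<zero>" using 1 yc by simp
      then show False using integral[of b j] c jc ab(3) j(2) by blast
    qed
    ultimately show ?thesis using ab(1) by blast
  qed
  moreover have "\<one> \<notin> ?P" using y yc by simp
  ultimately obtain x where x: "x \<in> A" "x \<notin> ?P" "\<And>m. m \<in> M \<Longrightarrow> m \<otimes> x \<in> ?P"
    using socle_element[OF P] by blast
  define z where "z = x \<otimes> y"
  have xc: "x \<in> carrier Q" by (rule A_sub[OF x(1)])
  have z: "z \<in> carrier Q" "z \<notin> J" "z \<in> I"
    using x xc yc submodD(4)[OF Is x(1) y(1)] by (auto simp: z_def)
  have Mz: "m \<otimes> z \<in> J" if "m \<in> M" for m
    using x(3)[OF that] m_assoc[OF M_sub[OF that] xc yc] by (simp add: z_def)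
  obtain s where s: "s \<in> colon Q C M" "s \<notin> C" using socle_C by blast
  have sc: "s \<in> carrier Q" and sM: "\<And>m. m \<in> M \<Longrightarrow> s \<otimes> m \<in> C" using s(1) by (auto simp: colon_def)
  note K = C_submod
  have lin: "linear_mod C V J (\<lambda>_. \<zero>)"
    unfolding linear_mod_def using eqmod_refl[OF K zero_closed] A_sub by simp
  have "eqmod C \<zero> (s \<otimes> m)" if "m \<in> M" for m
    using eqmod_sym[OF K] eqmod_zero[OF K] sM[OF that] by blast
  then obtain \<psi> where \<psi>: "linear_mod C V {j \<oplus> a \<otimes> z | j a. j \<in> J \<and> a \<in> A} \<psi>"
    "\<And>j. j \<in> J \<Longrightarrow> eqmod C (\<psi> j) \<zero>" "eqmod C (\<psi> z) s"
    using extend_by_element[OF K J(1) z(1,2) Mz lin sc] by blast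
  let ?J = "{j \<oplus> a \<otimes> z | j a. j \<in> J \<and> a \<in> A}"
  note JJ = submod_sum[OF J(1) z(1)]
  have "?J \<subseteq> I" using J(2) z(3) submodD(3,4)[OF Is] by blast
  then have "fractional ?J" using fractional_subset[OF I JJ(1)] by blast
  then obtain q where q: "q \<in> carrier Q" "\<And>w. w \<in> ?J \<Longrightarrow> eqmod C (\<psi> w) (q \<otimes> w)"
    using baer_onD[OF baer_fractional[OF K baer_C] \<psi>(1)] by blast
  have "q \<otimes> j \<in> C" if "j \<in> J" for j
  proof -
    have "eqmod C (q \<otimes> j) \<zero>"
      by (rule eqmod_trans[OF K eqmod_sym[OF K q(2)[OF subsetD[OF JJ(2) that]]] \<psi>(2)[OF that]])
    then show ?thesis using eqmod_zero[OF K] by simp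
  qed
  then have "q \<in> colon Q C I" using q(1) dual by (auto simp: colon_def)
  then have "q \<otimes> z \<in> C" using z(3) by (auto simp: colon_def)
  then have "s \<in> C"
    using eqmod_mem[OF K q(2)[OF JJ(3)]] eqmod_mem[OF K \<psi>(3)] by blast
  then show False using s by blast
qed

lemma nonzero_in_C: obtains c where "c \<in> C" "c \<noteq> \<zero>"
proof -
  have "C \<noteq> {\<zero>}"
  proof
    assume C: "C = {\<zero>}"
    obtain s where s: "s \<in> carrier Q" "\<And>m. m \<in> M \<Longrightarrow> s \<otimes> m = \<zero>" "s \<noteq> \<zero>"
      using socle_C C by (auto simp: colon_def)
    have "m = \<zero>" if "m \<in> M" for m using s that integral[of s m] M_sub by blast
    then show False using M_nonzero M_zero by blast
  qed
  then show thesis using that submodD(2)[OF C_submod] by blast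
qed

text \<open>For a denominator d of C and any nonzero i in I, the product d i clears C : I, because d
  i x = d (x i).\<close>

lemma dual_fractional:
  assumes I: "submod Q A I" "I \<noteq> {\<zero>}"
  shows "fractional (colon Q C I)"
proof -
  obtain d where d: "d \<in> carrier Q" "d \<noteq> \<zero>" "\<And>x. x \<in> C \<Longrightarrow> d \<otimes> x \<in> A"
    using C_frac by (auto simp: fractional_def)
  obtain i where i: "i \<in> I" "i \<noteq> \<zero>" using I submodD(2)[OF I(1)] by blast
  have ic: "i \<in> carrier Q" by (rule submodD(1)[OF I(1) i(1)])
  have "d \<otimes> i \<otimes> x \<in> A" if "x \<in> colon Q C I" for x
  proof -
    have "x \<otimes> i \<in> C" "x \<in> carrier Q" using that i by (auto simp: colon_def)
    then show ?thesis using d(3)[of "x \<otimes> i"] d(1) ic by (simp add: m_assoc m_comm[of i x])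
  qed
  moreover have "d \<otimes> i \<noteq> \<zero>" using integral[of d i] d i ic by blast
  ultimately show ?thesis unfolding fractional_def using dual_submod[OF I(1)] d ic by blast
qed

text \<open>I \<subseteq> C : (C : I) is formal, and so is the inclusion of C : I in its own double
  dual. Hence I and C : (C : I) have the same dual, and \<open>dual_reflects\<close> makes them
  equal.\<close>

lemma double_dual:
  assumes I: "fractional I" "I \<noteq> {\<zero>}"
  shows "colon Q C (colon Q C I) = I"
proof (rule dual_reflects)
  note Is = fractional_submod[OF I(1)]
  show sub: "I \<subseteq> colon Q C (colon Q C I)"
  proof
    fix x assume x: "x \<in> I"
    then have xc: "x \<in> carrier Q" by (rule submodD(1)[OF Is])
    have "x \<otimes> y \<in> C" if "y \<in> colon Q C I" for y
    proof -
      have "y \<in> carrier Q" "y \<otimes> x \<in> C" using that x by (auto simp: colon_def)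
      then show ?thesis using m_comm[OF xc, of y] by simp
    qed
    then show "x \<in> colon Q C (colon Q C I)" using xc by (simp add: colon_def)
  qed
  obtain t where t: "t \<in> carrier Q" "t \<noteq> \<zero>" "\<And>x. x \<in> I \<Longrightarrow> t \<otimes> x \<in> A"
    using I by (auto simp: fractional_def)
  obtain c where c: "c \<in> C" "c \<noteq> \<zero>" by (rule nonzero_in_C)
  \<comment> \<open>A nonzero element of the dual, needed so that the double dual is again
    fractional.\<close>
  have "c \<otimes> t \<in> colon Q C I"
    unfolding colon_def
  proof (intro CollectI conjI ballI)
    fix x assume x: "x \<in> I"
    have "c \<otimes> t \<otimes> x = (t \<otimes> x) \<otimes> c" using C_sub[OF c(1)] t(1) submodD(1)[OF Is x] by (simp add: m_ac)
    then show "c \<otimes> t \<otimes> x \<in> C" using submodD(4)[OF C_submod t(3)[OF x] c(1)] by simp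
  qed (use C_sub[OF c(1)] t(1) in simp)
  moreover have "c \<otimes> t \<noteq> \<zero>" using integral[of c t] c C_sub t by blast
  ultimately have "colon Q C I \<noteq> {\<zero>}" by blast
  then show "fractional (colon Q C (colon Q C I))" by (rule dual_fractional[OF dual_submod[OF Is]])
  show "colon Q C I \<subseteq> colon Q C (colon Q C (colon Q C I))"
  proof
    fix x assume x: "x \<in> colon Q C I"
    then have xc: "x \<in> carrier Q" by (simp add: colon_def)
    have "x \<otimes> y \<in> C" if "y \<in> colon Q C (colon Q C I)" for y
    proof -
      have "y \<in> carrier Q" "y \<otimes> x \<in> C" using that x by (auto simp: colon_def)
      then show ?thesis using m_comm[OF xc, of y] by simp
    qed
    then show "x \<in> colon Q C (colon Q C (colon Q C I))" using xc by (simp add: colon_def)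
  qed
qed (use fractional_submod[OF I(1)] I(2) in auto)

lemma colon_A:
  assumes I: "submod Q A I"
  shows "colon Q I A = I"
proof (rule subset_antisym)
  show "colon Q I A \<subseteq> I"
  proof
    fix x assume "x \<in> colon Q I A"
    then have "x \<in> carrier Q" "x \<otimes> \<one> \<in> I" using A_one unfolding colon_def by blast+
    then show "x \<in> I" by simp
  qed
  show "I \<subseteq> colon Q I A"
  proof
    fix x assume x: "x \<in> I"
    have "x \<otimes> a \<in> I" if "a \<in> A" for a
      using submodD(4)[OF I that x] m_comm[OF submodD(1)[OF I x] A_sub[OF that]] by simp
    then show "x \<in> colon Q I A" using submodD(1)[OF I x] by (simp add: colon_def)
  qed
qed

text \<open>C is the dual of A, so C : C is the double dual of A.\<close>

lemma C_colon_C: "colon Q C C = A"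
proof -
  have "A \<noteq> {\<zero>}" using A_one one_not_zero by blast
  then show ?thesis
    using double_dual[OF zero_or_fractional[OF submod_A]] colon_A[OF C_submod] by simp
qed

end

section \<open>Ext of the residue field\<close>

lemma submodule_of_submodule:
  assumes "module R M" "submodule N R M" "submodule N' R M" "N \<subseteq> N'"
  shows "submodule N R (M\<lparr>carrier := N'\<rparr>)"
proof (rule module.module_incl_imp_submodule)
  show "module R (M\<lparr>carrier := N'\<rparr>)" by (rule submodule.submodule_is_module[OF assms(3,1)])
  show "module R (M\<lparr>carrier := N', carrier := N\<rparr>)"
    using submodule.submodule_is_module[OF assms(2,1)] by simp
qed (use assms(4) in simp)

text \<open>The extensional form of \<open>dual_differential\<close>, so that it is itself a module
  homomorphism, whose kernel gives the cocycles and whose image gives the coboundaries.\<close>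

definition dual_map ::
  "('a, 'r) ring_scheme \<Rightarrow> (nat \<Rightarrow> nat) \<Rightarrow> (nat \<Rightarrow> (nat \<Rightarrow> 'a) \<Rightarrow> (nat \<Rightarrow> 'a)) \<Rightarrow> ('a, 'c) module \<Rightarrow> nat
     \<Rightarrow> ((nat \<Rightarrow> 'a) \<Rightarrow> 'c) \<Rightarrow> ((nat \<Rightarrow> 'a) \<Rightarrow> 'c)"
  where "dual_map R r d W i = (\<lambda>f\<in>module_hom R (free_module R (r i)) W. dual_differential R r d i f)"

locale free_complex = cring R for R (structure) +
  fixes r :: "nat \<Rightarrow> nat" and d :: "nat \<Rightarrow> (nat \<Rightarrow> 'a) \<Rightarrow> (nat \<Rightarrow> 'a)"
  assumes d_hom: "d i \<in> module_hom R (free_module R (r (Suc i))) (free_module R (r i))"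
    and d_d: "v \<in> carrier (free_module R (r (Suc (Suc i)))) \<Longrightarrow> d i (d (Suc i) v) = \<zero>\<^bsub>free_module R (r i)\<^esub>"
begin

abbreviation Fr where "Fr i \<equiv> F (r i)"

lemma d_closed: "v \<in> carrier (Fr (Suc i)) \<Longrightarrow> d i v \<in> carrier (Fr i)"
  by (rule module_homD(1)[OF d_hom])

lemma dual_differential_apply: "v \<in> carrier (Fr (Suc i)) \<Longrightarrow> dual_differential R r d i f v = f (d i v)"
  by (simp add: dual_differential_def compose_eq)

lemma dual_map_hom:
  assumes W: "module R W"
  shows "dual_map R r d W i \<in> module_hom R (hom_module R (Fr i) W) (hom_module R (Fr (Suc i)) W)"
proof -
  note M = free_module_module
  have 1: "dual_differential R r d i f \<in> module_hom R (Fr (Suc i)) W" if "f \<in> module_hom R (Fr i) W" for f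
    unfolding dual_differential_def by (rule module_hom_compose[OF d_hom that M])
  have 2: "dual_differential R r d i f \<in> extensional (carrier (Fr (Suc i)))" for f
    unfolding dual_differential_def by (rule compose_extensional)
  show ?thesis
  proof (rule module_homI)
    fix f assume f: "f \<in> carrier (hom_module R (Fr i) W)"
    then have f': "f \<in> module_hom R (Fr i) W" by simp
    show "dual_map R r d W i f \<in> carrier (hom_module R (Fr (Suc i)) W)"
      using f' 1[OF f'] by (simp add: dual_map_def)
    {
      fix g assume g: "g \<in> carrier (hom_module R (Fr i) W)"
      then have g': "g \<in> module_hom R (Fr i) W" by simp
      have s: "f \<oplus>\<^bsub>hom_module R (Fr i) W\<^esub> g \<in> module_hom R (Fr i) W"
        using module_hom_add[OF M W f' g'] by simp
      have "dual_differential R r d i (f \<oplus>\<^bsub>hom_module R (Fr i) W\<^esub> g)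
          = dual_differential R r d i f \<oplus>\<^bsub>hom_module R (Fr (Suc i)) W\<^esub> dual_differential R r d i g"
        by (rule extensionalityI[OF 2])
          (simp_all add: dual_differential_apply d_closed)
      then show "dual_map R r d W i (f \<oplus>\<^bsub>hom_module R (Fr i) W\<^esub> g)
          = dual_map R r d W i f \<oplus>\<^bsub>hom_module R (Fr (Suc i)) W\<^esub> dual_map R r d W i g"
        unfolding dual_map_def using f' g' s by (simp only: restrict_apply' if_True)
    }
    fix a assume a: "a \<in> carrier R"
    have s: "a \<odot>\<^bsub>hom_module R (Fr i) W\<^esub> f \<in> module_hom R (Fr i) W"
      using module_hom_smult[OF M W f' a] by simp
    have "dual_differential R r d i (a \<odot>\<^bsub>hom_module R (Fr i) W\<^esub> f)
        = a \<odot>\<^bsub>hom_module R (Fr (Suc i)) W\<^esub> dual_differential R r d i f"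
      by (rule extensionalityI[OF 2])
        (simp_all add: dual_differential_apply d_closed)
    then show "dual_map R r d W i (a \<odot>\<^bsub>hom_module R (Fr i) W\<^esub> f)
        = a \<odot>\<^bsub>hom_module R (Fr (Suc i)) W\<^esub> dual_map R r d W i f"
      unfolding dual_map_def using f' s by (simp only: restrict_apply' if_True)
  qed (simp add: dual_map_def)
qed

lemma cocycles_iff:
  assumes "module R W"
  shows "f \<in> cocycles R r d W i \<longleftrightarrow>
    f \<in> module_hom R (Fr i) W \<and> (\<forall>v\<in>carrier (Fr (Suc i)). f (d i v) = \<zero>\<^bsub>W\<^esub>)"
proof -
  have "dual_differential R r d i f = (\<lambda>x\<in>carrier (Fr (Suc i)). \<zero>\<^bsub>W\<^esub>)
      \<longleftrightarrow> (\<forall>v\<in>carrier (Fr (Suc i)). f (d i v) = \<zero>\<^bsub>W\<^esub>)"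
    unfolding dual_differential_def compose_def by (auto simp: fun_eq_iff restrict_def)
  then show ?thesis by (simp add: cocycles_def)
qed

lemma coboundaries_Suc_iff:
  assumes "module R W"
  shows "f \<in> coboundaries R r d W (Suc j) \<longleftrightarrow> f \<in> module_hom R (Fr (Suc j)) W \<and>
    (\<exists>h\<in>module_hom R (Fr j) W. \<forall>v\<in>carrier (Fr (Suc j)). f v = h (d j v))"
proof
  assume "f \<in> coboundaries R r d W (Suc j)"
  then obtain h where h: "h \<in> module_hom R (Fr j) W" "f = dual_differential R r d j h"
    by (auto simp: coboundaries_def)
  show "f \<in> module_hom R (Fr (Suc j)) W \<and>
    (\<exists>h\<in>module_hom R (Fr j) W. \<forall>v\<in>carrier (Fr (Suc j)). f v = h (d j v))"
    unfolding h(2) using dual_differential_apply h(1) module_hom_compose[OF d_hom h(1) free_module_module]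
    by (auto simp: dual_differential_def)
next
  assume "f \<in> module_hom R (Fr (Suc j)) W \<and>
    (\<exists>h\<in>module_hom R (Fr j) W. \<forall>v\<in>carrier (Fr (Suc j)). f v = h (d j v))"
  then obtain h where f: "f \<in> module_hom R (Fr (Suc j)) W" and h: "h \<in> module_hom R (Fr j) W"
    "\<And>v. v \<in> carrier (Fr (Suc j)) \<Longrightarrow> f v = h (d j v)" by blast
  have "f = dual_differential R r d j h"
    by (rule extensionalityI[OF module_homD(2)[OF f]])
      (simp_all add: dual_differential_def compose_extensional compose_eq h(2))
  then show "f \<in> coboundaries R r d W (Suc j)" using h(1) by (simp add: coboundaries_def)
qed

lemma cocycles_submodule:
  assumes W: "module R W"
  shows "submodule (cocycles R r d W i) R (hom_module R (Fr i) W)"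
proof -
  have "cocycles R r d W i = {f \<in> carrier (hom_module R (Fr i) W).
      dual_map R r d W i f = \<zero>\<^bsub>hom_module R (Fr (Suc i)) W\<^esub>}"
    by (auto simp: cocycles_def dual_map_def)
  then show ?thesis
    using module_hom_kernel[OF hom_module_module[OF free_module_module W]
        hom_module_module[OF free_module_module W] dual_map_hom[OF W]] by simp
qed

lemma coboundaries_submodule:
  assumes W: "module R W"
  shows "submodule (coboundaries R r d W i) R (hom_module R (Fr i) W)"
proof (cases i)
  case 0
  interpret H: module R "hom_module R (Fr i) W" by (rule hom_module_module[OF free_module_module W])
  have "\<ominus>\<^bsub>hom_module R (Fr i) W\<^esub> \<zero>\<^bsub>hom_module R (Fr i) W\<^esub> = \<zero>\<^bsub>hom_module R (Fr i) W\<^esub>"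
    using H.minus_equality[of "\<zero>\<^bsub>hom_module R (Fr i) W\<^esub>" "\<zero>\<^bsub>hom_module R (Fr i) W\<^esub>"]
      H.l_zero[OF H.zero_closed] H.zero_closed by blast
  moreover have "coboundaries R r d W i = {\<zero>\<^bsub>hom_module R (Fr i) W\<^esub>}" using 0 by (simp add: coboundaries_def)
  ultimately show ?thesis
    using H.zero_closed H.l_zero[OF H.zero_closed] H.smult_r_null
    by (intro H.submoduleI) (simp_all del: hom_module_sel)
next
  case (Suc j)
  have "coboundaries R r d W i = dual_map R r d W j ` carrier (hom_module R (Fr j) W)"
    using Suc by (auto simp: coboundaries_def dual_map_def)
  then show ?thesis
    using module_hom_image[OF hom_module_module[OF free_module_module W]
        hom_module_module[OF free_module_module W] dual_map_hom[OF W]] Suc by simp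
qed

lemma coboundaries_subset:
  assumes W: "module R W"
  shows "coboundaries R r d W i \<subseteq> cocycles R r d W i"
proof (cases i)
  case 0
  then show ?thesis using submodule_zero[OF cocycles_submodule[OF W, of i]] by (simp add: coboundaries_def)
next
  case (Suc j)
  show ?thesis
  proof
    fix f assume "f \<in> coboundaries R r d W i"
    then obtain h where f: "f \<in> module_hom R (Fr i) W" and h: "h \<in> module_hom R (Fr j) W"
      "\<And>v. v \<in> carrier (Fr (Suc j)) \<Longrightarrow> f v = h (d j v)" unfolding Suc coboundaries_Suc_iff[OF W] by blast
    have "f (d i v) = \<zero>\<^bsub>W\<^esub>" if "v \<in> carrier (Fr (Suc i))" for v
      using h(2)[of "d i v"] that d_closed[of v i] d_d[of v j] Suc module_hom_zero[OF free_module_module W h(1)] by simp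
    then show "f \<in> cocycles R r d W i" unfolding cocycles_iff[OF W] using f by blast
  qed
qed

abbreviation cohomology where "cohomology W i \<equiv>
  quotient_module ((hom_module R (Fr i) W)\<lparr>carrier := cocycles R r d W i\<rparr>) (coboundaries R r d W i)"

lemma cohomology_module_with_submodule:
  assumes W: "module R W"
  shows "module_with_submodule R ((hom_module R (Fr i) W)\<lparr>carrier := cocycles R r d W i\<rparr>) (coboundaries R r d W i)"
  using submodule.submodule_is_module[OF cocycles_submodule[OF W] hom_module_module[OF free_module_module W]]
    submodule_of_submodule[OF hom_module_module[OF free_module_module W] coboundaries_submodule[OF W]
      cocycles_submodule[OF W] coboundaries_subset[OF W]]
  by (simp add: module_with_submodule_def module_with_submodule_axioms_def)

lemma cohomology_trivial_iff:
  assumes W: "module R W"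
  shows "carrier (cohomology W i) = {\<zero>\<^bsub>cohomology W i\<^esub>} \<longleftrightarrow> cocycles R r d W i \<subseteq> coboundaries R r d W i"
  using module_with_submodule.quotient_trivial_iff[OF cohomology_module_with_submodule[OF W]] by simp

end

section \<open>The residue field and its chosen resolution\<close>

context one_dim_domain
begin

lemma S_Units: "x \<in> A \<Longrightarrow> x \<notin> M \<Longrightarrow> x \<in> Units S"
  using inv_nonzero[OF A_sub, of x] M_zero unit_A[of x] unfolding Units_def by auto

lemma S_local: "local_ring S" and S_maximal: "maximalideal M S" and S_max_ideal: "max_ideal S = M"
proof -
  have "ideal M S" using ideal_iff M_submod M_A by blast
  then show 1: "local_ring S" "maximalideal M S"
    using local_ringI[OF S_cring] one_notin_M S_Units by auto
  show "max_ideal S = M" by (rule local_ring_max_ideal[OF 1])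
qed

lemma regular_module_S: "regular_module S = V\<lparr>carrier := A\<rparr>"
  by (simp add: regular_module_def)

lemma V_restrict_module: "submod Q A K \<Longrightarrow> module S (V\<lparr>carrier := K\<rparr>)"
  using submodule.submodule_is_module[of K S V] submodule_iff regular_module_module by blast

lemma residue_with_submodule: "module_with_submodule S (regular_module S) M"
  unfolding regular_module_S module_with_submodule_def module_with_submodule_axioms_def
  using submodule_of_submodule[OF regular_module_module, of M A] M_submod submod_A submodule_iff M_A
    V_restrict_module[OF submod_A] by blast

lemma residue_module_eq: "residue_module S = quotient_module (regular_module S) M"
  by (simp add: residue_module_def S_max_ideal)

text \<open>The very choice made inside \<open>Ext_module\<close>, named so that its exactness can
  be stated.\<close>

definition resolution where "resolution = (SOME (r, d). \<exists>e. free_resolution S (residue_module S) r d e)"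

abbreviation r where "r \<equiv> fst resolution"
abbreviation d where "d \<equiv> snd resolution"
abbreviation FR where "FR i \<equiv> FS (r i)"

lemma Ext_module_residue: "Ext_module S i (residue_module S) W =
  quotient_module ((hom_module S (FR i) W)\<lparr>carrier := cocycles S r d W i\<rparr>) (coboundaries S r d W i)"
  unfolding Ext_module_def resolution_def by (simp add: Let_def case_prod_beta)

lemma residue_module_module: "module S (residue_module S)"
proof -
  interpret L: module_with_submodule S "regular_module S" M by (rule residue_with_submodule)
  interpret AS: abelian_subgroup M "regular_module S" by (rule L.abelian_subgroup)
  have rep: "\<exists>x\<in>A. U = M +>\<^bsub>regular_module S\<^esub> x" if "U \<in> carrier (residue_module S)" for U
    using that by (auto simp: residue_module_eq L.cosets)
  note add = L.coset_add and sm = L.coset_smult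
  have c [simp]: "carrier (regular_module S) = A" by simp
  have in_c: "M +>\<^bsub>regular_module S\<^esub> x \<in> carrier (residue_module S)" if "x \<in> A" for x
    using that by (auto simp: residue_module_eq L.cosets)
  have ops: "(M +>\<^bsub>regular_module S\<^esub> x) \<oplus>\<^bsub>residue_module S\<^esub> (M +>\<^bsub>regular_module S\<^esub> y) = M +>\<^bsub>regular_module S\<^esub> (x \<oplus> y)"
    "a \<odot>\<^bsub>residue_module S\<^esub> (M +>\<^bsub>regular_module S\<^esub> x) = M +>\<^bsub>regular_module S\<^esub> (a \<otimes> x)"
    if "x \<in> A" "y \<in> A" "a \<in> A" for x y a
    using add[of x y] sm[of a x] that by (simp_all add: residue_module_eq)
  have z: "\<zero>\<^bsub>residue_module S\<^esub> = M +>\<^bsub>regular_module S\<^esub> \<zero>"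
    using L.coset_eq_N_iff[of \<zero>] M_zero by (simp add: residue_module_eq)
  show ?thesis
  proof (rule moduleI[OF S_cring])
    show "abelian_group (residue_module S)"
    proof (rule abelian_groupI)
      show "\<zero>\<^bsub>residue_module S\<^esub> \<in> carrier (residue_module S)" unfolding z by (rule in_c) simp
      fix U assume "U \<in> carrier (residue_module S)"
      then obtain x where x: "x \<in> A" "U = M +>\<^bsub>regular_module S\<^esub> x" using rep by blast
      show "\<zero>\<^bsub>residue_module S\<^esub> \<oplus>\<^bsub>residue_module S\<^esub> U = U" unfolding z x using x by (simp add: ops)
      have "(M +>\<^bsub>regular_module S\<^esub> \<ominus> x) \<oplus>\<^bsub>residue_module S\<^esub> U = \<zero>\<^bsub>residue_module S\<^esub>"
        unfolding z x using x A_neg[OF x(1)] by (simp add: ops l_neg)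
      then show "\<exists>V\<in>carrier (residue_module S). V \<oplus>\<^bsub>residue_module S\<^esub> U = \<zero>\<^bsub>residue_module S\<^esub>"
        using in_c[OF A_neg[OF x(1)]] by blast
      fix V' assume "V' \<in> carrier (residue_module S)"
      then obtain y where y: "y \<in> A" "V' = M +>\<^bsub>regular_module S\<^esub> y" using rep by blast
      show "U \<oplus>\<^bsub>residue_module S\<^esub> V' \<in> carrier (residue_module S)"
        unfolding x y using x y in_c[OF A_add[OF x(1) y(1)]] by (simp add: ops)
      show "U \<oplus>\<^bsub>residue_module S\<^esub> V' = V' \<oplus>\<^bsub>residue_module S\<^esub> U"
        unfolding x y using x y by (simp add: ops a_comm)
      fix W assume "W \<in> carrier (residue_module S)"
      then obtain w where w: "w \<in> A" "W = M +>\<^bsub>regular_module S\<^esub> w" using rep by blast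
      show "U \<oplus>\<^bsub>residue_module S\<^esub> V' \<oplus>\<^bsub>residue_module S\<^esub> W = U \<oplus>\<^bsub>residue_module S\<^esub> (V' \<oplus>\<^bsub>residue_module S\<^esub> W)"
        unfolding x y w using x y w by (simp add: ops a_assoc A_add)
    qed
  next
    fix a U assume a: "a \<in> carrier S" and "U \<in> carrier (residue_module S)"
    then obtain x where x: "x \<in> A" "U = M +>\<^bsub>regular_module S\<^esub> x" using rep by blast
    have aA: "a \<in> A" using a by simp
    show "a \<odot>\<^bsub>residue_module S\<^esub> U \<in> carrier (residue_module S)"
      unfolding x using x aA in_c[OF A_mult[OF aA x(1)]] by (simp add: ops)
    {
      fix V' assume "V' \<in> carrier (residue_module S)"
      then obtain y where y: "y \<in> A" "V' = M +>\<^bsub>regular_module S\<^esub> y" using rep by blast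
      show "a \<odot>\<^bsub>residue_module S\<^esub> (U \<oplus>\<^bsub>residue_module S\<^esub> V')
          = a \<odot>\<^bsub>residue_module S\<^esub> U \<oplus>\<^bsub>residue_module S\<^esub> a \<odot>\<^bsub>residue_module S\<^esub> V'"
        unfolding x y using x y aA by (simp add: ops A_add A_mult r_distr)
    }
    fix b assume b: "b \<in> carrier S"
    then have bA: "b \<in> A" by simp
    show "(a \<oplus>\<^bsub>S\<^esub> b) \<odot>\<^bsub>residue_module S\<^esub> U = a \<odot>\<^bsub>residue_module S\<^esub> U \<oplus>\<^bsub>residue_module S\<^esub> b \<odot>\<^bsub>residue_module S\<^esub> U"
      unfolding x using x aA bA by (simp add: ops A_add A_mult l_distr)
    show "(a \<otimes>\<^bsub>S\<^esub> b) \<odot>\<^bsub>residue_module S\<^esub> U = a \<odot>\<^bsub>residue_module S\<^esub> (b \<odot>\<^bsub>residue_module S\<^esub> U)"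
      unfolding x using x aA bA by (simp add: ops A_mult m_assoc)
  next
    fix U assume "U \<in> carrier (residue_module S)"
    then obtain x where x: "x \<in> A" "U = M +>\<^bsub>regular_module S\<^esub> x" using rep by blast
    show "\<one>\<^bsub>S\<^esub> \<odot>\<^bsub>residue_module S\<^esub> U = U" unfolding x using x by (simp add: ops)
  qed
qed

text \<open>A resolution starting with A -> A / M exists, so the choice yields a genuine resolution.
  The chosen one may start differently.\<close>

lemma resolution_exists: "\<exists>e. free_resolution S (residue_module S) r d e"
proof -
  interpret S: cring S by (rule S_cring)
  interpret L: module_with_submodule S "regular_module S" M by (rule residue_with_submodule)
  define c where "c = (\<lambda>v\<in>carrier (FS 1). v 0 \<odot>\<^bsub>regular_module S\<^esub> \<one>)"
  have c: "c \<in> module_hom S (FS 1) (regular_module S)"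
    unfolding c_def by (rule S.coordinate_hom[OF L.module_axioms]) simp_all
  define e where "e = compose (carrier (FS 1)) (\<lambda>x\<in>carrier (regular_module S). M +>\<^bsub>regular_module S\<^esub> x) c"
  have e: "e \<in> module_hom S (FS 1) (residue_module S)"
    unfolding e_def residue_module_eq by (rule module_hom_compose[OF c L.projection_hom FS_module])
  have "carrier (residue_module S) \<subseteq> e ` carrier (FS 1)"
  proof
    fix U assume "U \<in> carrier (residue_module S)"
    then obtain x where x: "x \<in> A" "U = M +>\<^bsub>regular_module S\<^esub> x" by (auto simp: residue_module_eq L.cosets)
    let ?v = "\<lambda>i\<in>{..<1::nat}. x"
    have v: "?v \<in> carrier (FS 1)" using x by (simp add: free_module_sel)
    then have "e ?v = U" using x A_sub[OF x(1)] by (simp add: e_def compose_eq c_def)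
    then show "U \<in> e ` carrier (FS 1)" using v by blast
  qed
  then have "e ` carrier (FS 1) = carrier (residue_module S)" using module_homD(1)[OF e] by blast
  then obtain r' d' where "free_resolution S (residue_module S) r' d' e"
    by (rule noetherian_ring.free_resolution_exists[OF noeth S_cring residue_module_module e])
  then have "case (r', d') of (r', d') \<Rightarrow> \<exists>e. free_resolution S (residue_module S) r' d' e" by auto
  from someI[of "\<lambda>(r', d'). \<exists>e. free_resolution S (residue_module S) r' d' e", OF this]
  show ?thesis by (simp add: resolution_def case_prod_beta)
qed

end

context cring_with_subring
begin

lemma V_hom_diff:
  assumes f: "f \<in> module_hom S N V" and g: "g \<in> module_hom S N V" and "module S N"
  shows "(\<lambda>x\<in>carrier N. f x \<ominus> g x) \<in> module_hom S N V"
proof -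
  interpret N: module S N by fact
  note F = module_homD[OF f, unfolded regular_module_sel] and G = module_homD[OF g, unfolded regular_module_sel]
  show ?thesis
  proof (rule module_homI)
    fix x assume x: "x \<in> carrier N"
    show "(\<lambda>x\<in>carrier N. f x \<ominus> g x) x \<in> carrier V" using F(1)[OF x] G(1)[OF x] x by simp
    {
      fix y assume y: "y \<in> carrier N"
      have "(f x \<oplus> f y) \<ominus> (g x \<oplus> g y) = (f x \<ominus> g x) \<oplus> (f y \<ominus> g y)"
        using F(1)[OF x] G(1)[OF x] F(1)[OF y] G(1)[OF y] by algebra
      then show "(\<lambda>x\<in>carrier N. f x \<ominus> g x) (x \<oplus>\<^bsub>N\<^esub> y)
          = (\<lambda>x\<in>carrier N. f x \<ominus> g x) x \<oplus>\<^bsub>V\<^esub> (\<lambda>x\<in>carrier N. f x \<ominus> g x) y"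
        using x y N.a_closed[OF x y] F(3)[OF x y] G(3)[OF x y] by simp
    }
    fix a assume a: "a \<in> carrier S"
    then have ac: "a \<in> carrier Q" using A_sub by simp
    have "(a \<otimes> f x) \<ominus> (a \<otimes> g x) = a \<otimes> (f x \<ominus> g x)"
      using F(1)[OF x] G(1)[OF x] ac by algebra
    then show "(\<lambda>x\<in>carrier N. f x \<ominus> g x) (a \<odot>\<^bsub>N\<^esub> x) = a \<odot>\<^bsub>V\<^esub> (\<lambda>x\<in>carrier N. f x \<ominus> g x) x"
      using x N.smult_closed[OF a x] F(4)[OF a x] G(4)[OF a x] by simp
  qed simp
qed

end

section \<open>Ext of the residue field, degree by degree\<close>

context one_dim_domain
begin

lemma resolution_complex: "free_complex S r d"
  and resolution_exact: "d (Suc i) ` carrier (FR (Suc (Suc i))) = {v \<in> carrier (FR (Suc i)). d i v = \<zero>\<^bsub>FR i\<^esub>}"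
proof -
  interpret S: cring S by (rule S_cring)
  obtain e where e: "free_resolution S (residue_module S) r d e" using resolution_exists by blast
  have h: "d i \<in> module_hom S (FR (Suc i)) (FR i)" for i using e by (simp add: free_resolution_def)
  show ex: "d (Suc i) ` carrier (FR (Suc (Suc i))) = {v \<in> carrier (FR (Suc i)). d i v = \<zero>\<^bsub>FR i\<^esub>}" for i
    using e by (simp add: free_resolution_def)
  show "free_complex S r d"
  proof (unfold_locales)
    show "d i \<in> module_hom S (FR (Suc i)) (FR i)" for i by (rule h)
    fix v i assume "v \<in> carrier (FR (Suc (Suc i)))"
    then have "d (Suc i) v \<in> d (Suc i) ` carrier (FR (Suc (Suc i)))" by (rule imageI)
    then show "d i (d (Suc i) v) = \<zero>\<^bsub>FR i\<^esub>" unfolding ex by blast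
  qed
qed

lemma d_hom: "d i \<in> module_hom S (FR (Suc i)) (FR i)"
  using free_complex.d_hom[OF resolution_complex] .

text \<open>The rank of F_0 is unknown, so its augmentation is lifted along A -> A / M to a map p :
  F_0 -> A. Then the image of d_0 is the preimage of M under p, and p takes a unit value at
  v0.\<close>

lemma residue_generator:
  obtains p v0 where "p \<in> module_hom S (FR 0) V" "\<And>v. v \<in> carrier (FR 0) \<Longrightarrow> p v \<in> A"
    "\<And>v. v \<in> carrier (FR 0) \<Longrightarrow> v \<in> d 0 ` carrier (FR (Suc 0)) \<longleftrightarrow> p v \<in> M"
    "v0 \<in> carrier (FR 0)" "p v0 \<notin> M"
proof -
  interpret S: cring S by (rule S_cring)
  interpret L: module_with_submodule S "regular_module S" M by (rule residue_with_submodule)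
  obtain e where "free_resolution S (residue_module S) r d e" using resolution_exists by blast
  then have e: "e \<in> module_hom S (FR 0) (residue_module S)" "e ` carrier (FR 0) = carrier (residue_module S)"
    and ker: "d 0 ` carrier (FR (Suc 0)) = {v \<in> carrier (FR 0). e v = \<zero>\<^bsub>residue_module S\<^esub>}"
    by (simp_all add: free_resolution_def)
  have "\<exists>x\<in>carrier (regular_module S). e (unit_vector S (r 0) j) = M +>\<^bsub>regular_module S\<^esub> x" for j
    using module_homD(1)[OF e(1) S.unit_vector_closed[of "r 0" j]]
    unfolding residue_module_eq quotient_module_sel L.cosets by blast
  then obtain c where c: "\<And>j. c j \<in> carrier (regular_module S)"
    "\<And>j. e (unit_vector S (r 0) j) = M +>\<^bsub>regular_module S\<^esub> c j" by metis
  obtain p where p: "p \<in> module_hom S (FR 0) (regular_module S)"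
    "\<And>j. j < r 0 \<Longrightarrow> p (unit_vector S (r 0) j) = c j"
    using S.free_module_hom_exists[OF L.module_axioms, of "r 0" c] c(1) by blast
  note pr = module_hom_compose[OF p(1) L.projection_hom FS_module, folded residue_module_eq]
  have ep: "e v = M +>\<^bsub>regular_module S\<^esub> p v" if v: "v \<in> carrier (FR 0)" for v
  proof -
    have "e v = compose (carrier (FR 0)) (\<lambda>x\<in>carrier (regular_module S). M +>\<^bsub>regular_module S\<^esub> x) p v"
      by (rule S.free_module_hom_eqI[OF residue_module_module e(1) pr _ v])
        (simp only: compose_eq[OF S.unit_vector_closed] p(2) c restrict_apply' if_True)
    also have "\<dots> = M +>\<^bsub>regular_module S\<^esub> p v"
      using module_homD(1)[OF p(1) v] by (simp only: compose_eq[OF v] restrict_apply' if_True)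
    finally show ?thesis .
  qed
  have pA: "p v \<in> A" if "v \<in> carrier (FR 0)" for v using module_homD(1)[OF p(1) that] by simp
  have z: "\<zero>\<^bsub>residue_module S\<^esub> = M" by (simp add: residue_module_eq)
  have pM: "v \<in> d 0 ` carrier (FR (Suc 0)) \<longleftrightarrow> p v \<in> M" if "v \<in> carrier (FR 0)" for v
    unfolding ker z using that ep[OF that] L.coset_eq_N_iff[of "p v"] pA[OF that] by simp
  have "A \<subseteq> carrier Q" using A_sub by blast
  then have pV: "p \<in> module_hom S (FR 0) V"
    using p(1) module_hom_restrict_iff[of A p "FR 0"] unfolding regular_module_S by simp
  have "M +>\<^bsub>regular_module S\<^esub> \<one> \<in> e ` carrier (FR 0)"
    unfolding e(2) residue_module_eq quotient_module_sel L.cosets by (rule imageI) simp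
  then obtain v0 where v0: "v0 \<in> carrier (FR 0)" "M +>\<^bsub>regular_module S\<^esub> \<one> = e v0" by blast
  have "p v0 \<notin> M"
  proof
    assume "p v0 \<in> M"
    then have "M +>\<^bsub>regular_module S\<^esub> \<one> = M" using ep[OF v0(1)] v0 L.coset_eq_N_iff[of "p v0"] pA[OF v0(1)] by simp
    then show False using L.coset_eq_N_iff[of \<one>] one_notin_M by simp
  qed
  then show thesis using that[OF pV] pA pM v0(1) by blast
qed

text \<open>Q and Q / K are both injective, so Ext vanishes from degree 2 on. Injectivity of Q
  writes f = g d; modulo K the map g kills the image of d, hence the kernel of the next
  differential, so it factors as k d; then g - k d has values in K and still restricts to f.\<close>

lemma cocycle_is_coboundary:
  assumes K: "submod Q A K" and baer: "baer K"
    and f: "f \<in> module_hom S (FR (Suc (Suc j))) (V\<lparr>carrier := K\<rparr>)"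
    and cocycle: "\<And>w. w \<in> carrier (FR (Suc (Suc (Suc j)))) \<Longrightarrow> f (d (Suc (Suc j)) w) = \<zero>"
  obtains h where "h \<in> module_hom S (FR (Suc j)) (V\<lparr>carrier := K\<rparr>)"
    "\<And>w. w \<in> carrier (FR (Suc (Suc j))) \<Longrightarrow> f w = h (d (Suc j) w)"
proof -
  have Kc: "K \<subseteq> carrier Q" using submodD(1)[OF K] by blast
  note iff = module_hom_restrict_iff[OF Kc]
  have f': "f \<in> module_hom S (FR (Suc (Suc j))) V" "\<And>v. v \<in> carrier (FR (Suc (Suc j))) \<Longrightarrow> f v \<in> K"
    using f unfolding iff by blast+
  obtain g where g: "g \<in> module_hom S (FR (Suc j)) V"
    "\<And>v. v \<in> carrier (FR (Suc (Suc j))) \<Longrightarrow> eqmod {\<zero>} (f v) (g (d (Suc j) v))"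
  proof (rule factor_through[OF submod_zero baer_zero d_hom f'(1)])
    fix v assume "v \<in> carrier (FR (Suc (Suc j)))" "d (Suc j) v = \<zero>\<^bsub>FR (Suc j)\<^esub>"
    then have "v \<in> d (Suc (Suc j)) ` carrier (FR (Suc (Suc (Suc j))))" unfolding resolution_exact by blast
    then show "f v \<in> {\<zero>}" using cocycle by auto
  qed blast
  have fg: "f v = g (d (Suc j) v)" if "v \<in> carrier (FR (Suc (Suc j)))" for v
    using g(2)[OF that] by (simp add: eqmod_zero_eq)
  obtain k where k: "k \<in> module_hom S (FR j) V"
    "\<And>v. v \<in> carrier (FR (Suc j)) \<Longrightarrow> eqmod K (g v) (k (d j v))"
  proof (rule factor_through[OF K baer d_hom g(1)])
    fix v assume "v \<in> carrier (FR (Suc j))" "d j v = \<zero>\<^bsub>FR j\<^esub>"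
    then have "v \<in> d (Suc j) ` carrier (FR (Suc (Suc j)))" unfolding resolution_exact by blast
    then obtain w where "w \<in> carrier (FR (Suc (Suc j)))" "v = d (Suc j) w" by blast
    then show "g v \<in> K" using fg f'(2) by metis
  qed blast
  define kd where "kd = compose (carrier (FR (Suc j))) k (d j)"
  have kd: "kd \<in> module_hom S (FR (Suc j)) V" unfolding kd_def by (rule module_hom_compose[OF d_hom k(1) FS_module])
  have kd_eq: "kd v = k (d j v)" if "v \<in> carrier (FR (Suc j))" for v
    unfolding kd_def using compose_eq[OF that] .
  define h where "h = (\<lambda>v\<in>carrier (FR (Suc j)). g v \<ominus> kd v)"
  have hV: "h \<in> module_hom S (FR (Suc j)) V" unfolding h_def by (rule V_hom_diff[OF g(1) kd FS_module])
  have hv: "h v = g v \<ominus> k (d j v)" if "v \<in> carrier (FR (Suc j))" for v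
    unfolding h_def using that kd_eq[OF that] by simp
  have "h v \<in> K" if "v \<in> carrier (FR (Suc j))" for v
    using hv[OF that] k(2)[OF that] by (simp add: eqmod_def)
  then have hK: "h \<in> module_hom S (FR (Suc j)) (V\<lparr>carrier := K\<rparr>)" unfolding iff using hV by blast
  show thesis
  proof (rule that[OF hK])
    fix w assume w: "w \<in> carrier (FR (Suc (Suc j)))"
    note dw = module_homD(1)[OF d_hom w]
    have "k (d j (d (Suc j) w)) = \<zero>"
      using free_complex.d_d[OF resolution_complex w] module_hom_zero[OF FS_module regular_module_module k(1)] by simp
    moreover have "g (d (Suc j) w) \<in> carrier Q" using module_homD(1)[OF g(1) dw] by simp
    moreover have "x \<ominus> \<zero> = x" if "x \<in> carrier Q" for x using that by algebra
    ultimately show "f w = h (d (Suc j) w)" using hv[OF dw] fg[OF w] by simp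
  qed
qed

text \<open>A 1-cocycle is h d_0 for a map h : F_0 -> Q, as Q is injective. Since M F_0 lies in the
  image of d_0, h maps into K : M. This is how Ext^1 of the residue field becomes (K : M) /
  K.\<close>

lemma cocycle_factors:
  assumes K: "submod Q A K"
    and f: "f \<in> module_hom S (FR (Suc 0)) (V\<lparr>carrier := K\<rparr>)"
    and cocycle: "\<And>w. w \<in> carrier (FR (Suc (Suc 0))) \<Longrightarrow> f (d (Suc 0) w) = \<zero>"
  obtains h where "h \<in> module_hom S (FR 0) V"
    "\<And>w. w \<in> carrier (FR (Suc 0)) \<Longrightarrow> f w = h (d 0 w)"
    "\<And>v. v \<in> carrier (FR 0) \<Longrightarrow> h v \<in> colon Q K M"
proof -
  have Kc: "K \<subseteq> carrier Q" using submodD(1)[OF K] by blast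
  have f': "f \<in> module_hom S (FR (Suc 0)) V" "\<And>v. v \<in> carrier (FR (Suc 0)) \<Longrightarrow> f v \<in> K"
    using f unfolding module_hom_restrict_iff[OF Kc] by blast+
  obtain h where h: "h \<in> module_hom S (FR 0) V"
    "\<And>v. v \<in> carrier (FR (Suc 0)) \<Longrightarrow> eqmod {\<zero>} (f v) (h (d 0 v))"
  proof (rule factor_through[OF submod_zero baer_zero d_hom f'(1)])
    fix v assume "v \<in> carrier (FR (Suc 0))" "d 0 v = \<zero>\<^bsub>FR 0\<^esub>"
    then have "v \<in> d (Suc 0) ` carrier (FR (Suc (Suc 0)))" unfolding resolution_exact by blast
    then show "f v \<in> {\<zero>}" using cocycle by auto
  qed blast
  have fh: "f v = h (d 0 v)" if "v \<in> carrier (FR (Suc 0))" for v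
    using h(2)[OF that] by (simp add: eqmod_zero_eq)
  obtain p v0 where p: "p \<in> module_hom S (FR 0) V" "\<And>v. v \<in> carrier (FR 0) \<Longrightarrow> p v \<in> A"
    "\<And>v. v \<in> carrier (FR 0) \<Longrightarrow> v \<in> d 0 ` carrier (FR (Suc 0)) \<longleftrightarrow> p v \<in> M"
    by (rule residue_generator) blast
  interpret FF: module S "FR 0" by (rule FS_module)
  have "h v \<in> colon Q K M" if v: "v \<in> carrier (FR 0)" for v
  proof -
    have hc: "h v \<in> carrier Q" using module_homD(1)[OF h(1) v] by simp
    have "h v \<otimes> m \<in> K" if m: "m \<in> M" for m
    proof -
      have mS: "m \<in> carrier S" using m M_A by auto
      note mv = FF.smult_closed[OF mS v]
      have "p (m \<odot>\<^bsub>FR 0\<^esub> v) = p v \<otimes> m"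
        using module_homD(4)[OF p(1) mS v] m_comm[OF M_sub[OF m] A_sub[OF p(2)[OF v]]] by simp
      also have "\<dots> \<in> M" by (rule submodD(4)[OF M_submod p(2)[OF v] m])
      finally obtain w where w: "w \<in> carrier (FR (Suc 0))" "m \<odot>\<^bsub>FR 0\<^esub> v = d 0 w"
        using p(3)[OF mv] by blast
      have "h v \<otimes> m = m \<otimes> h v" by (rule m_comm[OF hc M_sub[OF m]])
      also have "\<dots> = f w" using module_homD(4)[OF h(1) mS v] fh[OF w(1)] w(2) by simp
      finally show ?thesis using f'(2)[OF w(1)] by simp
    qed
    then show ?thesis using hc by (simp add: colon_def)
  qed
  then show thesis using that[OF h(1) fh] by blast
qed

text \<open>The cocycle vanishes on M F_0, and a nonzero m in M can be cancelled in Q.\<close>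

lemma cocycle_0:
  assumes K: "submod Q A K"
    and f: "f \<in> module_hom S (FR 0) (V\<lparr>carrier := K\<rparr>)"
    and cocycle: "\<And>w. w \<in> carrier (FR (Suc 0)) \<Longrightarrow> f (d 0 w) = \<zero>" and v: "v \<in> carrier (FR 0)"
  shows "f v = \<zero>"
proof -
  obtain p where p: "p \<in> module_hom S (FR 0) V" "\<And>v. v \<in> carrier (FR 0) \<Longrightarrow> p v \<in> A"
    "\<And>v. v \<in> carrier (FR 0) \<Longrightarrow> v \<in> d 0 ` carrier (FR (Suc 0)) \<longleftrightarrow> p v \<in> M"
    by (rule residue_generator) blast
  interpret FF: module S "FR 0" by (rule FS_module)
  obtain m where m: "m \<in> M" "m \<noteq> \<zero>" using M_nonzero M_zero by blast
  have mS: "m \<in> carrier S" using m M_A by auto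
  have "p (m \<odot>\<^bsub>FR 0\<^esub> v) = p v \<otimes> m"
    using module_homD(4)[OF p(1) mS v] m_comm[OF M_sub[OF m(1)] A_sub[OF p(2)[OF v]]] by simp
  also have "\<dots> \<in> M" by (rule submodD(4)[OF M_submod p(2)[OF v] m(1)])
  finally have "f (m \<odot>\<^bsub>FR 0\<^esub> v) = \<zero>" using p(3)[OF FF.smult_closed[OF mS v]] cocycle by auto
  then have "m \<otimes> f v = \<zero>" using module_homD(4)[OF f mS v] by simp
  moreover have "f v \<in> carrier Q" using module_homD(1)[OF f v] submodD(1)[OF K] by simp
  ultimately show ?thesis using integral[of m "f v"] M_sub[OF m(1)] m(2) by blast
qed

text \<open>The connecting map from Ext^1(k, Q / K) to Ext^2(k, K), written out. A map \<phi> on M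
  is pulled back along p d_0 : F_1 -> M and lifted to g : F_1 -> Q. Then g d_1 is a K-valued
  2-cocycle; writing it as k d_1 with k valued in K lets g - k descend to a map h on the image of
  d_0, which extends to F_0.\<close>

lemma baer_if_second_cocycles_trivial:
  assumes K: "submod Q A K"
    and triv: "\<And>f. f \<in> module_hom S (FR (Suc (Suc 0))) (V\<lparr>carrier := K\<rparr>) \<Longrightarrow>
      (\<And>w. w \<in> carrier (FR (Suc (Suc (Suc 0)))) \<Longrightarrow> f (d (Suc (Suc 0)) w) = \<zero>) \<Longrightarrow>
      \<exists>h\<in>module_hom S (FR (Suc 0)) (V\<lparr>carrier := K\<rparr>). \<forall>w\<in>carrier (FR (Suc (Suc 0))). f w = h (d (Suc 0) w)"
  shows "baer K"
proof (rule baer_if_baer_on_M[OF K])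
  interpret S: cring S by (rule S_cring)
  interpret F0: module S "FR 0" by (rule FS_module)
  interpret F1: module S "FR (Suc 0)" by (rule FS_module)
  have Kc: "K \<subseteq> carrier Q" using submodD(1)[OF K] by blast
  note iff = module_hom_restrict_iff[OF Kc]
  show "baer_on K M"
    unfolding baer_on_def
  proof (intro allI impI)
    fix \<phi> assume \<phi>: "linear_mod K V M \<phi>"
    note D = linear_modD[OF \<phi>, unfolded regular_module_sel]
    obtain p v0 where p: "p \<in> module_hom S (FR 0) V" "\<And>v. v \<in> carrier (FR 0) \<Longrightarrow> p v \<in> A"
      "\<And>v. v \<in> carrier (FR 0) \<Longrightarrow> v \<in> d 0 ` carrier (FR (Suc 0)) \<longleftrightarrow> p v \<in> M"
      and v0: "v0 \<in> carrier (FR 0)" "p v0 \<notin> M"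
      by (rule residue_generator) blast
    have pM: "p (d 0 w) \<in> M" if w: "w \<in> carrier (FR (Suc 0))" for w
      using p(3)[OF module_homD(1)[OF d_hom w]] w by blast
    obtain g where g: "g \<in> module_hom S (FR (Suc 0)) V"
      "\<And>j. j < r (Suc 0) \<Longrightarrow> g (unit_vector S (r (Suc 0)) j) = \<phi> (p (d 0 (unit_vector S (r (Suc 0)) j)))"
      by (rule S.free_module_hom_exists[OF regular_module_module, of "r (Suc 0)" "\<lambda>j. \<phi> (p (d 0 (unit_vector S (r (Suc 0)) j)))"])
        (use D(1)[OF pM[OF S.unit_vector_closed]] in auto)
    note G = module_homD[OF g(1), unfolded regular_module_sel]
    \<comment> \<open>g was prescribed on unit vectors only; both sides are linear modulo K, so they
      agree everywhere.\<close>
    have "carrier (FR (Suc 0)) \<subseteq> {w \<in> carrier (FR (Suc 0)). eqmod K (g w) (\<phi> (p (d 0 w)))}"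
    proof (rule S.free_module_span)
      have "\<phi> (p (d 0 \<zero>\<^bsub>FR (Suc 0)\<^esub>)) \<in> K"
        using linear_mod_zero[OF K regular_module_module \<phi>] M_zero
          module_hom_zero[OF FS_module FS_module d_hom] module_hom_zero[OF FS_module regular_module_module p(1)] by simp
      then have "eqmod K \<zero> (\<phi> (p (d 0 \<zero>\<^bsub>FR (Suc 0)\<^esub>)))" using eqmod_zero[OF K] eqmod_sym[OF K] by blast
      then show "\<zero>\<^bsub>FR (Suc 0)\<^esub> \<in> {w \<in> carrier (FR (Suc 0)). eqmod K (g w) (\<phi> (p (d 0 w)))}"
        using module_hom_zero[OF FS_module regular_module_module g(1)] F1.zero_closed by simp
      fix v w assume "v \<in> {w \<in> carrier (FR (Suc 0)). eqmod K (g w) (\<phi> (p (d 0 w)))}"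
        "w \<in> {w \<in> carrier (FR (Suc 0)). eqmod K (g w) (\<phi> (p (d 0 w)))}"
      then have v: "v \<in> carrier (FR (Suc 0))" "eqmod K (g v) (\<phi> (p (d 0 v)))"
        and w: "w \<in> carrier (FR (Suc 0))" "eqmod K (g w) (\<phi> (p (d 0 w)))" by blast+
      have "p (d 0 (v \<oplus>\<^bsub>FR (Suc 0)\<^esub> w)) = p (d 0 v) \<oplus> p (d 0 w)"
        using module_homD(3)[OF d_hom v(1) w(1)]
          module_homD(3)[OF p(1) module_homD(1)[OF d_hom v(1)] module_homD(1)[OF d_hom w(1)]] by simp
      then have "eqmod K (\<phi> (p (d 0 (v \<oplus>\<^bsub>FR (Suc 0)\<^esub> w)))) (\<phi> (p (d 0 v)) \<oplus> \<phi> (p (d 0 w)))"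
        using D(2)[OF pM[OF v(1)] pM[OF w(1)]] by simp
      then have "eqmod K (g v \<oplus> g w) (\<phi> (p (d 0 (v \<oplus>\<^bsub>FR (Suc 0)\<^esub> w))))"
        by (rule eqmod_trans[OF K eqmod_add[OF K v(2) w(2)] eqmod_sym[OF K]])
      then show "v \<oplus>\<^bsub>FR (Suc 0)\<^esub> w \<in> {w \<in> carrier (FR (Suc 0)). eqmod K (g w) (\<phi> (p (d 0 w)))}"
        using G(3)[OF v(1) w(1)] F1.a_closed[OF v(1) w(1)] by simp
    next
      fix a v assume a: "a \<in> carrier S" and "v \<in> {w \<in> carrier (FR (Suc 0)). eqmod K (g w) (\<phi> (p (d 0 w)))}"
      then have v: "v \<in> carrier (FR (Suc 0))" "eqmod K (g v) (\<phi> (p (d 0 v)))" by blast+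
      have aA: "a \<in> A" using a by simp
      have "p (d 0 (a \<odot>\<^bsub>FR (Suc 0)\<^esub> v)) = a \<otimes> p (d 0 v)"
        using module_homD(4)[OF d_hom a v(1)] module_homD(4)[OF p(1) a module_homD(1)[OF d_hom v(1)]] by simp
      then have "eqmod K (\<phi> (p (d 0 (a \<odot>\<^bsub>FR (Suc 0)\<^esub> v)))) (a \<otimes> \<phi> (p (d 0 v)))"
        using D(3)[OF aA pM[OF v(1)]] by simp
      then have "eqmod K (a \<otimes> g v) (\<phi> (p (d 0 (a \<odot>\<^bsub>FR (Suc 0)\<^esub> v))))"
        by (rule eqmod_trans[OF K eqmod_smult[OF K v(2) aA] eqmod_sym[OF K]])
      then show "a \<odot>\<^bsub>FR (Suc 0)\<^esub> v \<in> {w \<in> carrier (FR (Suc 0)). eqmod K (g w) (\<phi> (p (d 0 w)))}"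
        using G(4)[OF a v(1)] F1.smult_closed[OF a v(1)] by simp
    next
      fix j assume "j < r (Suc 0)"
      then show "unit_vector S (r (Suc 0)) j \<in> {w \<in> carrier (FR (Suc 0)). eqmod K (g w) (\<phi> (p (d 0 w)))}"
        using g(2) eqmod_refl[OF K D(1)[OF pM[OF S.unit_vector_closed]]] S.unit_vector_closed by simp
    qed
    then have g\<phi>: "eqmod K (g w) (\<phi> (p (d 0 w)))" if "w \<in> carrier (FR (Suc 0))" for w using that by blast
    define f where "f = compose (carrier (FR (Suc (Suc 0)))) g (d (Suc 0))"
    have fV: "f \<in> module_hom S (FR (Suc (Suc 0))) V" unfolding f_def by (rule module_hom_compose[OF d_hom g(1) FS_module])
    have fv: "f w = g (d (Suc 0) w)" if "w \<in> carrier (FR (Suc (Suc 0)))" for w unfolding f_def using compose_eq[OF that] .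
    have "f w \<in> K" if w: "w \<in> carrier (FR (Suc (Suc 0)))" for w
    proof -
      have "p (d 0 (d (Suc 0) w)) = \<zero>"
        using free_complex.d_d[OF resolution_complex w] module_hom_zero[OF FS_module regular_module_module p(1)] by simp
      then have "\<phi> (p (d 0 (d (Suc 0) w))) \<in> K"
        using linear_mod_zero[OF K regular_module_module \<phi>] M_zero by simp
      then show ?thesis using eqmod_mem[OF K g\<phi>[OF module_homD(1)[OF d_hom w]]] fv[OF w] by simp
    qed
    then have fK: "f \<in> module_hom S (FR (Suc (Suc 0))) (V\<lparr>carrier := K\<rparr>)" unfolding iff using fV by blast
    have "f (d (Suc (Suc 0)) w) = \<zero>" if w: "w \<in> carrier (FR (Suc (Suc (Suc 0))))" for w
      using fv[OF module_homD(1)[OF d_hom w]] free_complex.d_d[OF resolution_complex w]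
        module_hom_zero[OF FS_module regular_module_module g(1)] by simp
    then obtain k where k: "k \<in> module_hom S (FR (Suc 0)) (V\<lparr>carrier := K\<rparr>)"
      "\<And>w. w \<in> carrier (FR (Suc (Suc 0))) \<Longrightarrow> f w = k (d (Suc 0) w)"
      using triv[OF fK] by blast
    have kV: "k \<in> module_hom S (FR (Suc 0)) V" "\<And>w. w \<in> carrier (FR (Suc 0)) \<Longrightarrow> k w \<in> K" using k(1) unfolding iff by blast+
    \<comment> \<open>Subtracting k keeps g a representative of \<phi> p d_0 modulo K and makes it
      vanish exactly on the image of d_1, the kernel of d_0.\<close>
    define l where "l = (\<lambda>w\<in>carrier (FR (Suc 0)). g w \<ominus> k w)"
    have l: "l \<in> module_hom S (FR (Suc 0)) V" unfolding l_def by (rule V_hom_diff[OF g(1) kV(1) FS_module])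
    have lv: "l w = g w \<ominus> k w" if "w \<in> carrier (FR (Suc 0))" for w unfolding l_def using that by simp
    obtain h where h: "h \<in> module_hom S (FR 0) V"
      "\<And>w. w \<in> carrier (FR (Suc 0)) \<Longrightarrow> eqmod {\<zero>} (l w) (h (d 0 w))"
    proof (rule factor_through[OF submod_zero baer_zero d_hom l])
      fix v assume v: "v \<in> carrier (FR (Suc 0))" "d 0 v = \<zero>\<^bsub>FR 0\<^esub>"
      then have "v \<in> d (Suc 0) ` carrier (FR (Suc (Suc 0)))" unfolding resolution_exact by blast
      then obtain w where w: "w \<in> carrier (FR (Suc (Suc 0)))" "v = d (Suc 0) w" by blast
      then have "g v = k v" using fv k(2) by metis
      then show "l v \<in> {\<zero>}" using lv[OF v(1)] G(1)[OF v(1)] by (simp add: a_minus_def r_neg)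
    qed blast
    have key: "eqmod K (\<phi> (p (d 0 w))) (h (d 0 w))" if w: "w \<in> carrier (FR (Suc 0))" for w
    proof -
      have c: "g w \<in> carrier Q" "k w \<in> carrier Q" using G(1)[OF w] kV(2)[OF w] Kc by auto
      have "h (d 0 w) = g w \<ominus> k w" using h(2)[OF w] lv[OF w] by (simp add: eqmod_zero_eq)
      moreover have "g w \<ominus> (g w \<ominus> k w) = k w" using c by algebra
      ultimately have "eqmod K (g w) (h (d 0 w))" unfolding eqmod_def using c kV(2)[OF w] by simp
      then show ?thesis by (rule eqmod_trans[OF K eqmod_sym[OF K g\<phi>[OF w]]])
    qed
    have uA: "p v0 \<in> A" by (rule p(2)[OF v0(1)])
    have iu: "inv (p v0) \<in> A" by (rule unit_A[OF uA v0(2)])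
    have u0: "p v0 \<noteq> \<zero>" using v0(2) M_zero by auto
    note inv = inv_nonzero[OF A_sub[OF uA] u0]
    have hc: "h v0 \<in> carrier Q" using module_homD(1)[OF h(1) v0(1)] by simp
    show "\<exists>q\<in>carrier Q. \<forall>x\<in>M. eqmod K (\<phi> x) (q \<otimes> x)"
    proof (intro bexI ballI)
      \<comment> \<open>The multiplier is h(v0) / p(v0): each x in M equals p(a v0) with a = x /
        p(v0), and a v0 lies in the image of d_0.\<close>
      show "inv (p v0) \<otimes> h v0 \<in> carrier Q" using inv hc by simp
      fix x assume x: "x \<in> M"
      have xc: "x \<in> carrier Q" by (rule M_sub[OF x])
      let ?a = "x \<otimes> inv (p v0)"
      have aA: "?a \<in> A" using x M_A iu A_mult by blast
      then have aS: "?a \<in> carrier S" by simp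
      have pa: "p (?a \<odot>\<^bsub>FR 0\<^esub> v0) = x"
        using module_homD(4)[OF p(1) aS v0(1)] inv xc A_sub[OF uA] by (simp add: m_assoc)
      then have "?a \<odot>\<^bsub>FR 0\<^esub> v0 \<in> d 0 ` carrier (FR (Suc 0))" using p(3)[OF F0.smult_closed[OF aS v0(1)]] x by simp
      then obtain w where w: "w \<in> carrier (FR (Suc 0))" "?a \<odot>\<^bsub>FR 0\<^esub> v0 = d 0 w" by blast
      have "h (d 0 w) = inv (p v0) \<otimes> h v0 \<otimes> x"
        using module_homD(4)[OF h(1) aS v0(1)] w(2) inv(1) hc xc by (simp add: m_ac)
      then show "eqmod K (\<phi> x) (inv (p v0) \<otimes> h v0 \<otimes> x)" using key[OF w(1)] pa w(2) by simp
    qed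
  qed
qed

end

section \<open>Canonical modules over one-dimensional local domains\<close>

lemma (in abelian_group) add_minus_cancel:
  "x \<in> carrier G \<Longrightarrow> y \<in> carrier G \<Longrightarrow> (x \<oplus> y) \<ominus> y = x"
  by (simp add: a_minus_def a_assoc r_neg)

lemma module_iso_inverse:
  assumes M: "module R M" and N: "module R N" and f: "f \<in> module_hom R M N" "bij_betw f (carrier M) (carrier N)"
  obtains g where "g \<in> module_hom R N M" "\<And>x. x \<in> carrier M \<Longrightarrow> g (f x) = x" "\<And>y. y \<in> carrier N \<Longrightarrow> f (g y) = y"
proof -
  interpret M: module R M by fact
  interpret N: module R N by fact
  define g where "g = (\<lambda>y\<in>carrier N. inv_into (carrier M) f y)"
  have gc: "g y \<in> carrier M" and fg: "f (g y) = y" if "y \<in> carrier N" for y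
    using that f(2) by (simp_all add: g_def bij_betw_def inv_into_into f_inv_into_f)
  have gf: "g (f x) = x" if "x \<in> carrier M" for x
    using that f module_homD(1)[OF f(1) that] by (simp add: g_def bij_betw_def)
  have "g \<in> module_hom R N M"
  proof (rule module_homI)
    fix x y assume x: "x \<in> carrier N" and y: "y \<in> carrier N"
    have "f (g x \<oplus>\<^bsub>M\<^esub> g y) = x \<oplus>\<^bsub>N\<^esub> y" using module_homD(3)[OF f(1) gc[OF x] gc[OF y]] fg x y by simp
    then show "g (x \<oplus>\<^bsub>N\<^esub> y) = g x \<oplus>\<^bsub>M\<^esub> g y" using gf[OF M.a_closed[OF gc[OF x] gc[OF y]]] by simp
  next
    fix a x assume a: "a \<in> carrier R" and x: "x \<in> carrier N"
    have "f (a \<odot>\<^bsub>M\<^esub> g x) = a \<odot>\<^bsub>N\<^esub> x" using module_homD(4)[OF f(1) a gc[OF x]] fg x by simp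
    then show "g (a \<odot>\<^bsub>N\<^esub> x) = a \<odot>\<^bsub>M\<^esub> g x" using gf[OF M.smult_closed[OF a gc[OF x]]] by simp
  qed (use gc in \<open>auto simp: g_def\<close>)
  then show thesis using that gf fg by blast
qed

section \<open>Dimension and depth of the ring\<close>

context one_dim_domain
begin

lemma S_domain: "domain S"
proof -
  have "\<one>\<^bsub>S\<^esub> \<noteq> \<zero>\<^bsub>S\<^esub>" by simp
  moreover have "a = \<zero>\<^bsub>S\<^esub> \<or> b = \<zero>\<^bsub>S\<^esub>" if "a \<otimes>\<^bsub>S\<^esub> b = \<zero>\<^bsub>S\<^esub>" "a \<in> carrier S" "b \<in> carrier S" for a b
    using that integral[of a b] A_sub by simp
  ultimately show ?thesis by (intro domain.intro domain_axioms.intro S_cring)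
qed

lemma krull_dim_S: "krull_dim S = 1"
proof (rule antisym)
  let ?N = "{enat n | n. \<exists>P. (\<forall>i\<le>n. primeideal (P i) S) \<and> (\<forall>i<n. P i \<subset> P (Suc i))}"
  show "krull_dim S \<le> 1"
    unfolding krull_dim_def
  proof (rule Sup_least)
    fix x assume "x \<in> ?N"
    then obtain n P where n: "x = enat n" "\<And>i. i \<le> n \<Longrightarrow> primeideal (P i) S" "\<And>i. i < n \<Longrightarrow> P i \<subset> P (Suc i)" by blast
    have PM: "P (Suc i) = M" if "Suc i \<le> n" for i
    proof (rule prime_eq_M[OF n(2)[OF that]])
      interpret P: primeideal "P i" S using n(2)[of i] that by simp
      have "\<zero> \<in> P i" using additive_subgroup.zero_closed[OF P.additive_subgroup_axioms] by simp
      then show "P (Suc i) \<noteq> {\<zero>}" using n(3)[of i] that by auto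
    qed
    have "n \<le> 1"
    proof (rule ccontr)
      assume "\<not> n \<le> 1"
      then show False using PM[of 0] PM[of 1] n(3)[of 1] by simp
    qed
    then show "x \<le> 1" using n(1) by (simp add: one_enat_def)
  qed
  define P where "P i = (if i = 0 then {\<zero>} else M)" for i :: nat
  have "primeideal {\<zero>} S" using domain.zeroprimeideal[OF S_domain] by simp
  moreover have "primeideal M S" using cring.maximalideal_prime[OF S_cring S_maximal] .
  ultimately have "\<forall>i\<le>1. primeideal (P i) S" by (simp add: P_def)
  moreover have "\<forall>i<1. P i \<subset> P (Suc i)" using M_zero M_nonzero by (auto simp: P_def)
  ultimately have "enat 1 \<in> ?N" by blast
  then show "1 \<le> krull_dim S" unfolding krull_dim_def by (simp add: one_enat_def Sup_upper)
qed

text \<open>A nonzero x in M is regular. After it nothing in M is: a socle element of A / (x) is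
  killed by all of M.\<close>

lemma depth_S: "depth S = 1"
proof (rule antisym)
  interpret S: cring S by (rule S_cring)
  let ?N = "{enat (length xs) | xs. regular_sequence S xs \<and> set xs \<subseteq> max_ideal S}"
  have Idl_empty: "Idl\<^bsub>S\<^esub> {} = {\<zero>}"
    using S.genideal_minimal[of "{\<zero>}" "{}"] S.zeroideal S.genideal_ideal[of "{}"]
      additive_subgroup.zero_closed[of "Idl\<^bsub>S\<^esub> {}" S] by (auto simp: ideal_def)
  have Idl_M: "Idl\<^bsub>S\<^esub> {x} \<subseteq> M" if "x \<in> M" for x
    using S.genideal_minimal[of M "{x}"] that ideal_iff M_submod M_A by blast
  show "depth S \<le> 1"
    unfolding depth_def
  proof (rule Sup_least)
    fix z assume "z \<in> ?N"
    then obtain xs where xs: "z = enat (length xs)" "regular_sequence S xs" "set xs \<subseteq> M"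
      using S_max_ideal by auto
    have "length xs \<le> 1"
    proof (rule ccontr)
      assume "\<not> length xs \<le> 1"
      then have len: "0 < length xs" "1 < length xs" by linarith+
      let ?x = "xs ! 0" and ?y = "xs ! 1"
      have xM: "?x \<in> M" "?y \<in> M" using xs(3) nth_mem[OF len(1)] nth_mem[OF len(2)] by auto
      have xA: "?x \<in> A" using xM M_A by blast
      have reg: "a \<in> Idl\<^bsub>S\<^esub> (set (take i xs))"
        if "i < length xs" "a \<in> A" "xs ! i \<otimes> a \<in> Idl\<^bsub>S\<^esub> (set (take i xs))" for i a
        using xs(2) that unfolding regular_sequence_def by simp
      \<comment> \<open>If the first entry were zero, regularity would put \<one> into the zero
        ideal.\<close>
      have "?x \<noteq> \<zero>"
      proof
        assume "?x = \<zero>"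
        then have "\<one> \<in> {\<zero>}" using reg[OF len(1), of \<one>] Idl_empty by simp
        then show False by simp
      qed
      have t1: "set (take 1 xs) = {?x}" using len by (cases xs) auto
      let ?I = "Idl\<^bsub>S\<^esub> {?x}"
      have I: "submod Q A ?I" "?I \<subseteq> A" using S.genideal_ideal[of "{?x}"] xA ideal_iff by auto
      have "?x \<in> ?I" using S.genideal_self[of "{?x}"] xA by simp
      then have "?I \<noteq> {\<zero>}" using \<open>?x \<noteq> \<zero>\<close> by blast
      moreover have "\<one> \<notin> ?I" using Idl_M[OF xM(1)] one_notin_M by blast
      ultimately obtain w where w: "w \<in> A" "w \<notin> ?I" "\<And>m. m \<in> M \<Longrightarrow> m \<otimes> w \<in> ?I"
        using socle_element[OF I] by blast
      have "w \<in> ?I" using reg[OF len(2) w(1)] w(3)[OF xM(2)] t1 by simp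
      then show False using w by simp
    qed
    then show "z \<le> 1" using xs(1) by (simp add: one_enat_def)
  qed
  obtain m where m: "m \<in> M" "m \<noteq> \<zero>" using M_nonzero M_zero by blast
  have "regular_sequence S [m]"
    unfolding regular_sequence_def
  proof (intro conjI allI impI ballI)
    show "set [m] \<subseteq> carrier S" using m M_A by auto
    show "Idl\<^bsub>S\<^esub> (set [m]) \<noteq> carrier S" using Idl_M[OF m(1)] one_notin_M A_one by auto
    fix i a assume "i < length [m]" "a \<in> carrier S" "[m] ! i \<otimes>\<^bsub>S\<^esub> a \<in> Idl\<^bsub>S\<^esub> (set (take i [m]))"
    then show "a \<in> Idl\<^bsub>S\<^esub> (set (take i [m]))"
      using integral[of m a] m M_sub A_sub Idl_empty by auto
  qed
  then have "enat (length [m]) \<in> ?N" using m(1) S_max_ideal by (intro CollectI exI[of _ "[m]"]) auto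
  then have "enat 1 \<in> ?N" by (simp only: length_Cons list.size One_nat_def)
  then show "1 \<le> depth S" unfolding depth_def one_enat_def by (simp add: Sup_upper)
qed

lemma S_CM: "CM_local_ring S"
  unfolding CM_local_ring_def using S_local noeth depth_S krull_dim_S by simp

section \<open>Canonical modules and canonical ideals\<close>

lemma fractional_finitely_generated:
  assumes K: "fractional K"
  shows "finitely_generated_module S (V\<lparr>carrier := K\<rparr>)"
proof -
  obtain t where t: "t \<in> carrier Q" "t \<noteq> \<zero>" "\<And>x. x \<in> K \<Longrightarrow> t \<otimes> x \<in> A" and Ks: "submod Q A K"
    using K by (auto simp: fractional_def)
  have "t \<in> Units Q" using t field_Units by blast
  then obtain G where G: "finite G" "G \<subseteq> K" and GY: "\<And>Y. submod Q A Y \<Longrightarrow> G \<subseteq> Y \<Longrightarrow> K \<subseteq> Y"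
    by (rule fractional_fg[OF Ks _ t(3)]) blast+
  have "N = K" if N: "submodule N S (V\<lparr>carrier := K\<rparr>)" "G \<subseteq> N" for N
  proof -
    interpret N: submodule N S "V\<lparr>carrier := K\<rparr>" by (rule N)
    have "N \<subseteq> K" using N.subset by simp
    moreover have "submod Q A N"
      using \<open>N \<subseteq> K\<close> submodD(1)[OF Ks] N.one_closed N.m_closed N.smult_closed by (intro submodI) auto
    ultimately show ?thesis using GY[of N] N(2) by blast
  qed
  then show ?thesis
    unfolding finitely_generated_module_def using G V_restrict_module[OF Ks] by (intro conjI exI[of _ G]) auto
qed

text \<open>Vanishing of Ext^2 makes Q / C injective, and nonvanishing of Ext^1 keeps C : M from
  lying in C. The mutually inverse maps \<theta> and \<eta> carry cochains between W and C.\<close>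

lemma canonical_idealI:
  assumes W: "canonical_module S W" and C: "fractional C" and iso: "module_isomorphic S (V\<lparr>carrier := C\<rparr>) W"
  shows "canonical_ideal Q A M C"
proof -
  interpret fc: free_complex S r d by (rule resolution_complex)
  note Cs = fractional_submod[OF C]
  have Cc: "C \<subseteq> carrier Q" using submodD(1)[OF Cs] by blast
  have Wm: "module S W" using W by (simp add: canonical_module_def finitely_generated_module_def)
  have VC: "module S (V\<lparr>carrier := C\<rparr>)" by (rule V_restrict_module[OF Cs])
  obtain \<theta> where \<theta>: "\<theta> \<in> module_hom S (V\<lparr>carrier := C\<rparr>) W" "bij_betw \<theta> (carrier (V\<lparr>carrier := C\<rparr>)) (carrier W)"
    using iso by (auto simp: module_isomorphic_def)
  obtain \<eta> where \<eta>: "\<eta> \<in> module_hom S W (V\<lparr>carrier := C\<rparr>)"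
    "\<And>x. x \<in> carrier (V\<lparr>carrier := C\<rparr>) \<Longrightarrow> \<eta> (\<theta> x) = x" "\<And>y. y \<in> carrier W \<Longrightarrow> \<theta> (\<eta> y) = y"
    by (rule module_iso_inverse[OF VC Wm \<theta>]) blast
  have \<theta>0: "\<theta> \<zero> = \<zero>\<^bsub>W\<^esub>" using module_hom_zero[OF VC Wm \<theta>(1)] by simp
  have \<eta>0: "\<eta> \<zero>\<^bsub>W\<^esub> = \<zero>" using module_hom_zero[OF Wm VC \<eta>(1)] by simp
  have Ext2: "carrier (Ext_module S 2 (residue_module S) W) = {\<zero>\<^bsub>Ext_module S 2 (residue_module S) W\<^esub>}"
    using W krull_dim_S unfolding canonical_module_def by (auto simp: one_enat_def dest: spec[of _ 2])
  have Ext1: "module_isomorphic S (Ext_module S 1 (residue_module S) W) (residue_module S)"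
    using W krull_dim_S unfolding canonical_module_def by (auto simp: one_enat_def dest: spec[of _ 1])
  have "cocycles S r d W 2 \<subseteq> coboundaries S r d W 2"
    using Ext2 fc.cohomology_trivial_iff[OF Wm, of 2] unfolding Ext_module_residue by simp
  then have triv2: "cocycles S r d W (Suc (Suc 0)) \<subseteq> coboundaries S r d W (Suc (Suc 0))"
    by (simp add: numeral_2_eq_2)
  have "baer C"
  proof (rule baer_if_second_cocycles_trivial[OF Cs])
    fix f assume f: "f \<in> module_hom S (FR (Suc (Suc 0))) (V\<lparr>carrier := C\<rparr>)"
      and cyc: "\<And>w. w \<in> carrier (FR (Suc (Suc (Suc 0)))) \<Longrightarrow> f (d (Suc (Suc 0)) w) = \<zero>"
    let ?g = "compose (carrier (FR (Suc (Suc 0)))) \<theta> f"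
    have ge: "?g w = \<theta> (f w)" if "w \<in> carrier (FR (Suc (Suc 0)))" for w using compose_eq[OF that] .
    have "?g \<in> cocycles S r d W (Suc (Suc 0))"
      unfolding fc.cocycles_iff[OF Wm]
      using module_hom_compose[OF f \<theta>(1) FS_module] ge[OF fc.d_closed] cyc \<theta>0 by simp
    then obtain h where h: "h \<in> module_hom S (FR (Suc 0)) W"
      "\<And>v. v \<in> carrier (FR (Suc (Suc 0))) \<Longrightarrow> ?g v = h (d (Suc 0) v)"
      using triv2 fc.coboundaries_Suc_iff[OF Wm, of ?g "Suc 0"] by blast
    let ?k = "compose (carrier (FR (Suc 0))) \<eta> h"
    have "?k \<in> module_hom S (FR (Suc 0)) (V\<lparr>carrier := C\<rparr>)" by (rule module_hom_compose[OF h(1) \<eta>(1) FS_module])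
    moreover have "f w = ?k (d (Suc 0) w)" if w: "w \<in> carrier (FR (Suc (Suc 0)))" for w
      using compose_eq[OF fc.d_closed[OF w], of \<eta> h] h(2)[OF w] ge[OF w] \<eta>(2)[OF module_homD(1)[OF f w]] by simp
    ultimately show "\<exists>h\<in>module_hom S (FR (Suc 0)) (V\<lparr>carrier := C\<rparr>). \<forall>w\<in>carrier (FR (Suc (Suc 0))). f w = h (d (Suc 0) w)"
      by blast
  qed
  moreover have "\<not> colon Q C M \<subseteq> C"
  proof
    \<comment> \<open>Then every 1-cocycle extends to a C-valued map on F_0, so Ext^1 vanishes and
      the residue field would have a single element.\<close>
    assume sub: "colon Q C M \<subseteq> C"
    have "cocycles S r d W (Suc 0) \<subseteq> coboundaries S r d W (Suc 0)"
    proof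
      fix f assume "f \<in> cocycles S r d W (Suc 0)"
      then have f: "f \<in> module_hom S (FR (Suc 0)) W" "\<And>v. v \<in> carrier (FR (Suc (Suc 0))) \<Longrightarrow> f (d (Suc 0) v) = \<zero>\<^bsub>W\<^esub>"
        unfolding fc.cocycles_iff[OF Wm] by blast+
      let ?g = "compose (carrier (FR (Suc 0))) \<eta> f"
      have ge: "?g w = \<eta> (f w)" if "w \<in> carrier (FR (Suc 0))" for w using compose_eq[OF that] .
      have g: "?g \<in> module_hom S (FR (Suc 0)) (V\<lparr>carrier := C\<rparr>)" by (rule module_hom_compose[OF f(1) \<eta>(1) FS_module])
      have "?g (d (Suc 0) w) = \<zero>" if "w \<in> carrier (FR (Suc (Suc 0)))" for w
        using ge[OF fc.d_closed[OF that]] f(2)[OF that] \<eta>0 by simp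
      then obtain h where h: "h \<in> module_hom S (FR 0) V" "\<And>w. w \<in> carrier (FR (Suc 0)) \<Longrightarrow> ?g w = h (d 0 w)"
        "\<And>v. v \<in> carrier (FR 0) \<Longrightarrow> h v \<in> colon Q C M"
        using cocycle_factors[OF Cs g] by blast
      have hC: "h \<in> module_hom S (FR 0) (V\<lparr>carrier := C\<rparr>)"
        unfolding module_hom_restrict_iff[OF Cc] using h(1,3) sub by blast
      let ?k = "compose (carrier (FR 0)) \<theta> h"
      have "?k \<in> module_hom S (FR 0) W" by (rule module_hom_compose[OF hC \<theta>(1) FS_module])
      moreover have "f w = ?k (d 0 w)" if w: "w \<in> carrier (FR (Suc 0))" for w
        using compose_eq[OF fc.d_closed[OF w], of \<theta> h] h(2)[OF w] ge[OF w] \<eta>(3)[OF module_homD(1)[OF f(1) w]] by simp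
      ultimately show "f \<in> coboundaries S r d W (Suc 0)" unfolding fc.coboundaries_Suc_iff[OF Wm] using f(1) by blast
    qed
    then have "carrier (Ext_module S 1 (residue_module S) W) = {\<zero>\<^bsub>Ext_module S 1 (residue_module S) W\<^esub>}"
      using fc.cohomology_trivial_iff[OF Wm, of "Suc 0"] unfolding Ext_module_residue One_nat_def by simp
    moreover obtain g where "g ` carrier (Ext_module S 1 (residue_module S) W) = carrier (residue_module S)"
      using Ext1 unfolding module_isomorphic_def bij_betw_def by blast
    ultimately obtain u where u: "carrier (residue_module S) = {u}" using image_insert image_empty by metis
    interpret L: module_with_submodule S "regular_module S" M by (rule residue_with_submodule)
    have "M +>\<^bsub>regular_module S\<^esub> \<one> \<in> {u}" "M +>\<^bsub>regular_module S\<^esub> \<zero> \<in> {u}"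
      unfolding u[symmetric] residue_module_eq quotient_module_sel L.cosets by (auto intro!: imageI)
    then have "M +>\<^bsub>regular_module S\<^esub> \<one> = M"
      using L.coset_eq_N_iff[of \<zero>] M_zero by simp
    then show False using L.coset_eq_N_iff[of \<one>] one_notin_M by simp
  qed
  ultimately show ?thesis
    using C by (intro canonical_ideal.intro canonical_ideal_axioms.intro one_dim_domain_axioms)
qed

text \<open>Ext^1 is (K : M) / K, generated by the class of s with annihilator M. The cocycle
  belonging to s is \<beta> = s p d_0, and l |-> l \<beta> is the map from A whose preimage of the
  coboundaries is M and which is onto modulo them.\<close>

lemma residue_cohomology:
  assumes K: "submod Q A K" and s: "s \<in> colon Q K M" "s \<notin> K"
    and gen: "\<And>x. x \<in> colon Q K M \<Longrightarrow> \<exists>b\<in>A. x \<ominus> b \<otimes> s \<in> K"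
  shows "module_isomorphic S (Ext_module S 1 (residue_module S) (V\<lparr>carrier := K\<rparr>)) (residue_module S)"
proof -
  let ?W = "V\<lparr>carrier := K\<rparr>"
  interpret S: cring S by (rule S_cring)
  interpret fc: free_complex S r d by (rule resolution_complex)
  interpret F0: module S "FR 0" by (rule FS_module)
  have Kc: "K \<subseteq> carrier Q" using submodD(1)[OF K] by blast
  note iff = module_hom_restrict_iff[OF Kc]
  have Wm: "module S ?W" by (rule V_restrict_module[OF K])
  have sc: "s \<in> carrier Q" and sM: "\<And>m. m \<in> M \<Longrightarrow> s \<otimes> m \<in> K" using s(1) by (auto simp: colon_def)
  have sA: "a \<in> M" if "a \<in> A" "a \<otimes> s \<in> K" for a by (rule multiplier_in_M[OF K sc s(2) that])
  obtain p v0 where p: "p \<in> module_hom S (FR 0) V" "\<And>v. v \<in> carrier (FR 0) \<Longrightarrow> p v \<in> A"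
    "\<And>v. v \<in> carrier (FR 0) \<Longrightarrow> v \<in> d 0 ` carrier (FR (Suc 0)) \<longleftrightarrow> p v \<in> M"
    and v0: "v0 \<in> carrier (FR 0)" "p v0 \<notin> M"
    by (rule residue_generator) blast
  note P = module_homD[OF p(1), unfolded regular_module_sel]
  have pM: "p (d 0 w) \<in> M" if "w \<in> carrier (FR (Suc 0))" for w using p(3)[OF fc.d_closed[OF that]] that by blast
  have uA: "p v0 \<in> A" by (rule p(2)[OF v0(1)])
  have iu: "inv (p v0) \<in> A" by (rule unit_A[OF uA v0(2)])
  have u0: "p v0 \<noteq> \<zero>" using v0(2) M_zero by auto
  note inv = inv_nonzero[OF A_sub[OF uA] u0]
  have mult_p: "(\<lambda>v\<in>carrier (FR 0). c \<otimes> p v) \<in> module_hom S (FR 0) V" if c: "c \<in> carrier Q" for c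
  proof (rule module_homI)
    fix v assume v: "v \<in> carrier (FR 0)"
    show "(\<lambda>v\<in>carrier (FR 0). c \<otimes> p v) v \<in> carrier V" using P(1)[OF v] c v by simp
    show "(\<lambda>v\<in>carrier (FR 0). c \<otimes> p v) (v \<oplus>\<^bsub>FR 0\<^esub> w)
        = (\<lambda>v\<in>carrier (FR 0). c \<otimes> p v) v \<oplus>\<^bsub>V\<^esub> (\<lambda>v\<in>carrier (FR 0). c \<otimes> p v) w" if w: "w \<in> carrier (FR 0)" for w
      using F0.a_closed[OF v w] P(3)[OF v w] P(1)[OF v] P(1)[OF w] c v w by (simp add: r_distr)
    show "(\<lambda>v\<in>carrier (FR 0). c \<otimes> p v) (a \<odot>\<^bsub>FR 0\<^esub> v) = a \<odot>\<^bsub>V\<^esub> (\<lambda>v\<in>carrier (FR 0). c \<otimes> p v) v"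
      if a: "a \<in> carrier S" for a
      using F0.smult_closed[OF a v] P(4)[OF a v] P(1)[OF v] a A_sub c v by (simp add: m_lcomm)
  qed simp
  define \<beta> where "\<beta> = compose (carrier (FR (Suc 0))) (\<lambda>v\<in>carrier (FR 0). s \<otimes> p v) (d 0)"
  have \<beta>V: "\<beta> \<in> module_hom S (FR (Suc 0)) V" unfolding \<beta>_def by (rule module_hom_compose[OF d_hom mult_p[OF sc] FS_module])
  have \<beta>v: "\<beta> w = s \<otimes> p (d 0 w)" if "w \<in> carrier (FR (Suc 0))" for w
    unfolding \<beta>_def compose_eq[OF that] using fc.d_closed[OF that] by simp
  have \<beta>K: "\<beta> \<in> module_hom S (FR (Suc 0)) ?W" unfolding iff using \<beta>V \<beta>v sM[OF pM] by simp
  have \<beta>Z: "\<beta> \<in> cocycles S r d ?W (Suc 0)"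
    unfolding fc.cocycles_iff[OF Wm]
  proof (intro conjI \<beta>K ballI)
    fix v assume v: "v \<in> carrier (FR (Suc (Suc 0)))"
    show "\<beta> (d (Suc 0) v) = \<zero>\<^bsub>?W\<^esub>"
      using \<beta>v[OF fc.d_closed[OF v]] fc.d_d[OF v] module_hom_zero[OF FS_module regular_module_module p(1)] sc by simp
  qed
  let ?H = "(hom_module S (FR (Suc 0)) ?W)\<lparr>carrier := cocycles S r d ?W (Suc 0)\<rparr>"
  let ?B = "coboundaries S r d ?W (Suc 0)"
  have HB: "module_with_submodule S ?H ?B" by (rule fc.cohomology_module_with_submodule[OF Wm])
  interpret H: module_with_submodule S ?H ?B by (rule HB)
  have \<beta>H: "\<beta> \<in> carrier ?H" using \<beta>Z by simp
  define b where "b = (\<lambda>l\<in>carrier (regular_module S). l \<odot>\<^bsub>?H\<^esub> \<beta>)"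
  have bv: "b l w = l \<otimes> (s \<otimes> p (d 0 w))" if "l \<in> A" "w \<in> carrier (FR (Suc 0))" for l w
    using that \<beta>v by (simp add: b_def)
  have bH: "b l \<in> cocycles S r d ?W (Suc 0)" if "l \<in> A" for l
    using H.smult_closed[OF _ \<beta>H, of l] that by (simp add: b_def)
  have bh: "b \<in> module_hom S (regular_module S) ?H"
  proof (rule module_homI)
    fix x y assume "x \<in> carrier (regular_module S)" "y \<in> carrier (regular_module S)"
    then have x: "x \<in> carrier S" "y \<in> carrier S" by simp_all
    have "(x \<oplus>\<^bsub>S\<^esub> y) \<odot>\<^bsub>?H\<^esub> \<beta> = x \<odot>\<^bsub>?H\<^esub> \<beta> \<oplus>\<^bsub>?H\<^esub> y \<odot>\<^bsub>?H\<^esub> \<beta>" by (rule H.smult_l_distr[OF x \<beta>H])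
    then show "b (x \<oplus>\<^bsub>regular_module S\<^esub> y) = b x \<oplus>\<^bsub>?H\<^esub> b y"
      unfolding b_def using x S.a_closed[OF x] by (simp only: regular_module_sel restrict_apply' if_True)
  next
    fix a x assume a: "a \<in> carrier S" and "x \<in> carrier (regular_module S)"
    then have x: "x \<in> carrier S" by simp
    have "(a \<otimes>\<^bsub>S\<^esub> x) \<odot>\<^bsub>?H\<^esub> \<beta> = a \<odot>\<^bsub>?H\<^esub> (x \<odot>\<^bsub>?H\<^esub> \<beta>)" by (rule H.smult_assoc1[OF a x \<beta>H])
    then show "b (a \<odot>\<^bsub>regular_module S\<^esub> x) = a \<odot>\<^bsub>?H\<^esub> b x"
      unfolding b_def using x S.m_closed[OF a x] by (simp only: regular_module_sel restrict_apply' if_True)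
  next
    fix x assume "x \<in> carrier (regular_module S)"
    then show "b x \<in> carrier ?H" using bH[of x] by simp
  qed (simp add: b_def)
  have cobI: "f \<in> ?B" if "f \<in> module_hom S (FR (Suc 0)) ?W" "k \<in> module_hom S (FR 0) V"
    "\<And>v. v \<in> carrier (FR 0) \<Longrightarrow> k v \<in> K" "\<And>w. w \<in> carrier (FR (Suc 0)) \<Longrightarrow> f w = k (d 0 w)" for f k
  proof -
    have "k \<in> module_hom S (FR 0) ?W" unfolding iff using that(2,3) by blast
    then show ?thesis unfolding fc.coboundaries_Suc_iff[OF Wm] using that(1,4) by blast
  qed
  have iso: "module_isomorphic S (quotient_module ?H ?B) (quotient_module (regular_module S) M)"
  proof (rule quotient_module_isomorphic[OF HB residue_with_submodule bh])
    fix l assume "l \<in> carrier (regular_module S)"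
    then have l: "l \<in> A" by simp
    have lc: "l \<in> carrier Q" by (rule A_sub[OF l])
    show "b l \<in> ?B \<longleftrightarrow> l \<in> M"
    proof
      assume lM: "l \<in> M"
      have ls: "l \<otimes> s \<in> K" using sM[OF lM] m_comm[OF sc lc] by simp
      show "b l \<in> ?B"
      proof (rule cobI[OF _ mult_p])
        show "b l \<in> module_hom S (FR (Suc 0)) ?W" using bH[OF l] unfolding fc.cocycles_iff[OF Wm] by blast
        show "l \<otimes> s \<in> carrier Q" using lc sc by simp
        fix v assume v: "v \<in> carrier (FR 0)"
        have "l \<otimes> s \<otimes> p v = p v \<otimes> (l \<otimes> s)" using P(1)[OF v] lc sc by (intro m_comm) auto
        then show "(\<lambda>v\<in>carrier (FR 0). l \<otimes> s \<otimes> p v) v \<in> K" using v submodD(4)[OF K p(2)[OF v] ls] by simp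
      next
        fix w assume w: "w \<in> carrier (FR (Suc 0))"
        then show "b l w = (\<lambda>v\<in>carrier (FR 0). l \<otimes> s \<otimes> p v) (d 0 w)"
          using bv[OF l w] fc.d_closed[OF w] P(1)[OF fc.d_closed[OF w]] lc sc by (simp add: m_assoc)
      qed
    next
      assume "b l \<in> ?B"
      then obtain h where h: "h \<in> module_hom S (FR 0) ?W" "\<And>w. w \<in> carrier (FR (Suc 0)) \<Longrightarrow> b l w = h (d 0 w)"
        unfolding fc.coboundaries_Suc_iff[OF Wm] by blast
      have hK: "h v0 \<in> K" using module_homD(1)[OF h(1) v0(1)] by simp
      \<comment> \<open>A coboundary is controlled only on the image of d_0. Multiplying v0 by a
        nonzero m moves it there, and m is cancelled afterwards, giving l s p(v0) = h(v0) \<in>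
        K.\<close>
      obtain m where m: "m \<in> M" "m \<noteq> \<zero>" using M_nonzero M_zero by blast
      have mc: "m \<in> carrier Q" by (rule M_sub[OF m(1)])
      have mS: "m \<in> carrier S" using m M_A by auto
      have pm: "p (m \<odot>\<^bsub>FR 0\<^esub> v0) = m \<otimes> p v0" using P(4)[OF mS v0(1)] .
      have "m \<otimes> p v0 = p v0 \<otimes> m" by (rule m_comm[OF mc A_sub[OF uA]])
      then have "p (m \<odot>\<^bsub>FR 0\<^esub> v0) \<in> M" using pm submodD(4)[OF M_submod uA m(1)] by simp
      then obtain w where w: "w \<in> carrier (FR (Suc 0))" "m \<odot>\<^bsub>FR 0\<^esub> v0 = d 0 w"
        using p(3)[OF F0.smult_closed[OF mS v0(1)]] by blast
      have "l \<otimes> (s \<otimes> (m \<otimes> p v0)) = m \<otimes> h v0"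
        using bv[OF l w(1)] h(2)[OF w(1)] w(2) pm module_homD(4)[OF h(1) mS v0(1)] by simp
      moreover have "l \<otimes> (s \<otimes> (m \<otimes> p v0)) = m \<otimes> (l \<otimes> s \<otimes> p v0)"
        using lc sc mc A_sub[OF uA] by (simp add: m_ac)
      ultimately have "l \<otimes> s \<otimes> p v0 = h v0"
        using m_lcancel[OF m(2) mc] lc sc A_sub[OF uA] hK Kc by auto
      then have "inv (p v0) \<otimes> (l \<otimes> s \<otimes> p v0) \<in> K" using submodD(4)[OF K iu hK] by simp
      moreover have "inv (p v0) \<otimes> (l \<otimes> s \<otimes> p v0) = l \<otimes> s"
        using inv lc sc A_sub[OF uA] m_assoc[of "l \<otimes> s" "p v0" "inv (p v0)"] m_comm[of "inv (p v0)" "l \<otimes> s \<otimes> p v0"] by simp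
      ultimately show "l \<in> M" using sA[OF l] by simp
    qed
  next
    fix f assume "f \<in> carrier ?H"
    then have fZ: "f \<in> cocycles S r d ?W (Suc 0)" by simp
    then have f: "f \<in> module_hom S (FR (Suc 0)) ?W" "\<And>w. w \<in> carrier (FR (Suc (Suc 0))) \<Longrightarrow> f (d (Suc 0) w) = \<zero>"
      unfolding fc.cocycles_iff[OF Wm] by auto
    have fK: "f w \<in> K" if "w \<in> carrier (FR (Suc 0))" for w using module_homD(1)[OF f(1) that] by simp
    obtain h where h: "h \<in> module_hom S (FR 0) V" "\<And>w. w \<in> carrier (FR (Suc 0)) \<Longrightarrow> f w = h (d 0 w)"
      "\<And>v. v \<in> carrier (FR 0) \<Longrightarrow> h v \<in> colon Q K M"
      using cocycle_factors[OF K f] by blast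
    note Hh = module_homD[OF h(1), unfolded regular_module_sel]
    have "\<exists>x. x \<in> A \<and> h (unit_vector S (r 0) j) \<ominus> x \<otimes> s \<in> K" for j
      using gen[OF h(3)[OF S.unit_vector_closed]] by blast
    then obtain c where c: "\<And>j. c j \<in> A" "\<And>j. h (unit_vector S (r 0) j) \<ominus> c j \<otimes> s \<in> K" by metis
    \<comment> \<open>Modulo K the map h is t s for a linear t : F_0 -> A, found on unit vectors
      first.\<close>
    obtain t where tA: "t \<in> module_hom S (FR 0) (regular_module S)" and tj: "\<And>j. j < r 0 \<Longrightarrow> t (unit_vector S (r 0) j) = c j"
      by (rule S.free_module_hom_exists[of "regular_module S" "r 0" c])
        (use c(1) V_restrict_module[OF submod_A] in \<open>auto simp: regular_module_S\<close>)
    note T = module_homD[OF tA, unfolded regular_module_sel, simplified]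
    have tc: "t v \<in> carrier Q" if "v \<in> carrier (FR 0)" for v using T(1)[OF that] A_sub by blast
    have "carrier (FR 0) \<subseteq> {v \<in> carrier (FR 0). h v \<ominus> t v \<otimes> s \<in> K}"
    proof (rule S.free_module_span)
      have "h \<zero>\<^bsub>FR 0\<^esub> = \<zero>" using module_hom_zero[OF FS_module regular_module_module h(1)] by simp
      moreover have "t \<zero>\<^bsub>FR 0\<^esub> = \<zero>"
        using module_hom_zero[OF FS_module _ tA] V_restrict_module[OF submod_A] by (simp add: regular_module_S)
      moreover have "\<zero> \<ominus> \<zero> \<otimes> s = \<zero>" using sc by algebra
      ultimately show "\<zero>\<^bsub>FR 0\<^esub> \<in> {v \<in> carrier (FR 0). h v \<ominus> t v \<otimes> s \<in> K}"
        using F0.zero_closed submodD(2)[OF K] by simp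
      fix v w assume "v \<in> {v \<in> carrier (FR 0). h v \<ominus> t v \<otimes> s \<in> K}" "w \<in> {v \<in> carrier (FR 0). h v \<ominus> t v \<otimes> s \<in> K}"
      then have v: "v \<in> carrier (FR 0)" "h v \<ominus> t v \<otimes> s \<in> K" and w: "w \<in> carrier (FR 0)" "h w \<ominus> t w \<otimes> s \<in> K" by blast+
      have "(h v \<oplus> h w) \<ominus> (t v \<oplus> t w) \<otimes> s = (h v \<ominus> t v \<otimes> s) \<oplus> (h w \<ominus> t w \<otimes> s)"
        using Hh(1)[OF v(1)] Hh(1)[OF w(1)] tc[OF v(1)] tc[OF w(1)] sc by algebra
      then show "v \<oplus>\<^bsub>FR 0\<^esub> w \<in> {v \<in> carrier (FR 0). h v \<ominus> t v \<otimes> s \<in> K}"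
        using Hh(3)[OF v(1) w(1)] T(3)[OF v(1) w(1)] submodD(3)[OF K v(2) w(2)] F0.a_closed[OF v(1) w(1)] by simp
    next
      fix a v assume a: "a \<in> carrier S" and "v \<in> {v \<in> carrier (FR 0). h v \<ominus> t v \<otimes> s \<in> K}"
      then have v: "v \<in> carrier (FR 0)" "h v \<ominus> t v \<otimes> s \<in> K" and aA: "a \<in> A" by auto
      have "a \<otimes> h v \<ominus> (a \<otimes> t v) \<otimes> s = a \<otimes> (h v \<ominus> t v \<otimes> s)"
        using Hh(1)[OF v(1)] tc[OF v(1)] A_sub[OF aA] sc by algebra
      then show "a \<odot>\<^bsub>FR 0\<^esub> v \<in> {v \<in> carrier (FR 0). h v \<ominus> t v \<otimes> s \<in> K}"
        using Hh(4)[OF a v(1)] T(4)[OF aA v(1)] submodD(4)[OF K aA v(2)] F0.smult_closed[OF a v(1)] by simp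
    next
      fix j assume "j < r 0"
      then show "unit_vector S (r 0) j \<in> {v \<in> carrier (FR 0). h v \<ominus> t v \<otimes> s \<in> K}"
        using tj c(2) S.unit_vector_closed by simp
    qed
    then have ht: "h v \<ominus> t v \<otimes> s \<in> K" if "v \<in> carrier (FR 0)" for v using that by blast
    \<comment> \<open>On the image of d_0 the map h equals the K-valued f, so t s has values in K
      there, which forces t into M.\<close>
    have tM: "t (d 0 w) \<in> M" if w: "w \<in> carrier (FR (Suc 0))" for w
    proof (rule sA)
      note dw = fc.d_closed[OF w]
      show "t (d 0 w) \<in> A" by (rule T(1)[OF dw])
      have "h (d 0 w) \<ominus> (h (d 0 w) \<ominus> t (d 0 w) \<otimes> s) = t (d 0 w) \<otimes> s"
        using Hh(1)[OF dw] tc[OF dw] sc by algebra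
      moreover have "h (d 0 w) \<in> K" using h(2)[OF w] fK[OF w] by simp
      ultimately show "t (d 0 w) \<otimes> s \<in> K" using submod_diff[OF K _ ht[OF dw], of "h (d 0 w)"] by simp
    qed
    \<comment> \<open>Modulo M the map t factors through p, so it is e p with e read off at v0:
      subtracting (p v / p v0) v0 from v gives an element of the image of d_0.\<close>
    define e where "e = t v0 \<otimes> inv (p v0)"
    have eA: "e \<in> A" unfolding e_def by (rule A_mult[OF T(1)[OF v0(1)] iu])
    have ec: "e \<in> carrier Q" by (rule A_sub[OF eA])
    have te: "t v \<ominus> e \<otimes> p v \<in> M" if v: "v \<in> carrier (FR 0)" for v
    proof -
      let ?a = "\<ominus> (p v \<otimes> inv (p v0))"
      have aA: "?a \<in> A" by (rule A_neg[OF A_mult[OF p(2)[OF v] iu]])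
      then have aS: "?a \<in> carrier S" by simp
      let ?x = "v \<oplus>\<^bsub>FR 0\<^esub> (?a \<odot>\<^bsub>FR 0\<^esub> v0)"
      note av = F0.smult_closed[OF aS v0(1)]
      note xF = F0.a_closed[OF v av]
      have "p ?x = p v \<oplus> ?a \<otimes> p v0" using P(3)[OF v av] P(4)[OF aS v0(1)] by simp
      also have "?a \<otimes> p v0 = \<ominus> (p v \<otimes> (inv (p v0) \<otimes> p v0))" using P(1)[OF v] P(1)[OF v0(1)] inv(1) by algebra
      also have "\<dots> = \<ominus> p v" using inv(3) P(1)[OF v] by simp
      finally have "p ?x = \<zero>" using P(1)[OF v] by (simp add: r_neg)
      then obtain w where w: "w \<in> carrier (FR (Suc 0))" "?x = d 0 w" using p(3)[OF xF] M_zero by auto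
      have "t ?x \<in> M" using tM[OF w(1)] w(2) by simp
      moreover have "t ?x = t v \<oplus> ?a \<otimes> t v0" using T(3)[OF v av] T(4)[OF aA v0(1)] by simp
      moreover have "t v \<oplus> ?a \<otimes> t v0 = t v \<ominus> e \<otimes> p v"
        unfolding e_def using P(1)[OF v] inv(1) tc[OF v] tc[OF v0(1)] by algebra
      ultimately show ?thesis by simp
    qed
    let ?m = "\<lambda>v\<in>carrier (FR 0). e \<otimes> s \<otimes> p v"
    have es: "e \<otimes> s \<in> carrier Q" using ec sc by simp
    \<comment> \<open>h is congruent to e s p modulo K, so the difference is a K-valued map on F_0
      and f - e \<beta> is its coboundary.\<close>
    let ?k = "\<lambda>v\<in>carrier (FR 0). h v \<ominus> ?m v"
    have k: "?k \<in> module_hom S (FR 0) V" by (rule V_hom_diff[OF h(1) mult_p[OF es] FS_module])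
    have kK: "?k v \<in> K" if v: "v \<in> carrier (FR 0)" for v
    proof -
      have "s \<otimes> (t v \<ominus> e \<otimes> p v) \<in> K" by (rule sM[OF te[OF v]])
      then have "(h v \<ominus> t v \<otimes> s) \<oplus> s \<otimes> (t v \<ominus> e \<otimes> p v) \<in> K" by (rule submodD(3)[OF K ht[OF v]])
      moreover have "(h v \<ominus> t v \<otimes> s) \<oplus> s \<otimes> (t v \<ominus> e \<otimes> p v) = h v \<ominus> e \<otimes> s \<otimes> p v"
        using Hh(1)[OF v] tc[OF v] sc ec P(1)[OF v] by algebra
      ultimately show ?thesis using v by simp
    qed
    let ?g = "compose (carrier (FR (Suc 0))) ?k (d 0)"
    have kW: "?k \<in> module_hom S (FR 0) ?W" unfolding iff using k kK by blast
    have gW: "?g \<in> module_hom S (FR (Suc 0)) ?W" by (rule module_hom_compose[OF d_hom kW FS_module])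
    have gB: "?g \<in> ?B" by (rule cobI[OF gW k kK]) (use compose_eq in \<open>auto simp del: restrict_apply\<close>)
    have gv: "?g w = f w \<ominus> b e w" if w: "w \<in> carrier (FR (Suc 0))" for w
      using compose_eq[OF w, of ?k "d 0"] h(2)[OF w] bv[OF eA w] fc.d_closed[OF w] P(1)[OF fc.d_closed[OF w]] ec sc
      by (simp add: m_assoc)
    have "f = ?g \<oplus>\<^bsub>?H\<^esub> b e"
    proof (rule extensionalityI[OF module_homD(2)[OF f(1)]])
      show "?g \<oplus>\<^bsub>?H\<^esub> b e \<in> extensional (carrier (FR (Suc 0)))" by simp
      fix w assume w: "w \<in> carrier (FR (Suc 0))"
      have bc: "b e w \<in> carrier Q" using bv[OF eA w] ec sc P(1)[OF fc.d_closed[OF w]] by simp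
      have fc': "f w \<in> carrier Q" using fK[OF w] Kc by blast
      have "f w = (f w \<ominus> b e w) \<oplus> b e w" using bc fc' by algebra
      then show "f w = (?g \<oplus>\<^bsub>?H\<^esub> b e) w" using gv[OF w] w by simp
    qed
    moreover have gH: "?g \<in> carrier ?H" using gB fc.coboundaries_subset[OF Wm, of "Suc 0"] by auto
    moreover have beH: "b e \<in> carrier ?H" using bH[OF eA] by simp
    ultimately have "f \<ominus>\<^bsub>?H\<^esub> b e = ?g"
      using abelian_group.add_minus_cancel[OF H.M.abelian_group_axioms gH beH] by (simp only:)
    then have "f \<ominus>\<^bsub>?H\<^esub> b e \<in> ?B" using gB by (simp only:)
    then show "\<exists>l\<in>carrier (regular_module S). f \<ominus>\<^bsub>?H\<^esub> b l \<in> ?B" using eA by (intro bexI[of _ e]) auto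
  qed
  then show ?thesis unfolding Ext_module_residue One_nat_def unfolding residue_module_eq .
qed

text \<open>Degree 0 vanishes by torsion-freeness, degrees from 2 on by injectivity of Q and Q / K,
  and degree 1 is one-dimensional because (K : M) / K is generated by s.\<close>

lemma canonical_moduleI:
  assumes frac: "fractional K" and baer: "baer K" and s: "s \<in> colon Q K M" "s \<notin> K"
    and gen: "\<And>x. x \<in> colon Q K M \<Longrightarrow> \<exists>b\<in>A. x \<ominus> b \<otimes> s \<in> K"
  shows "canonical_module S (V\<lparr>carrier := K\<rparr>)"
proof -
  let ?W = "V\<lparr>carrier := K\<rparr>"
  interpret fc: free_complex S r d by (rule resolution_complex)
  note K = fractional_submod[OF frac]
  have Wm: "module S ?W" by (rule V_restrict_module[OF K])
  have "cocycles S r d ?W i \<subseteq> coboundaries S r d ?W i" if i: "i \<noteq> 1" for i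
  proof
    fix f assume fZ: "f \<in> cocycles S r d ?W i"
    consider "i = 0" | j where "i = Suc (Suc j)" using i by (metis One_nat_def not0_implies_Suc)
    then show "f \<in> coboundaries S r d ?W i"
    proof cases
      case 1
      then have f: "f \<in> module_hom S (FR 0) ?W" "\<And>w. w \<in> carrier (FR (Suc 0)) \<Longrightarrow> f (d 0 w) = \<zero>"
        using fZ unfolding fc.cocycles_iff[OF Wm] by auto
      have "f = (\<lambda>x\<in>carrier (FR 0). \<zero>\<^bsub>?W\<^esub>)"
        by (rule extensionalityI[OF module_homD(2)[OF f(1)]]) (use cocycle_0[OF K f] in auto)
      then show ?thesis using 1 by (simp add: coboundaries_def)
    next
      case (2 j)
      then have f: "f \<in> module_hom S (FR (Suc (Suc j))) ?W"
        "\<And>w. w \<in> carrier (FR (Suc (Suc (Suc j)))) \<Longrightarrow> f (d (Suc (Suc j)) w) = \<zero>"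
        using fZ unfolding fc.cocycles_iff[OF Wm] by auto
      obtain h where "h \<in> module_hom S (FR (Suc j)) ?W"
        "\<And>w. w \<in> carrier (FR (Suc (Suc j))) \<Longrightarrow> f w = h (d (Suc j) w)"
        by (rule cocycle_is_coboundary[OF K baer f]) blast+
      then show ?thesis unfolding 2 fc.coboundaries_Suc_iff[OF Wm] using f(1) by blast
    qed
  qed
  then have "carrier (Ext_module S i (residue_module S) ?W) = {\<zero>\<^bsub>Ext_module S i (residue_module S) ?W\<^esub>}"
    if "i \<noteq> 1" for i
    unfolding Ext_module_residue using fc.cohomology_trivial_iff[OF Wm] that by blast
  moreover have "module_isomorphic S (Ext_module S 1 (residue_module S) ?W) (residue_module S)"
    by (rule residue_cohomology[OF K s gen])
  ultimately show ?thesis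
    unfolding canonical_module_def using S_CM fractional_finitely_generated[OF frac] krull_dim_S
    by (auto simp: one_enat_def)
qed

end

section \<open>Integral closure\<close>

context cring_with_subring
begin

text \<open>The A-module generated by the powers of x with exponent below k. Membership of x^k in it
  is a monic equation of degree k, without any polynomial syntax.\<close>

primrec power_span :: "'a \<Rightarrow> nat \<Rightarrow> 'a set" where
  "power_span x 0 = {\<zero>}"
| "power_span x (Suc k) = {y \<oplus> a \<otimes> x [^] k | y a. y \<in> power_span x k \<and> a \<in> A}"

lemma power_span_submod: "x \<in> carrier Q \<Longrightarrow> submod Q A (power_span x k)"
  by (induct k) (simp_all add: submod_zero submod_sum(1))

lemma power_span_Suc: "x \<in> carrier Q \<Longrightarrow> power_span x k \<subseteq> power_span x (Suc k)"
  "x \<in> carrier Q \<Longrightarrow> x [^] k \<in> power_span x (Suc k)"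
  using submod_sum(2,3)[OF power_span_submod, of x "x [^] k" k] by simp_all

lemma power_in_span:
  assumes x: "x \<in> carrier Q" and "i < k" shows "x [^] i \<in> power_span x k"
  using assms(2)
proof (induct k)
  case (Suc k)
  show ?case
  proof (cases "i = k")
    case True then show ?thesis using power_span_Suc(2)[OF x] by blast
  next
    case False
    then have "x [^] i \<in> power_span x k" using Suc by simp
    then show ?thesis using power_span_Suc(1)[OF x] by blast
  qed
qed simp

lemma power_span_least:
  assumes Y: "submod Q A Y" and "\<And>i. i < k \<Longrightarrow> x [^] i \<in> Y"
  shows "power_span x k \<subseteq> Y"
  using assms(2)
proof (induct k)
  case 0 then show ?case using submodD(2)[OF Y] by simp
next
  case (Suc k)
  then have "power_span x k \<subseteq> Y" "x [^] k \<in> Y" by simp_all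
  then show ?case using submodD(3,4)[OF Y] by (auto simp: subset_eq)
qed

lemma power_span_mult:
  assumes x: "x \<in> carrier Q" and y: "y \<in> power_span x k"
  shows "y \<otimes> x \<in> power_span x (Suc k)"
  using y
proof (induct k arbitrary: y)
  case 0
  then have "y \<otimes> x = \<zero>" using x by simp
  then show ?case using submodD(2)[OF power_span_submod[OF x]] by metis
next
  case (Suc k)
  then obtain z a where z: "z \<in> power_span x k" "a \<in> A" "y = z \<oplus> a \<otimes> x [^] k" by auto
  have zc: "z \<in> carrier Q" using submodD(1)[OF power_span_submod[OF x] z(1)] .
  have xk: "x [^] k \<in> carrier Q" using x by simp
  have "y \<otimes> x = z \<otimes> x \<oplus> a \<otimes> (x [^] k \<otimes> x)" unfolding z(3) using zc x xk A_sub[OF z(2)] by algebra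
  then have "y \<otimes> x = z \<otimes> x \<oplus> a \<otimes> x [^] Suc k" by simp
  then show ?case using Suc(1)[OF z(1)] z(2) unfolding power_span.simps(2)[of x "Suc k"] by blast
qed

text \<open>Division by x with remainder; it serves to lower the degree of a monic relation.\<close>

lemma power_span_constant_term:
  assumes x: "x \<in> carrier Q" and y: "y \<in> power_span x (Suc k)"
  shows "\<exists>z\<in>power_span x k. \<exists>c\<in>A. y = z \<otimes> x \<oplus> c"
  using y
proof (induct k arbitrary: y)
  case 0
  then obtain a where a: "a \<in> A" "y = a" using A_sub by auto
  then have "y = \<zero> \<otimes> x \<oplus> a" using x A_sub by simp
  then show ?case using a by auto
next
  case (Suc k)
  then obtain w a where w: "w \<in> power_span x (Suc k)" "a \<in> A" "y = w \<oplus> a \<otimes> x [^] Suc k" by auto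
  obtain z c where z: "z \<in> power_span x k" "c \<in> A" "w = z \<otimes> x \<oplus> c" using Suc(1)[OF w(1)] by blast
  have zc: "z \<in> carrier Q" using submodD(1)[OF power_span_submod[OF x] z(1)] .
  have xk: "x [^] k \<in> carrier Q" using x by simp
  have "y = (z \<oplus> a \<otimes> x [^] k) \<otimes> x \<oplus> c"
    unfolding w z nat_pow_Suc using zc x xk A_sub[OF w(2)] A_sub[OF z(2)] by algebra
  moreover have "z \<oplus> a \<otimes> x [^] k \<in> power_span x (Suc k)" using z(1) w(2) by auto
  ultimately show ?case using z(2) by blast
qed

text \<open>A monic equation of degree k makes the span stable under multiplication by x; k \<noteq>
  0 puts x^0 into it.\<close>

lemma all_powers_in_span:
  assumes x: "x \<in> carrier Q" and k: "x [^] k \<in> power_span x k" "k \<noteq> 0"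
  shows "x [^] (j::nat) \<in> power_span x k"
proof (induct j)
  case 0 then show ?case using power_in_span[OF x, of 0 k] k(2) by simp
next
  case (Suc j)
  have "power_span x (Suc k) \<subseteq> power_span x k"
    using submodD(3,4)[OF power_span_submod[OF x]] k(1) by auto
  then show ?case using power_span_mult[OF x Suc] by auto
qed

lemma power_span_eq: 
  assumes x: "x \<in> carrier Q"
  shows "power_span x k = {eval q x | q. set q \<subseteq> A \<and> length q = k}"
proof (induct k)
  case 0 then show ?case by auto
next
  case (Suc k)
  \<comment> \<open>Coefficient lists start with the leading coefficient, so a new top term is a new
    head.\<close>
  have comm: "eval q x \<oplus> a \<otimes> x [^] length q = eval (a # q) x" if "set q \<subseteq> A" "a \<in> A" for a q
  proof -
    have "eval q x \<in> carrier Q" using eval_in_carrier[of q x] that x A_sub by blast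
    then show ?thesis using x A_sub[OF that(2)] by (simp add: a_comm)
  qed
  show ?case
  proof
    show "power_span x (Suc k) \<subseteq> {eval q x | q. set q \<subseteq> A \<and> length q = Suc k}"
    proof
      fix y assume "y \<in> power_span x (Suc k)"
      then obtain z a where z: "z \<in> power_span x k" "a \<in> A" "y = z \<oplus> a \<otimes> x [^] k" by auto
      obtain q where "set q \<subseteq> A" "length q = k" "z = eval q x" using z(1) unfolding Suc by blast
      with z have "set q \<subseteq> A" "length q = k" "a \<in> A" "y = eval q x \<oplus> a \<otimes> x [^] k" by simp_all
      then show "y \<in> {eval q x | q. set q \<subseteq> A \<and> length q = Suc k}"
        using comm[of q a] by (intro CollectI exI[of _ "a # q"]) simp
    qed
    show "{eval q x | q. set q \<subseteq> A \<and> length q = Suc k} \<subseteq> power_span x (Suc k)"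
    proof
      fix y assume "y \<in> {eval q x | q. set q \<subseteq> A \<and> length q = Suc k}"
      then obtain p where p: "set p \<subseteq> A" "length p = Suc k" "y = eval p x" by blast
      then obtain a q where q: "p = a # q" by (cases p) auto
      have "y = eval q x \<oplus> a \<otimes> x [^] k" using comm[of q a] p q by simp
      moreover have "eval q x \<in> power_span x k" using Suc p q by auto
      ultimately show "y \<in> power_span x (Suc k)" using p q by auto
    qed
  qed
qed

text \<open>Splitting the leading \<one> off a monic polynomial leaves an arbitrary coefficient list
  of length k. In the other direction \<open>\<one> \<noteq> \<zero>\<close> makes
  \<open>\<one> # q\<close> a polynomial with nonzero leading coefficient.\<close>

lemma integral_closure_iff:
  assumes nz: "\<one> \<noteq> \<zero>"
  shows "x \<in> integral_closure Q A \<longleftrightarrow> x \<in> carrier Q \<and> (\<exists>k. x [^] k \<in> power_span x k)"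
proof -
  have "(\<exists>p\<in>carrier (A[X]\<^bsub>Q\<^esub>). p \<noteq> [] \<and> lead_coeff p = \<one> \<and> eval p x = \<zero>) \<longleftrightarrow> (\<exists>k. x [^] k \<in> power_span x k)"
    (is "?L \<longleftrightarrow> ?R") if x: "x \<in> carrier Q"
  proof
    assume ?L
    then obtain p where p: "polynomial A p" "p \<noteq> []" "lead_coeff p = \<one>" "eval p x = \<zero>"
      by (auto simp: univ_poly_carrier[symmetric])
    then obtain q where q: "p = \<one> # q" by (cases p) auto
    have qA: "set q \<subseteq> A" using p q by (simp add: polynomial_def)
    let ?k = "length q"
    have "eval q x \<in> power_span x ?k" unfolding power_span_eq[OF x] using qA by blast
    then have "\<ominus> eval q x \<in> power_span x ?k" by (rule submod_neg[OF power_span_submod[OF x]])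
    moreover have "eval q x \<in> carrier Q" using eval_in_carrier[of q x] qA x A_sub by blast
    moreover have "x [^] ?k \<oplus> eval q x = \<zero>" using p(4) q x by simp
    ultimately have "x [^] ?k \<in> power_span x ?k" using x by (metis minus_equality minus_minus nat_pow_closed)
    then show ?R by blast
  next
    assume ?R
    then obtain k where "x [^] k \<in> power_span x k" by blast
    then have "\<ominus> (x [^] k) \<in> power_span x k" by (rule submod_neg[OF power_span_submod[OF x]])
    then obtain q where q: "set q \<subseteq> A" "length q = k" "\<ominus> (x [^] k) = eval q x" unfolding power_span_eq[OF x] by blast
    have "eval (\<one> # q) x = \<zero>" using q x by (simp add: q(3)[symmetric] r_neg)
    moreover have "polynomial A (\<one> # q)" using q nz by (simp add: polynomial_def)
    ultimately show ?L by (intro bexI[of _ "\<one> # q"]) (auto simp: univ_poly_carrier[symmetric])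
  qed
  then show ?thesis unfolding integral_closure_def by blast
qed

text \<open>Multiply an integral equation of degree k for y by b^(k-1): the left side becomes y, and
  every term on the right lies in B because b y = \<one>.\<close>

lemma inverse_of_integral:
  assumes nz: "\<one> \<noteq> \<zero>" and B: "subcring B Q" "A \<subseteq> B" and b: "b \<in> B" and y: "y \<in> integral_closure Q A" "b \<otimes> y = \<one>"
  shows "y \<in> B"
proof -
  interpret B: cring_with_subring Q B by (intro cring_with_subring.intro cring_with_subring_axioms.intro is_cring B(1))
  obtain k where yc: "y \<in> carrier Q" and k: "y [^] k \<in> power_span y k"
    using y(1) integral_closure_iff[OF nz] by blast
  have bc: "b \<in> carrier Q" by (rule B.A_sub[OF b])
  have "k \<noteq> 0" using k nz by (cases k) auto
  then obtain j where j: "k = Suc j" by (cases k) auto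
  have by_pow: "b [^] i \<otimes> y [^] i = \<one>" for i :: nat
    using nat_pow_distrib[OF bc yc, of i] y(2) nat_pow_one[of i] by simp
  \<comment> \<open>Here j = k - 1, so that y^i b^j = b^(j-i) for every i < k.\<close>
  let ?Y = "{z \<in> carrier Q. z \<otimes> b [^] j \<in> B}"
  have Y: "submod Q A ?Y"
    by (rule submod_preimage[OF submod_mono[OF B.submod_A B(2)] submod_carrier]) (simp add: bc)
  have "power_span y k \<subseteq> ?Y"
  proof (rule power_span_least[OF Y])
    fix i assume "i < k"
    then have "j = (j - i) + i" using j by simp
    then have "b [^] j = b [^] (j - i) \<otimes> b [^] i" using nat_pow_mult[OF bc, of "j - i" i] by simp
    then have "y [^] i \<otimes> b [^] j = b [^] (j - i) \<otimes> (b [^] i \<otimes> y [^] i)" using bc yc by (simp add: m_ac)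
    also have "\<dots> = b [^] (j - i)" using by_pow bc by simp
    finally show "y [^] i \<in> ?Y" using B.A_pow[OF b] yc by simp
  qed
  then have "y [^] k \<otimes> b [^] j \<in> B" using k by blast
  moreover have "y [^] k \<otimes> b [^] j = y \<otimes> (b [^] j \<otimes> y [^] j)" unfolding j using bc yc by (simp add: m_ac)
  ultimately show ?thesis using by_pow yc by simp
qed

end

text \<open>The denominator t carries the modules spanned by powers of x into A. Their ascending
  chain repeats somewhere, and cancelling t gives x^k in the span of the lower powers.\<close>

lemma (in noetherian_subring) almost_integral:
  assumes nz: "\<one> \<noteq> \<zero>" and x: "x \<in> carrier Q" and t: "t \<in> Units Q" "\<And>k::nat. t \<otimes> x [^] k \<in> A"
  shows "x \<in> integral_closure Q A"
proof -
  have tc: "t \<in> carrier Q" using t by blast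
  define Y where "Y k = (\<lambda>z. t \<otimes> z) ` power_span x k" for k
  have sub: "power_span x k \<subseteq> {z \<in> carrier Q. z \<otimes> t \<in> A}" for k
    using t(2) x tc by (intro power_span_least submod_preimage submod_A submod_carrier) (simp_all add: m_comm)
  obtain k where "Y (Suc k) = Y k"
  proof (rule submod_chain_stabilizes[of Y])
    show "submod Q A (Y k)" for k unfolding Y_def by (rule submod_image[OF power_span_submod[OF x] tc])
    show "Y k \<subseteq> A" for k unfolding Y_def using sub[of k] tc m_comm by auto
    show "Y k \<subseteq> Y (Suc k)" for k unfolding Y_def by (rule image_mono[OF power_span_Suc(1)[OF x]])
  qed
  then have "t \<otimes> x [^] k \<in> Y k" using power_span_Suc(2)[OF x, of k] unfolding Y_def by blast
  then obtain z where z: "z \<in> power_span x k" "t \<otimes> x [^] k = t \<otimes> z" by (auto simp: Y_def)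
  have "x [^] k = z"
    using Units_l_cancel[OF t(1), of "x [^] k" z] z submodD(1)[OF power_span_submod[OF x] z(1)] x by simp
  then show ?thesis using integral_closure_iff[OF nz] x z(1) by blast
qed

lemma (in cring_with_subring) subset_integral_closure: "\<one> \<noteq> \<zero> \<Longrightarrow> A \<subseteq> integral_closure Q A"
proof
  fix x assume nz: "\<one> \<noteq> \<zero>" and x: "x \<in> A"
  have xc: "x \<in> carrier Q" by (rule A_sub[OF x])
  have "x \<otimes> x [^] (0::nat) \<in> power_span x 1"
    by (rule submodD(4)[OF power_span_submod[OF xc] x power_in_span[OF xc]]) simp
  then have "x [^] (1::nat) \<in> power_span x 1" using xc by simp
  then show "x \<in> integral_closure Q A" using integral_closure_iff[OF nz] xc by blast
qed

section \<open>Birational overrings\<close>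

locale one_dim_domain_local_closure = one_dim_domain +
  assumes closure_local: "local_ring (Q\<lparr>carrier := integral_closure Q A\<rparr>)"
    and conductor: "\<exists>t\<in>carrier Q. t \<noteq> \<zero> \<and> (\<forall>x\<in>integral_closure Q A. t \<otimes> x \<in> A)"
begin

definition Rb where "Rb = integral_closure Q A"
definition N where "N = max_ideal (Q\<lparr>carrier := Rb\<rparr>)"

lemma Rb_subcring: "subcring Rb Q"
proof -
  have "cring (Q\<lparr>carrier := Rb\<rparr>)" using closure_local by (simp add: local_ring_def Rb_def)
  moreover have "Rb \<subseteq> carrier Q" unfolding Rb_def integral_closure_def by blast
  ultimately show ?thesis using subcring_iff by blast
qed

sublocale Rb: cring_with_subring Q Rb
  by (intro cring_with_subring.intro cring_with_subring_axioms.intro is_cring Rb_subcring)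

lemma A_Rb: "A \<subseteq> Rb" using subset_integral_closure by (simp add: Rb_def)

lemma N_maximal: "maximalideal N (Q\<lparr>carrier := Rb\<rparr>)"
  using local_ring_maximalideal[OF closure_local] by (simp add: N_def Rb_def)

lemma N_submod: "submod Q Rb N" and N_Rb: "N \<subseteq> Rb"
  using maximalideal.axioms(1)[OF N_maximal] Rb.ideal_iff by auto

lemma one_notin_N: "\<one> \<notin> N"
  using ideal.one_imp_carrier[OF maximalideal.axioms(1)[OF N_maximal]] maximalideal.I_notcarr[OF N_maximal] by auto

lemma unit_Rb:
  assumes "x \<in> Rb" "x \<notin> N"
  shows "inv x \<in> Rb"
proof -
  have "x \<in> Units (Q\<lparr>carrier := Rb\<rparr>)"
    using local_ring_unit[OF closure_local N_maximal[unfolded Rb_def]] assms by (simp add: Rb_def)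
  then obtain y where y: "y \<in> Rb" "x \<otimes> y = \<one>" by (auto simp: Units_def)
  then have "inv x = y" using comm_inv_char[of x y] Rb.A_sub assms by blast
  then show ?thesis using y by simp
qed

lemma Rb_fractional: "fractional Rb"
  unfolding fractional_def using submod_mono[OF Rb.submod_A A_Rb] conductor by (auto simp: Rb_def)

section \<open>Properties inherited by rings between A and its closure\<close>

context
  fixes B assumes B: "subcring B Q" "A \<subseteq> B" "B \<subseteq> Rb"
begin

interpretation B: cring_with_subring Q B
  by (intro cring_with_subring.intro cring_with_subring_axioms.intro is_cring B(1))

text \<open>An ideal of B is an A-submodule with a common denominator from the conductor, so it is
  finitely generated over A and all the more over B.\<close>

lemma overring_noetherian: "noetherian_ring (Q\<lparr>carrier := B\<rparr>)"
proof -
  interpret BR: cring "Q\<lparr>carrier := B\<rparr>" by (rule B.S_cring)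
  show ?thesis
  proof (rule BR.noetherian_ringI)
    fix I assume "ideal I (Q\<lparr>carrier := B\<rparr>)"
    then have I: "submod Q B I" "I \<subseteq> B" using B.ideal_iff by auto
    obtain t where t: "t \<in> carrier Q" "t \<noteq> \<zero>" "\<And>x. x \<in> Rb \<Longrightarrow> t \<otimes> x \<in> A" using conductor by (auto simp: Rb_def)
    have "t \<in> Units Q" using t field_Units by blast
    moreover have "t \<otimes> x \<in> A" if "x \<in> I" for x using t(3) that I(2) B(3) by blast
    ultimately obtain G where G: "finite G" "G \<subseteq> I" and GY: "\<And>Y. submod Q A Y \<Longrightarrow> G \<subseteq> Y \<Longrightarrow> I \<subseteq> Y"
      by (rule fractional_fg[OF submod_mono[OF I(1) B(2)]]) blast+
    have GB: "G \<subseteq> carrier (Q\<lparr>carrier := B\<rparr>)" using G I by auto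
    have "ideal (Idl\<^bsub>Q\<lparr>carrier := B\<rparr>\<^esub> G) (Q\<lparr>carrier := B\<rparr>)" by (rule BR.genideal_ideal[OF GB])
    then have "submod Q A (Idl\<^bsub>Q\<lparr>carrier := B\<rparr>\<^esub> G)" using B.ideal_iff submod_mono[OF _ B(2)] by blast
    then have "I \<subseteq> Idl\<^bsub>Q\<lparr>carrier := B\<rparr>\<^esub> G" by (rule GY[OF _ BR.genideal_self[OF GB]])
    moreover have "Idl\<^bsub>Q\<lparr>carrier := B\<rparr>\<^esub> G \<subseteq> I"
      using G(2) I B.ideal_iff by (intro BR.genideal_minimal) auto
    ultimately show "\<exists>G\<subseteq>carrier (Q\<lparr>carrier := B\<rparr>). finite G \<and> I = Idl\<^bsub>Q\<lparr>carrier := B\<rparr>\<^esub> G"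
      using G GB by blast
  qed
qed

text \<open>If x is integral over B with an equation of degree k, clear the finitely many powers
  below k by s and the coefficients from B by the conductor element t. Then t s clears every power
  of x, so x is almost integral, hence integral, over A.\<close>

lemma overring_integral_closure: "integral_closure Q B = Rb"
proof
  show "Rb \<subseteq> integral_closure Q B"
  proof
    fix x assume "x \<in> Rb"
    then have xc: "x \<in> carrier Q" and "\<exists>k. x [^] k \<in> power_span x k" using integral_closure_iff by (auto simp: Rb_def)
    moreover have "power_span x k \<subseteq> B.power_span x k" for k
      by (rule power_span_least[OF submod_mono[OF B.power_span_submod[OF xc] B(2)] B.power_in_span[OF xc]])
    ultimately show "x \<in> integral_closure Q B" using B.integral_closure_iff by auto
  qed
  show "integral_closure Q B \<subseteq> Rb"
  proof
    fix x assume "x \<in> integral_closure Q B"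
    then obtain k where x: "x \<in> carrier Q" and k: "x [^] k \<in> B.power_span x k" using B.integral_closure_iff by auto
    have "k \<noteq> 0" using k by (cases k) auto
    obtain t where t: "t \<in> carrier Q" "t \<noteq> \<zero>" "\<And>x. x \<in> Rb \<Longrightarrow> t \<otimes> x \<in> A" using conductor by (auto simp: Rb_def)
    have "\<exists>s\<in>carrier Q. s \<noteq> \<zero> \<and> (\<forall>i<j. s \<otimes> x [^] i \<in> A)" for j :: nat
    proof (induct j)
      case 0 show ?case by (rule bexI[of _ \<one>]) auto
    next
      case (Suc j)
      then obtain s where s: "s \<in> carrier Q" "s \<noteq> \<zero>" "\<And>i. i < j \<Longrightarrow> s \<otimes> x [^] i \<in> A" by blast
      have xj: "x [^] j \<in> carrier Q" using x by simp
      obtain a b where ab: "a \<in> A" "b \<in> A" "b \<noteq> \<zero>" "x [^] j = a \<otimes> inv b" using fraction[OF xj] by blast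
      obtain c e where ce: "c \<in> A" "e \<in> A" "e \<noteq> \<zero>" "s = c \<otimes> inv e" using fraction[OF s(1)] by blast
      note ib = inv_nonzero[OF A_sub[OF ab(2)] ab(3)] and ie = inv_nonzero[OF A_sub[OF ce(2)] ce(3)]
      have cs: "a \<in> carrier Q" "b \<in> carrier Q" "c \<in> carrier Q" "e \<in> carrier Q" using ab ce A_sub by auto
      have "c \<noteq> \<zero>" using s(2) ce(4) ie by auto
      \<comment> \<open>The next denominator is b c, with b the denominator of x^j and c = e s the
        numerator of s: passing from s to c puts this factor into A, so it may also multiply
        a.\<close>
      have "b \<otimes> c \<noteq> \<zero>" using integral[of b c] ab(3) \<open>c \<noteq> \<zero>\<close> cs by blast
      moreover have "b \<otimes> c \<otimes> x [^] i \<in> A" if "i < Suc j" for i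
      proof (cases "i = j")
        case True
        have "b \<otimes> c \<otimes> x [^] j = c \<otimes> (a \<otimes> (b \<otimes> inv b))" unfolding ab(4) using cs ib(1) by (simp add: m_ac)
        then show ?thesis using True ib(2) cs ab ce A_mult by simp
      next
        case False
        then have "s \<otimes> x [^] i \<in> A" using s(3) that by simp
        then have "b \<otimes> (e \<otimes> (s \<otimes> x [^] i)) \<in> A" using ab(2) ce(2) A_mult by blast
        moreover have "e \<otimes> s = c" unfolding ce(4) using cs ie by (metis m_assoc m_comm r_one)
        moreover have "b \<otimes> (e \<otimes> (s \<otimes> x [^] i)) = b \<otimes> (e \<otimes> s) \<otimes> x [^] i" using cs s(1) x by (simp add: m_assoc)
        ultimately show ?thesis by simp
      qed
      ultimately show ?case using cs by blast
    qed
    from this[of k] obtain s where s: "s \<in> carrier Q" "s \<noteq> \<zero>" "\<And>i. i < k \<Longrightarrow> s \<otimes> x [^] i \<in> A" by blast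
    have span: "t \<otimes> s \<otimes> z \<in> A" if "z \<in> B.power_span x j" "j \<le> k" for z j
      using that
    proof (induct j arbitrary: z)
      case 0 then show ?case using t s by simp
    next
      case (Suc j)
      then obtain y b where z: "y \<in> B.power_span x j" "b \<in> B" "z = y \<oplus> b \<otimes> x [^] j" by auto
      have yc: "y \<in> carrier Q" using submodD(1)[OF B.power_span_submod[OF x] z(1)] .
      have xj: "x [^] j \<in> carrier Q" using x by simp
      have "t \<otimes> s \<otimes> z = t \<otimes> s \<otimes> y \<oplus> (t \<otimes> b) \<otimes> (s \<otimes> x [^] j)"
        unfolding z(3) using t(1) s(1) yc xj B.A_sub[OF z(2)] by algebra
      moreover have "t \<otimes> s \<otimes> y \<in> A" using Suc(1)[OF z(1)] Suc(3) by simp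
      moreover have "t \<otimes> b \<in> A" using t(3) z(2) B(3) by blast
      moreover have "s \<otimes> x [^] j \<in> A" using s(3) Suc(3) by simp
      ultimately show ?case by (simp add: A_add A_mult)
    qed
    have "t \<otimes> s \<in> Units Q" using integral[of t s] t s field_Units by blast
    moreover have "t \<otimes> s \<otimes> x [^] j \<in> A" for j :: nat
      by (rule span[OF B.all_powers_in_span[OF x k \<open>k \<noteq> 0\<close>]]) simp
    ultimately show "x \<in> Rb" unfolding Rb_def using almost_integral[OF one_not_zero x] by blast
  qed
qed

text \<open>Outside N the element b is a unit of Rb, so its inverse is integral over A and already
  lies in B.\<close>

lemma inverse_in_overring:
  assumes b: "b \<in> B" "b \<notin> N" shows "inv b \<in> B"
proof -
  have bR: "b \<in> Rb" using b B by blast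
  have b0: "b \<noteq> \<zero>" using b(2) submodD(2)[OF N_submod] by blast
  show ?thesis
    using inverse_of_integral[OF one_not_zero B(1,2) b(1), of "inv b"] unit_Rb[OF bR b(2)]
      inv_nonzero[OF Rb.A_sub[OF bR] b0] by (simp add: Rb_def)
qed

end

lemma N_Int_A: "N \<inter> A = M"
proof
  have sub: "x \<in> M" if "x \<in> A" "x \<in> N" for x
  proof (rule ccontr)
    assume "x \<notin> M"
    then have "inv x \<in> A" "x \<noteq> \<zero>" using unit_A that(1) M_zero by auto
    then have "inv x \<otimes> x \<in> N" using submodD(4)[OF N_submod _ that(2)] A_Rb by blast
    then show False using inv_nonzero[OF A_sub[OF that(1)] \<open>x \<noteq> \<zero>\<close>] one_notin_N by simp
  qed
  then show "N \<inter> A \<subseteq> M" by blast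
  show "M \<subseteq> N \<inter> A"
  proof
    fix x assume x: "x \<in> M"
    then have xA: "x \<in> A" using M_A by blast
    have "x \<in> N"
    proof (rule ccontr)
      assume xN: "x \<notin> N"
      then have x0: "x \<noteq> \<zero>" using submodD(2)[OF N_submod] by blast
      have "inv x \<in> A" by (rule inverse_in_overring[OF subA order_refl A_Rb xA xN])
      then have "inv x \<otimes> x \<in> M" using submodD(4)[OF M_submod _ x] by blast
      then show False using inv_nonzero[OF A_sub[OF xA] x0] one_notin_M by simp
    qed
    then show "x \<in> N \<inter> A" using xA by blast
  qed
qed

text \<open>The point is that a nonzero prime P of B equals N \<inter> B. It contains M, since it
  meets A in a nonzero prime. For b in N \<inter> B take a monic relation of least degree for b over
  A modulo P: its constant term lies in N \<inter> A = M \<subseteq> P, so b times a relation of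
  smaller degree lies in P, and primeness leaves b \<in> P.\<close>

lemma overring_one_dim_domain:
  assumes B: "subcring B Q" "A \<subseteq> B" "B \<subseteq> Rb"
  shows "one_dim_domain Q B (N \<inter> B)"
proof -
  interpret B: cring_with_subring Q B by (intro cring_with_subring.intro cring_with_subring_axioms.intro is_cring B(1))
  have NB: "submod Q B N" by (rule submod_mono[OF N_submod B(3)])
  have prime: "P = N \<inter> B" if P: "primeideal P (Q\<lparr>carrier := B\<rparr>)" "P \<noteq> {\<zero>}" for P
  proof -
    interpret P: primeideal P "Q\<lparr>carrier := B\<rparr>" by (rule P(1))
    have Ps: "submod Q B P" "P \<subseteq> B" using B.ideal_iff P.is_ideal by auto
    have one: "\<one> \<notin> P" using P.one_imp_carrier P.I_notcarr by auto
    have prod: "a \<in> P \<or> b \<in> P" if "a \<in> B" "b \<in> B" "a \<otimes> b \<in> P" for a b using P.I_prime[of a b] that by simp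
    have PN: "P \<subseteq> N"
    proof
      fix b assume b: "b \<in> P"
      then have bB: "b \<in> B" using Ps by blast
      show "b \<in> N"
      proof (rule ccontr)
        assume bN: "b \<notin> N"
        then have b0: "b \<noteq> \<zero>" using submodD(2)[OF N_submod] by blast
        have "inv b \<otimes> b \<in> P" by (rule submodD(4)[OF Ps(1) inverse_in_overring[OF B bB bN] b])
        then show False using inv_nonzero[OF B.A_sub[OF bB] b0] one by simp
      qed
    qed
    have "P \<inter> A = M"
    proof (rule prime_eq_M)
      show "primeideal (P \<inter> A) (Q\<lparr>carrier := A\<rparr>)"
      proof (rule primeidealI[OF _ S_cring])
        show "ideal (P \<inter> A) S" using ideal_iff submod_Int[OF submod_mono[OF Ps(1) B(2)] submod_A] by blast
        show "carrier S \<noteq> P \<inter> A"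
        proof
          assume "carrier S = P \<inter> A"
          then have "A = P \<inter> A" by simp
          then show False using one A_one by blast
        qed
        fix a b assume "a \<in> carrier S" "b \<in> carrier S" "a \<otimes>\<^bsub>S\<^esub> b \<in> P \<inter> A"
        then have ab: "a \<in> A" "b \<in> A" "a \<otimes> b \<in> P" by simp_all
        have "a \<in> P \<or> b \<in> P" by (rule prod[OF subsetD[OF B(2) ab(1)] subsetD[OF B(2) ab(2)] ab(3)])
        then show "a \<in> P \<inter> A \<or> b \<in> P \<inter> A" using ab by blast
      qed
      obtain b where b: "b \<in> P" "b \<noteq> \<zero>" using P(2) submodD(2)[OF Ps(1)] by blast
      have bc: "b \<in> carrier Q" by (rule submodD(1)[OF Ps(1) b(1)])
      obtain u v where uv: "u \<in> A" "v \<in> A" "v \<noteq> \<zero>" "b = u \<otimes> inv v" using fraction[OF bc] by blast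
      note iv = inv_nonzero[OF A_sub[OF uv(2)] uv(3)]
      have "v \<otimes> b = u" unfolding uv(4) using A_sub[OF uv(1)] A_sub[OF uv(2)] iv by (metis m_comm m_assoc r_one)
      moreover have "v \<otimes> b \<in> P" using submodD(4)[OF Ps(1) _ b(1)] uv(2) B(2) by blast
      moreover have "v \<otimes> b \<noteq> \<zero>" using integral[of v b] A_sub[OF uv(2)] bc uv(3) b(2) by blast
      ultimately show "P \<inter> A \<noteq> {\<zero>}" using uv(1) by blast
    qed
    then have MP: "M \<subseteq> P" by blast
    have "N \<inter> B \<subseteq> P"
    proof
      fix b assume b: "b \<in> N \<inter> B"
      then have bB: "b \<in> B" and bN: "b \<in> N" by auto
      have bc: "b \<in> carrier Q" by (rule B.A_sub[OF bB])
      have spanB: "power_span b k \<subseteq> B" for k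
        by (rule power_span_least[OF submod_mono[OF B.submod_A B(2)] B.A_pow[OF bB]])
      \<comment> \<open>\<open>E k\<close>: modulo P, the element b satisfies a monic equation of
        degree k with coefficients in A. Integrality over A provides one such k.\<close>
      define E where "E k \<longleftrightarrow> (\<exists>z\<in>power_span b k. b [^] k \<ominus> z \<in> P)" for k
      have "b \<in> Rb" using bB B(3) by blast
      then obtain k where "b [^] k \<in> power_span b k" using integral_closure_iff by (auto simp: Rb_def)
      moreover have "b [^] k \<ominus> b [^] k = \<zero>" using bc by (simp add: a_minus_def r_neg)
      ultimately have "E k" unfolding E_def using submodD(2)[OF Ps(1)] by metis
      then obtain l where l: "E l" "\<And>i. i < l \<Longrightarrow> \<not> E i" using exists_least_iff[of E] by blast
      have "l \<noteq> 0"
      proof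
        assume "l = 0"
        moreover have "\<one> \<ominus> \<zero> = \<one>" by algebra
        ultimately show False using l(1) one by (simp add: E_def)
      qed
      then obtain j where j: "l = Suc j" by (cases l) auto
      obtain z where z: "z \<in> power_span b l" "b [^] l \<ominus> z \<in> P" using l(1) by (auto simp: E_def)
      obtain w c where w: "w \<in> power_span b j" "c \<in> A" "z = w \<otimes> b \<oplus> c"
        using power_span_constant_term[OF bc z(1)[unfolded j]] by blast
      have wB: "w \<in> B" using w(1) spanB by blast
      have cs: "w \<in> carrier Q" "c \<in> carrier Q" "b [^] j \<in> carrier Q" using B.A_sub[OF wB] A_sub[OF w(2)] bc by auto
      have dB: "b [^] j \<ominus> w \<in> B" by (rule B.A_diff[OF B.A_pow[OF bB] wB])
      \<comment> \<open>The relation is b times a monic expression of degree l - 1, minus the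
        constant term c. As b and P lie in N, so does c.\<close>
      have eq: "b [^] l \<ominus> z = (b [^] j \<ominus> w) \<otimes> b \<ominus> c" unfolding j w(3) nat_pow_Suc using cs bc by algebra
      have "(b [^] j \<ominus> w) \<otimes> b \<in> N" by (rule submodD(4)[OF NB dB bN])
      moreover have "(b [^] j \<ominus> w) \<otimes> b \<ominus> c \<in> N" using eq z(2) PN by auto
      ultimately have "(b [^] j \<ominus> w) \<otimes> b \<ominus> ((b [^] j \<ominus> w) \<otimes> b \<ominus> c) \<in> N" by (rule Rb.submod_diff[OF N_submod])
      moreover have "(b [^] j \<ominus> w) \<otimes> b \<ominus> ((b [^] j \<ominus> w) \<otimes> b \<ominus> c) = c" using cs bc by algebra
      ultimately have "c \<in> P" using N_Int_A w(2) MP by auto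
      then have "((b [^] j \<ominus> w) \<otimes> b \<ominus> c) \<oplus> c \<in> P" using eq z(2) submodD(3)[OF Ps(1)] by simp
      moreover have "((b [^] j \<ominus> w) \<otimes> b \<ominus> c) \<oplus> c = (b [^] j \<ominus> w) \<otimes> b" using cs bc by algebra
      ultimately have "b [^] j \<ominus> w \<in> P \<or> b \<in> P" using prod[OF dB bB] by simp
      moreover have "b [^] j \<ominus> w \<notin> P" using l(2)[of j] j w(1) unfolding E_def by blast
      ultimately show "b \<in> P" by blast
    qed
    then show ?thesis using PN Ps(2) by blast
  qed
  show ?thesis
  proof (intro one_dim_domain.intro one_dim_domain_axioms.intro noetherian_subring.intro noetherian_subring_axioms.intro)
    show "field Q" by (rule field_axioms)
    show "cring_with_subring Q B" by (rule B.cring_with_subring_axioms)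
    show "noetherian_ring (Q\<lparr>carrier := B\<rparr>)" by (rule overring_noetherian[OF B])
    show "\<exists>a\<in>B. \<exists>s\<in>B. s \<noteq> \<zero> \<and> q = a \<otimes> inv s" if "q \<in> carrier Q" for q using fraction[OF that] B(2) by blast
    show "submod Q B (N \<inter> B)" by (rule B.submod_Int[OF NB B.submod_A])
    show "N \<inter> B \<subseteq> B" "\<one> \<notin> N \<inter> B" using one_notin_N by auto
    show "N \<inter> B \<noteq> {\<zero>}"
    proof -
      have "M \<subseteq> N \<inter> B" using N_Int_A B(2) by blast
      then show ?thesis using M_zero M_nonzero by blast
    qed
    show "inv x \<in> B" if "x \<in> B" "x \<notin> N \<inter> B" for x using inverse_in_overring[OF B] that by blast
    show "P = N \<inter> B" if "primeideal P (Q\<lparr>carrier := B\<rparr>)" "P \<noteq> {\<zero>}" for P by (rule prime[OF that])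
  qed
qed

end

section \<open>The total ring of fractions is a field\<close>

context cring_with_subring
begin

text \<open>The product of the denominators of finitely many generators. This is applied before Q is
  known to be a field, so the denominator is provided as a unit of Q.\<close>

lemma integral_closure_conductor:
  assumes tot: "total_ring_of_fractions Q A" and fin: "finite_integral_closure Q A"
  obtains t where "t \<in> A" "t \<in> Units Q" "\<And>x. x \<in> integral_closure Q A \<Longrightarrow> t \<otimes> x \<in> A"
proof -
  let ?Rb = "integral_closure Q A"
  have Rbc: "?Rb \<subseteq> carrier Q" by (auto simp: integral_closure_def)
  obtain G where G: "finite G" "G \<subseteq> ?Rb"
    and GN: "\<And>N. submodule N S (V\<lparr>carrier := ?Rb\<rparr>) \<Longrightarrow> G \<subseteq> N \<Longrightarrow> N = ?Rb"
    and md: "module S (V\<lparr>carrier := ?Rb\<rparr>)"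
    using fin unfolding finite_integral_closure_def finitely_generated_module_def by auto
  have Rs: "submodule ?Rb S V"
    using module.module_incl_imp_submodule[OF regular_module_module _ md] Rbc by simp
  have "\<exists>t\<in>A \<inter> Units Q. \<forall>g\<in>G. t \<otimes> g \<in> A"
    using G
  proof (induct G)
    case empty
    then show ?case by (intro bexI[of _ \<one>]) auto
  next
    case (insert g G)
    then obtain t where t: "t \<in> A" "t \<in> Units Q" "\<And>g. g \<in> G \<Longrightarrow> t \<otimes> g \<in> A" by auto
    have gc: "g \<in> carrier Q" using insert Rbc by blast
    obtain a s where as: "a \<in> A" "s \<in> nonzerodivisors S" "g = a \<otimes> inv s"
      using tot gc unfolding total_ring_of_fractions_def by blast
    have s: "s \<in> A" "s \<in> Units Q"
      using as(2) tot by (auto simp: nonzerodivisors_def total_ring_of_fractions_def)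
    have c: "a \<in> carrier Q" "s \<in> carrier Q" "t \<in> carrier Q" using as s t A_sub by auto
    have "t \<otimes> s \<otimes> g = t \<otimes> a \<otimes> (s \<otimes> inv s)" unfolding as(3) using c Units_inv_closed[OF s(2)] by algebra
    then have "t \<otimes> s \<otimes> g \<in> A" using s(2) c A_mult[OF t(1) as(1)] by simp
    moreover have "t \<otimes> s \<otimes> h \<in> A" if h: "h \<in> G" for h
    proof -
      have hc: "h \<in> carrier Q" using insert(4) h Rbc by blast
      have "t \<otimes> s \<otimes> h = s \<otimes> (t \<otimes> h)" using c hc by (simp add: m_ac)
      then show ?thesis using A_mult[OF s(1) t(3)[OF h]] by simp
    qed
    ultimately show ?case using A_mult[OF t(1) s(1)] Units_m_closed[OF t(2) s(2)] by (intro bexI[of _ "t \<otimes> s"]) auto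
  qed
  then obtain t where t: "t \<in> A" "t \<in> Units Q" "\<And>g. g \<in> G \<Longrightarrow> t \<otimes> g \<in> A" by auto
  have tc: "t \<in> carrier Q" by (rule A_sub[OF t(1)])
  \<comment> \<open>The elements cleared by t form a submodule containing the generators, hence
    everything.\<close>
  let ?N = "{x \<in> ?Rb. x \<otimes> t \<in> A}"
  have "submod Q A ?N" using Rs submodule_iff by (intro submod_preimage submod_A tc) auto
  then have "submodule ?N S (V\<lparr>carrier := ?Rb\<rparr>)"
    using Rs submodule_iff by (intro submodule_of_submodule[OF regular_module_module]) auto
  moreover have "G \<subseteq> ?N"
  proof
    fix g assume g: "g \<in> G"
    then have "g \<in> carrier Q" using G(2) Rbc by blast
    then show "g \<in> ?N" using g G(2) t(3)[OF g] m_comm[OF tc] by auto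
  qed
  ultimately have N: "?N = ?Rb" by (rule GN)
  show thesis
  proof (rule that[OF t(1,2)])
    fix x assume x: "x \<in> ?Rb"
    then have "x \<otimes> t \<in> A" using N by blast
    then show "t \<otimes> x \<in> A" using m_comm[OF tc, of x] x Rbc by auto
  qed
qed

section \<open>Primes of a one-dimensional local ring\<close>

lemma prime_chain_length:
  assumes "krull_dim S = 1" and "primeideal P0 S" "primeideal P1 S" "primeideal P2 S" "P0 \<subset> P1" "P1 \<subset> P2"
  shows False
proof -
  define P where "P i = (if i = 0 then P0 else if i = 1 then P1 else P2)" for i :: nat
  have "\<forall>i\<le>2. primeideal (P i) S" using assms by (auto simp: P_def)
  moreover have "\<forall>i<2. P i \<subset> P (Suc i)" using assms by (auto simp: P_def less_2_cases_iff)
  ultimately have "enat 2 \<le> krull_dim S" unfolding krull_dim_def by (intro Sup_upper) blast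
  then show False using assms(1) by (simp add: one_enat_def)
qed

lemma local_ring_prime_subset:
  assumes "local_ring S" "maximalideal m S" "primeideal P S"
  shows "P \<subseteq> m"
proof -
  interpret S: cring S by (rule S_cring)
  interpret P: primeideal P S by (rule assms(3))
  have "\<one> \<notin> P" using P.one_imp_carrier P.I_notcarr by auto
  then obtain M where "maximalideal M S" "P \<subseteq> M" using S.exists_maximalideal[OF P.is_ideal] by auto
  then show ?thesis using assms(1,2) unfolding local_ring_def by blast
qed

text \<open>A prime disjoint from the displayed set would be strictly contained in \<open>m\<close>, and every prime
  above it containing \<open>x\<close> would be \<open>m\<close>, so a power of \<open>a\<close> would lie in the set.\<close>

lemma power_divisible:
  assumes loc: "local_ring S" and dim: "krull_dim S = 1" and m: "maximalideal m S"
    and a: "a \<in> m" "a \<in> nonzerodivisors S" and x: "x \<in> A"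
  obtains n :: nat and s y where "s \<in> nonzerodivisors S" "y \<in> A" "x [^] n \<otimes> (s \<ominus> x \<otimes> y) = \<zero>"
proof -
  interpret S: cring S by (rule S_cring)
  interpret m: maximalideal m S by (rule m)
  have aA: "a \<in> A" using a by (simp add: nonzerodivisors_def)
  have xc: "x \<in> carrier Q" by (rule A_sub[OF x])
  have nzdA: "s \<in> A" if "s \<in> nonzerodivisors S" for s using that by (simp add: nonzerodivisors_def)
  have nzd_mult: "s \<otimes> t \<in> nonzerodivisors S" if s: "s \<in> nonzerodivisors S" and t: "t \<in> nonzerodivisors S" for s t
  proof -
    have st: "\<forall>z\<in>A. s \<otimes> z = \<zero> \<longrightarrow> z = \<zero>" "\<forall>z\<in>A. t \<otimes> z = \<zero> \<longrightarrow> z = \<zero>"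
      using s t by (simp_all add: nonzerodivisors_def)
    have "z = \<zero>" if z: "z \<in> A" "s \<otimes> t \<otimes> z = \<zero>" for z
    proof -
      have "s \<otimes> (t \<otimes> z) = \<zero>"
        using z(2) m_assoc[OF A_sub[OF nzdA[OF s]] A_sub[OF nzdA[OF t]] A_sub[OF z(1)]] by simp
      then have "t \<otimes> z = \<zero>" using st(1) A_mult[OF nzdA[OF t] z(1)] by blast
      then show ?thesis using st(2) z(1) by blast
    qed
    then show ?thesis using A_mult[OF nzdA[OF s] nzdA[OF t]] by (simp add: nonzerodivisors_def)
  qed
  have nzd_one: "\<one> \<in> nonzerodivisors S" using A_sub by (simp add: nonzerodivisors_def)
  have nzd_pow: "a [^] (k::nat) \<in> nonzerodivisors S" for k
    by (induct k) (simp_all add: nzd_one nzd_mult a(2))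
  \<comment> \<open>\<open>\<zero> \<in> T\<close> says that x^n s = x^(n+1) y, so in Q the power
    x^n is a multiple of x^(n+1).\<close>
  define T where "T = {x [^] n \<otimes> (s \<ominus> x \<otimes> y) | (n::nat) s y. s \<in> nonzerodivisors S \<and> y \<in> A}"
  have TI: "s \<ominus> x \<otimes> y \<in> T" if "s \<in> nonzerodivisors S" "y \<in> A" for s y
  proof -
    have "s \<ominus> x \<otimes> y = x [^] (0::nat) \<otimes> (s \<ominus> x \<otimes> y)" using A_sub[OF nzdA[OF that(1)]] A_sub[OF that(2)] xc by simp
    then show ?thesis unfolding T_def using that by blast
  qed
  have "\<zero> \<in> T"
  proof (rule ccontr)
    assume "\<zero> \<notin> T"
    obtain P where P: "primeideal P S" "P \<inter> T = {}"
    proof (rule S.exists_primeideal_disjoint[of "{\<zero>}" T])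
      show "ideal {\<zero>} S" using S.zeroideal by simp
      show "{\<zero>} \<inter> T = {}" using \<open>\<zero> \<notin> T\<close> by blast
      show "T \<subseteq> carrier S" unfolding T_def using x nzdA by (auto intro!: A_mult A_pow A_diff)
      show "\<one>\<^bsub>S\<^esub> \<in> T" using TI[OF nzd_one A_zero] xc by (simp add: a_minus_def)
      fix u v assume "u \<in> T" "v \<in> T"
      then obtain n s y k t z where u: "s \<in> nonzerodivisors S" "y \<in> A" "u = x [^] (n::nat) \<otimes> (s \<ominus> x \<otimes> y)"
        and v: "t \<in> nonzerodivisors S" "z \<in> A" "v = x [^] (k::nat) \<otimes> (t \<ominus> x \<otimes> z)" unfolding T_def by blast
      \<comment> \<open>From (s - x y)(t - x z) = s t - x w; this makes T closed under
        products.\<close>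
      let ?w = "(s \<otimes> z \<oplus> t \<otimes> y) \<ominus> x \<otimes> y \<otimes> z"
      have c: "s \<in> carrier Q" "t \<in> carrier Q" "y \<in> carrier Q" "z \<in> carrier Q" "x [^] n \<in> carrier Q" "x [^] k \<in> carrier Q"
        using u v nzdA A_sub xc by auto
      have "u \<otimes> v = (x [^] n \<otimes> x [^] k) \<otimes> (s \<otimes> t \<ominus> x \<otimes> ?w)" unfolding u v using c xc by algebra
      also have "x [^] n \<otimes> x [^] k = x [^] (n + k)" by (rule nat_pow_mult[OF xc])
      finally have "u \<otimes> v = x [^] (n + k) \<otimes> (s \<otimes> t \<ominus> x \<otimes> ?w)" .
      moreover have "?w \<in> A" using u v x nzdA by (intro A_diff A_add A_mult) auto
      ultimately have "u \<otimes> v \<in> T" unfolding T_def using nzd_mult[OF u(1) v(1)] by blast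
      then show "u \<otimes>\<^bsub>S\<^esub> v \<in> T" by simp
    qed blast
    interpret P: primeideal P S by (rule P(1))
    have Ps: "submod Q A P" using ideal_iff P.is_ideal by blast
    have xP: "x \<notin> P"
    proof
      assume "x \<in> P"
      moreover have "x = x [^] (1::nat) \<otimes> (\<one> \<ominus> x \<otimes> \<zero>)" using xc by (simp add: a_minus_def)
      then have "x \<in> T" unfolding T_def using nzd_one A_zero by blast
      ultimately show False using P(2) by blast
    qed
    have nzP: "s \<notin> P" if "s \<in> nonzerodivisors S" for s
    proof
      assume "s \<in> P"
      moreover have "s \<in> T" using TI[OF that A_zero] xc A_sub[OF nzdA[OF that]] by (simp add: a_minus_def)
      ultimately show False using P(2) by blast
    qed
    define J where "J = {p \<oplus> y \<otimes> x | p y. p \<in> P \<and> y \<in> A}"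
    note JJ = submod_sum[OF Ps xc, folded J_def]
    have "J \<subseteq> A" unfolding J_def using P.a_subset x by (auto intro!: A_add A_mult)
    then have Ji: "ideal J S" using JJ(1) ideal_iff by blast
    \<comment> \<open>If P + (x) missed all powers of a, a prime above it would miss them too and
      lie strictly between P and m.\<close>
    have "\<exists>k::nat. a [^] k \<in> J"
    proof (rule ccontr)
      assume no: "\<not> (\<exists>k::nat. a [^] k \<in> J)"
      obtain P' where P': "primeideal P' S" "J \<subseteq> P'" "P' \<inter> range (\<lambda>k::nat. a [^] k) = {}"
      proof (rule S.exists_primeideal_disjoint[OF Ji, of "range (\<lambda>k::nat. a [^] k)"])
        show "J \<inter> range (\<lambda>k::nat. a [^] k) = {}" using no by blast
        show "range (\<lambda>k::nat. a [^] k) \<subseteq> carrier S" using A_pow[OF aA] by auto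
        show "\<one>\<^bsub>S\<^esub> \<in> range (\<lambda>k::nat. a [^] k)" using nat_pow_0[of a] rangeI[of "\<lambda>k::nat. a [^] k" 0] by simp
        fix u v assume "u \<in> range (\<lambda>k::nat. a [^] k)" "v \<in> range (\<lambda>k::nat. a [^] k)"
        then obtain k l :: nat where "u = a [^] k" "v = a [^] l" by blast
        then have "u \<otimes>\<^bsub>S\<^esub> v = a [^] (k + l)" using nat_pow_mult[OF A_sub[OF aA]] by simp
        then show "u \<otimes>\<^bsub>S\<^esub> v \<in> range (\<lambda>k::nat. a [^] k)" by blast
      qed blast
      have "a [^] (1::nat) \<notin> P'" using P'(3) by blast
      then have "a \<notin> P'" using A_sub[OF aA] by simp
      moreover have "P' \<subseteq> m" by (rule local_ring_prime_subset[OF loc m P'(1)])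
      ultimately have "P' \<subset> m" using a(1) by blast
      moreover have "P \<subset> P'" using JJ(2,3) P'(2) xP by blast
      ultimately show False
        using prime_chain_length[OF dim P(1) P'(1) S.maximalideal_prime[OF m]] by blast
    qed
    then obtain k :: nat and p y where k: "p \<in> P" "y \<in> A" "a [^] k = p \<oplus> y \<otimes> x" unfolding J_def by blast
    have c: "p \<in> carrier Q" "y \<in> carrier Q" using submodD(1)[OF Ps k(1)] A_sub[OF k(2)] by auto
    \<comment> \<open>The left side lies in T, because a^k is a nonzerodivisor, and the right side
      lies in P.\<close>
    have "a [^] k \<ominus> x \<otimes> y = p" unfolding k(3) using c xc by algebra
    then have "p \<in> T" using TI[OF nzd_pow k(2), of k] by simp
    then show False using k(1) P(2) by blast
  qed
  then show thesis using that unfolding T_def by auto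
qed

end

text \<open>A nonzero x in A becomes a unit of Q: \<open>power_divisible\<close> gives x^k = x^k w
  with w = x y / s, so w^k is idempotent. If it is \<one>, x is invertible; if it is \<zero>, x is
  nilpotent and hence zero. The closure being local settles the idempotents, its finiteness the
  nilpotents.\<close>

lemma (in noetherian_subring) total_ring_of_fractions_field:
  assumes tot: "total_ring_of_fractions Q A" and loc: "local_ring S" and dim: "krull_dim S = 1"
    and m: "maximalideal m S" and a: "a \<in> m" "a \<in> nonzerodivisors S"
    and closure_local: "local_ring (Q\<lparr>carrier := integral_closure Q A\<rparr>)"
    and fin: "finite_integral_closure Q A"
  shows "field Q"
proof -
  interpret S: cring S by (rule S_cring)
  interpret m: maximalideal m S by (rule m)
  let ?Rb = "integral_closure Q A"
  have nz: "\<one> \<noteq> \<zero>"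
  proof
    assume "\<one> = \<zero>"
    then have "\<one>\<^bsub>S\<^esub> \<in> m" using additive_subgroup.zero_closed[OF m.additive_subgroup_axioms] by simp
    then show False using m.one_imp_carrier m.I_notcarr by simp
  qed
  have nzdU: "s \<in> Units Q" if "s \<in> nonzerodivisors S" for s
    using tot that by (auto simp: total_ring_of_fractions_def)
  have nzdA: "s \<in> A" if "s \<in> nonzerodivisors S" for s using that by (simp add: nonzerodivisors_def)
  have aU: "a \<in> Units Q" by (rule nzdU[OF a(2)])
  have aA: "a \<in> A" by (rule nzdA[OF a(2)])
  have ac: "a \<in> carrier Q" "inv a \<in> carrier Q" using aU by auto
  let ?QR = "Q\<lparr>carrier := ?Rb\<rparr>"
  obtain n where n: "maximalideal n ?QR" using closure_local by (auto simp: local_ring_def)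
  interpret n: maximalideal n ?QR by (rule n)
  have one_n: "\<one> \<notin> n" using n.one_imp_carrier n.I_notcarr by auto
  have inRb: "x \<in> ?Rb" if "x \<in> carrier Q" "x [^] k \<in> power_span x k" for x k
    using that integral_closure_iff[OF nz] by blast
  have idem: "e = \<zero> \<or> e = \<one>" if e: "e \<in> carrier Q" "e \<otimes> e = e" for e
  proof -
    have idRb: "f \<in> ?Rb" if f: "f \<in> carrier Q" "f \<otimes> f = f" for f
    proof (rule inRb[OF f(1), of 2])
      have "f [^] (1::nat) \<in> power_span f 2" by (rule power_in_span[OF f(1)]) simp
      then show "f [^] (2::nat) \<in> power_span f 2" using f by (simp add: numeral_2_eq_2)
    qed
    \<comment> \<open>e and f = \<one> - e are integral with e f = \<zero>. They cannot both lie in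
      n, and the one outside n is a unit of the closure, which annihilates the other.\<close>
    let ?f = "\<one> \<ominus> e"
    have fc: "?f \<in> carrier Q" using e by simp
    have ef: "e \<otimes> ?f = \<zero>"
    proof -
      have "e \<otimes> ?f = e \<ominus> e \<otimes> e" using e(1) by algebra
      then show ?thesis using e by (simp add: a_minus_def r_neg)
    qed
    have "?f \<otimes> ?f = ?f \<ominus> e \<otimes> ?f" using e(1) by algebra
    then have "?f \<otimes> ?f = ?f" using ef fc minus_equality[of \<zero> \<zero>] by (simp add: a_minus_def)
    then have fR: "?f \<in> ?Rb" by (rule idRb[OF fc])
    have eR: "e \<in> ?Rb" by (rule idRb[OF e])
    have ann: "z = \<zero>" if z: "w \<in> ?Rb" "w \<notin> n" "z \<in> carrier Q" "w \<otimes> z = \<zero>" for w z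
    proof -
      have "w \<in> Units ?QR" using local_ring_unit[OF closure_local n] z by simp
      then obtain y where y: "y \<in> ?Rb" "y \<otimes> w = \<one>" by (auto simp: Units_def)
      have c: "y \<in> carrier Q" "w \<in> carrier Q" using y z by (auto simp: integral_closure_def)
      have "z = (y \<otimes> w) \<otimes> z" using y z by simp
      also have "\<dots> = y \<otimes> (w \<otimes> z)" using c z by (simp add: m_assoc)
      finally show ?thesis using z c by simp
    qed
    show ?thesis
    proof (cases "e \<in> n")
      case False
      have "?f = \<zero>" by (rule ann[OF eR False fc ef])
      moreover have "e = \<one> \<ominus> ?f" using e(1) by algebra
      moreover have "\<one> \<ominus> \<zero> = \<one>" by algebra
      ultimately show ?thesis by simp
    next
      case True
      have "?f \<notin> n"
      proof
        assume "?f \<in> n"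
        then have "e \<oplus> ?f \<in> n" using additive_subgroup.a_closed[OF n.additive_subgroup_axioms True] by simp
        moreover have "e \<oplus> ?f = \<one>" using e(1) by algebra
        ultimately show False using one_n by simp
      qed
      then show ?thesis using ann[OF fR _ e(1)] ef m_comm[OF e(1) fc] by simp
    qed
  qed
  have reduced: "x = \<zero>" if x: "x \<in> A" "x [^] (k::nat) = \<zero>" for x k
  proof -
    have xc: "x \<in> carrier Q" by (rule A_sub[OF x(1)])
    obtain t where t: "t \<in> A" "t \<in> Units Q" "\<And>y. y \<in> ?Rb \<Longrightarrow> t \<otimes> y \<in> A"
      using integral_closure_conductor[OF tot fin] by blast
    have tc: "t \<in> carrier Q" using t by blast
    \<comment> \<open>Every a^(-j) x is nilpotent, so integral, and t clears it. The principal
      ideals of the z_j ascend because a z_(j+1) = z_j; once z_(j+1) = z_j c, the element \<one> - c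
      a kills z_(j+1), and it is a unit since a \<in> m.\<close>
    define z where "z j = t \<otimes> (inv a [^] j \<otimes> x)" for j :: nat
    have zA: "z j \<in> A" for j
      unfolding z_def
    proof (rule t(3), rule inRb)
      show yc: "inv a [^] j \<otimes> x \<in> carrier Q" using ac xc by simp
      have "(inv a [^] j \<otimes> x) [^] k = \<zero>"
        using nat_pow_distrib[of "inv a [^] j" x k] ac xc x(2) by simp
      then show "(inv a [^] j \<otimes> x) [^] k \<in> power_span (inv a [^] j \<otimes> x) k"
        using submodD(2)[OF power_span_submod[OF yc]] by simp
    qed
    have zc: "z j \<in> carrier Q" for j by (rule A_sub[OF zA])
    have za: "a \<otimes> z (Suc j) = z j" for j
    proof -
      have "a \<otimes> z (Suc j) = (a \<otimes> inv a) \<otimes> z j" unfolding z_def using ac tc xc by (simp add: m_ac)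
      then show ?thesis using aU zc by simp
    qed
    define Y where "Y j = (\<lambda>c. z j \<otimes> c) ` A" for j
    obtain j where j: "Y (Suc j) = Y j"
    proof (rule submod_chain_stabilizes[of Y])
      show "submod Q A (Y j)" for j unfolding Y_def by (rule submod_image[OF submod_A zc])
      show "Y j \<subseteq> A" for j unfolding Y_def using A_mult zA by blast
      show "Y j \<subseteq> Y (Suc j)" for j
      proof
        fix u assume "u \<in> Y j"
        then obtain c where c: "c \<in> A" "u = z j \<otimes> c" by (auto simp: Y_def)
        have "u = (a \<otimes> z (Suc j)) \<otimes> c" unfolding za using c(2) .
        also have "\<dots> = z (Suc j) \<otimes> (a \<otimes> c)" using zc ac A_sub[OF c(1)] by (simp add: m_ac)
        finally have "u = z (Suc j) \<otimes> (a \<otimes> c)" .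
        then show "u \<in> Y (Suc j)" unfolding Y_def using A_mult[OF aA c(1)] by blast
      qed
    qed
    have "z (Suc j) \<otimes> \<one> \<in> Y (Suc j)" unfolding Y_def using A_one by blast
    then obtain c where c: "c \<in> A" "z (Suc j) = z j \<otimes> c" unfolding j using zc by (auto simp: Y_def)
    have cc: "c \<in> carrier Q" by (rule A_sub[OF c(1)])
    have eq: "z (Suc j) = a \<otimes> z (Suc j) \<otimes> c" using c(2) za[of j] by simp
    let ?u = "\<one> \<ominus> c \<otimes> a"
    have "?u \<otimes> z (Suc j) = z (Suc j) \<ominus> a \<otimes> z (Suc j) \<otimes> c" using cc ac zc[of "Suc j"] by algebra
    also have "\<dots> = \<zero>" unfolding eq[symmetric] using zc by (simp add: a_minus_def r_neg)
    finally have uz: "?u \<otimes> z (Suc j) = \<zero>" .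
    have caM: "c \<otimes> a \<in> m" using m.I_l_closed[OF a(1), of c] c(1) by simp
    have uA: "?u \<in> A" using c(1) aA by (intro A_diff A_mult A_one)
    have "?u \<notin> m"
    proof
      assume "?u \<in> m"
      then have "?u \<oplus> c \<otimes> a \<in> m" using additive_subgroup.a_closed[OF m.additive_subgroup_axioms _ caM] by simp
      moreover have "?u \<oplus> c \<otimes> a = \<one>" using cc ac by algebra
      ultimately show False using m.one_imp_carrier m.I_notcarr by simp
    qed
    then have "?u \<in> Units S" using local_ring_unit[OF loc m, of ?u] uA by simp
    then obtain v where v: "v \<in> A" "v \<otimes> ?u = \<one>" by (auto simp: Units_def)
    have "z (Suc j) = (v \<otimes> ?u) \<otimes> z (Suc j)" using v zc by simp
    also have "\<dots> = v \<otimes> (?u \<otimes> z (Suc j))" using A_sub[OF v(1)] A_sub[OF uA] zc by (rule m_assoc)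
    finally have zj: "z (Suc j) = \<zero>" using uz A_sub[OF v(1)] by simp
    have "z i = \<zero>" if "i \<le> Suc j" for i
      using that
    proof (induct rule: inc_induct)
      case base show ?case by (rule zj)
    next
      case (step i)
      then show ?case using za[of i] ac by simp
    qed
    from this[of 0] have "z 0 = \<zero>" by simp
    then have "t \<otimes> x = t \<otimes> \<zero>" unfolding z_def using xc tc by simp
    then show ?thesis using Units_l_cancel[OF t(2) xc zero_closed] by simp
  qed
  have unit: "x \<in> Units Q" if x: "x \<in> A" "x \<noteq> \<zero>" for x
  proof -
    have xc: "x \<in> carrier Q" by (rule A_sub[OF x(1)])
    obtain k :: nat and s y where s: "s \<in> nonzerodivisors S" "y \<in> A" "x [^] k \<otimes> (s \<ominus> x \<otimes> y) = \<zero>"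
      by (rule power_divisible[OF loc dim m a x(1)])
    have sU: "s \<in> Units Q" by (rule nzdU[OF s(1)])
    have c: "s \<in> carrier Q" "inv s \<in> carrier Q" "y \<in> carrier Q" "x [^] k \<in> carrier Q" using sU A_sub[OF s(2)] xc by auto
    define w where "w = x \<otimes> (y \<otimes> inv s)"
    have wc: "w \<in> carrier Q" using xc c by (simp add: w_def)
    have "x [^] k \<otimes> s \<ominus> x [^] k \<otimes> (x \<otimes> y) = \<zero>" using s(3) c xc by algebra
    then have "x [^] k \<otimes> s = x [^] k \<otimes> (x \<otimes> y)" using c xc by simp
    then have "x [^] k \<otimes> s \<otimes> inv s = x [^] k \<otimes> (x \<otimes> y) \<otimes> inv s" by simp
    then have xw: "x [^] k = x [^] k \<otimes> w" using sU c xc by (simp add: m_assoc w_def)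
    have xwn: "x [^] k = x [^] k \<otimes> w [^] i" for i :: nat
    proof (induct i)
      case 0 then show ?case using c by simp
    next
      case (Suc i)
      have "x [^] k \<otimes> w [^] Suc i = (x [^] k \<otimes> w [^] i) \<otimes> w" using c wc by (simp add: m_assoc)
      then show ?case using Suc xw by simp
    qed
    \<comment> \<open>The exponent k makes e a multiple of x^k, and x^k e = x^k; together these give
      e e = e.\<close>
    define e where "e = w [^] k"
    have ec: "e \<in> carrier Q" using wc by (simp add: e_def)
    have ey: "e = x [^] k \<otimes> (y \<otimes> inv s) [^] k" unfolding e_def w_def using c xc by (intro nat_pow_distrib) auto
    have yk: "(y \<otimes> inv s) [^] k \<in> carrier Q" using c by simp
    have "e \<otimes> e = (x [^] k \<otimes> (y \<otimes> inv s) [^] k) \<otimes> e" using ey by simp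
    also have "\<dots> = (x [^] k \<otimes> e) \<otimes> (y \<otimes> inv s) [^] k" using c(4) yk ec by (simp only: m_ac m_closed)
    also have "\<dots> = e" using xwn[of k] ey by (simp add: e_def)
    finally have "e = \<zero> \<or> e = \<one>" by (rule idem[OF ec])
    then have e1: "e = \<one>"
    proof
      assume "e = \<zero>"
      then have "x [^] k = \<zero>" using xwn[of k] c by (simp add: e_def)
      then show ?thesis using reduced[OF x(1)] x(2) by blast
    qed
    have "x [^] k \<otimes> (y \<otimes> inv s) [^] k = \<one>" using ey e1 by simp
    then have xkU: "x [^] k \<in> Units Q" using c yk m_comm[OF c(4) yk] by (auto simp: Units_def)
    have "x [^] k \<otimes> w = x [^] k \<otimes> \<one>" using xw c by simp
    then have "w = \<one>" using Units_l_cancel[OF xkU wc one_closed] by simp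
    then have "x \<otimes> (y \<otimes> inv s) = \<one>" "(y \<otimes> inv s) \<otimes> x = \<one>" using m_comm[OF xc, of "y \<otimes> inv s"] c by (auto simp: w_def)
    then show ?thesis using xc c by (auto simp: Units_def)
  qed
  have "q \<in> Units Q" if q: "q \<in> carrier Q" "q \<noteq> \<zero>" for q
  proof -
    obtain b s where bs: "b \<in> A" "s \<in> nonzerodivisors S" "q = b \<otimes> inv s"
      using tot q unfolding total_ring_of_fractions_def by blast
    have "b \<noteq> \<zero>" using bs q nzdU[OF bs(2)] by auto
    then show ?thesis unfolding bs(3) by (intro Units_m_closed unit[OF bs(1)] Units_inv_Units nzdU[OF bs(2)])
  qed
  moreover have "\<zero> \<notin> Units Q" using nz by (auto simp: Units_def)
  ultimately have "Units Q = carrier Q - {\<zero>}" by blast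
  then show ?thesis by (intro cring_fieldI is_cring)
qed

section \<open>Canonical ideals of birational overrings\<close>

context one_dim_domain_local_closure
begin

context
  fixes C B c
  assumes C: "canonical_ideal Q A M C" and B: "subcring B Q" "A \<subseteq> B" "B \<subseteq> Rb"
    and c: "c \<in> carrier Q" "c \<noteq> \<zero>"
begin

interpretation C: canonical_ideal Q A M C by (rule C)
interpretation B: one_dim_domain Q B "N \<inter> B" by (rule overring_one_dim_domain[OF B])

text \<open>C : B is Hom(B, C) inside Q, the B-module that inherits canonicity from C. The scalar c
  leaves the isomorphism class alone and is available for moving the ideal to a prescribed position
  between B and Rb.\<close>

abbreviation (input) "D \<equiv> colon Q C B"
abbreviation (input) "K \<equiv> (\<lambda>x. c \<otimes> x) ` colon Q C B"

lemma D_C: "D \<subseteq> C"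
proof
  fix x assume "x \<in> D"
  then have "x \<in> carrier Q" "x \<otimes> \<one> \<in> C" using B.A_one unfolding colon_def by blast+
  then show "x \<in> C" by simp
qed

lemma D_submod: "submod Q B D"
proof (rule submodI)
  note A = submodD[OF colon_submod[OF C.C_submod, of B]]
  have Bc: "B \<subseteq> carrier Q" using B.A_sub by blast
  show "D \<subseteq> carrier Q" "\<zero> \<in> D" "\<And>x y. x \<in> D \<Longrightarrow> y \<in> D \<Longrightarrow> x \<oplus> y \<in> D" using A(1-3)[OF Bc] by blast+
  fix b x assume b: "b \<in> B" and x: "x \<in> D"
  have xc: "x \<in> carrier Q" and bc: "b \<in> carrier Q" using x b B.A_sub by (auto simp: colon_def)
  have "b \<otimes> x \<otimes> e \<in> C" if e: "e \<in> B" for e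
  proof -
    have "b \<otimes> x \<otimes> e = x \<otimes> (b \<otimes> e)" using xc bc B.A_sub[OF e] by (simp add: m_ac)
    then show ?thesis using x B.A_mult[OF b e] by (simp add: colon_def)
  qed
  then show "b \<otimes> x \<in> D" using xc bc by (simp add: colon_def)
qed

lemma K_submod: "submod Q B K"
  by (rule B.submod_image[OF D_submod c(1)])

lemma K_D: "z \<in> K \<Longrightarrow> inv c \<otimes> z \<in> D"
  using inv_nonzero[OF c] c submodD(1)[OF D_submod] by (auto simp: m_assoc[symmetric])

lemma K_fractional: "B.fractional K"
proof -
  obtain t where t: "t \<in> carrier Q" "t \<noteq> \<zero>" "\<And>x. x \<in> C \<Longrightarrow> t \<otimes> x \<in> A" using C.C_frac by (auto simp: fractional_def)
  note ic = inv_nonzero[OF c]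
  have "t \<otimes> inv c \<otimes> z \<in> B" if z: "z \<in> K" for z
  proof -
    have "z \<in> carrier Q" by (rule submodD(1)[OF K_submod z])
    then have "t \<otimes> inv c \<otimes> z = t \<otimes> (inv c \<otimes> z)" using t ic by (simp add: m_assoc)
    then show ?thesis using t(3)[of "inv c \<otimes> z"] K_D[OF z] D_C B(2) by auto
  qed
  moreover have "t \<otimes> inv c \<noteq> \<zero>" using integral[of t "inv c"] t ic by blast
  ultimately show ?thesis unfolding B.fractional_def using K_submod t(1) ic(1) by blast
qed

text \<open>Divided by c, a map to Q / K becomes an A-linear map to Q / C, because D \<subseteq> C,
  and so it is multiplication by some q modulo C. The congruence holds at b x for all b in B as
  well, and this improves it from C to C : B.\<close>

lemma K_baer: "B.baer K"
  unfolding B.baer_def B.baer_on_def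
proof (intro allI impI, elim conjE)
  fix I \<phi> assume I: "submod Q B I" "I \<subseteq> B" and \<phi>: "B.linear_mod K V I \<phi>"
  note L = B.linear_modD[OF \<phi>, unfolded regular_module_sel]
  note ic = inv_nonzero[OF c]
  have IA: "submod Q A I" by (rule submod_mono[OF I(1) B(2)])
  have If: "fractional I" using fractional_subset[OF Rb_fractional IA] I(2) B(3) by blast
  have inC: "inv c \<otimes> (u \<ominus> v) \<in> C" if "B.eqmod K u v" for u v
    using K_D[of "u \<ominus> v"] D_C that by (auto simp: B.eqmod_def)
  have "linear_mod C V I (\<lambda>x. inv c \<otimes> \<phi> x)"
    unfolding linear_mod_def regular_module_sel
  proof (intro conjI ballI)
    fix x assume x: "x \<in> I"
    show "inv c \<otimes> \<phi> x \<in> carrier Q" using L(1)[OF x] ic by simp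
    {
      fix y assume y: "y \<in> I"
      note cc = L(1)[OF x] L(1)[OF y] L(1)[OF submodD(3)[OF I(1) x y]] ic(1)
      have "inv c \<otimes> (\<phi> (x \<oplus> y) \<ominus> (\<phi> x \<oplus> \<phi> y)) = inv c \<otimes> \<phi> (x \<oplus> y) \<ominus> (inv c \<otimes> \<phi> x \<oplus> inv c \<otimes> \<phi> y)"
        using cc by algebra
      then show "eqmod C (inv c \<otimes> \<phi> (x \<oplus> y)) (inv c \<otimes> \<phi> x \<oplus> inv c \<otimes> \<phi> y)"
        using inC[OF L(2)[OF x y]] cc by (simp add: eqmod_def)
    }
    fix a assume a: "a \<in> A"
    then have aB: "a \<in> B" using B(2) by blast
    note cc = L(1)[OF x] L(1)[OF submodD(4)[OF I(1) aB x]] ic(1) A_sub[OF a]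
    have "inv c \<otimes> (\<phi> (a \<otimes> x) \<ominus> a \<otimes> \<phi> x) = inv c \<otimes> \<phi> (a \<otimes> x) \<ominus> a \<otimes> (inv c \<otimes> \<phi> x)"
      using cc by algebra
    then show "eqmod C (inv c \<otimes> \<phi> (a \<otimes> x)) (a \<otimes> (inv c \<otimes> \<phi> x))"
      using inC[OF L(3)[OF aB x]] cc by (simp add: eqmod_def)
  qed
  then obtain q where q: "q \<in> carrier Q" "\<And>x. x \<in> I \<Longrightarrow> eqmod C (inv c \<otimes> \<phi> x) (q \<otimes> x)"
    using baer_onD[OF baer_fractional[OF C.C_submod C.baer_C If]] by blast
  show "\<exists>q\<in>carrier Q. \<forall>x\<in>I. B.eqmod K (\<phi> x) (q \<otimes> x)"
  proof (intro bexI ballI)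
    show "c \<otimes> q \<in> carrier Q" using c q by simp
    fix x assume x: "x \<in> I"
    have xc: "x \<in> carrier Q" by (rule submodD(1)[OF I(1) x])
    let ?w = "inv c \<otimes> \<phi> x \<ominus> q \<otimes> x"
    have "?w \<in> D"
      unfolding colon_def
    proof (intro CollectI conjI ballI)
      show "?w \<in> carrier Q" using L(1)[OF x] ic q xc by simp
      fix b assume b: "b \<in> B"
      note bx = submodD(4)[OF I(1) b x]
      note cc = L(1)[OF x] L(1)[OF bx] ic(1) B.A_sub[OF b] xc q(1)
      \<comment> \<open>The first bracket is the congruence at b x, the second the B-linearity of
        \<phi> modulo K.\<close>
      have "?w \<otimes> b = (inv c \<otimes> \<phi> (b \<otimes> x) \<ominus> q \<otimes> (b \<otimes> x)) \<ominus> inv c \<otimes> (\<phi> (b \<otimes> x) \<ominus> b \<otimes> \<phi> x)"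
        using cc by algebra
      moreover have "inv c \<otimes> \<phi> (b \<otimes> x) \<ominus> q \<otimes> (b \<otimes> x) \<in> C" using q(2)[OF bx] by (simp add: eqmod_def)
      ultimately show "?w \<otimes> b \<in> C" using submod_diff[OF C.C_submod] inC[OF L(3)[OF b x]] by simp
    qed
    then have "c \<otimes> ?w \<in> K" by (rule imageI)
    moreover have "c \<otimes> ?w = (c \<otimes> inv c) \<otimes> \<phi> x \<ominus> c \<otimes> q \<otimes> x" using c(1) ic(1) L(1)[OF x] q(1) xc by algebra
    ultimately show "B.eqmod K (\<phi> x) (c \<otimes> q \<otimes> x)" unfolding B.eqmod_def using ic L(1)[OF x] c q xc by simp
  qed
qed

text \<open>Duality over A computes the socle over B. As N \<inter> B is smaller than B, some s lies
  in C : (N \<inter> B) outside D. The dual of Z = D + B s lies in the dual B of D, contains N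
  \<inter> B, and contains no unit of B; so it is N \<inter> B, and dualising once more gives C : (N
  \<inter> B) = Z.\<close>

lemma K_canonical: "canonical_module (Q\<lparr>carrier := B\<rparr>) (V\<lparr>carrier := K\<rparr>)"
proof -
  let ?N = "N \<inter> B"
  note ic = inv_nonzero[OF c]
  have BA: "submod Q A B" by (rule submod_mono[OF B.submod_A B(2)])
  have Bf: "fractional B" by (rule fractional_subset[OF Rb_fractional BA B(3)])
  have NA: "submod Q A ?N" by (rule submod_mono[OF B.M_submod B(2)])
  have Nf: "fractional ?N" by (rule fractional_subset[OF Bf NA]) blast
  have "\<not> colon Q C ?N \<subseteq> D"
  proof
    assume "colon Q C ?N \<subseteq> D"
    then have "B = ?N" by (intro C.dual_reflects Bf NA B.M_nonzero) auto
    then show False using B.A_one B.one_notin_M by blast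
  qed
  then obtain s where s: "s \<in> colon Q C ?N" "s \<notin> D" by blast
  have sc: "s \<in> carrier Q" and sN: "\<And>m. m \<in> ?N \<Longrightarrow> s \<otimes> m \<in> C" using s(1) unfolding colon_def by blast+
  let ?Z = "{x \<oplus> b \<otimes> s | x b. x \<in> D \<and> b \<in> B}"
  note ZZ = B.submod_sum[OF D_submod sc]
  have NZ: "?N \<subseteq> colon Q C ?Z"
  proof
    fix m assume m: "m \<in> ?N"
    have mc: "m \<in> carrier Q" by (rule B.M_sub[OF m])
    have "m \<otimes> z \<in> C" if z: "z \<in> ?Z" for z
    proof -
      obtain x b where z: "x \<in> D" "b \<in> B" "z = x \<oplus> b \<otimes> s" using z by blast
      have xc: "x \<in> carrier Q" by (rule submodD(1)[OF D_submod z(1)])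
      have "m \<otimes> z = x \<otimes> m \<oplus> s \<otimes> (b \<otimes> m)" unfolding z(3) using mc xc sc B.A_sub[OF z(2)] by algebra
      moreover have "x \<otimes> m \<in> C" using z(1) m by (simp add: colon_def)
      moreover have "s \<otimes> (b \<otimes> m) \<in> C" by (rule sN[OF submodD(4)[OF B.M_submod z(2) m]])
      ultimately show ?thesis using submodD(3)[OF C.C_submod] by simp
    qed
    then show "m \<in> colon Q C ?Z" using mc by (simp add: colon_def)
  qed
  have Z_N: "colon Q C ?Z \<subseteq> ?N"
  proof
    fix y assume y: "y \<in> colon Q C ?Z"
    have "colon Q C ?Z \<subseteq> colon Q C D" by (rule C.dual_antimono[OF ZZ(2)])
    moreover have "colon Q C D = B" by (rule C.double_dual[OF Bf]) (use B.A_one one_not_zero in blast)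
    ultimately have yB: "y \<in> B" using y by blast
    have yc: "y \<in> carrier Q" by (rule B.A_sub[OF yB])
    show "y \<in> ?N"
    \<comment> \<open>A unit y of B in the dual of Z would give s b = y (y^(-1) b s) \<in> C for all
      b, that is s \<in> D.\<close>
    proof (rule ccontr)
      assume yN: "y \<notin> ?N"
      then have y0: "y \<noteq> \<zero>" using B.M_zero by blast
      have iy: "inv y \<in> B" by (rule B.unit_A[OF yB yN])
      note iyc = inv_nonzero[OF yc y0]
      have "s \<otimes> b \<in> C" if b: "b \<in> B" for b
      proof -
        have bc: "b \<in> carrier Q" by (rule B.A_sub[OF b])
        have "inv y \<otimes> b \<in> B" by (rule B.A_mult[OF iy b])
        then have "\<zero> \<oplus> (inv y \<otimes> b) \<otimes> s \<in> ?Z" using submodD(2)[OF D_submod] by blast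
        then have "y \<otimes> (\<zero> \<oplus> (inv y \<otimes> b) \<otimes> s) \<in> C" using y unfolding colon_def by blast
        moreover have "y \<otimes> (\<zero> \<oplus> (inv y \<otimes> b) \<otimes> s) = (y \<otimes> inv y) \<otimes> (s \<otimes> b)" using yc iyc(1) bc sc by algebra
        ultimately show ?thesis using iyc(2) bc sc by simp
      qed
      then show False using s(2) sc by (simp add: colon_def)
    qed
  qed
  have Zf: "fractional ?Z"
  proof -
    have "?Z \<subseteq> colon Q C ?N"
    proof -
      have "colon Q C ?N \<supseteq> D" by (rule C.dual_antimono) blast
      moreover have "b \<otimes> s \<in> colon Q C ?N" if b: "b \<in> B" for b
        unfolding colon_def
      proof (intro CollectI conjI ballI)
        show "b \<otimes> s \<in> carrier Q" using B.A_sub[OF b] sc by simp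
        fix m assume m: "m \<in> ?N"
        have "b \<otimes> s \<otimes> m = s \<otimes> (b \<otimes> m)" using B.A_sub[OF b] sc B.M_sub[OF m] by (simp add: m_ac)
        then show "b \<otimes> s \<otimes> m \<in> C" using sN[OF submodD(4)[OF B.M_submod b m]] by simp
      qed
      ultimately show ?thesis using submodD(3)[OF C.dual_submod[OF NA]] by blast
    qed
    then show ?thesis
      by (rule fractional_subset[OF C.dual_fractional[OF NA B.M_nonzero] submod_mono[OF ZZ(1) B(2)]])
  qed
  have Z0: "?Z \<noteq> {\<zero>}"
  proof
    assume "?Z = {\<zero>}"
    then have "s \<in> {\<zero>}" using ZZ(3) by (simp only:)
    then show False using s(2) submodD(2)[OF D_submod] by simp
  qed
  have "?N = colon Q C ?Z" by (rule subset_antisym[OF NZ Z_N])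
  then have "colon Q C ?N = colon Q C (colon Q C ?Z)" by (rule arg_cong)
  also have "\<dots> = ?Z" by (rule C.double_dual[OF Zf Z0])
  finally have dualN: "colon Q C ?N = ?Z" .
  have K_colon: "inv c \<otimes> x \<in> colon Q C ?N" if x: "x \<in> colon Q K ?N" for x
    unfolding colon_def
  proof (intro CollectI conjI ballI)
    have xc: "x \<in> carrier Q" using x by (simp add: colon_def)
    show "inv c \<otimes> x \<in> carrier Q" using ic xc by simp
    fix m assume m: "m \<in> ?N"
    have "inv c \<otimes> x \<otimes> m = inv c \<otimes> (x \<otimes> m)" using ic xc B.M_sub[OF m] by (simp add: m_assoc)
    moreover have "x \<otimes> m \<in> K" using x m unfolding colon_def by blast
    ultimately show "inv c \<otimes> x \<otimes> m \<in> C" using K_D[of "x \<otimes> m"] D_C by auto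
  qed
  show ?thesis
  proof (rule B.canonical_moduleI[OF K_fractional K_baer])
    show "c \<otimes> s \<in> colon Q K ?N"
      unfolding colon_def[of Q K ?N]
    proof (intro CollectI conjI ballI)
      show "c \<otimes> s \<in> carrier Q" using c sc by simp
      fix m assume m: "m \<in> ?N"
      have mc: "m \<in> carrier Q" by (rule B.M_sub[OF m])
      have "s \<otimes> m \<otimes> b \<in> C" if b: "b \<in> B" for b
      proof -
        have "s \<otimes> m \<otimes> b = s \<otimes> (b \<otimes> m)" using sc mc B.A_sub[OF b] by (simp add: m_ac)
        then show ?thesis using sN[OF submodD(4)[OF B.M_submod b m]] by simp
      qed
      then have "s \<otimes> m \<in> D" using sc mc by (simp add: colon_def)
      then have "c \<otimes> (s \<otimes> m) \<in> K" by (rule imageI)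
      then show "c \<otimes> s \<otimes> m \<in> K" using c sc mc by (simp add: m_assoc)
    qed
    show "c \<otimes> s \<notin> K"
    proof
      assume "c \<otimes> s \<in> K"
      then have "inv c \<otimes> (c \<otimes> s) \<in> D" by (rule K_D)
      then show False using s(2) ic c sc by (simp add: m_assoc[symmetric])
    qed
    fix x assume x: "x \<in> colon Q K ?N"
    have xc: "x \<in> carrier Q" using x by (simp add: colon_def)
    obtain y b where yb: "y \<in> D" "b \<in> B" "inv c \<otimes> x = y \<oplus> b \<otimes> s"
      using K_colon[OF x] unfolding dualN by blast
    have yc: "y \<in> carrier Q" and bc: "b \<in> carrier Q" using submodD(1)[OF D_submod yb(1)] B.A_sub[OF yb(2)] by auto
    have "x = c \<otimes> (inv c \<otimes> x)" using c ic xc by (simp add: m_assoc[symmetric])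
    then have "x \<ominus> b \<otimes> (c \<otimes> s) = c \<otimes> (y \<oplus> b \<otimes> s) \<ominus> b \<otimes> (c \<otimes> s)" unfolding yb(3) by simp
    also have "\<dots> = c \<otimes> y" using c yc bc sc by algebra
    finally show "\<exists>b\<in>B. x \<ominus> b \<otimes> (c \<otimes> s) \<in> K" using yb(1,2) by blast
  qed
qed

text \<open>As \<one> \<in> K, each homomorphism K -> B is multiplication by its value at \<one>, an
  element of B : K. Under the assumptions such a value lies in the conductor B : Rb, which absorbs K
  \<subseteq> Rb. Conversely each conductor element is the value at \<one> of its own
  multiplication.\<close>

lemma K_far_flung:
  assumes BK: "B \<subseteq> K" and K_Rb: "K \<subseteq> Rb" and tr: "colon Q B K \<subseteq> colon Q B Rb"
  shows "far_flung_Gorenstein Q B (V\<lparr>carrier := K\<rparr>)"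
proof -
  let ?S = "Q\<lparr>carrier := B\<rparr>" and ?W = "V\<lparr>carrier := K\<rparr>"
  interpret BS: cring ?S by (rule B.S_cring)
  have nzd: "s \<in> B" "s \<noteq> \<zero>" if "s \<in> nonzerodivisors ?S" for s
  proof -
    show "s \<in> B" using that by (simp add: nonzerodivisors_def)
    show "s \<noteq> \<zero>"
    proof
      assume "s = \<zero>"
      then have "\<forall>x\<in>B. x = \<zero>" using that B.A_sub by (simp add: nonzerodivisors_def)
      then show False using B.A_one one_not_zero by blast
    qed
  qed
  have nzdI: "s \<in> nonzerodivisors ?S" if "s \<in> B" "s \<noteq> \<zero>" for s
    using that integral[of s] B.A_sub unfolding nonzerodivisors_def by auto
  have "total_ring_of_fractions Q B"
    unfolding total_ring_of_fractions_def
  proof (intro conjI ballI)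
    show "nonzerodivisors ?S \<subseteq> Units Q" using nzd B.A_sub field_Units by blast
    show "\<exists>a\<in>B. \<exists>s\<in>nonzerodivisors ?S. q = a \<otimes> inv s" if "q \<in> carrier Q" for q
      using B.fraction[OF that] nzdI by blast
  qed (rule is_cring, rule B(1))
  moreover have "canonical_between Q B ?W"
    unfolding canonical_between_def
  proof (intro exI conjI)
    show "B \<subseteq> K" by (rule BK)
    show "K \<subseteq> integral_closure Q B" using K_Rb overring_integral_closure[OF B] by simp
    show "submodule K ?S V" using B.submodule_iff K_submod by blast
    have "(\<lambda>x\<in>K. x) \<in> module_hom ?S ?W ?W"
      using submodD[OF K_submod] by (intro module_homI) (auto simp del: image_iff)
    then show "module_isomorphic ?S ?W ?W"
      unfolding module_isomorphic_def by (intro bexI[of _ "\<lambda>x\<in>K. x"]) (auto simp: bij_betw_def inj_on_def)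
  qed
  moreover have "finite_integral_closure Q B"
    unfolding finite_integral_closure_def overring_integral_closure[OF B]
  proof (rule B.fractional_finitely_generated)
    obtain t where "t \<in> carrier Q" "t \<noteq> \<zero>" "\<forall>x\<in>Rb. t \<otimes> x \<in> A" using conductor by (auto simp: Rb_def)
    then show "B.fractional Rb" unfolding B.fractional_def using submod_mono[OF Rb.submod_A B(3)] B(2) by blast
  qed
  moreover have "trace_ideal ?S ?W = colon Q B Rb"
  proof
    have sub: "submod Q B (colon Q B Rb)" using B.colon_submod[OF B.submod_A] Rb.A_sub by blast
    have in_B: "colon Q B Rb \<subseteq> B"
    proof
      fix x assume "x \<in> colon Q B Rb"
      then have "x \<in> carrier Q" "x \<otimes> \<one> \<in> B" using Rb.A_one unfolding colon_def by blast+
      then show "x \<in> B" by simp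
    qed
    have regular: "regular_module ?S = V\<lparr>carrier := B\<rparr>" by (rule B.regular_module_S)
    have oneK: "\<one> \<in> K" using BK B.A_one by blast
    have image: "f x \<in> colon Q B Rb" if f: "f \<in> module_hom ?S ?W (regular_module ?S)" and x: "x \<in> K" for f x
    proof -
      have fB: "f y \<in> B" if "y \<in> K" for y using module_homD(1)[OF f, of y] that by simp
      have fm: "f (b \<otimes> y) = b \<otimes> f y" if "b \<in> B" "y \<in> K" for b y using module_homD(4)[OF f, of b y] that by simp
      let ?a = "f \<one>"
      have ac: "?a \<in> carrier Q" by (rule B.A_sub[OF fB[OF oneK]])
      \<comment> \<open>Write y = u / v: then v f(y) = f(u) = u f(\<one>), and v is
        cancelled.\<close>
      have fa: "f y = ?a \<otimes> y" if y: "y \<in> K" for y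
      proof -
        have yc: "y \<in> carrier Q" by (rule submodD(1)[OF K_submod y])
        obtain u v where uv: "u \<in> B" "v \<in> B" "v \<noteq> \<zero>" "y = u \<otimes> inv v" using B.fraction[OF yc] by blast
        have uc: "u \<in> carrier Q" "v \<in> carrier Q" using uv B.A_sub by auto
        note iv = inv_nonzero[OF uc(2) uv(3)]
        have fc: "f y \<in> carrier Q" by (rule B.A_sub[OF fB[OF y]])
        have vy: "v \<otimes> y = u" unfolding uv(4) using uc iv by (metis m_comm m_assoc r_one)
        have "v \<otimes> f y = f (u \<otimes> \<one>)" using fm[OF uv(2) y] vy uc by simp
        also have "\<dots> = u \<otimes> ?a" by (rule fm[OF uv(1) oneK])
        also have "\<dots> = v \<otimes> (?a \<otimes> y)" unfolding vy[symmetric] using uc yc ac by (simp add: m_ac)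
        finally show ?thesis using m_lcancel[OF uv(3) uc(2) fc] ac yc by simp
      qed
      have "?a \<otimes> y \<in> B" if "y \<in> K" for y using fB[OF that] fa[OF that] by simp
      then have "?a \<in> colon Q B K" unfolding colon_def using ac by blast
      then have aR: "?a \<in> colon Q B Rb" using tr by blast
      have xR: "x \<in> Rb" using x K_Rb by blast
      have "?a \<otimes> x \<otimes> y \<in> B" if y: "y \<in> Rb" for y
      proof -
        have "?a \<otimes> x \<otimes> y = ?a \<otimes> (x \<otimes> y)" using ac Rb.A_sub[OF xR] Rb.A_sub[OF y] by (rule m_assoc)
        then show ?thesis using aR Rb.A_mult[OF xR y] by (simp add: colon_def)
      qed
      then show ?thesis unfolding fa[OF x] colon_def using ac Rb.A_sub[OF xR] by simp
    qed
    let ?U = "\<Union>f\<in>module_hom ?S ?W (regular_module ?S). f ` carrier ?W"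
    have U: "?U \<subseteq> colon Q B Rb" using image by auto
    then have U': "?U \<subseteq> carrier ?S" using in_B by auto
    show "trace_ideal ?S ?W \<subseteq> colon Q B Rb"
      unfolding trace_ideal_def
      by (rule BS.genideal_minimal[OF _ U]) (use B.ideal_iff sub in_B in blast)
    show "colon Q B Rb \<subseteq> trace_ideal ?S ?W"
    proof
      fix a assume a: "a \<in> colon Q B Rb"
      have ac: "a \<in> carrier Q" using a by (simp add: colon_def)
      have aB: "a \<otimes> x \<in> B" if "x \<in> K" for x using a that K_Rb unfolding colon_def by blast
      let ?f = "\<lambda>x\<in>K. a \<otimes> x"
      note Kc = submodD(1)[OF K_submod]
      have "?f \<in> module_hom ?S ?W (regular_module ?S)"
      proof (rule module_homI)
        fix x assume "x \<in> carrier ?W"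
        then have x: "x \<in> K" by simp
        show "?f x \<in> carrier (regular_module ?S)" using aB[OF x] x by (simp del: image_iff)
        show "?f (x \<oplus>\<^bsub>?W\<^esub> y) = ?f x \<oplus>\<^bsub>regular_module ?S\<^esub> ?f y" if "y \<in> carrier ?W" for y
          using that x submodD(3)[OF K_submod x, of y] ac Kc[OF x] Kc[of y] by (simp add: r_distr del: image_iff)
        show "?f (b \<odot>\<^bsub>?W\<^esub> x) = b \<odot>\<^bsub>regular_module ?S\<^esub> ?f x" if "b \<in> carrier ?S" for b
          using that x submodD(4)[OF K_submod _ x, of b] ac Kc[OF x] B.A_sub[of b] by (simp add: m_lcomm del: image_iff)
      qed simp
      moreover have "?f \<one> = a" using oneK ac by simp
      ultimately have "a \<in> ?U" using oneK by (intro UN_I[of ?f] image_eqI[of _ _ \<one>]) (simp_all del: image_iff)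
      then show "a \<in> trace_ideal ?S ?W" unfolding trace_ideal_def using BS.genideal_self[OF U'] by blast
    qed
  qed
  ultimately show ?thesis
    unfolding far_flung_Gorenstein_def overring_integral_closure[OF B] using B.S_CM B.krull_dim_S K_canonical by blast
qed

end

end

section \<open>The endomorphism ring of the maximal ideal\<close>

context one_dim_domain
begin

text \<open>From M^(n+1) = a M^n, multiplication by x / a preserves M^n. It follows that a^n (x /
  a)^k \<in> M^n \<subseteq> A for all k, so x / a is almost integral.\<close>

lemma reduction_integral:
  assumes a: "a \<in> M" "a \<noteq> \<zero>" and red: "is_reduction S (PIdl\<^bsub>S\<^esub> a) M" and x: "x \<in> M"
  shows "inv a \<otimes> x \<in> integral_closure Q A"
proof -
  interpret S: cring S by (rule S_cring)
  let ?J = "PIdl\<^bsub>S\<^esub> a"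
  obtain n :: nat where n: "?J \<cdot>\<^bsub>S\<^esub> (M [^]\<^bsub>ideals_set S\<^esub> n) = M [^]\<^bsub>ideals_set S\<^esub> Suc n"
    using red by (auto simp: is_reduction_def)
  define P where "P k = M [^]\<^bsub>ideals_set S\<^esub> k" for k :: nat
  have P0: "P 0 = A" by (simp add: P_def ideals_set_def nat_pow_def)
  have PS: "P (Suc k) = P k \<cdot>\<^bsub>S\<^esub> M" for k by (simp add: P_def ideals_set_def nat_pow_def)
  have ac: "a \<in> carrier Q" and xc: "x \<in> carrier Q" using a x M_sub by auto
  note ia = inv_nonzero[OF ac a(2)]
  have Mi: "ideal M S" using ideal_iff M_submod M_A by blast
  have Pi: "ideal (P k) S" for k
  proof (induct k)
    case 0 show ?case unfolding P0 using S.oneideal by simp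
  next
    case (Suc k) then show ?case unfolding PS by (rule S.ideal_prod_is_ideal[OF _ Mi])
  qed
  have Psub: "submod Q A (P k)" "P k \<subseteq> A" for k using Pi ideal_iff by auto
  have aP: "a [^] k \<in> P k" for k :: nat
  proof (induct k)
    case 0 show ?case by (simp add: P0)
  next
    case (Suc k)
    have "a [^] k \<otimes>\<^bsub>S\<^esub> a \<in> P (Suc k)" unfolding PS by (rule ideal_prod.prod[OF Suc a(1)])
    then show ?case by simp
  qed
  \<comment> \<open>An ideal product consists of sums of products, so divisibility by a is checked
    by induction on its generation.\<close>
  have JP: "inv a \<otimes> z \<in> P n" if "z \<in> ?J \<cdot>\<^bsub>S\<^esub> P n" for z
    using that
  proof (induct z rule: ideal_prod.induct)
    case (prod i z)
    then obtain b where b: "b \<in> A" "i = b \<otimes> a" by (auto simp: cgenideal_def)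
    have zc: "z \<in> carrier Q" by (rule submodD(1)[OF Psub(1) prod(2)])
    have "inv a \<otimes> (i \<otimes> z) = (a \<otimes> inv a) \<otimes> (b \<otimes> z)" unfolding b(2) using ac ia(1) A_sub[OF b(1)] zc by (simp add: m_ac)
    also have "\<dots> = b \<otimes> z" using ia(2) A_sub[OF b(1)] zc by simp
    finally show ?case using submodD(4)[OF Psub(1) b(1) prod(2)] by simp
  next
    case (sum u v)
    have "inv a \<otimes> u \<in> carrier Q" "inv a \<otimes> v \<in> carrier Q" using sum submodD(1)[OF Psub(1)] by blast+
    have "u \<in> A" "v \<in> A"
      using sum(1,3) S.ideal_prod_in_carrier[OF S.cgenideal_ideal[of a] Pi[of n]] a(1) M_A by auto
    then have "inv a \<otimes> (u \<oplus> v) = inv a \<otimes> u \<oplus> inv a \<otimes> v" using ia(1) A_sub by (simp add: r_distr)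
    then show ?case using submodD(3)[OF Psub(1) sum(2,4)] by simp
  qed
  let ?y = "inv a \<otimes> x"
  have yc: "?y \<in> carrier Q" using ia xc by simp
  have step: "z \<otimes> ?y \<in> P n" if z: "z \<in> P n" for z
  proof -
    have zc: "z \<in> carrier Q" by (rule submodD(1)[OF Psub(1) z])
    have "z \<otimes>\<^bsub>S\<^esub> x \<in> P n \<cdot>\<^bsub>S\<^esub> M" by (rule ideal_prod.prod[OF z x])
    then have "z \<otimes> x \<in> ?J \<cdot>\<^bsub>S\<^esub> P n" using n unfolding P_def[symmetric] PS by simp
    then have "inv a \<otimes> (z \<otimes> x) \<in> P n" by (rule JP)
    then show ?thesis using zc xc ia(1) by (simp add: m_lcomm)
  qed
  have "a [^] n \<otimes> ?y [^] k \<in> P n" for k :: nat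
  proof (induct k)
    case 0 then show ?case using aP[of n] ac by simp
  next
    case (Suc k)
    have "a [^] n \<otimes> ?y [^] Suc k = a [^] n \<otimes> ?y [^] k \<otimes> ?y" using ac yc by (simp add: m_assoc)
    then show ?case using step[OF Suc] by simp
  qed
  moreover have "a [^] n \<in> Units Q"
  proof -
    have "a \<in> Units Q" using ac a(2) field_Units by blast
    then show ?thesis by (rule Units_pow_closed)
  qed
  ultimately show ?thesis using almost_integral[OF one_not_zero yc] Psub(2) by blast
qed

text \<open>Multiplication by \<alpha> maps C into A and takes \<one> to \<alpha>; transported along
  C \<cong> W this exhibits \<alpha> as a value of a homomorphism on W.\<close>

lemma colon_subset_trace:
  assumes W: "module S W" and C: "submod Q A C" "\<one> \<in> C" and iso: "module_isomorphic S (V\<lparr>carrier := C\<rparr>) W"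
  shows "colon Q A C \<subseteq> trace_ideal S W"
proof
  interpret S: cring S by (rule S_cring)
  fix \<alpha> assume \<alpha>: "\<alpha> \<in> colon Q A C"
  have ac: "\<alpha> \<in> carrier Q" and aC: "\<And>x. x \<in> C \<Longrightarrow> \<alpha> \<otimes> x \<in> A" using \<alpha> unfolding colon_def by blast+
  have VC: "module S (V\<lparr>carrier := C\<rparr>)" by (rule V_restrict_module[OF C(1)])
  note Cc = submodD(1)[OF C(1)]
  obtain \<theta> where \<theta>: "\<theta> \<in> module_hom S (V\<lparr>carrier := C\<rparr>) W" "bij_betw \<theta> (carrier (V\<lparr>carrier := C\<rparr>)) (carrier W)"
    using iso by (auto simp: module_isomorphic_def)
  obtain \<eta> where \<eta>: "\<eta> \<in> module_hom S W (V\<lparr>carrier := C\<rparr>)"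
    "\<And>x. x \<in> carrier (V\<lparr>carrier := C\<rparr>) \<Longrightarrow> \<eta> (\<theta> x) = x" "\<And>y. y \<in> carrier W \<Longrightarrow> \<theta> (\<eta> y) = y"
    by (rule module_iso_inverse[OF VC W \<theta>]) blast
  let ?f = "\<lambda>x\<in>C. \<alpha> \<otimes> x"
  have f: "?f \<in> module_hom S (V\<lparr>carrier := C\<rparr>) (regular_module S)"
  proof (rule module_homI)
    fix x assume "x \<in> carrier (V\<lparr>carrier := C\<rparr>)"
    then have x: "x \<in> C" by simp
    show "?f x \<in> carrier (regular_module S)" using aC[OF x] x by simp
    show "?f (x \<oplus>\<^bsub>V\<lparr>carrier := C\<rparr>\<^esub> y) = ?f x \<oplus>\<^bsub>regular_module S\<^esub> ?f y" if "y \<in> carrier (V\<lparr>carrier := C\<rparr>)" for y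
      using that x submodD(3)[OF C(1) x, of y] ac Cc[OF x] Cc[of y] by (simp add: r_distr)
    show "?f (b \<odot>\<^bsub>V\<lparr>carrier := C\<rparr>\<^esub> x) = b \<odot>\<^bsub>regular_module S\<^esub> ?f x" if "b \<in> carrier S" for b
      using that x submodD(4)[OF C(1) _ x, of b] ac Cc[OF x] A_sub[of b] by (simp add: m_lcomm)
  qed simp
  let ?g = "compose (carrier W) ?f \<eta>"
  have g: "?g \<in> module_hom S W (regular_module S)" by (rule module_hom_compose[OF \<eta>(1) f W])
  have t1: "\<theta> \<one> \<in> carrier W" using module_homD(1)[OF \<theta>(1), of \<one>] C(2) by simp
  have "?g (\<theta> \<one>) = ?f (\<eta> (\<theta> \<one>))" by (rule compose_eq[OF t1])
  also have "\<dots> = \<alpha>" using \<eta>(2)[of \<one>] C(2) ac by simp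
  finally have ga: "?g (\<theta> \<one>) = \<alpha>" .
  let ?U = "\<Union>f\<in>module_hom S W (regular_module S). f ` carrier W"
  have "?g (\<theta> \<one>) \<in> ?U" using g t1 by blast
  moreover have "?U \<subseteq> carrier S"
  proof
    fix y assume "y \<in> ?U"
    then obtain f w where "f \<in> module_hom S W (regular_module S)" "w \<in> carrier W" "y = f w" by blast
    then have "y \<in> carrier (regular_module S)" using module_homD(1) by metis
    then show "y \<in> carrier S" by simp
  qed
  ultimately show "\<alpha> \<in> trace_ideal S W"
    unfolding trace_ideal_def ga using S.genideal_self by blast
qed

text \<open>For a fixed nonzero a in M, an endomorphism f satisfies a f(x) = f(a x) = x f(a), so it
  is multiplication by f(a) / a. Cancelling a shows that the multiplier is unique.\<close>

lemma multiplication_ring_iso: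
  "(\<lambda>\<alpha>\<in>colon Q M M. \<lambda>x\<in>M. \<alpha> \<otimes> x)
    \<in> ring_iso (Q\<lparr>carrier := colon Q M M\<rparr>) (endomorphism_ring S (V\<lparr>carrier := M\<rparr>))"
proof -
  let ?B = "colon Q M M" and ?E = "endomorphism_ring S (V\<lparr>carrier := M\<rparr>)" and ?h = "\<lambda>\<alpha>. \<lambda>x\<in>M. \<alpha> \<otimes> x"
  have E: "carrier ?E = module_hom S (V\<lparr>carrier := M\<rparr>) (V\<lparr>carrier := M\<rparr>)" "monoid.mult ?E = compose M"
    "one ?E = (\<lambda>x\<in>M. x)" "ring.add ?E = (\<lambda>f g. \<lambda>x\<in>M. f x \<oplus> g x)"
    by (simp_all add: endomorphism_ring_def)
  have Bc: "\<alpha> \<in> carrier Q" "\<And>x. x \<in> M \<Longrightarrow> \<alpha> \<otimes> x \<in> M" if "\<alpha> \<in> ?B" for \<alpha> using that by (auto simp: colon_def)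
  obtain a where a: "a \<in> M" "a \<noteq> \<zero>" using M_nonzero M_zero by blast
  note ac = M_sub[OF a(1)]
  note ia = inv_nonzero[OF ac a(2)]
  have B_submod: "submod Q A ?B" by (rule colon_submod[OF M_submod]) (use M_sub in blast)
  have hE: "?h \<alpha> \<in> carrier ?E" if \<alpha>: "\<alpha> \<in> ?B" for \<alpha>
    unfolding E
  proof (rule module_homI)
    fix x assume "x \<in> carrier (V\<lparr>carrier := M\<rparr>)"
    then have x: "x \<in> M" by simp
    show "?h \<alpha> x \<in> carrier (V\<lparr>carrier := M\<rparr>)" using Bc(2)[OF \<alpha> x] x by simp
    show "?h \<alpha> (x \<oplus>\<^bsub>V\<lparr>carrier := M\<rparr>\<^esub> y) = ?h \<alpha> x \<oplus>\<^bsub>V\<lparr>carrier := M\<rparr>\<^esub> ?h \<alpha> y" if "y \<in> carrier (V\<lparr>carrier := M\<rparr>)" for y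
      using that x submodD(3)[OF M_submod x, of y] Bc(1)[OF \<alpha>] M_sub[OF x] M_sub[of y] by (simp add: r_distr)
    show "?h \<alpha> (b \<odot>\<^bsub>V\<lparr>carrier := M\<rparr>\<^esub> x) = b \<odot>\<^bsub>V\<lparr>carrier := M\<rparr>\<^esub> ?h \<alpha> x" if "b \<in> carrier S" for b
      using that x submodD(4)[OF M_submod _ x, of b] Bc(1)[OF \<alpha>] M_sub[OF x] A_sub[of b] by (simp add: m_lcomm)
  qed simp
  have closed: "\<alpha> \<otimes> \<beta> \<in> ?B" "\<alpha> \<oplus> \<beta> \<in> ?B" "\<one> \<in> ?B" if \<alpha>: "\<alpha> \<in> ?B" and \<beta>: "\<beta> \<in> ?B" for \<alpha> \<beta>
  proof -
    have "\<alpha> \<otimes> \<beta> \<otimes> x \<in> M" if x: "x \<in> M" for x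
      using m_assoc[OF Bc(1)[OF \<alpha>] Bc(1)[OF \<beta>] M_sub[OF x]] Bc(2)[OF \<alpha> Bc(2)[OF \<beta> x]] by simp
    then show "\<alpha> \<otimes> \<beta> \<in> ?B" using Bc(1)[OF \<alpha>] Bc(1)[OF \<beta>] by (simp add: colon_def)
    show "\<alpha> \<oplus> \<beta> \<in> ?B" by (rule submodD(3)[OF B_submod \<alpha> \<beta>])
    show "\<one> \<in> ?B" using M_sub by (simp add: colon_def)
  qed
  have "(\<lambda>\<alpha>\<in>?B. ?h \<alpha>) \<in> ring_hom (Q\<lparr>carrier := ?B\<rparr>) ?E"
  proof (rule ring_hom_memI)
    fix \<alpha> assume "\<alpha> \<in> carrier (Q\<lparr>carrier := ?B\<rparr>)"
    then have \<alpha>: "\<alpha> \<in> ?B" by simp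
    show "(\<lambda>\<alpha>\<in>?B. ?h \<alpha>) \<alpha> \<in> carrier ?E" using hE[OF \<alpha>] \<alpha> by simp
    fix \<beta> assume "\<beta> \<in> carrier (Q\<lparr>carrier := ?B\<rparr>)"
    then have \<beta>: "\<beta> \<in> ?B" by simp
    have "?h (\<alpha> \<otimes> \<beta>) = compose M (?h \<alpha>) (?h \<beta>)"
      unfolding compose_def
      by (rule restrict_ext) (use Bc(1)[OF \<alpha>] Bc(1)[OF \<beta>] Bc(2)[OF \<beta>] M_sub in \<open>simp add: m_assoc\<close>)
    then show "(\<lambda>\<alpha>\<in>?B. ?h \<alpha>) (\<alpha> \<otimes>\<^bsub>Q\<lparr>carrier := ?B\<rparr>\<^esub> \<beta>) = (\<lambda>\<alpha>\<in>?B. ?h \<alpha>) \<alpha> \<otimes>\<^bsub>?E\<^esub> (\<lambda>\<alpha>\<in>?B. ?h \<alpha>) \<beta>"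
      using \<alpha> \<beta> closed(1)[OF \<alpha> \<beta>] by (simp add: E)
    have "?h (\<alpha> \<oplus> \<beta>) = (\<lambda>x\<in>M. ?h \<alpha> x \<oplus> ?h \<beta> x)"
      by (rule restrict_ext) (use Bc(1)[OF \<alpha>] Bc(1)[OF \<beta>] M_sub in \<open>simp add: l_distr\<close>)
    then show "(\<lambda>\<alpha>\<in>?B. ?h \<alpha>) (\<alpha> \<oplus>\<^bsub>Q\<lparr>carrier := ?B\<rparr>\<^esub> \<beta>) = (\<lambda>\<alpha>\<in>?B. ?h \<alpha>) \<alpha> \<oplus>\<^bsub>?E\<^esub> (\<lambda>\<alpha>\<in>?B. ?h \<alpha>) \<beta>"
      using \<alpha> \<beta> closed(2)[OF \<alpha> \<beta>] by (simp add: E)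
  next
    have "?h \<one> = (\<lambda>x\<in>M. x)" by (rule restrict_ext) (use M_sub in simp)
    moreover have "\<one> \<in> ?B" using M_sub by (simp add: colon_def)
    ultimately show "(\<lambda>\<alpha>\<in>?B. ?h \<alpha>) \<one>\<^bsub>Q\<lparr>carrier := ?B\<rparr>\<^esub> = \<one>\<^bsub>?E\<^esub>" by (simp add: E)
  qed
  moreover have "bij_betw (\<lambda>\<alpha>\<in>?B. ?h \<alpha>) ?B (carrier ?E)"
  proof (rule bij_betwI')
    fix \<alpha> \<beta> assume \<alpha>: "\<alpha> \<in> ?B" and \<beta>: "\<beta> \<in> ?B"
    show "(\<lambda>\<alpha>\<in>?B. ?h \<alpha>) \<alpha> = (\<lambda>\<alpha>\<in>?B. ?h \<alpha>) \<beta> \<longleftrightarrow> \<alpha> = \<beta>"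
    proof
      assume "(\<lambda>\<alpha>\<in>?B. ?h \<alpha>) \<alpha> = (\<lambda>\<alpha>\<in>?B. ?h \<alpha>) \<beta>"
      then have "?h \<alpha> a = ?h \<beta> a" using \<alpha> \<beta> by simp
      then have "\<alpha> \<otimes> a = \<beta> \<otimes> a" using a by simp
      then show "\<alpha> = \<beta>" using m_rcancel[OF a(2) ac Bc(1)[OF \<alpha>] Bc(1)[OF \<beta>]] by simp
    qed simp
  next
    fix \<alpha> assume "\<alpha> \<in> ?B"
    then show "(\<lambda>\<alpha>\<in>?B. ?h \<alpha>) \<alpha> \<in> carrier ?E" using hE by simp
  next
    fix f assume "f \<in> carrier ?E"
    then have f: "f \<in> module_hom S (V\<lparr>carrier := M\<rparr>) (V\<lparr>carrier := M\<rparr>)" by (simp add: E)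
    have fM: "f x \<in> M" if "x \<in> M" for x using module_homD(1)[OF f, of x] that by simp
    have fm: "f (b \<otimes> x) = b \<otimes> f x" if "b \<in> A" "x \<in> M" for b x using module_homD(4)[OF f, of b x] that by simp
    let ?\<alpha> = "inv a \<otimes> f a"
    have fa: "f a \<in> carrier Q" using M_sub[OF fM[OF a(1)]] .
    have eq: "f x = ?\<alpha> \<otimes> x" if x: "x \<in> M" for x
    proof -
      have xc: "x \<in> carrier Q" "f x \<in> carrier Q" using M_sub x fM by auto
      have "a \<otimes> f x = f (x \<otimes> a)" using fm[of a x] a x M_A m_comm[OF ac xc(1)] by auto
      also have "\<dots> = x \<otimes> f a" using fm[of x a] a x M_A by auto
      finally have "inv a \<otimes> (a \<otimes> f x) = inv a \<otimes> (x \<otimes> f a)" by simp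
      moreover have "inv a \<otimes> (a \<otimes> f x) = f x" using ia ac xc by (simp add: m_assoc[symmetric])
      moreover have "inv a \<otimes> (x \<otimes> f a) = ?\<alpha> \<otimes> x" using ia(1) xc fa by (simp add: m_ac)
      ultimately show ?thesis by simp
    qed
    have \<alpha>c: "?\<alpha> \<in> carrier Q" using ia fa by simp
    have "?\<alpha> \<otimes> x \<in> M" if "x \<in> M" for x using eq[OF that] fM[OF that] by simp
    then have \<alpha>: "?\<alpha> \<in> ?B" using \<alpha>c by (simp add: colon_def)
    have "f = ?h ?\<alpha>"
      by (rule extensionalityI[of _ M]) (use module_homD(2)[OF f] eq in auto)
    then show "\<exists>\<alpha>\<in>?B. f = (\<lambda>\<alpha>\<in>?B. ?h \<alpha>) \<alpha>" using \<alpha> by (intro bexI[of _ ?\<alpha>]) auto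
  qed
  ultimately show ?thesis by (simp add: ring_iso_def)
qed

end

section \<open>The endomorphism ring of the maximal ideal is far-flung Gorenstein\<close>

context one_dim_domain_local_closure
begin

lemma endomorphism_ring_far_flung:
  assumes C: "canonical_ideal Q A M C" and AC: "A \<subseteq> C" and C_Rb: "C \<subseteq> Rb"
    and tr: "colon Q A C \<subseteq> colon Q A Rb"
    and a: "a \<in> M" "a \<noteq> \<zero>" and red: "\<And>x. x \<in> M \<Longrightarrow> inv a \<otimes> x \<in> Rb"
  shows "\<exists>W :: ('a, 'a) module. far_flung_Gorenstein Q (colon Q M M) W"
proof -
  interpret C: canonical_ideal Q A M C by (rule C)
  let ?B = "colon Q M M"
  have ac: "a \<in> carrier Q" by (rule M_sub[OF a(1)])
  note ia = inv_nonzero[OF ac a(2)]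
  show ?thesis
  proof (cases "colon Q A M \<subseteq> ?B")
    case False
    then obtain \<alpha> where "\<alpha> \<in> colon Q A M" "\<alpha> \<notin> ?B" by blast
    then obtain x where \<alpha>: "\<alpha> \<in> carrier Q" and x: "x \<in> M" "\<alpha> \<otimes> x \<in> A" "\<alpha> \<otimes> x \<notin> M" unfolding colon_def by blast
    have xc: "x \<in> carrier Q" by (rule M_sub[OF x(1)])
    have u: "inv (\<alpha> \<otimes> x) \<in> A" by (rule unit_A[OF x(2,3)])
    have u0: "\<alpha> \<otimes> x \<noteq> \<zero>" using x(3) M_zero by auto
    note iu = inv_nonzero[OF A_sub[OF x(2)] u0]
    \<comment> \<open>\<alpha> x is a unit of A for some x in M, so \<beta> = (\<alpha> x)^(-1)
      \<alpha> (\<beta> x) lies in A whenever \<beta> x lies in M.\<close>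
    have "?B = A"
    proof
      show "A \<subseteq> ?B" using A_sub submodD(4)[OF M_submod] by (auto simp: colon_def)
      show "?B \<subseteq> A"
      proof
        fix \<beta> assume \<beta>: "\<beta> \<in> ?B"
        have \<beta>c: "\<beta> \<in> carrier Q" and \<beta>x: "\<beta> \<otimes> x \<in> M" using \<beta> x(1) by (auto simp: colon_def)
        have "\<alpha> \<otimes> (\<beta> \<otimes> x) \<in> A" using \<open>\<alpha> \<in> colon Q A M\<close> \<beta>x by (simp add: colon_def)
        then have "inv (\<alpha> \<otimes> x) \<otimes> (\<alpha> \<otimes> (\<beta> \<otimes> x)) \<in> A" using u A_mult by blast
        moreover have "inv (\<alpha> \<otimes> x) \<otimes> (\<alpha> \<otimes> (\<beta> \<otimes> x)) = (inv (\<alpha> \<otimes> x) \<otimes> (\<alpha> \<otimes> x)) \<otimes> \<beta>"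
          using iu(1) \<alpha> xc \<beta>c by algebra
        ultimately show "\<beta> \<in> A" using iu(3) \<beta>c by simp
      qed
    qed
    \<comment> \<open>The general construction with overring A and scalar \<one> returns C
      itself.\<close>
    moreover have "(\<lambda>x. \<one> \<otimes> x) ` colon Q C A = C"
      unfolding C.colon_A[OF C.C_submod] using C.C_sub by (auto simp: image_iff)
    then have "far_flung_Gorenstein Q A (V\<lparr>carrier := C\<rparr>)"
      using K_far_flung[OF C subA order_refl A_Rb one_closed one_not_zero] AC C_Rb tr by simp
    ultimately show ?thesis by metis
  next
    case AM: True
    have B_sub: "\<beta> \<in> carrier Q" "\<And>x. x \<in> M \<Longrightarrow> \<beta> \<otimes> x \<in> M" if "\<beta> \<in> ?B" for \<beta> using that by (auto simp: colon_def)
    have AB: "A \<subseteq> ?B" using A_sub submodD(4)[OF M_submod] by (auto simp: colon_def)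
    have BA: "submod Q A ?B" by (rule colon_submod[OF M_submod]) (use M_sub in blast)
    have B: "subcring ?B Q"
    proof (rule subcringI', rule subringI)
      show "?B \<subseteq> carrier Q" using B_sub by blast
      show "\<one> \<in> ?B" using AB A_one by blast
      show "\<ominus> h \<in> ?B" if "h \<in> ?B" for h by (rule submod_neg[OF BA that])
      show "h \<oplus> k \<in> ?B" if "h \<in> ?B" "k \<in> ?B" for h k by (rule submodD(3)[OF BA that])
      show "h \<otimes> k \<in> ?B" if h: "h \<in> ?B" and k: "k \<in> ?B" for h k
      proof -
        have "h \<otimes> k \<otimes> x \<in> M" if x: "x \<in> M" for x
          using m_assoc[OF B_sub(1)[OF h] B_sub(1)[OF k] M_sub[OF x]] B_sub(2)[OF h B_sub(2)[OF k x]] by simp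
        then show ?thesis using B_sub(1)[OF h] B_sub(1)[OF k] by (simp add: colon_def)
      qed
    qed
    have B_Rb: "?B \<subseteq> Rb"
    proof
      fix \<beta> assume \<beta>: "\<beta> \<in> ?B"
      \<comment> \<open>The element a is a common denominator for all powers of \<beta>, so \<beta>
        is almost integral over A.\<close>
      have "a \<otimes> \<beta> [^] k \<in> M" for k :: nat
      proof (induct k)
        case 0 then show ?case using a ac by simp
      next
        case (Suc k)
        have "a \<otimes> \<beta> [^] Suc k = \<beta> \<otimes> (a \<otimes> \<beta> [^] k)" using ac B_sub(1)[OF \<beta>] by (simp add: m_ac)
        then show ?case using B_sub(2)[OF \<beta> Suc] by simp
      qed
      then have "\<And>k::nat. a \<otimes> \<beta> [^] k \<in> A" using M_A by blast
      moreover have "a \<in> Units Q" using ac a(2) field_Units by blast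
      ultimately show "\<beta> \<in> Rb" unfolding Rb_def using almost_integral[OF one_not_zero B_sub(1)[OF \<beta>]] by blast
    qed
    let ?D = "colon Q C ?B"
    let ?K = "(\<lambda>x. inv a \<otimes> x) ` ?D"
    note conds = C B AB B_Rb ia(1,4)
    have DI: "a \<otimes> y \<in> ?D" if y: "y \<in> carrier Q" "\<And>b. b \<in> ?B \<Longrightarrow> a \<otimes> y \<otimes> b \<in> C" for y
      using that ac by (simp add: colon_def)
    have KI: "y \<in> ?K" if y: "y \<in> carrier Q" "\<And>b. b \<in> ?B \<Longrightarrow> a \<otimes> y \<otimes> b \<in> C" for y
    proof -
      have "y = inv a \<otimes> (a \<otimes> y)" using y(1) ac ia by (simp add: m_assoc[symmetric])
      then show ?thesis using DI[OF y] by blast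
    qed
    have KC: "a \<otimes> y \<in> C" if y: "y \<in> ?K" for y
    proof -
      obtain z where z: "z \<in> ?D" "y = inv a \<otimes> z" using y by blast
      have zC: "z \<in> C" using D_C[OF conds(1-4) ia(1,4)] z(1) by blast
      have "a \<otimes> y = (a \<otimes> inv a) \<otimes> z" unfolding z(2) using ac ia(1) C.C_sub[OF zC] by (simp add: m_assoc)
      then show ?thesis using zC C.C_sub[OF zC] ia(2) by simp
    qed
    have B_K: "?B \<subseteq> ?K"
    proof
      fix \<beta> assume \<beta>: "\<beta> \<in> ?B"
      show "\<beta> \<in> ?K"
      proof (rule KI[OF B_sub(1)[OF \<beta>]])
        fix b assume b: "b \<in> ?B"
        have "a \<otimes> \<beta> \<otimes> b = b \<otimes> (\<beta> \<otimes> a)" using ac B_sub(1)[OF \<beta>] B_sub(1)[OF b] by (simp add: m_ac)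
        also have "\<dots> \<in> M" by (rule B_sub(2)[OF b B_sub(2)[OF \<beta> a(1)]])
        finally show "a \<otimes> \<beta> \<otimes> b \<in> C" using M_A AC by blast
      qed
    qed
    have C_K: "C \<subseteq> ?K"
    proof
      fix y assume y: "y \<in> C"
      show "y \<in> ?K"
      proof (rule KI[OF C.C_sub[OF y]])
        fix b assume b: "b \<in> ?B"
        have "b \<otimes> a \<in> A" using B_sub(2)[OF b a(1)] M_A by blast
        then have "(b \<otimes> a) \<otimes> y \<in> C" by (rule submodD(4)[OF C.C_submod _ y])
        then show "a \<otimes> y \<otimes> b \<in> C" using ac B_sub(1)[OF b] C.C_sub[OF y] by (simp add: m_ac)
      qed
    qed
    have K_Rb: "?K \<subseteq> Rb"
    proof
      let ?I = "(\<lambda>x. a \<otimes> x) ` Rb"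
      have RbA: "submod Q A Rb" by (rule submod_mono[OF Rb.submod_A A_Rb])
      have Is: "submod Q A ?I" by (rule submod_image[OF RbA ac])
      have "?I \<subseteq> Rb" using Rb.A_mult a(1) M_A A_Rb by blast
      then have If: "fractional ?I" by (rule fractional_subset[OF Rb_fractional Is])
      have "a \<otimes> \<one> \<in> ?I" using Rb.A_one by blast
      then have I0: "?I \<noteq> {\<zero>}" using a ac by auto
      \<comment> \<open>K \<subseteq> Rb is the dual of this inclusion, read after multiplying by a.
        For x in M and y in C, \<gamma> x y = \<gamma> a ((x / a) y) lies in C because (x / a) y
        \<in> Rb; so \<gamma> x \<in> C : C = A, and A : M is contained in the endomorphism
        ring.\<close>
      have "colon Q C ?I \<subseteq> ?B"
      proof -
        have "\<gamma> \<otimes> x \<in> A" if \<gamma>: "\<gamma> \<in> colon Q C ?I" and x: "x \<in> M" for \<gamma> x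
        proof -
          have \<gamma>c: "\<gamma> \<in> carrier Q" using \<gamma> by (simp add: colon_def)
          have xc: "x \<in> carrier Q" by (rule M_sub[OF x])
          have "\<gamma> \<otimes> x \<otimes> y \<in> C" if y: "y \<in> C" for y
          proof -
            have yc: "y \<in> carrier Q" by (rule C.C_sub[OF y])
            have "(inv a \<otimes> x) \<otimes> y \<in> Rb" using Rb.A_mult[OF red[OF x]] y C_Rb by blast
            then have "\<gamma> \<otimes> (a \<otimes> ((inv a \<otimes> x) \<otimes> y)) \<in> C" using \<gamma> unfolding colon_def by blast
            moreover have "\<gamma> \<otimes> (a \<otimes> ((inv a \<otimes> x) \<otimes> y)) = (a \<otimes> inv a) \<otimes> (\<gamma> \<otimes> x \<otimes> y)"
              using \<gamma>c ac ia(1) xc yc by algebra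
            ultimately show ?thesis using ia(2) \<gamma>c xc yc by simp
          qed
          then have "\<gamma> \<otimes> x \<in> colon Q C C" using \<gamma>c xc by (simp add: colon_def)
          then show ?thesis using C.C_colon_C by simp
        qed
        then have "colon Q C ?I \<subseteq> colon Q A M" by (auto simp: colon_def)
        then show ?thesis using AM by blast
      qed
      then have "?D \<subseteq> colon Q C (colon Q C ?I)" by (rule C.dual_antimono)
      then have DI': "?D \<subseteq> ?I" using C.double_dual[OF If I0] by simp
      fix y assume "y \<in> ?K"
      then obtain z where z: "z \<in> ?D" "y = inv a \<otimes> z" by blast
      obtain w where w: "w \<in> Rb" "z = a \<otimes> w" using z(1) DI' by blast
      have "y = w" unfolding z(2) w(2) using ac ia Rb.A_sub[OF w(1)] by (simp add: m_assoc[symmetric])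
      then show "y \<in> Rb" using w(1) by simp
    qed
    have "colon Q ?B ?K \<subseteq> colon Q ?B Rb"
    proof
      fix \<alpha> assume \<alpha>: "\<alpha> \<in> colon Q ?B ?K"
      have \<alpha>c: "\<alpha> \<in> carrier Q" and \<alpha>K: "\<And>y. y \<in> ?K \<Longrightarrow> \<alpha> \<otimes> y \<in> ?B" using \<alpha> unfolding colon_def by blast+
      have "a \<otimes> \<alpha> \<in> colon Q A C"
        unfolding colon_def
      proof (intro CollectI conjI ballI)
        show "a \<otimes> \<alpha> \<in> carrier Q" using ac \<alpha>c by simp
        fix y assume y: "y \<in> C"
        have yc: "y \<in> carrier Q" by (rule C.C_sub[OF y])
        \<comment> \<open>The elements y and z of C both lie in K: \<alpha> y falls into the
          endomorphism ring, multiplying it by z stays in K, and a carries K into C.\<close>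
        have "a \<otimes> \<alpha> \<otimes> y \<in> colon Q C C"
          unfolding colon_def
        proof (intro CollectI conjI ballI)
          show "a \<otimes> \<alpha> \<otimes> y \<in> carrier Q" using ac \<alpha>c yc by simp
          fix z assume z: "z \<in> C"
          have "(\<alpha> \<otimes> y) \<otimes> z \<in> ?K"
            by (rule submodD(4)[OF K_submod[OF conds(1-4) ia(1,4)] \<alpha>K]) (use y z C_K in blast)+
          then have "a \<otimes> ((\<alpha> \<otimes> y) \<otimes> z) \<in> C" by (rule KC)
          then show "a \<otimes> \<alpha> \<otimes> y \<otimes> z \<in> C" using ac \<alpha>c yc C.C_sub[OF z] by (simp add: m_assoc)
        qed
        then show "a \<otimes> \<alpha> \<otimes> y \<in> A" using C.C_colon_C by simp
      qed
      then have aR: "a \<otimes> \<alpha> \<otimes> z \<in> A" if "z \<in> Rb" for z using tr that unfolding colon_def by blast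
      have "\<alpha> \<otimes> y \<in> ?B" if y: "y \<in> Rb" for y
      proof -
        have yc: "y \<in> carrier Q" by (rule Rb.A_sub[OF y])
        have "\<alpha> \<otimes> y \<otimes> x \<in> A" if x: "x \<in> M" for x
        proof -
          have xc: "x \<in> carrier Q" by (rule M_sub[OF x])
          \<comment> \<open>Here x / a \<in> Rb lets the factor a be traded for an arbitrary x in
            M.\<close>
          have "a \<otimes> \<alpha> \<otimes> (y \<otimes> (inv a \<otimes> x)) \<in> A" by (rule aR[OF Rb.A_mult[OF y red[OF x]]])
          moreover have "a \<otimes> \<alpha> \<otimes> (y \<otimes> (inv a \<otimes> x)) = (a \<otimes> inv a) \<otimes> (\<alpha> \<otimes> y \<otimes> x)"
            using ac ia(1) \<alpha>c xc yc by algebra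
          ultimately show ?thesis using ia(2) \<alpha>c xc yc by simp
        qed
        then have "\<alpha> \<otimes> y \<in> colon Q A M" using \<alpha>c yc by (simp add: colon_def)
        then show ?thesis using AM by blast
      qed
      then show "\<alpha> \<in> colon Q ?B Rb" using \<alpha>c by (simp add: colon_def)
    qed
    then have "far_flung_Gorenstein Q ?B (V\<lparr>carrier := ?K\<rparr>)"
      by (rule K_far_flung[OF conds B_K K_Rb])
    then show ?thesis by blast
  qed
qed

end

theorem theorem3p3:
  fixes Q :: "'a ring" and R \<mm> :: "'a set" and \<omega> :: "('a, 'b) module"
  assumes "total_ring_of_fractions Q R"
    and "CM_local_ring (Q\<lparr>carrier := R\<rparr>)"
    and "krull_dim (Q\<lparr>carrier := R\<rparr>) = 1"
    and "maximalideal \<mm> (Q\<lparr>carrier := R\<rparr>)"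
    and "canonical_module (Q\<lparr>carrier := R\<rparr>) \<omega>"
    and "canonical_between Q R \<omega>"
    and "finite_integral_closure Q R"
    and "local_ring (Q\<lparr>carrier := integral_closure Q R\<rparr>)"
    and "\<exists>a\<in>\<mm>. a \<in> nonzerodivisors (Q\<lparr>carrier := R\<rparr>) \<and>
           is_reduction (Q\<lparr>carrier := R\<rparr>) (PIdl\<^bsub>Q\<lparr>carrier := R\<rparr>\<^esub> a) \<mm>"
    and "far_flung_Gorenstein Q R \<omega>"
  shows "(\<lambda>\<alpha>\<in>colon Q \<mm> \<mm>. \<lambda>x\<in>\<mm>. \<alpha> \<otimes>\<^bsub>Q\<^esub> x)
           \<in> ring_iso (Q\<lparr>carrier := colon Q \<mm> \<mm>\<rparr>)
               (endomorphism_ring (Q\<lparr>carrier := R\<rparr>) ((regular_module Q)\<lparr>carrier := \<mm>\<rparr>))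
         \<and> (\<exists>\<omega>\<^sub>B :: ('a, 'a) module. far_flung_Gorenstein Q (colon Q \<mm> \<mm>) \<omega>\<^sub>B)"
proof -
  let ?S = "Q\<lparr>carrier := R\<rparr>"
  have Qc: "cring Q" and Rs: "subcring R Q" using assms(1) by (auto simp: total_ring_of_fractions_def)
  have loc: "local_ring ?S" and noeth: "noetherian_ring ?S" using assms(2) by (auto simp: CM_local_ring_def)
  interpret R: noetherian_subring Q R
    by (intro noetherian_subring.intro cring_with_subring.intro cring_with_subring_axioms.intro
        noetherian_subring_axioms.intro Qc Rs noeth)
  obtain a where a: "a \<in> \<mm>" "a \<in> nonzerodivisors ?S" "is_reduction ?S (PIdl\<^bsub>?S\<^esub> a) \<mm>" using assms(9) by blast
  interpret Q: field Q
    by (rule R.total_ring_of_fractions_field[OF assms(1) loc assms(3,4) a(1,2) assms(8,7)])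
  interpret S: cring ?S by (rule R.S_cring)
  interpret m: maximalideal \<mm> ?S by (rule assms(4))
  have ms: "submod Q R \<mm>" "\<mm> \<subseteq> R" using R.ideal_iff m.is_ideal by auto
  have one: "\<one>\<^bsub>Q\<^esub> \<notin> \<mm>" using m.one_imp_carrier m.I_notcarr by auto
  have nzd0: "s \<noteq> \<zero>\<^bsub>Q\<^esub>" if "s \<in> nonzerodivisors ?S" for s
  proof
    assume "s = \<zero>\<^bsub>Q\<^esub>"
    then have "\<forall>x\<in>R. x = \<zero>\<^bsub>Q\<^esub>" using that R.A_sub by (simp add: nonzerodivisors_def)
    then show False using R.A_one Q.one_not_zero by blast
  qed
  interpret A: one_dim_domain Q R \<mm>
  proof (intro one_dim_domain.intro one_dim_domain_axioms.intro Q.field_axioms R.noetherian_subring_axioms ms one)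
    show "\<exists>a\<in>R. \<exists>s\<in>R. s \<noteq> \<zero>\<^bsub>Q\<^esub> \<and> q = a \<otimes>\<^bsub>Q\<^esub> inv\<^bsub>Q\<^esub> s" if q: "q \<in> carrier Q" for q
    proof -
      obtain b s where bs: "b \<in> R" "s \<in> nonzerodivisors ?S" "q = b \<otimes>\<^bsub>Q\<^esub> inv\<^bsub>Q\<^esub> s"
        using assms(1) q unfolding total_ring_of_fractions_def by blast
      have "s \<in> R" using bs(2) by (simp add: nonzerodivisors_def)
      then show ?thesis using bs nzd0 by blast
    qed
    show "\<mm> \<noteq> {\<zero>\<^bsub>Q\<^esub>}" using a(1) nzd0[OF a(2)] by blast
    show "inv\<^bsub>Q\<^esub> x \<in> R" if x: "x \<in> R" "x \<notin> \<mm>" for x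
    proof -
      have "x \<in> Units ?S" using local_ring_unit[OF loc assms(4), of x] x by simp
      then obtain y where y: "y \<in> R" "x \<otimes>\<^bsub>Q\<^esub> y = \<one>\<^bsub>Q\<^esub>" by (auto simp: Units_def)
      then have "inv\<^bsub>Q\<^esub> x = y" using R.comm_inv_char[of x y] R.A_sub x by blast
      then show ?thesis using y by simp
    qed
    fix P assume P: "primeideal P ?S" "P \<noteq> {\<zero>\<^bsub>Q\<^esub>}"
    have "primeideal {\<zero>\<^bsub>Q\<^esub>} ?S"
    proof (rule primeidealI[OF _ R.S_cring])
      show "ideal {\<zero>\<^bsub>Q\<^esub>} ?S" using S.zeroideal by simp
      have "\<one>\<^bsub>Q\<^esub> \<in> carrier ?S" "\<one>\<^bsub>Q\<^esub> \<notin> {\<zero>\<^bsub>Q\<^esub>}" using R.A_one Q.one_not_zero by simp_all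
      then show "carrier ?S \<noteq> {\<zero>\<^bsub>Q\<^esub>}" by metis
      show "x \<in> {\<zero>\<^bsub>Q\<^esub>} \<or> y \<in> {\<zero>\<^bsub>Q\<^esub>}" if "x \<in> carrier ?S" "y \<in> carrier ?S" "x \<otimes>\<^bsub>?S\<^esub> y \<in> {\<zero>\<^bsub>Q\<^esub>}" for x y
        using that Q.integral[of x y] R.A_sub by simp
    qed
    \<comment> \<open>A nonzero prime below the maximal ideal but different from it would give a
      chain of three primes.\<close>
    moreover have "{\<zero>\<^bsub>Q\<^esub>} \<subset> P"
      using P(2) submodD(2)[of Q R P] R.ideal_iff primeideal.axioms(1)[OF P(1)] by blast
    moreover have "P \<subseteq> \<mm>" by (rule R.local_ring_prime_subset[OF loc assms(4) P(1)])
    ultimately show "P = \<mm>"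
      using R.prime_chain_length[OF assms(3) _ P(1) S.maximalideal_prime[OF assms(4)]] by blast
  qed
  obtain t where t: "t \<in> R" "t \<in> Units Q" "\<And>x. x \<in> integral_closure Q R \<Longrightarrow> t \<otimes>\<^bsub>Q\<^esub> x \<in> R"
    by (rule R.integral_closure_conductor[OF assms(1,7)]) blast
  interpret A: one_dim_domain_local_closure Q R \<mm>
  proof (intro one_dim_domain_local_closure.intro one_dim_domain_local_closure_axioms.intro
      A.one_dim_domain_axioms assms(8))
    show "\<exists>t\<in>carrier Q. t \<noteq> \<zero>\<^bsub>Q\<^esub> \<and> (\<forall>x\<in>integral_closure Q R. t \<otimes>\<^bsub>Q\<^esub> x \<in> R)"
      using t R.A_sub Q.field_Units by blast
  qed
  obtain C where C: "R \<subseteq> C" "C \<subseteq> integral_closure Q R" "submodule C ?S (regular_module Q)"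
    "module_isomorphic ?S ((regular_module Q)\<lparr>carrier := C\<rparr>) \<omega>"
    using assms(6) by (auto simp: canonical_between_def)
  have Cs: "submod Q R C" using C(3) R.submodule_iff by blast
  have C_Rb: "C \<subseteq> A.Rb" using C(2) by (simp add: A.Rb_def)
  have Cf: "R.fractional C" by (rule R.fractional_subset[OF A.Rb_fractional Cs C_Rb])
  have Wm: "module ?S \<omega>" using assms(5) by (simp add: canonical_module_def finitely_generated_module_def)
  have "trace_ideal ?S \<omega> = colon Q R A.Rb" using assms(10) by (simp add: far_flung_Gorenstein_def A.Rb_def)
  \<comment> \<open>The far-flung hypothesis on R enters here: R : C lies in the trace ideal, which
    is the conductor.\<close>
  then have "colon Q R C \<subseteq> colon Q R A.Rb" using A.colon_subset_trace[OF Wm Cs _ C(4)] C(1) R.A_one by blast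
  moreover have "inv\<^bsub>Q\<^esub> a \<otimes>\<^bsub>Q\<^esub> x \<in> A.Rb" if "x \<in> \<mm>" for x
    using A.reduction_integral[OF a(1) nzd0[OF a(2)] a(3) that] by (simp add: A.Rb_def)
  ultimately have "\<exists>\<omega>\<^sub>B :: ('a, 'a) module. far_flung_Gorenstein Q (colon Q \<mm> \<mm>) \<omega>\<^sub>B"
    using A.endomorphism_ring_far_flung[OF A.canonical_idealI[OF assms(5) Cf C(4)] C(1) C_Rb _ a(1) nzd0[OF a(2)]]
    by blast
  then show ?thesis using A.multiplication_ring_iso by blast
qed

end
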